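(* Let $X_{\Sigma,\mathcal B}$ be a quasinormal toric supervariety with supertorus $T_{N,c}$, let $\sigma\in\Sigma$, let $\operatorname{Orb}_c(\sigma)=T_{N,c}\cdot\mathfrak p$ be the $T_{N,c}$-orbit of a closed point $\mathfrak p\in\operatorname{Orb}(\sigma)$, and let $X_{\Sigma,\mathcal B}(\sigma)$ be the Zariski closure of $\operatorname{Orb}_c(\sigma)$ in $X_{\Sigma,\mathcal B}$. Then $X_{\Sigma,\mathcal B}(\sigma)$ is a toric supervariety with torus $\operatorname{Orb}_c(\sigma)$. There are two cases: (a) If $\operatorname{Orb}_c(\sigma)\cong T_{N(\sigma)}$ (first case in the context), then $X_{\Sigma,\mathcal B}(\sigma)$ is the ordinary toric variety with fan $\bar\Sigma=\{\bar\tau\mid\tau\in\Sigma,\ \sigma\le\tau\}$, where $\bar\tau$ denotes the image of $\tau$ in $N(\sigma)_{\mathbb R}=N_{\mathbb R}/(N_\sigma)_{\mathbb R}$. (b) If $\operatorname{Orb}_c(\sigma)\cong T_{N(\sigma),\bar c}$ (second case in the context), then $X_{\Sigma,\mathcal B}(\sigma)$ is the toric supervariety with the fan $\bar\Sigma=\{\bar\tau\mid\tau\in\Sigma,\ \sigma\le\tau\}$ and decorations $\mathcal B_{\bar\tau}=\mathcal B_\tau\cap\sigma^\perp$ for $\tau\ge\sigma$.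
   Context: Ground field $\mathbb C$. For a lattice $N$ with $M=N^*$: $T_N=N\otimes\mathbb C^\times$, and for $c\in N_{\mathbb C}$, $T_{N,c}$ is the supertorus with coordinate Hopf superalgebra $\mathbb C[M,\xi]$ ($\xi$ odd, $\xi^2=0$), $\Delta x^m=x^m\otimes x^m(1+\langle m,c\rangle\xi\otimes\xi)$, $\Delta\xi=\xi\otimes1+1\otimes\xi$. A toric supervariety with torus $T$ is a supervariety containing the supertorus $T$ (possibly purely even) as an open subscheme such that the action of $T$ on itself extends; it is quasinormal if its underlying ordinary variety is normal. For a fan $\Sigma$ in $N_{\mathbb R}$ and $\sigma\in\Sigma$, $S_\sigma=\check\sigma\cap M$ and $m'\le_\sigma m$ means $m-m'\in S_\sigma$. $c$-admissible decorations $\mathcal B=\{\mathcal B_\sigma\}_{\sigma\in\Sigma}$ are nonempty finite sets $\mathcal B_\sigma\subset S_\sigma$ with, for all $\sigma,\sigma'\in\Sigma$: (i) for all $m\in S_\sigma$ with $\langle m,c\rangle\neq0$ there is $b\in\mathcal B_\sigma$ with $b\le_\sigma m$; (ii) for all $b\in\mathcal B_\sigma$ there is $b'\in\mathcal B_{\sigma'}$ with $b'\le_{\sigma\cap\sigma'}b$; (iii) if $a,b\in\mathcal B_\sigma$, $a\le_\sigma b$, then $a=b$. $X_{\Sigma,\mathcal B}$ is the toric supervariety with torus $T_{N,c}$ glued from $\operatorname{Spec}(\mathbb C[S_\sigma]\oplus\xi J^\sigma)$, $J^\sigma=(x^b\mid b\in\mathcal B_\sigma)$; every quasinormal toric supervariety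 with torus $T_{N,c}$ has this form. $\operatorname{Orb}(\sigma)$ is the $T_N$-orbit in the ordinary toric variety $X_\Sigma$ (the underlying variety) corresponding to $\sigma$. $N_\sigma\subseteq N$ is the sublattice spanned by $\sigma\cap N$, $N(\sigma)=N/N_\sigma$ (with character lattice $\sigma^\perp\cap M$), and $\bar c$ is the image of $c$ in $N(\sigma)_{\mathbb C}$. $\sigma\le\tau$ means $\sigma$ is a face of $\tau$. The orbit functor of a closed point is $(G\cdot\mathfrak p)(A)=G(A)\cdot\mathfrak p_A$ for superalgebras $A$, where $\mathfrak p_A$ is $\mathfrak p$ viewed as an $A$-point. Two cases for the orbit of $\mathfrak p\in\operatorname{Orb}(\sigma)$: first case, every monomial $x^b$ with $b\in\mathcal B_\sigma$ vanishes at $\mathfrak p$, and then $\operatorname{Orb}_c(\sigma)\cong T_{N(\sigma)}$ (purely even); second case, otherwise, and then $\operatorname{Orb}_c(\sigma)\cong T_{N(\sigma),\bar c}$. The closure of $\operatorname{Orb}_c(\sigma)$ is the smallest closed subvariety of $X_{\Sigma,\mathcal B}$ containing it. *)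

theory Defs
  imports
    "HOL-Analysis.Analysis"
    "HOL-Library.Poly_Mapping"
    "HOL-Algebra.Ideal"
    "HOL-Algebra.Module"
    "HOL-Algebra.Subrings"
begin

section \<open>Superalgebras over the complex numbers\<close>

record 'a superalg = "(complex, 'a) module" +
  even_part :: "'a set"
  odd_part :: "'a set"

definition complex_ring :: "complex ring" where
  "complex_ring = \<lparr>carrier = UNIV, mult = (*), one = 1, zero = 0, add = (+)\<rparr>"

definition superalgebra :: "'a superalg \<Rightarrow> bool" where
  "superalgebra A \<longleftrightarrow>
     ring A \<and> module complex_ring A \<and>
     (\<forall>z. \<forall>a\<in>carrier A. \<forall>b\<in>carrier A.
        (z \<odot>\<^bsub>A\<^esub> a) \<otimes>\<^bsub>A\<^esub> b = z \<odot>\<^bsub>A\<^esub> (a \<otimes>\<^bsub>A\<^esub> b) \<and>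
        a \<otimes>\<^bsub>A\<^esub> (z \<odot>\<^bsub>A\<^esub> b) = z \<odot>\<^bsub>A\<^esub> (a \<otimes>\<^bsub>A\<^esub> b)) \<and>
     submodule (even_part A) complex_ring A \<and>
     submodule (odd_part A) complex_ring A \<and>
     even_part A \<inter> odd_part A = {\<zero>\<^bsub>A\<^esub>} \<and>
     (\<forall>a\<in>carrier A. \<exists>x\<in>even_part A. \<exists>y\<in>odd_part A. a = x \<oplus>\<^bsub>A\<^esub> y) \<and>
     \<one>\<^bsub>A\<^esub> \<in> even_part A \<and>
     (\<forall>a\<in>even_part A. \<forall>b\<in>even_part A. a \<otimes>\<^bsub>A\<^esub> b \<in> even_part A) \<and>
     (\<forall>a\<in>even_part A. \<forall>b\<in>odd_part A. a \<otimes>\<^bsub>A\<^esub> b \<in> odd_part A) \<and>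
     (\<forall>a\<in>odd_part A. \<forall>b\<in>odd_part A. a \<otimes>\<^bsub>A\<^esub> b \<in> even_part A) \<and>
     (\<forall>a\<in>even_part A. \<forall>b\<in>carrier A. a \<otimes>\<^bsub>A\<^esub> b = b \<otimes>\<^bsub>A\<^esub> a) \<and>
     (\<forall>a\<in>odd_part A. \<forall>b\<in>odd_part A. a \<otimes>\<^bsub>A\<^esub> b = \<ominus>\<^bsub>A\<^esub> (b \<otimes>\<^bsub>A\<^esub> a))"

text \<open>Homomorphisms are extensional, so that equal homomorphisms are equal functions.\<close>

definition shom :: "'a superalg \<Rightarrow> 'a superalg \<Rightarrow> ('a \<Rightarrow> 'a) set" where
  "shom A B = {h \<in> ring_hom A B. h \<in> extensional (carrier A) \<and>
     (\<forall>z. \<forall>a\<in>carrier A. h (z \<odot>\<^bsub>A\<^esub> a) = z \<odot>\<^bsub>B\<^esub> h a) \<and>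
     h ` even_part A \<subseteq> even_part B \<and> h ` odd_part A \<subseteq> odd_part B}"

definition superideal :: "'a set \<Rightarrow> 'a superalg \<Rightarrow> bool" where
  "superideal I A \<longleftrightarrow> ideal I A \<and>
     (\<forall>x\<in>even_part A. \<forall>y\<in>odd_part A. x \<oplus>\<^bsub>A\<^esub> y \<in> I \<longrightarrow> x \<in> I \<and> y \<in> I)"

definition superfield :: "'a superalg \<Rightarrow> bool" where
  "superfield K \<longleftrightarrow> superalgebra K \<and> field K"

text \<open>The ideal generated by the odd elements; the quotient by it is the coordinate ring of the
  underlying ordinary scheme.\<close>

definition odd_ideal :: "'a superalg \<Rightarrow> 'a set" where
  "odd_ideal A = Idl\<^bsub>A\<^esub> (odd_part A)"

text \<open>The underlying ordinary ring is a domain and the superalgebra embeds into its localization at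
  the generic point.  (The library's prime ideals presuppose a commutative ring.)\<close>

definition superdomain :: "'a superalg \<Rightarrow> bool" where
  "superdomain A \<longleftrightarrow> superalgebra A \<and> odd_ideal A \<noteq> carrier A \<and>
     (\<forall>a\<in>carrier A. \<forall>b\<in>carrier A.
        a \<otimes>\<^bsub>A\<^esub> b \<in> odd_ideal A \<longrightarrow> a \<in> odd_ideal A \<or> b \<in> odd_ideal A) \<and>
     (\<forall>a\<in>carrier A - odd_ideal A. \<forall>b\<in>carrier A. a \<otimes>\<^bsub>A\<^esub> b = \<zero>\<^bsub>A\<^esub> \<longrightarrow> b = \<zero>\<^bsub>A\<^esub>)"

text \<open>For a superdomain: its underlying ordinary domain is integrally closed in its fraction
  field.  The element \<open>a / b\<close> of the fraction field is integral iff \<open>a\<close> and \<open>b\<close> satisfy the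
  homogenized monic equation below.\<close>

definition normal_reduction :: "'a superalg \<Rightarrow> bool" where
  "normal_reduction A \<longleftrightarrow>
     (\<forall>a\<in>carrier A. \<forall>b\<in>carrier A - odd_ideal A.
        (\<exists>(n::nat) r. 0 < n \<and> r \<in> {..<n} \<rightarrow> carrier A \<and>
           (a [^]\<^bsub>A\<^esub> n) \<oplus>\<^bsub>A\<^esub>
             (\<Oplus>\<^bsub>A\<^esub>i\<in>{..<n}. r i \<otimes>\<^bsub>A\<^esub> ((a [^]\<^bsub>A\<^esub> i) \<otimes>\<^bsub>A\<^esub> (b [^]\<^bsub>A\<^esub> (n - i)))) \<in> odd_ideal A) \<longrightarrow>
        (\<exists>d\<in>carrier A. a \<ominus>\<^bsub>A\<^esub> (d \<otimes>\<^bsub>A\<^esub> b) \<in> odd_ideal A))"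

definition finitely_generated :: "'a superalg \<Rightarrow> bool" where
  "finitely_generated A \<longleftrightarrow> (\<exists>F. finite F \<and> F \<subseteq> carrier A \<and>
     (\<forall>C. subring C A \<and> (\<forall>z. \<forall>a\<in>C. z \<odot>\<^bsub>A\<^esub> a \<in> C) \<and> F \<subseteq> C \<longrightarrow> C = carrier A))"

text \<open>\<open>l\<close> exhibits \<open>L\<close> as the localization of \<open>A\<close> at the powers of the even element \<open>f\<close>.\<close>

definition is_localization :: "'a superalg \<Rightarrow> 'a \<Rightarrow> 'a superalg \<Rightarrow> ('a \<Rightarrow> 'a) \<Rightarrow> bool" where
  "is_localization A f L l \<longleftrightarrow> superalgebra L \<and> l \<in> shom A L \<and> l f \<in> Units L \<and>
     (\<forall>y\<in>carrier L. \<exists>a\<in>carrier A. \<exists>n::nat. y \<otimes>\<^bsub>L\<^esub> (l f [^]\<^bsub>L\<^esub> n) = l a) \<and>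
     (\<forall>a\<in>carrier A. l a = \<zero>\<^bsub>L\<^esub> \<longleftrightarrow> (\<exists>n::nat. (f [^]\<^bsub>A\<^esub> n) \<otimes>\<^bsub>A\<^esub> a = \<zero>\<^bsub>A\<^esub>))"

section \<open>Superschemes as functors of points\<close>

text \<open>
  Superschemes are treated as functors from superalgebras to sets, following Demazure-Gabriel and
  Jantzen (\<^emph>\<open>Representations of Algebraic Groups\<close>, I.1): a superscheme is a functor that is local
  for the Zariski topology and is covered by affine open subfunctors.  The test superalgebras are
  those whose carrier is a subset of a fixed type \<^typ>\<open>'a\<close>.  Below this is a type of the cardinality
  of the continuum, so it contains isomorphic copies of all finitely generated superalgebras and
  is closed, up to isomorphism, under quotients, localizations and residue fields.

  The values of a functor (and all families indexed by superalgebras below) are only meaningful at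
  arguments that satisfy \<^const>\<open>superalgebra\<close>.
\<close>

record ('a, 'x) sfunctor =
  pts :: "'a superalg \<Rightarrow> 'x set"
  fmap :: "'a superalg \<Rightarrow> 'a superalg \<Rightarrow> ('a \<Rightarrow> 'a) \<Rightarrow> 'x \<Rightarrow> 'x"

definition is_sfunctor :: "('a, 'x) sfunctor \<Rightarrow> bool" where
  "is_sfunctor X \<longleftrightarrow>
     (\<forall>A B f x. superalgebra A \<and> superalgebra B \<and> f \<in> shom A B \<and> x \<in> pts X A \<longrightarrow>
        fmap X A B f x \<in> pts X B) \<and>
     (\<forall>A x. superalgebra A \<and> x \<in> pts X A \<longrightarrow> fmap X A A (restrict id (carrier A)) x = x) \<and>
     (\<forall>A B C f g x. superalgebra A \<and> superalgebra B \<and> superalgebra C \<and>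
        f \<in> shom A B \<and> g \<in> shom B C \<and> x \<in> pts X A \<longrightarrow>
        fmap X A C (compose (carrier A) g f) x = fmap X B C g (fmap X A B f x))"

definition Sp :: "'a superalg \<Rightarrow> ('a, 'a \<Rightarrow> 'a) sfunctor" where
  "Sp R = \<lparr>pts = (\<lambda>A. shom R A), fmap = (\<lambda>A B f h. compose (carrier R) f h)\<rparr>"

definition natural_map ::
  "('a, 'y) sfunctor \<Rightarrow> ('a, 'x) sfunctor \<Rightarrow> ('a superalg \<Rightarrow> 'y \<Rightarrow> 'x) \<Rightarrow> bool" where
  "natural_map Y X \<eta> \<longleftrightarrow>
     (\<forall>A. superalgebra A \<longrightarrow> \<eta> A \<in> pts Y A \<rightarrow> pts X A) \<and>
     (\<forall>A B f y. superalgebra A \<and> superalgebra B \<and> f \<in> shom A B \<and> y \<in> pts Y A \<longrightarrow>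
        \<eta> B (fmap Y A B f y) = fmap X A B f (\<eta> A y))"

definition subfunctor :: "('a, 'x) sfunctor \<Rightarrow> ('a superalg \<Rightarrow> 'x set) \<Rightarrow> bool" where
  "subfunctor X Y \<longleftrightarrow>
     (\<forall>A. superalgebra A \<longrightarrow> Y A \<subseteq> pts X A) \<and>
     (\<forall>A B f y. superalgebra A \<and> superalgebra B \<and> f \<in> shom A B \<and> y \<in> Y A \<longrightarrow>
        fmap X A B f y \<in> Y B)"

definition restrict_to :: "('a, 'x) sfunctor \<Rightarrow> ('a superalg \<Rightarrow> 'x set) \<Rightarrow> ('a, 'x) sfunctor" where
  "restrict_to X Y = \<lparr>pts = Y, fmap = fmap X\<rparr>"

text \<open>A subfunctor is closed (open) if its inverse image under every map from \<open>Sp A\<close>, i.e.\ every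
  \<open>A\<close>-point, is the closed subfunctor \<open>V(I)\<close> (the open subfunctor \<open>D(I)\<close>) of \<open>Sp A\<close> for some
  superideal \<open>I\<close>.\<close>

definition closed_sub :: "('a, 'x) sfunctor \<Rightarrow> ('a superalg \<Rightarrow> 'x set) \<Rightarrow> bool" where
  "closed_sub X Y \<longleftrightarrow> subfunctor X Y \<and>
     (\<forall>A x. superalgebra A \<and> x \<in> pts X A \<longrightarrow>
        (\<exists>I. superideal I A \<and> (\<forall>B f. superalgebra B \<and> f \<in> shom A B \<longrightarrow>
           (fmap X A B f x \<in> Y B \<longleftrightarrow> (\<forall>a\<in>I. f a = \<zero>\<^bsub>B\<^esub>)))))"

definition open_sub :: "('a, 'x) sfunctor \<Rightarrow> ('a superalg \<Rightarrow> 'x set) \<Rightarrow> bool" where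
  "open_sub X Y \<longleftrightarrow> subfunctor X Y \<and>
     (\<forall>A x. superalgebra A \<and> x \<in> pts X A \<longrightarrow>
        (\<exists>I. superideal I A \<and> (\<forall>B f. superalgebra B \<and> f \<in> shom A B \<longrightarrow>
           (fmap X A B f x \<in> Y B \<longleftrightarrow> Idl\<^bsub>B\<^esub> (f ` I) = carrier B))))"

text \<open>An open covering is tested on points with values in fields.\<close>

definition open_cover :: "('a, 'x) sfunctor \<Rightarrow> ('a superalg \<Rightarrow> 'x set) set \<Rightarrow> bool" where
  "open_cover X \<U> \<longleftrightarrow> (\<forall>U\<in>\<U>. open_sub X U) \<and>
     (\<forall>K. superfield K \<longrightarrow> pts X K \<subseteq> (\<Union>U\<in>\<U>. U K))"

text \<open>The sheaf condition for coverings of \<open>Sp A\<close> by principal open subsets \<open>D(f)\<close>, \<open>f \<in> F\<close>.  The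
  agreement of \<open>x f\<close> and \<open>x g\<close> over \<open>D(f) \<inter> D(g)\<close> is expressed on all test superalgebras \<open>B\<close>
  over which both are defined.\<close>

definition local_sfunctor :: "('a, 'x) sfunctor \<Rightarrow> bool" where
  "local_sfunctor X \<longleftrightarrow> (\<forall>A F L l x.
     superalgebra A \<and> finite F \<and> F \<subseteq> even_part A \<and> Idl\<^bsub>A\<^esub> F = carrier A \<and>
     (\<forall>f\<in>F. is_localization A f (L f) (l f) \<and> x f \<in> pts X (L f)) \<and>
     (\<forall>f\<in>F. \<forall>g\<in>F. \<forall>B u v. superalgebra B \<and> u \<in> shom (L f) B \<and> v \<in> shom (L g) B \<and>
        compose (carrier A) u (l f) = compose (carrier A) v (l g) \<longrightarrow>
        fmap X (L f) B u (x f) = fmap X (L g) B v (x g))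
     \<longrightarrow> (\<exists>!y. y \<in> pts X A \<and> (\<forall>f\<in>F. fmap X A (L f) (l f) y = x f)))"

definition affine_open :: "'a superalg \<Rightarrow> ('a, 'x) sfunctor \<Rightarrow> ('a superalg \<Rightarrow> 'x set) \<Rightarrow> bool" where
  "affine_open R X U \<longleftrightarrow> superalgebra R \<and> open_sub X U \<and>
     (\<exists>\<eta>. natural_map (Sp R) X \<eta> \<and> (\<forall>A. superalgebra A \<longrightarrow> bij_betw (\<eta> A) (pts (Sp R) A) (U A)))"

definition affine_open_immersion ::
  "'a superalg \<Rightarrow> ('a, 'x) sfunctor \<Rightarrow> ('a superalg \<Rightarrow> ('a \<Rightarrow> 'a) \<Rightarrow> 'x) \<Rightarrow> bool" where
  "affine_open_immersion R X \<eta> \<longleftrightarrow> superalgebra R \<and> natural_map (Sp R) X \<eta> \<and>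
     (\<forall>A. superalgebra A \<longrightarrow> inj_on (\<eta> A) (pts (Sp R) A)) \<and>
     open_sub X (\<lambda>A. \<eta> A ` pts (Sp R) A)"

text \<open>The diagonal is closed.\<close>

definition separated :: "('a, 'x) sfunctor \<Rightarrow> bool" where
  "separated X \<longleftrightarrow> (\<forall>A x y. superalgebra A \<and> x \<in> pts X A \<and> y \<in> pts X A \<longrightarrow>
     (\<exists>I. superideal I A \<and> (\<forall>B f. superalgebra B \<and> f \<in> shom A B \<longrightarrow>
        (fmap X A B f x = fmap X A B f y \<longleftrightarrow> (\<forall>a\<in>I. f a = \<zero>\<^bsub>B\<^esub>)))))"

definition irreducible_sfunctor :: "('a, 'x) sfunctor \<Rightarrow> bool" where
  "irreducible_sfunctor X \<longleftrightarrow> (\<exists>K. superfield K \<and> pts X K \<noteq> {}) \<and>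
     (\<forall>U V. open_sub X U \<and> open_sub X V \<and>
        (\<exists>K. superfield K \<and> U K \<noteq> {}) \<and> (\<exists>K. superfield K \<and> V K \<noteq> {}) \<longrightarrow>
        (\<exists>K. superfield K \<and> U K \<inter> V K \<noteq> {}))"

text \<open>A supervariety is an integral separated superscheme of finite type.\<close>

definition supervariety :: "('a, 'x) sfunctor \<Rightarrow> bool" where
  "supervariety X \<longleftrightarrow> is_sfunctor X \<and> local_sfunctor X \<and> separated X \<and> irreducible_sfunctor X \<and>
     (\<exists>\<U>. finite \<U> \<and> open_cover X \<U> \<and>
        (\<forall>U\<in>\<U>. \<exists>R. superdomain R \<and> finitely_generated R \<and> affine_open R X U))"

definition quasinormal :: "('a, 'x) sfunctor \<Rightarrow> bool" where
  "quasinormal X \<longleftrightarrow> supervariety X \<and>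
     (\<exists>\<U>. open_cover X \<U> \<and>
        (\<forall>U\<in>\<U>. \<exists>R. superdomain R \<and> normal_reduction R \<and> affine_open R X U))"

definition closed_subvariety :: "('a, 'x) sfunctor \<Rightarrow> ('a superalg \<Rightarrow> 'x set) \<Rightarrow> bool" where
  "closed_subvariety X Z \<longleftrightarrow> closed_sub X Z \<and> supervariety (restrict_to X Z)"

text \<open>The intersection of all closed subvarieties containing \<open>Y\<close>.  When it is itself a closed
  subvariety, it is the smallest one containing \<open>Y\<close>.\<close>

definition zariski_closure ::
  "('a, 'x) sfunctor \<Rightarrow> ('a superalg \<Rightarrow> 'x set) \<Rightarrow> 'a superalg \<Rightarrow> 'x set" where
  "zariski_closure X Y A = {x \<in> pts X A.
     \<forall>Z. closed_subvariety X Z \<and> (\<forall>B. superalgebra B \<longrightarrow> Y B \<subseteq> Z B) \<longrightarrow> x \<in> Z A}"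

section \<open>Lattices, fans and decorations\<close>

definition zlattice :: "'v::euclidean_space set \<Rightarrow> bool" where
  "zlattice N \<longleftrightarrow> (\<exists>E. independent E \<and> N = range (\<lambda>k::'v \<Rightarrow> int. \<Sum>e\<in>E. of_int (k e) *\<^sub>R e))"

text \<open>\<open>N\<^sub>\<real>\<close> is \<^term>\<open>span N\<close>.  The inner product identifies the dual lattice \<open>M\<close> of \<open>N\<close> with a
  lattice in the same space.\<close>

definition dual_lattice :: "'v::euclidean_space set \<Rightarrow> 'v set" where
  "dual_lattice N = {m \<in> span N. \<forall>u\<in>N. m \<bullet> u \<in> \<int>}"

text \<open>An element of \<open>N\<^sub>\<complex>\<close> is given by its real and imaginary parts.\<close>

definition complexified :: "'v::euclidean_space set \<Rightarrow> ('v \<times> 'v) set" where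
  "complexified N = span N \<times> span N"

definition pairing :: "'v::euclidean_space \<Rightarrow> 'v \<times> 'v \<Rightarrow> complex" where
  "pairing m c = Complex (m \<bullet> fst c) (m \<bullet> snd c)"

definition fan_cone :: "'v::euclidean_space set \<Rightarrow> 'v set \<Rightarrow> bool" where
  "fan_cone N \<sigma> \<longleftrightarrow> (\<exists>G. finite G \<and> G \<subseteq> N \<and> \<sigma> = convex_cone hull G) \<and>
     \<sigma> \<inter> uminus ` \<sigma> = {0}"

text \<open>The library counts the empty set as a face.\<close>

definition is_face :: "'v::euclidean_space set \<Rightarrow> 'v set \<Rightarrow> bool" where
  "is_face \<sigma> \<tau> \<longleftrightarrow> \<sigma> face_of \<tau> \<and> \<sigma> \<noteq> {}"

definition fan :: "'v::euclidean_space set \<Rightarrow> 'v set set \<Rightarrow> bool" where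
  "fan N \<Sigma> \<longleftrightarrow> finite \<Sigma> \<and> \<Sigma> \<noteq> {} \<and> (\<forall>\<sigma>\<in>\<Sigma>. fan_cone N \<sigma>) \<and>
     (\<forall>\<tau>\<in>\<Sigma>. \<forall>\<sigma>. is_face \<sigma> \<tau> \<longrightarrow> \<sigma> \<in> \<Sigma>) \<and>
     (\<forall>\<sigma>\<in>\<Sigma>. \<forall>\<tau>\<in>\<Sigma>. is_face (\<sigma> \<inter> \<tau>) \<sigma> \<and> is_face (\<sigma> \<inter> \<tau>) \<tau>)"

definition cone_monoid :: "'v::euclidean_space set \<Rightarrow> 'v set \<Rightarrow> 'v set" where
  "cone_monoid N \<sigma> = {m \<in> dual_lattice N. \<forall>u\<in>\<sigma>. 0 \<le> m \<bullet> u}"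

definition cone_perp :: "'v::euclidean_space set \<Rightarrow> 'v set \<Rightarrow> 'v set" where
  "cone_perp N \<sigma> = {m \<in> dual_lattice N. \<forall>u\<in>\<sigma>. m \<bullet> u = 0}"

definition cone_le :: "'v::euclidean_space set \<Rightarrow> 'v set \<Rightarrow> 'v \<Rightarrow> 'v \<Rightarrow> bool" where
  "cone_le N \<sigma> m' m \<longleftrightarrow> m - m' \<in> cone_monoid N \<sigma>"

definition admissible ::
  "'v::euclidean_space set \<Rightarrow> 'v \<times> 'v \<Rightarrow> 'v set set \<Rightarrow> ('v set \<Rightarrow> 'v set) \<Rightarrow> bool" where
  "admissible N c \<Sigma> \<B> \<longleftrightarrow>
     (\<forall>\<sigma>\<in>\<Sigma>. finite (\<B> \<sigma>) \<and> \<B> \<sigma> \<noteq> {} \<and> \<B> \<sigma> \<subseteq> cone_monoid N \<sigma>) \<and>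
     (\<forall>\<sigma>\<in>\<Sigma>. \<forall>m\<in>cone_monoid N \<sigma>. pairing m c \<noteq> 0 \<longrightarrow> (\<exists>b\<in>\<B> \<sigma>. cone_le N \<sigma> b m)) \<and>
     (\<forall>\<sigma>\<in>\<Sigma>. \<forall>\<sigma>'\<in>\<Sigma>. \<forall>b\<in>\<B> \<sigma>. \<exists>b'\<in>\<B> \<sigma>'. cone_le N (\<sigma> \<inter> \<sigma>') b' b) \<and>
     (\<forall>\<sigma>\<in>\<Sigma>. \<forall>a\<in>\<B> \<sigma>. \<forall>b\<in>\<B> \<sigma>. cone_le N \<sigma> a b \<longrightarrow> a = b)"

text \<open>The quotient map \<open>N\<^sub>\<real> \<rightarrow> N\<^sub>\<real> / (N\<^sub>\<sigma>)\<^sub>\<real>\<close>, with the quotient realized as an orthogonal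
  complement.  Since \<open>N\<^sub>\<sigma>\<close> is saturated in \<open>N\<close>, it is the kernel of this map on \<open>N\<close>, so the image
  of \<open>N\<close> is \<open>N(\<sigma>) = N / N\<^sub>\<sigma>\<close>; with the dual lattice as above, the character lattice of \<open>N(\<sigma>)\<close> is
  the subset \<open>\<sigma>\<^sup>\<bottom> \<inter> M\<close> of \<open>M\<close>.\<close>

definition quot :: "'v::euclidean_space set \<Rightarrow> 'v set \<Rightarrow> 'v \<Rightarrow> 'v" where
  "quot N \<sigma> u = (THE w. w \<in> (span (\<sigma> \<inter> N))\<^sup>\<bottom> \<and> u - w \<in> span (\<sigma> \<inter> N))"

definition quot_lattice :: "'v::euclidean_space set \<Rightarrow> 'v set \<Rightarrow> 'v set" where
  "quot_lattice N \<sigma> = quot N \<sigma> ` N"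

definition quot_param :: "'v::euclidean_space set \<Rightarrow> 'v set \<Rightarrow> 'v \<times> 'v \<Rightarrow> 'v \<times> 'v" where
  "quot_param N \<sigma> c = (quot N \<sigma> (fst c), quot N \<sigma> (snd c))"

definition quot_fan :: "'v::euclidean_space set \<Rightarrow> 'v set set \<Rightarrow> 'v set \<Rightarrow> 'v set set" where
  "quot_fan N \<Sigma> \<sigma> = {quot N \<sigma> ` \<tau> | \<tau>. \<tau> \<in> \<Sigma> \<and> is_face \<sigma> \<tau>}"

section \<open>Toric superalgebras and supertori\<close>

text \<open>The pair \<open>(f, g)\<close> stands for \<open>f + \<xi> g\<close>, where \<open>f\<close> and \<open>g\<close> are Laurent polynomials, i.e.\
  elements of the group algebra of the ambient space (whose product is the convolution product of
  \<^typ>\<open>'v \<Rightarrow>\<^sub>0 complex\<close>).\<close>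

type_synonym 'v coord = "('v \<Rightarrow>\<^sub>0 complex) \<times> ('v \<Rightarrow>\<^sub>0 complex)"

text \<open>\<open>\<complex>[S] \<oplus> \<xi> J\<close>, where \<open>J\<close> is spanned by the monomials with exponents in the second argument.\<close>

definition toric_alg :: "'v::euclidean_space set \<Rightarrow> 'v set \<Rightarrow> 'v coord superalg" where
  "toric_alg S J = \<lparr>
     carrier = {(f, g). Poly_Mapping.keys f \<subseteq> S \<and> Poly_Mapping.keys g \<subseteq> J},
     mult = (\<lambda>(f, g) (f', g'). (f * f', f * g' + g * f')),
     one = (1, 0),
     zero = (0, 0),
     add = (\<lambda>(f, g) (f', g'). (f + f', g + g')),
     smult = (\<lambda>z (f, g). (Poly_Mapping.single 0 z * f, Poly_Mapping.single 0 z * g)),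
     even_part = {(f, g). Poly_Mapping.keys f \<subseteq> S \<and> g = 0},
     odd_part = {(f, g). f = 0 \<and> Poly_Mapping.keys g \<subseteq> J}\<rparr>"

definition x_monom :: "'v::euclidean_space \<Rightarrow> 'v coord" where
  "x_monom m = (Poly_Mapping.single m 1, 0)"

definition xi_monom :: "'v::euclidean_space \<Rightarrow> 'v coord" where
  "xi_monom m = (0, Poly_Mapping.single m 1)"

definition supertorus_alg :: "'v::euclidean_space set \<Rightarrow> 'v coord superalg" where
  "supertorus_alg N = toric_alg (dual_lattice N) (dual_lattice N)"

definition even_torus_alg :: "'v::euclidean_space set \<Rightarrow> 'v coord superalg" where
  "even_torus_alg N = toric_alg (dual_lattice N) {}"

text \<open>\<open>\<complex>[S\<^sub>\<sigma>] \<oplus> \<xi> J\<^sup>\<sigma>\<close>\<close>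

definition chart_alg ::
  "'v::euclidean_space set \<Rightarrow> ('v set \<Rightarrow> 'v set) \<Rightarrow> 'v set \<Rightarrow> 'v coord superalg" where
  "chart_alg N \<B> \<sigma> =
     toric_alg (cone_monoid N \<sigma>) {b + s | b s. b \<in> \<B> \<sigma> \<and> s \<in> cone_monoid N \<sigma>}"

text \<open>The formulas
  \<open>x\<^sup>m \<mapsto> x\<^sup>m \<otimes> x\<^sup>m (1 + \<langle>m,c\<rangle> \<xi> \<otimes> \<xi>)\<close> and \<open>\<xi> x\<^sup>m \<mapsto> \<xi> x\<^sup>m \<otimes> x\<^sup>m + x\<^sup>m \<otimes> \<xi> x\<^sup>m\<close>
  define the comultiplication of a supertorus (for \<open>R = \<complex>[M,\<xi>]\<close>), and the coaction on the coordinate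
  superalgebra \<open>R\<close> of a chart.  On \<open>A\<close>-points, \<open>g\<close> and \<open>h\<close> are sent to the composition of this map
  with \<open>g \<otimes> h\<close> and the multiplication of \<open>A\<close>.  The case distinction is needed because
  \<open>\<xi> x\<^sup>m\<close> need not lie in \<open>R\<close> when \<open>\<langle>m,c\<rangle> = 0\<close>.  For a purely even torus and its actions take
  \<open>c = 0\<close>; then the terms with \<open>\<xi>\<close> do not occur.\<close>

definition conv ::
  "'v::euclidean_space \<times> 'v \<Rightarrow> 'v coord superalg \<Rightarrow> 'v coord superalg \<Rightarrow>
   ('v coord \<Rightarrow> 'v coord) \<Rightarrow> ('v coord \<Rightarrow> 'v coord) \<Rightarrow> ('v coord \<Rightarrow> 'v coord)" where
  "conv c R A g h = (\<lambda>q\<in>carrier R.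
     (\<Oplus>\<^bsub>A\<^esub>m\<in>Poly_Mapping.keys (fst q). Poly_Mapping.lookup (fst q) m \<odot>\<^bsub>A\<^esub>
        ((g (x_monom m) \<otimes>\<^bsub>A\<^esub> h (x_monom m)) \<oplus>\<^bsub>A\<^esub>
         (if pairing m c = 0 then \<zero>\<^bsub>A\<^esub>
          else pairing m c \<odot>\<^bsub>A\<^esub> (g (xi_monom m) \<otimes>\<^bsub>A\<^esub> h (xi_monom m))))) \<oplus>\<^bsub>A\<^esub>
     (\<Oplus>\<^bsub>A\<^esub>m\<in>Poly_Mapping.keys (snd q). Poly_Mapping.lookup (snd q) m \<odot>\<^bsub>A\<^esub>
        ((g (xi_monom m) \<otimes>\<^bsub>A\<^esub> h (x_monom m)) \<oplus>\<^bsub>A\<^esub> (g (x_monom m) \<otimes>\<^bsub>A\<^esub> h (xi_monom m)))))"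

text \<open>The counit \<open>x\<^sup>m \<mapsto> 1\<close>, \<open>\<xi> \<mapsto> 0\<close>, as an \<open>A\<close>-point of the torus.\<close>

definition torus_unit ::
  "'v::euclidean_space coord superalg \<Rightarrow> 'v coord superalg \<Rightarrow> 'v coord \<Rightarrow> 'v coord" where
  "torus_unit H A = (\<lambda>q\<in>carrier H. (\<Sum>m\<in>Poly_Mapping.keys (fst q). Poly_Mapping.lookup (fst q) m) \<odot>\<^bsub>A\<^esub> \<one>\<^bsub>A\<^esub>)"

text \<open>Actions of the supertorus with coordinate Hopf superalgebra \<open>H\<close> and parameter \<open>c\<close>.\<close>

definition torus_action ::
  "'v::euclidean_space coord superalg \<Rightarrow> 'v \<times> 'v \<Rightarrow> ('v coord, 'x) sfunctor \<Rightarrow>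
   ('v coord superalg \<Rightarrow> ('v coord \<Rightarrow> 'v coord) \<Rightarrow> 'x \<Rightarrow> 'x) \<Rightarrow> bool" where
  "torus_action H c X act \<longleftrightarrow>
     (\<forall>A. superalgebra A \<longrightarrow>
        (\<forall>g\<in>shom H A. \<forall>x\<in>pts X A. act A g x \<in> pts X A) \<and>
        (\<forall>x\<in>pts X A. act A (torus_unit H A) x = x) \<and>
        (\<forall>g\<in>shom H A. \<forall>h\<in>shom H A. \<forall>x\<in>pts X A.
           act A (conv c H A g h) x = act A g (act A h x))) \<and>
     (\<forall>A B f. superalgebra A \<and> superalgebra B \<and> f \<in> shom A B \<longrightarrow>
        (\<forall>g\<in>shom H A. \<forall>x\<in>pts X A.
           fmap X A B f (act A g x) = act B (compose (carrier H) f g) (fmap X A B f x)))"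

text \<open>\<open>H\<close> is the coordinate Hopf superalgebra of a supertorus with parameter \<open>c\<close>, or of a purely
  even torus with \<open>c = 0\<close>; \<open>j\<close> is the inclusion of the torus.\<close>

definition toric_supervariety ::
  "'v::euclidean_space coord superalg \<Rightarrow> 'v \<times> 'v \<Rightarrow> ('v coord, 'x) sfunctor \<Rightarrow>
   ('v coord superalg \<Rightarrow> ('v coord \<Rightarrow> 'v coord) \<Rightarrow> 'x) \<Rightarrow>
   ('v coord superalg \<Rightarrow> ('v coord \<Rightarrow> 'v coord) \<Rightarrow> 'x \<Rightarrow> 'x) \<Rightarrow> bool" where
  "toric_supervariety H c X j act \<longleftrightarrow>
     supervariety X \<and> affine_open_immersion H X j \<and> torus_action H c X act \<and>
     (\<forall>A. superalgebra A \<longrightarrow>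
        (\<forall>g\<in>shom H A. \<forall>h\<in>shom H A. act A g (j A h) = j A (conv c H A g h)))"

text \<open>\<open>X\<close> is the toric supervariety \<open>X\<^sub>\<Sigma>\<^sub>,\<^sub>\<B>\<close>: it is glued from the charts
  \<open>\<phi> \<sigma> : Sp (\<complex>[S\<^sub>\<sigma>] \<oplus> \<xi> J\<^sup>\<sigma>) \<rightarrow> X\<close>, where the charts of \<open>\<sigma>\<close> and \<open>\<tau>\<close> are glued along that of
  \<open>\<sigma> \<inter> \<tau>\<close>; its torus is the chart of the cone \<open>{0}\<close>, and the action of the torus is given on each
  chart by the coaction.  With \<open>\<B> = (\<lambda>_. {})\<close>, \<open>c = 0\<close> and \<open>H\<close> the coordinate algebra of the
  purely even torus, this is the ordinary toric variety \<open>X\<^sub>\<Sigma>\<close>.\<close>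

definition glued_toric ::
  "'v::euclidean_space coord superalg \<Rightarrow> 'v set \<Rightarrow> 'v \<times> 'v \<Rightarrow> 'v set set \<Rightarrow> ('v set \<Rightarrow> 'v set) \<Rightarrow>
   ('v coord, 'x) sfunctor \<Rightarrow>
   ('v set \<Rightarrow> 'v coord superalg \<Rightarrow> ('v coord \<Rightarrow> 'v coord) \<Rightarrow> 'x) \<Rightarrow>
   ('v coord superalg \<Rightarrow> ('v coord \<Rightarrow> 'v coord) \<Rightarrow> 'x \<Rightarrow> 'x) \<Rightarrow> bool" where
  "glued_toric H N c \<Sigma> \<B> X \<phi> act \<longleftrightarrow>
     toric_supervariety H c X (\<phi> {0}) act \<and>
     (\<forall>\<sigma>\<in>\<Sigma>. affine_open_immersion (chart_alg N \<B> \<sigma>) X (\<phi> \<sigma>)) \<and>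
     open_cover X ((\<lambda>\<sigma> A. \<phi> \<sigma> A ` shom (chart_alg N \<B> \<sigma>) A) ` \<Sigma>) \<and>
     (\<forall>\<sigma>\<in>\<Sigma>. \<forall>\<tau>\<in>\<Sigma>. is_face \<sigma> \<tau> \<longrightarrow>
        (\<forall>A. superalgebra A \<longrightarrow> (\<forall>h\<in>shom (chart_alg N \<B> \<sigma>) A.
           \<phi> \<sigma> A h = \<phi> \<tau> A (restrict h (carrier (chart_alg N \<B> \<tau>)))))) \<and>
     (\<forall>\<sigma>\<in>\<Sigma>. \<forall>\<tau>\<in>\<Sigma>. \<forall>A. superalgebra A \<longrightarrow>
        \<phi> \<sigma> A ` shom (chart_alg N \<B> \<sigma>) A \<inter> \<phi> \<tau> A ` shom (chart_alg N \<B> \<tau>) A =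
        \<phi> (\<sigma> \<inter> \<tau>) A ` shom (chart_alg N \<B> (\<sigma> \<inter> \<tau>)) A) \<and>
     (\<forall>\<sigma>\<in>\<Sigma>. \<forall>A. superalgebra A \<longrightarrow> (\<forall>g\<in>shom H A. \<forall>h\<in>shom (chart_alg N \<B> \<sigma>) A.
        act A g (\<phi> \<sigma> A h) = \<phi> \<sigma> A (conv c (chart_alg N \<B> \<sigma>) A g h)))"

definition is_toric_supervariety_of_fan ::
  "'v::euclidean_space set \<Rightarrow> 'v \<times> 'v \<Rightarrow> 'v set set \<Rightarrow> ('v set \<Rightarrow> 'v set) \<Rightarrow> 
   ('v coord, 'x) sfunctor \<Rightarrow> 
   ('v set \<Rightarrow> 'v coord superalg \<Rightarrow> ('v coord \<Rightarrow> 'v coord) \<Rightarrow> 'x) \<Rightarrow> 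
   ('v coord superalg \<Rightarrow> ('v coord \<Rightarrow> 'v coord) \<Rightarrow> 'x \<Rightarrow> 'x) \<Rightarrow> bool" where
  "is_toric_supervariety_of_fan N c \<Sigma> \<B> X \<phi> act \<longleftrightarrow>
     zlattice N \<and> c \<in> complexified N \<and> fan N \<Sigma> \<and> admissible N c \<Sigma> \<B> \<and>
     glued_toric (supertorus_alg N) N c \<Sigma> \<B> X \<phi> act"

definition is_toric_variety_of_fan ::
  "'v::euclidean_space set \<Rightarrow> 'v set set \<Rightarrow> 
   ('v coord, 'x) sfunctor \<Rightarrow> 
   ('v set \<Rightarrow> 'v coord superalg \<Rightarrow> ('v coord \<Rightarrow> 'v coord) \<Rightarrow> 'x) \<Rightarrow> 
   ('v coord superalg \<Rightarrow> ('v coord \<Rightarrow> 'v coord) \<Rightarrow> 'x \<Rightarrow> 'x) \<Rightarrow> bool" where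
  "is_toric_variety_of_fan N \<Sigma> X \<phi> act \<longleftrightarrow>
     zlattice N \<and> fan N \<Sigma> \<and> glued_toric (even_torus_alg N) N 0 \<Sigma> (\<lambda>_. {}) X \<phi> act"

section \<open>Points and orbits\<close>

text \<open>The superalgebra \<open>\<complex>\<close>, as \<open>\<complex>[{0}]\<close>.  Closed points of a supervariety are its \<open>\<complex>\<close>-points.\<close>

definition ground :: "'v::euclidean_space coord superalg" where
  "ground = toric_alg {0} {}"

definition structure_map :: "'v::euclidean_space coord superalg \<Rightarrow> 'v coord \<Rightarrow> 'v coord" where
  "structure_map A = (\<lambda>q\<in>carrier ground. Poly_Mapping.lookup (fst q) 0 \<odot>\<^bsub>A\<^esub> \<one>\<^bsub>A\<^esub>)"

text \<open>The distinguished point of \<open>Orb(\<sigma>)\<close>: \<open>x\<^sup>m \<mapsto> 1\<close> for \<open>m \<in> \<sigma>\<^sup>\<bottom>\<close>, and \<open>x\<^sup>m \<mapsto> 0\<close> otherwise.\<close>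

definition distinguished_point ::
  "'v::euclidean_space set \<Rightarrow> ('v set \<Rightarrow> 'v set) \<Rightarrow> 'v set \<Rightarrow> 'v coord \<Rightarrow> 'v coord" where
  "distinguished_point N \<B> \<sigma> = (\<lambda>q\<in>carrier (chart_alg N \<B> \<sigma>).
     (Poly_Mapping.single 0 (\<Sum>m\<in>Poly_Mapping.keys (fst q) \<inter> cone_perp N \<sigma>. Poly_Mapping.lookup (fst q) m), 0))"

text \<open>Odd elements vanish at \<open>\<complex>\<close>-points.  Hence the \<open>\<complex>\<close>-points of \<open>T\<^sub>N\<^sub>,\<^sub>c\<close> are those of \<open>T\<^sub>N\<close>, the
  \<open>\<complex>\<close>-points of \<open>X\<^sub>\<Sigma>\<^sub>,\<^sub>\<B>\<close> are those of \<open>X\<^sub>\<Sigma>\<close>, and the following is the set of closed points of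
  the \<open>T\<^sub>N\<close>-orbit in \<open>X\<^sub>\<Sigma>\<close> corresponding to \<open>\<sigma>\<close>.\<close>

definition Orb ::
  "'v::euclidean_space set \<Rightarrow> ('v set \<Rightarrow> 'v set) \<Rightarrow> 
   ('v set \<Rightarrow> 'v coord superalg \<Rightarrow> ('v coord \<Rightarrow> 'v coord) \<Rightarrow> 'x) \<Rightarrow> 
   ('v coord superalg \<Rightarrow> ('v coord \<Rightarrow> 'v coord) \<Rightarrow> 'x \<Rightarrow> 'x) \<Rightarrow> 
   'v set \<Rightarrow> 'x set" where
  "Orb N \<B> \<phi> act \<sigma> =
     {act ground t (\<phi> \<sigma> ground (distinguished_point N \<B> \<sigma>)) | t. t \<in> shom (supertorus_alg N) ground}"

definition orbit_functor ::
  "'v::euclidean_space coord superalg \<Rightarrow> ('v coord, 'x) sfunctor \<Rightarrow> 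
   ('v coord superalg \<Rightarrow> ('v coord \<Rightarrow> 'v coord) \<Rightarrow> 'x \<Rightarrow> 'x) \<Rightarrow> 
   'x \<Rightarrow> 'v coord superalg \<Rightarrow> 'x set" where
  "orbit_functor H X act p A = {act A g (fmap X ground A (structure_map A) p) | g. g \<in> shom H A}"

text \<open>Every monomial \<open>x\<^sup>b\<close> with \<open>b \<in> \<B>\<^sub>\<sigma>\<close> vanishes at \<open>p\<close>.\<close>

definition decorations_vanish ::
  "'v::euclidean_space set \<Rightarrow> ('v set \<Rightarrow> 'v set) \<Rightarrow> 
   ('v set \<Rightarrow> 'v coord superalg \<Rightarrow> ('v coord \<Rightarrow> 'v coord) \<Rightarrow> 'x) \<Rightarrow> 
   'v set \<Rightarrow> 'x \<Rightarrow> bool" where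
  "decorations_vanish N \<B> \<phi> \<sigma> p \<longleftrightarrow>
     (\<forall>h\<in>shom (chart_alg N \<B> \<sigma>) ground. \<phi> \<sigma> ground h = p \<longrightarrow>
        (\<forall>b\<in>\<B> \<sigma>. h (x_monom b) = \<zero>\<^bsub>ground\<^esub>))"

text \<open>\<open>j\<close> is an isomorphism of the torus with coordinate Hopf superalgebra \<open>H'\<close> onto the orbit of
  \<open>p\<close> under the torus with coordinate Hopf superalgebra \<open>H\<close>, compatible with the orbit map
  \<open>g \<mapsto> g \<cdot> p\<close> and the quotient map between the tori (dual to the inclusion of \<open>H'\<close> into \<open>H\<close>).\<close>

definition torus_is_orbit ::
  "'v::euclidean_space coord superalg \<Rightarrow> 'v coord superalg \<Rightarrow> ('v coord, 'x) sfunctor \<Rightarrow> 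
   ('v coord superalg \<Rightarrow> ('v coord \<Rightarrow> 'v coord) \<Rightarrow> 'x \<Rightarrow> 'x) \<Rightarrow> 
   'x \<Rightarrow> 
   ('v coord superalg \<Rightarrow> ('v coord \<Rightarrow> 'v coord) \<Rightarrow> 'x) \<Rightarrow> bool" where
  "torus_is_orbit H' H X act p j \<longleftrightarrow> (\<forall>A. superalgebra A \<longrightarrow>
     bij_betw (j A) (shom H' A) (orbit_functor H X act p A) \<and>
     (\<forall>g\<in>shom H A. j A (restrict g (carrier H')) = act A g (fmap X ground A (structure_map A) p)))"

end

theory Submission
  imports Defs
begin

text \<open>
  Write \<open>P = \<sigma>\<^sup>\<bottom> \<inter> M\<close>.  In the chart of a cone \<open>\<tau> \<ge> \<sigma>\<close>, the monomials \<open>x\<^sup>m\<close> and \<open>\<xi> x\<^sup>m\<close> with \<open>m \<notin> P\<close>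
  span an ideal, because \<open>P\<close> cuts out a face of \<open>S\<^sub>\<tau>\<close>; together with the unit ideals in the other charts
  these ideals are compatible with restriction to faces, and so glue to a closed subfunctor \<open>W\<close>.  The
  quotient of a chart is \<open>\<complex>[S\<^sub>\<tau> \<inter> P] \<oplus> \<xi> (J\<^sup>\<tau> \<inter> P)\<close>, which is the chart of \<open>\<tau>\<close> in the quotient fan
  with decorations \<open>\<B>\<^sub>\<tau> \<inter> P\<close>.  For \<open>\<tau> = \<sigma>\<close> it is the coordinate superalgebra \<open>H'\<close> of the orbit:
  \<open>J\<^sup>\<sigma> \<inter> P\<close> is empty or all of \<open>P\<close>, which makes the two cases.

  A closed subfunctor that contains the orbit contains its universal point, whence it contains \<open>W\<close>
  because \<open>\<complex>[S\<^sub>\<tau> \<inter> P] \<oplus> \<xi> (J\<^sup>\<tau> \<inter> P)\<close> embeds into \<open>H'\<close>; so \<open>W\<close> is the Zariski closure.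
  It is integral since the quotients are superdomains and \<open>\<complex>\<close>-points of the torus avoid finitely many
  hypersurfaces.  The action of \<open>T\<^sub>N\<^sub>,\<^sub>c\<close> on \<open>W\<close> factors through the quotient torus, because the coaction
  on each chart involves \<open>H'\<close> only, and the torus of \<open>W\<close> acts through a retraction \<open>M \<rightarrow> P\<close>.
\<close>

section \<open>Superalgebras\<close>

text \<open>Four obstacles shape the proof. Test superalgebras live in one fixed type, so
  localizations and residue fields have to be realized inside it; this is possible because the type
  is infinite. An \<open>A\<close>-point of \<open>X\<close> lies in charts only after passing to a
  finite principal cover, so the superideal that cuts out the glued subfunctor is the common kernel
  of maps from \<open>A\<close> to finitely many local quotients, and denominators must be cleared
  uniformly over the cover. The point \<open>p\<close> is any point of its orbit and differs from
  the distinguished one by a character \<open>z\<close> of \<open>M\<close>; the projections of the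
  charts are twisted by \<open>z\<close> so that the unit of the quotient torus goes to
  \<open>p\<close>. Finally, the retraction of \<open>M\<close> onto \<open>P\<close> need not
  respect \<open>c\<close>, so lifting points of the quotient torus need not be multiplicative; the
  action on the closure is well defined because torus points with equal restriction to
  \<open>H'\<close> act equally there. The zero ring is a legitimate test superalgebra: charts
  outside the star carry points of the closure over it only, which explains the recurring case
  distinction.\<close>

lemma cring_complex_ring: "cring complex_ring"
proof (rule cringI)
  show "abelian_group complex_ring"
  proof (rule abelian_groupI)
    fix x assume "x \<in> carrier complex_ring"
    have "- x \<oplus>\<^bsub>complex_ring\<^esub> x = \<zero>\<^bsub>complex_ring\<^esub>" "- x \<in> carrier complex_ring"
      by (simp_all add: complex_ring_def)
    then show "\<exists>y\<in>carrier complex_ring. y \<oplus>\<^bsub>complex_ring\<^esub> x = \<zero>\<^bsub>complex_ring\<^esub>" by blast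
  qed (simp_all add: complex_ring_def)
  show "comm_monoid complex_ring"
    by (rule comm_monoidI) (simp_all add: complex_ring_def)
qed (simp add: complex_ring_def distrib_right)

lemma complex_ring_simps [simp]:
  "carrier complex_ring = UNIV" "zero complex_ring = 0" "one complex_ring = 1"
  "mult complex_ring = (*)" "add complex_ring = (+)"
  by (simp_all add: complex_ring_def)

text \<open>Turns the predicate into a context in which the ring and module theory of the library is
  available for a test superalgebra.\<close>

locale salg =
  fixes A :: "'a superalg" (structure)
  assumes superalgebra: "superalgebra A"
begin

sublocale ring A
  using superalgebra by (simp add: superalgebra_def)

sublocale scalars: module complex_ring A
  using superalgebra by (simp add: superalgebra_def)

lemma smult_closed [simp, intro]: "a \<in> carrier A \<Longrightarrow> z \<odot> a \<in> carrier A"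
  using scalars.smult_closed by simp

lemma smult_add_left: "a \<in> carrier A \<Longrightarrow> (z + w) \<odot> a = z \<odot> a \<oplus> w \<odot> a"
  using scalars.smult_l_distr[of z w a] by simp

lemma smult_add_right: "a \<in> carrier A \<Longrightarrow> b \<in> carrier A \<Longrightarrow> z \<odot> (a \<oplus> b) = z \<odot> a \<oplus> z \<odot> b"
  using scalars.smult_r_distr[of z a b] by simp

lemma smult_smult: "a \<in> carrier A \<Longrightarrow> z \<odot> (w \<odot> a) = (z * w) \<odot> a"
  using scalars.smult_assoc1[of z w a] by simp

lemma smult_1 [simp]: "a \<in> carrier A \<Longrightarrow> 1 \<odot> a = a"
  using scalars.smult_one by simp

lemma smult_0 [simp]: "a \<in> carrier A \<Longrightarrow> 0 \<odot> a = \<zero>"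
  using scalars.smult_l_null by simp

lemma smult_zero [simp]: "z \<odot> \<zero> = \<zero>"
  using scalars.smult_r_null[of z] by simp

lemma smult_mult: "a \<in> carrier A \<Longrightarrow> b \<in> carrier A \<Longrightarrow> (z \<odot> a) \<otimes> b = z \<odot> (a \<otimes> b)"
  and mult_smult: "a \<in> carrier A \<Longrightarrow> b \<in> carrier A \<Longrightarrow> a \<otimes> (z \<odot> b) = z \<odot> (a \<otimes> b)"
  using superalgebra unfolding superalgebra_def by blast+

lemma smult_minus_1: "a \<in> carrier A \<Longrightarrow> (- 1) \<odot> a = \<ominus> a"
proof (rule minus_equality[symmetric])
  assume a: "a \<in> carrier A"
  have "(- 1) \<odot> a \<oplus> 1 \<odot> a = (- 1 + 1) \<odot> a" by (simp only: smult_add_left[OF a])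
  then show "(- 1) \<odot> a \<oplus> a = \<zero>" using a by simp
qed auto

lemma even_submodule: "submodule (even_part A) complex_ring A"
  and odd_submodule: "submodule (odd_part A) complex_ring A"
  using superalgebra unfolding superalgebra_def by blast+

lemma even_carrier: "a \<in> even_part A \<Longrightarrow> a \<in> carrier A"
  and even_add [intro]: "a \<in> even_part A \<Longrightarrow> b \<in> even_part A \<Longrightarrow> a \<oplus> b \<in> even_part A"
  and even_smult [intro]: "a \<in> even_part A \<Longrightarrow> z \<odot> a \<in> even_part A"
  and even_a_inv [intro]: "a \<in> even_part A \<Longrightarrow> \<ominus> a \<in> even_part A"
  using scalars.submoduleE[OF even_submodule] by auto

lemma odd_carrier: "a \<in> odd_part A \<Longrightarrow> a \<in> carrier A"
  and odd_add [intro]: "a \<in> odd_part A \<Longrightarrow> b \<in> odd_part A \<Longrightarrow> a \<oplus> b \<in> odd_part A"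
  and odd_smult [intro]: "a \<in> odd_part A \<Longrightarrow> z \<odot> a \<in> odd_part A"
  and odd_a_inv [intro]: "a \<in> odd_part A \<Longrightarrow> \<ominus> a \<in> odd_part A"
  using scalars.submoduleE[OF odd_submodule] by auto

lemma even_odd_zero: "a \<in> even_part A \<Longrightarrow> a \<in> odd_part A \<Longrightarrow> a = \<zero>"
  and zero_even [simp, intro]: "\<zero> \<in> even_part A"
  and zero_odd [simp, intro]: "\<zero> \<in> odd_part A"
  and one_even [simp, intro]: "\<one> \<in> even_part A"
  using superalgebra unfolding superalgebra_def by blast+

lemma even_odd_decomp:
  assumes "a \<in> carrier A"
  obtains x y where "x \<in> even_part A" "y \<in> odd_part A" "a = x \<oplus> y"
  using assms superalgebra unfolding superalgebra_def by blast

lemma even_mult_even [intro]: "a \<in> even_part A \<Longrightarrow> b \<in> even_part A \<Longrightarrow> a \<otimes> b \<in> even_part A"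
  and even_mult_odd [intro]: "a \<in> even_part A \<Longrightarrow> b \<in> odd_part A \<Longrightarrow> a \<otimes> b \<in> odd_part A"
  and odd_mult_odd [intro]: "a \<in> odd_part A \<Longrightarrow> b \<in> odd_part A \<Longrightarrow> a \<otimes> b \<in> even_part A"
  and even_comm: "a \<in> even_part A \<Longrightarrow> b \<in> carrier A \<Longrightarrow> a \<otimes> b = b \<otimes> a"
  and odd_anticomm: "a \<in> odd_part A \<Longrightarrow> b \<in> odd_part A \<Longrightarrow> a \<otimes> b = \<ominus> (b \<otimes> a)"
  using superalgebra unfolding superalgebra_def by blast+

lemma odd_mult_even [intro]: "a \<in> odd_part A \<Longrightarrow> b \<in> even_part A \<Longrightarrow> a \<otimes> b \<in> odd_part A"
  using even_comm[OF _ odd_carrier, of b a] even_mult_odd[of b a] by simp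

lemma even_pow [intro]: "a \<in> even_part A \<Longrightarrow> a [^] (n::nat) \<in> even_part A"
  by (induction n) (simp_all add: even_mult_even)

text \<open>The difference \<open>x - x' = y' - y\<close> is even and odd at once, hence
  zero.\<close>

lemma even_odd_unique:
  assumes "x \<in> even_part A" "y \<in> odd_part A" "x' \<in> even_part A" "y' \<in> odd_part A"
    and "x \<oplus> y = x' \<oplus> y'"
  shows "x = x'" "y = y'"
proof -
  note c = assms(1,3)[THEN even_carrier] assms(2,4)[THEN odd_carrier]
  have "x \<oplus> \<ominus> x' = (x \<oplus> y) \<oplus> \<ominus> y \<oplus> \<ominus> x'"
    using c by (simp add: a_assoc r_neg)
  also have "\<dots> = (x' \<oplus> y') \<oplus> \<ominus> y \<oplus> \<ominus> x'"
    using assms(5) by simp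
  also have "\<dots> = y' \<oplus> \<ominus> y"
    using c by (simp add: a_ac) (metis a_lcomm add.inv_closed add.m_closed r_neg2)
  finally have eq: "x \<oplus> \<ominus> x' = y' \<oplus> \<ominus> y" .
  then have "x \<oplus> \<ominus> x' \<in> even_part A \<inter> odd_part A"
    using assms by (metis IntI even_a_inv even_add odd_a_inv odd_add)
  then have "x \<oplus> \<ominus> x' = \<zero>" using even_odd_zero by auto
  then show "x = x'" using c by (metis a_inv_closed minus_equality minus_minus)
  then show "y = y'" using assms(5) c by simp
qed

text \<open>Anticommutativity of \<open>a\<close> with itself makes twice the square vanish, and 2
  is invertible over the complex numbers.\<close>

lemma odd_square: assumes "a \<in> odd_part A" shows "a \<otimes> a = \<zero>"
proof -
  have c: "a \<otimes> a \<in> carrier A" using assms odd_carrier by auto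
  have "a \<otimes> a \<oplus> a \<otimes> a = \<zero>"
    using odd_anticomm[OF assms assms] c by (metis r_neg)
  then have "(1 + 1) \<odot> (a \<otimes> a) = \<zero>"
    using c by (subst smult_add_left) auto
  then have "(1/2) \<odot> ((1 + 1) \<odot> (a \<otimes> a)) = \<zero>" by simp
  then show ?thesis using c by (subst (asm) smult_smult) auto
qed

lemma zero_ring_eq: assumes "\<one> = \<zero>" "a \<in> carrier A" shows "a = \<zero>"
  using l_one[OF assms(2)] l_null[OF assms(2)] assms(1) by simp

end

text \<open>A rule without additive inverses: negation is multiplication by the scalar -1. For
  fractions and for toric superalgebras only explicit formulas for sums, products and scalar
  multiples then have to be compared.\<close>

lemma superalgebraI:
  fixes A (structure)
  assumes closed: "\<And>a b. a \<in> carrier A \<Longrightarrow> b \<in> carrier A \<Longrightarrow> a \<oplus> b \<in> carrier A"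
      "\<And>a b. a \<in> carrier A \<Longrightarrow> b \<in> carrier A \<Longrightarrow> a \<otimes> b \<in> carrier A"
      "\<And>z a. a \<in> carrier A \<Longrightarrow> z \<odot> a \<in> carrier A" "\<zero> \<in> carrier A"
    and add: "\<And>a b c. a \<in> carrier A \<Longrightarrow> b \<in> carrier A \<Longrightarrow> c \<in> carrier A \<Longrightarrow> (a \<oplus> b) \<oplus> c = a \<oplus> (b \<oplus> c)"
      "\<And>a b. a \<in> carrier A \<Longrightarrow> b \<in> carrier A \<Longrightarrow> a \<oplus> b = b \<oplus> a"
      "\<And>a. a \<in> carrier A \<Longrightarrow> \<zero> \<oplus> a = a"
    and mult: "\<And>a b c. a \<in> carrier A \<Longrightarrow> b \<in> carrier A \<Longrightarrow> c \<in> carrier A \<Longrightarrow> (a \<otimes> b) \<otimes> c = a \<otimes> (b \<otimes> c)"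
      "\<And>a. a \<in> carrier A \<Longrightarrow> \<one> \<otimes> a = a" "\<And>a. a \<in> carrier A \<Longrightarrow> a \<otimes> \<one> = a"
      "\<And>a b c. a \<in> carrier A \<Longrightarrow> b \<in> carrier A \<Longrightarrow> c \<in> carrier A \<Longrightarrow> (a \<oplus> b) \<otimes> c = a \<otimes> c \<oplus> b \<otimes> c"
      "\<And>a b c. a \<in> carrier A \<Longrightarrow> b \<in> carrier A \<Longrightarrow> c \<in> carrier A \<Longrightarrow> c \<otimes> (a \<oplus> b) = c \<otimes> a \<oplus> c \<otimes> b"
    and smult: "\<And>z w a. a \<in> carrier A \<Longrightarrow> (z + w) \<odot> a = z \<odot> a \<oplus> w \<odot> a"
      "\<And>z a b. a \<in> carrier A \<Longrightarrow> b \<in> carrier A \<Longrightarrow> z \<odot> (a \<oplus> b) = z \<odot> a \<oplus> z \<odot> b"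
      "\<And>z w a. a \<in> carrier A \<Longrightarrow> (z * w) \<odot> a = z \<odot> (w \<odot> a)"
      "\<And>a. a \<in> carrier A \<Longrightarrow> 1 \<odot> a = a" "\<And>a. a \<in> carrier A \<Longrightarrow> 0 \<odot> a = \<zero>"
      "\<And>z a b. a \<in> carrier A \<Longrightarrow> b \<in> carrier A \<Longrightarrow> (z \<odot> a) \<otimes> b = z \<odot> (a \<otimes> b)"
      "\<And>z a b. a \<in> carrier A \<Longrightarrow> b \<in> carrier A \<Longrightarrow> a \<otimes> (z \<odot> b) = z \<odot> (a \<otimes> b)"
    and even: "even_part A \<subseteq> carrier A" "\<one> \<in> even_part A"
      "\<And>a b. a \<in> even_part A \<Longrightarrow> b \<in> even_part A \<Longrightarrow> a \<oplus> b \<in> even_part A"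
      "\<And>z a. a \<in> even_part A \<Longrightarrow> z \<odot> a \<in> even_part A"
      "\<And>a b. a \<in> even_part A \<Longrightarrow> b \<in> even_part A \<Longrightarrow> a \<otimes> b \<in> even_part A"
      "\<And>a b. a \<in> even_part A \<Longrightarrow> b \<in> carrier A \<Longrightarrow> a \<otimes> b = b \<otimes> a"
    and odd: "odd_part A \<subseteq> carrier A" "\<zero> \<in> odd_part A"
      "\<And>a b. a \<in> odd_part A \<Longrightarrow> b \<in> odd_part A \<Longrightarrow> a \<oplus> b \<in> odd_part A"
      "\<And>z a. a \<in> odd_part A \<Longrightarrow> z \<odot> a \<in> odd_part A"
      "\<And>a b. a \<in> even_part A \<Longrightarrow> b \<in> odd_part A \<Longrightarrow> a \<otimes> b \<in> odd_part A"
      "\<And>a b. a \<in> odd_part A \<Longrightarrow> b \<in> odd_part A \<Longrightarrow> a \<otimes> b \<in> even_part A"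
      "\<And>a b. a \<in> odd_part A \<Longrightarrow> b \<in> odd_part A \<Longrightarrow> a \<otimes> b = (- 1) \<odot> (b \<otimes> a)"
    and decomp: "\<And>a. a \<in> even_part A \<Longrightarrow> a \<in> odd_part A \<Longrightarrow> a = \<zero>"
      "\<And>a. a \<in> carrier A \<Longrightarrow> \<exists>x\<in>even_part A. \<exists>y\<in>odd_part A. a = x \<oplus> y"
  shows "superalgebra A"
proof -
  have neg: "(- 1) \<odot> a \<oplus> a = \<zero>" if "a \<in> carrier A" for a
  proof -
    have "(- 1) \<odot> a \<oplus> a = (- 1) \<odot> a \<oplus> 1 \<odot> a" by (simp only: smult(4)[OF that])
    also have "\<dots> = (- 1 + 1) \<odot> a" by (simp only: smult(1)[OF that])
    also have "\<dots> = \<zero>" using smult(5)[OF that] by simp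
    finally show ?thesis .
  qed
  have one: "\<one> \<in> carrier A" using even by auto
  have ab: "abelian_group A"
  proof (rule abelian_groupI)
    fix a assume a: "a \<in> carrier A"
    show "\<exists>y\<in>carrier A. y \<oplus> a = \<zero>" using neg[OF a] closed(3)[OF a] by blast
  qed (rule closed add; assumption?)+
  interpret ring A
    by (rule ringI[OF ab monoidI]; rule closed mult one; assumption?)
  have mod: "module complex_ring A"
    by (rule moduleI[OF cring_complex_ring ab]; simp only: complex_ring_simps; rule closed smult(1-4); assumption?)
  have inv: "\<ominus> a = (- 1) \<odot> a" if "a \<in> carrier A" for a
    using neg[OF that] that closed(3) by (metis minus_equality)
  \<comment> \<open>Zero is reached inside the even part as 0 times the unit.\<close>
  have z: "\<zero> \<in> even_part A"
    using even(1,2) even(4)[of \<one> 0] smult(5)[of \<one>] by auto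
  have "submodule (even_part A) complex_ring A"
    by (rule module.submoduleI[OF mod]) (use even(1,3,4) z inv in auto)
  moreover have "submodule (odd_part A) complex_ring A"
    by (rule module.submoduleI[OF mod]) (use odd(1-4) inv in auto)
  moreover have "a \<otimes> b = \<ominus> (b \<otimes> a)" if "a \<in> odd_part A" "b \<in> odd_part A" for a b
    using inv[of "b \<otimes> a"] odd(7)[OF that] closed(2) odd(1) that by (metis subsetD)
  moreover have "even_part A \<inter> odd_part A = {\<zero>}"
    using decomp(1) z odd(2) by blast
  ultimately show ?thesis
    unfolding superalgebra_def
    by (intro conjI ballI allI impI)
      (assumption | rule ring_axioms mod smult(6,7) even(2,5,6) odd(5,6) decomp(2); assumption)+
qed

lemma salgI: "superalgebra A \<Longrightarrow> salg A" by unfold_locales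

lemma shom_ring_hom: "f \<in> shom A B \<Longrightarrow> f \<in> ring_hom A B"
  and shom_extensional: "f \<in> shom A B \<Longrightarrow> f \<in> extensional (carrier A)"
  and shom_smult: "f \<in> shom A B \<Longrightarrow> a \<in> carrier A \<Longrightarrow> f (z \<odot>\<^bsub>A\<^esub> a) = z \<odot>\<^bsub>B\<^esub> f a"
  and shom_even: "f \<in> shom A B \<Longrightarrow> a \<in> even_part A \<Longrightarrow> f a \<in> even_part B"
  and shom_odd: "f \<in> shom A B \<Longrightarrow> a \<in> odd_part A \<Longrightarrow> f a \<in> odd_part B"
  by (auto simp: shom_def)

lemma shom_closed: "f \<in> shom A B \<Longrightarrow> a \<in> carrier A \<Longrightarrow> f a \<in> carrier B"
  and shom_add: "f \<in> shom A B \<Longrightarrow> a \<in> carrier A \<Longrightarrow> b \<in> carrier A \<Longrightarrow> f (a \<oplus>\<^bsub>A\<^esub> b) = f a \<oplus>\<^bsub>B\<^esub> f b"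
  and shom_mult: "f \<in> shom A B \<Longrightarrow> a \<in> carrier A \<Longrightarrow> b \<in> carrier A \<Longrightarrow> f (a \<otimes>\<^bsub>A\<^esub> b) = f a \<otimes>\<^bsub>B\<^esub> f b"
  and shom_one: "f \<in> shom A B \<Longrightarrow> f \<one>\<^bsub>A\<^esub> = \<one>\<^bsub>B\<^esub>"
  using shom_ring_hom[of f A B] by (auto simp: ring_hom_def)

lemma shomI:
  assumes "\<And>a. a \<in> carrier A \<Longrightarrow> f a \<in> carrier B"
    "\<And>a b. a \<in> carrier A \<Longrightarrow> b \<in> carrier A \<Longrightarrow> f (a \<oplus>\<^bsub>A\<^esub> b) = f a \<oplus>\<^bsub>B\<^esub> f b"
    "\<And>a b. a \<in> carrier A \<Longrightarrow> b \<in> carrier A \<Longrightarrow> f (a \<otimes>\<^bsub>A\<^esub> b) = f a \<otimes>\<^bsub>B\<^esub> f b"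
    "f \<one>\<^bsub>A\<^esub> = \<one>\<^bsub>B\<^esub>" "f \<in> extensional (carrier A)"
    "\<And>z a. a \<in> carrier A \<Longrightarrow> f (z \<odot>\<^bsub>A\<^esub> a) = z \<odot>\<^bsub>B\<^esub> f a"
    "\<And>a. a \<in> even_part A \<Longrightarrow> f a \<in> even_part B" "\<And>a. a \<in> odd_part A \<Longrightarrow> f a \<in> odd_part B"
  shows "f \<in> shom A B"
  using assms by (auto simp: shom_def ring_hom_def)

lemma shom_eqI:
  assumes "f \<in> shom A B" "g \<in> shom A C" "\<And>a. a \<in> carrier A \<Longrightarrow> f a = g a"
  shows "f = g"
  using assms by (meson extensionalityI shom_extensional)

lemma shom_zero:
  assumes "superalgebra A" "superalgebra B" "f \<in> shom A B" shows "f \<zero>\<^bsub>A\<^esub> = \<zero>\<^bsub>B\<^esub>"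
proof -
  interpret A: salg A using assms(1) by (rule salgI)
  interpret B: salg B using assms(2) by (rule salgI)
  show ?thesis
    using shom_smult[OF assms(3) A.zero_closed, of 0] shom_closed[OF assms(3) A.zero_closed] by simp
qed

lemma shom_a_inv:
  assumes "superalgebra A" "superalgebra B" "f \<in> shom A B" "a \<in> carrier A"
  shows "f (\<ominus>\<^bsub>A\<^esub> a) = \<ominus>\<^bsub>B\<^esub> f a"
proof -
  interpret A: salg A using assms(1) by (rule salgI)
  interpret B: salg B using assms(2) by (rule salgI)
  show ?thesis
    using shom_smult[OF assms(3,4), of "- 1"] shom_closed[OF assms(3,4)] assms(4)
    by (simp add: A.smult_minus_1 B.smult_minus_1)
qed

lemma shom_pow:
  assumes "superalgebra A" "superalgebra B" "f \<in> shom A B" "a \<in> carrier A"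
  shows "f (a [^]\<^bsub>A\<^esub> (n::nat)) = f a [^]\<^bsub>B\<^esub> n"
proof -
  interpret A: salg A using assms(1) by (rule salgI)
  interpret B: salg B using assms(2) by (rule salgI)
  show ?thesis
    by (induction n) (use assms in \<open>simp_all add: shom_one shom_mult\<close>)
qed

lemma shom_compose:
  assumes "superalgebra A" "f \<in> shom A B" "g \<in> shom B C"
  shows "compose (carrier A) g f \<in> shom A C"
proof -
  interpret A: salg A using assms(1) by (rule salgI)
  show ?thesis
    by (rule shomI)
      (use assms in \<open>simp_all add: compose_eq A.even_carrier A.odd_carrier shom_closed shom_add shom_mult
        shom_one shom_smult shom_even shom_odd compose_extensional\<close>)
qed

lemma shom_restrict_id: assumes "superalgebra A" shows "restrict id (carrier A) \<in> shom A A"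
proof -
  interpret A: salg A using assms by (rule salgI)
  show ?thesis
    by (rule shomI) (auto simp: A.even_carrier A.odd_carrier)
qed

text \<open>Homogeneity comes from the uniqueness of components in \<open>B\<close>: the images of
  the two components are again even and odd, so a vanishing sum forces both to vanish.\<close>

lemma superideal_kernel:
  fixes A (structure)
  assumes A: "superalgebra A" and B: "superalgebra B" and f: "f \<in> shom A B"
  shows "superideal {a \<in> carrier A. f a = \<zero>\<^bsub>B\<^esub>} A"
proof -
  interpret A: salg A using A by (rule salgI)
  interpret B: salg B using B by (rule salgI)
  have "ideal {a \<in> carrier A. f a = \<zero>\<^bsub>B\<^esub>} A"
  proof (rule idealI)
    show "subgroup {a \<in> carrier A. f a = \<zero>\<^bsub>B\<^esub>} (add_monoid A)"
    proof (rule A.add.subgroupI)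
      show "\<And>a. a \<in> {a \<in> carrier A. f a = \<zero>\<^bsub>B\<^esub>} \<Longrightarrow> \<ominus> a \<in> {a \<in> carrier A. f a = \<zero>\<^bsub>B\<^esub>}"
        using shom_a_inv[OF A B f] by auto
    qed (use A.zero_closed in \<open>auto simp: shom_add[OF f] shom_zero[OF A B f] simp del: A.zero_closed\<close>)
  qed (auto simp: A.ring_axioms shom_mult[OF f] shom_closed[OF f])
  moreover have "x \<in> {a \<in> carrier A. f a = \<zero>\<^bsub>B\<^esub>} \<and> y \<in> {a \<in> carrier A. f a = \<zero>\<^bsub>B\<^esub>}"
    if xy: "x \<in> even_part A" "y \<in> odd_part A" "x \<oplus> y \<in> {a \<in> carrier A. f a = \<zero>\<^bsub>B\<^esub>}" for x y
  proof -
    have c: "x \<in> carrier A" "y \<in> carrier A" using xy A.even_carrier A.odd_carrier by blast+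
    have "f x \<oplus>\<^bsub>B\<^esub> f y = \<zero>\<^bsub>B\<^esub> \<oplus>\<^bsub>B\<^esub> \<zero>\<^bsub>B\<^esub>"
      using xy shom_add[OF f c] by simp
    then have "f x = \<zero>\<^bsub>B\<^esub>" "f y = \<zero>\<^bsub>B\<^esub>"
      using B.even_odd_unique[of "f x" "f y" "\<zero>\<^bsub>B\<^esub>" "\<zero>\<^bsub>B\<^esub>"] shom_even[OF f xy(1)] shom_odd[OF f xy(2)]
      by blast+
    then show ?thesis using c by simp
  qed
  ultimately show ?thesis unfolding superideal_def by blast
qed

lemma shom_genideal:
  fixes A (structure)
  assumes A: "superalgebra A" and B: "superalgebra B" and f: "f \<in> shom A B"
    and S: "S \<subseteq> carrier A" "\<And>s. s \<in> S \<Longrightarrow> f s = \<zero>\<^bsub>B\<^esub>" and a: "a \<in> Idl S"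
  shows "f a = \<zero>\<^bsub>B\<^esub>"
proof -
  interpret A: salg A using A by (rule salgI)
  have "Idl S \<subseteq> {a \<in> carrier A. f a = \<zero>\<^bsub>B\<^esub>}"
    using superideal_kernel[OF A B f] S by (intro A.genideal_minimal) (auto simp: superideal_def)
  then show ?thesis using a by auto
qed

context salg
begin

text \<open>The sums of an even and an odd element that both belong to \<open>Idl S\<close> form a
  two-sided ideal containing \<open>S\<close>, so they exhaust \<open>Idl S\<close>; uniqueness of
  components finishes the argument.\<close>

lemma superideal_genideal:
  assumes "S \<subseteq> even_part A \<union> odd_part A"
  shows "superideal (Idl S) A"
proof -
  have Sc: "S \<subseteq> carrier A" using assms even_carrier odd_carrier by blast
  interpret I: ideal "Idl S" A by (rule genideal_ideal[OF Sc])
  define E where "E = {a. \<exists>x y. x \<in> even_part A \<and> y \<in> odd_part A \<and> x \<in> Idl S \<and> y \<in> Idl S \<and> a = x \<oplus> y}"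
  have EI': "x \<oplus> y \<in> E" if "x \<in> even_part A" "y \<in> odd_part A" "x \<in> Idl S" "y \<in> Idl S" for x y
    unfolding E_def using that by blast
  have E_add: "a \<oplus> b \<in> E" if ab: "a \<in> E" "b \<in> E" for a b
  proof -
    obtain x y x' y' where *: "x \<in> even_part A" "y \<in> odd_part A" "x \<in> Idl S" "y \<in> Idl S" "a = x \<oplus> y"
      "x' \<in> even_part A" "y' \<in> odd_part A" "x' \<in> Idl S" "y' \<in> Idl S" "b = x' \<oplus> y'"
      using ab unfolding E_def by blast
    have "a \<oplus> b = (x \<oplus> x') \<oplus> (y \<oplus> y')"
      using * by (simp add: even_carrier odd_carrier a_ac)
    then show ?thesis
      using EI'[OF even_add[OF *(1,6)] odd_add[OF *(2,7)] I.a_closed[OF *(3,8)] I.a_closed[OF *(4,9)]]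
      by simp
  qed
  have Eh: "a \<in> E" if "a \<in> Idl S" "a \<in> even_part A \<union> odd_part A" for a
  proof (cases "a \<in> even_part A")
    case True
    then have "a = a \<oplus> \<zero>" using even_carrier by simp
    then show ?thesis using EI'[OF True zero_odd that(1) I.zero_closed] by simp
  next
    case False
    then have "a \<in> odd_part A" using that by blast
    moreover from this have "a = \<zero> \<oplus> a" using odd_carrier by simp
    ultimately show ?thesis using EI'[OF zero_even _ I.zero_closed that(1)] by simp
  qed
  have E_sub: "E \<subseteq> carrier A" unfolding E_def using even_carrier odd_carrier by blast
  have EI: "E \<subseteq> Idl S" unfolding E_def by blast
  have E_neg: "\<ominus> a \<in> E" if a: "a \<in> E" for a
  proof -
    obtain x y where *: "x \<in> even_part A" "y \<in> odd_part A" "x \<in> Idl S" "y \<in> Idl S" "a = x \<oplus> y"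
      using a unfolding E_def by blast
    have "\<ominus> a = \<ominus> x \<oplus> \<ominus> y"
      unfolding *(5) by (rule minus_add[OF even_carrier[OF *(1)] odd_carrier[OF *(2)]])
    then show ?thesis
      using EI'[OF even_a_inv[OF *(1)] odd_a_inv[OF *(2)] I.a_inv_closed[OF *(3)] I.a_inv_closed[OF *(4)]]
      by simp
  qed
  \<comment> \<open>Splitting both factors leaves products of homogeneous elements, and each of
    these lies in \<open>Idl S\<close> and is homogeneous itself.\<close>
  have E_mult: "a \<otimes> r \<in> E \<and> r \<otimes> a \<in> E" if a: "a \<in> E" and r: "r \<in> carrier A" for a r
  proof -
    obtain x y where *: "x \<in> even_part A" "y \<in> odd_part A" "x \<in> Idl S" "y \<in> Idl S" "a = x \<oplus> y"
      using a unfolding E_def by blast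
    obtain u v where r: "u \<in> even_part A" "v \<in> odd_part A" "r = u \<oplus> v"
      using even_odd_decomp[OF r] by blast
    note c = *(1)[THEN even_carrier] *(2)[THEN odd_carrier] r(1)[THEN even_carrier] r(2)[THEN odd_carrier]
    have "x \<otimes> u \<in> E" "x \<otimes> v \<in> E" "y \<otimes> u \<in> E" "y \<otimes> v \<in> E"
      "u \<otimes> x \<in> E" "v \<otimes> x \<in> E" "u \<otimes> y \<in> E" "v \<otimes> y \<in> E"
      using c I.I_r_closed[OF *(3)] I.I_r_closed[OF *(4)] I.I_l_closed[OF *(3)] I.I_l_closed[OF *(4)]
        * r by (auto intro!: Eh)
    moreover have "a \<otimes> r = (x \<otimes> u \<oplus> x \<otimes> v) \<oplus> (y \<otimes> u \<oplus> y \<otimes> v)"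
        "r \<otimes> a = (u \<otimes> x \<oplus> v \<otimes> x) \<oplus> (u \<otimes> y \<oplus> v \<otimes> y)"
      using c *(5) r(3) by (simp_all add: l_distr r_distr a_ac)
    ultimately show ?thesis using E_add by simp
  qed
  have "ideal E A"
  proof (rule idealI)
    show "subgroup E (add_monoid A)"
    proof (rule add.subgroupI)
      show "E \<noteq> {}" using Eh[OF I.zero_closed] by auto
    qed (use E_sub E_add E_neg in auto)
  qed (use E_mult ring_axioms in auto)
  moreover have "S \<subseteq> E"
    using Eh assms genideal_self[OF Sc] by blast
  ultimately have "Idl S = E" using genideal_minimal[of E S] EI by blast
  moreover have "x \<in> Idl S \<and> y \<in> Idl S" if "x \<in> even_part A" "y \<in> odd_part A" "x \<oplus> y \<in> E" for x y
    using that even_odd_unique[of x y] unfolding E_def by blast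
  ultimately show ?thesis
    unfolding superideal_def using genideal_ideal[OF Sc] by blast
qed

end

section \<open>Localizations of quotients\<close>

text \<open>\<open>L\<close> is the localization of \<open>A / I\<close> at the powers of \<open>f\<close>.  The construction takes place inside the
  type of \<open>A\<close>: \<open>code\<close> maps pairs \<open>(a, n)\<close>, standing for \<open>a / f\<^sup>n\<close>, to representatives of their classes.\<close>

definition fraction_quotient ::
  "'a superalg \<Rightarrow> 'a set \<Rightarrow> 'a \<Rightarrow> 'a superalg \<Rightarrow> ('a \<Rightarrow> 'a) \<Rightarrow> bool" where
  "fraction_quotient A I f L l \<longleftrightarrow> superalgebra L \<and> l \<in> shom A L \<and> l f \<in> Units L \<and>
     (\<forall>y\<in>carrier L. \<exists>a\<in>carrier A. \<exists>n::nat. y \<otimes>\<^bsub>L\<^esub> (l f [^]\<^bsub>L\<^esub> n) = l a) \<and>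
     (\<forall>a\<in>carrier A. l a = \<zero>\<^bsub>L\<^esub> \<longleftrightarrow> (\<exists>n::nat. (f [^]\<^bsub>A\<^esub> n) \<otimes>\<^bsub>A\<^esub> a \<in> I))"

text \<open>The congruence in \<open>code_eq\<close> is equality of \<open>a / f^n\<close> and
  \<open>b / f^m\<close> in the localization of \<open>A / I\<close>: after cross-multiplication a
  further power \<open>f^k\<close> is allowed, since \<open>f\<close> may be a zero divisor modulo
  \<open>I\<close>.\<close>

locale fractions = salg A for A :: "'a superalg" (structure) +
  fixes I :: "'a set" and f :: 'a and code :: "'a \<times> nat \<Rightarrow> 'a"
  assumes superideal_I: "superideal I A" and f_even: "f \<in> even_part A"
    and code_eq: "\<And>a n b m. a \<in> carrier A \<Longrightarrow> b \<in> carrier A \<Longrightarrow> code (a, n) = code (b, m) \<longleftrightarrow>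
      (\<exists>k. (f [^] (k + m)) \<otimes> a \<ominus> (f [^] (k + n)) \<otimes> b \<in> I)"
begin

sublocale I: ideal I A
  using superideal_I by (simp add: superideal_def)

abbreviation cong_I (infix "\<doteq>" 50) where "a \<doteq> b \<equiv> a \<ominus> b \<in> I"

definition fr :: "'a \<Rightarrow> nat \<Rightarrow> 'a" where "fr a n = code (a, n)"

lemma f_carrier [simp, intro]: "f \<in> carrier A"
  using f_even even_carrier by blast

lemma f_comm: "a \<in> carrier A \<Longrightarrow> a \<otimes> f [^] (n::nat) = f [^] n \<otimes> a"
  using even_comm[OF even_pow[OF f_even]] by simp

lemma f_pow_lcomm:
  assumes "a \<in> carrier A" "b \<in> carrier A" shows "a \<otimes> (f [^] (n::nat) \<otimes> b) = f [^] n \<otimes> (a \<otimes> b)"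
  using assms f_comm[OF assms(1), of n] m_assoc[of a "f [^] n" b] m_assoc[of "f [^] n" a b] by simp

lemma f_pow_add: "a \<in> carrier A \<Longrightarrow> f [^] (n::nat) \<otimes> (f [^] m \<otimes> a) = f [^] (n + m) \<otimes> a"
  by (simp add: m_assoc[symmetric] nat_pow_mult)

lemma cong_add:
  assumes "a \<doteq> a'" "b \<doteq> b'" "a \<in> carrier A" "a' \<in> carrier A" "b \<in> carrier A" "b' \<in> carrier A"
  shows "a \<oplus> b \<doteq> a' \<oplus> b'"
proof -
  have "(a \<oplus> b) \<ominus> (a' \<oplus> b') = (a \<ominus> a') \<oplus> (b \<ominus> b')"
    using assms(3-) by (simp add: a_minus_def minus_add a_ac)
  then show ?thesis using I.a_closed[OF assms(1,2)] by simp
qed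

lemma cong_mult:
  assumes "a \<doteq> a'" "b \<doteq> b'" "a \<in> carrier A" "a' \<in> carrier A" "b \<in> carrier A" "b' \<in> carrier A"
  shows "a \<otimes> b \<doteq> a' \<otimes> b'"
proof -
  have "(a \<otimes> b) \<ominus> (a' \<otimes> b') = (a \<ominus> a') \<otimes> b \<oplus> a' \<otimes> (b \<ominus> b')"
    using assms(3-) by (simp add: a_minus_def l_distr r_distr l_minus r_minus a_assoc r_neg1)
  then show ?thesis
    using I.a_closed[OF I.I_r_closed[OF assms(1,5)] I.I_l_closed[OF assms(2,4)]] by simp
qed

lemma cong_refl: "a \<in> carrier A \<Longrightarrow> a \<doteq> a"
  by (simp add: a_minus_def r_neg)

lemma cong_f: "a \<doteq> a' \<Longrightarrow> a \<in> carrier A \<Longrightarrow> a' \<in> carrier A \<Longrightarrow> f [^] (n::nat) \<otimes> a \<doteq> f [^] n \<otimes> a'"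
  by (rule cong_mult) (auto intro: cong_refl)

lemma fr_eq: "a \<in> carrier A \<Longrightarrow> b \<in> carrier A \<Longrightarrow>
    fr a n = fr b m \<longleftrightarrow> (\<exists>k. f [^] (k + m) \<otimes> a \<doteq> f [^] (k + n) \<otimes> b)"
  unfolding fr_def by (rule code_eq)

lemma fr_raise: "a \<in> carrier A \<Longrightarrow> fr (f [^] k \<otimes> a) (n + k) = fr a n"
  by (subst fr_eq) (auto simp: f_pow_add add.commute[of _ k] add.assoc intro!: exI[of _ 0] cong_refl)

lemma fr_common:
  assumes "a \<in> carrier A" "b \<in> carrier A"
  shows "fr a n = fr (f [^] m \<otimes> a) (n + m)" "fr b m = fr (f [^] n \<otimes> b) (n + m)"
  using fr_raise[of a m n] fr_raise[of b n m] assms by (simp_all add: add.commute)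

text \<open>Carrier elements are mere codes, so the operations of \<open>frac_alg\<close> pick a
  numerator and a denominator by choice. The lemmas on products, sums and scalar multiples below
  show that the choice does not matter.\<close>

definition num where "num y = (SOME a. a \<in> carrier A \<and> (\<exists>n. y = fr a n))"
definition den where "den y = (SOME n. y = fr (num y) n)"

lemma num_den:
  assumes "a \<in> carrier A"
  shows "num (fr a n) \<in> carrier A" "fr (num (fr a n)) (den (fr a n)) = fr a n"
proof -
  have "num (fr a n) \<in> carrier A \<and> (\<exists>m. fr a n = fr (num (fr a n)) m)"
    unfolding num_def by (rule someI[of _ a]) (use assms in blast)
  then show "num (fr a n) \<in> carrier A" "fr (num (fr a n)) (den (fr a n)) = fr a n"
    unfolding den_def using someI_ex[of "\<lambda>m. fr a n = fr (num (fr a n)) m"] by auto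
qed

definition frac_alg :: "'a superalg" where
  "frac_alg = \<lparr>carrier = {fr a n | a n. a \<in> carrier A},
     mult = (\<lambda>x y. fr (num x \<otimes> num y) (den x + den y)), one = fr \<one> 0, zero = fr \<zero> 0,
     add = (\<lambda>x y. fr (f [^] den y \<otimes> num x \<oplus> f [^] den x \<otimes> num y) (den x + den y)),
     smult = (\<lambda>z x. fr (z \<odot> num x) (den x)),
     even_part = {fr a n | a n. a \<in> even_part A}, odd_part = {fr a n | a n. a \<in> odd_part A}\<rparr>"

lemma frac_mult:
  assumes a: "a \<in> carrier A" and b: "b \<in> carrier A"
  shows "fr a n \<otimes>\<^bsub>frac_alg\<^esub> fr b m = fr (a \<otimes> b) (n + m)"
proof -
  obtain a' n' where 1: "num (fr a n) = a'" "den (fr a n) = n'" "a' \<in> carrier A" "fr a' n' = fr a n"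
    using num_den[OF a, of n] by auto
  obtain b' m' where 2: "num (fr b m) = b'" "den (fr b m) = m'" "b' \<in> carrier A" "fr b' m' = fr b m"
    using num_den[OF b, of m] by auto
  obtain k l where kl: "f [^] (k + n) \<otimes> a' \<doteq> f [^] (k + n') \<otimes> a" "f [^] (l + m) \<otimes> b' \<doteq> f [^] (l + m') \<otimes> b"
    using 1 2 a b by (auto simp: fr_eq)
  have "(f [^] (k + n) \<otimes> a') \<otimes> (f [^] (l + m) \<otimes> b') \<doteq> (f [^] (k + n') \<otimes> a) \<otimes> (f [^] (l + m') \<otimes> b)"
    by (rule cong_mult[OF kl]) (use a b 1 2 in auto)
  moreover have "(f [^] (i::nat) \<otimes> x) \<otimes> (f [^] (j::nat) \<otimes> y) = f [^] (i + j) \<otimes> (x \<otimes> y)"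
    if "x \<in> carrier A" "y \<in> carrier A" for i j x y
    using that f_pow_lcomm[of x y j] m_assoc[of "f [^] i" x "f [^] j \<otimes> y"] f_pow_add[of "x \<otimes> y" i j]
    by simp
  ultimately have "f [^] ((k + l) + (n + m)) \<otimes> (a' \<otimes> b') \<doteq> f [^] ((k + l) + (n' + m')) \<otimes> (a \<otimes> b)"
    using a b 1 2 by (simp add: ac_simps)
  then have "fr (a' \<otimes> b') (n' + m') = fr (a \<otimes> b) (n + m)"
    using a b 1 2 by (subst fr_eq) auto
  then show ?thesis using 1 2 by (simp add: frac_alg_def)
qed

lemma frac_add':
  assumes a: "a \<in> carrier A" and b: "b \<in> carrier A"
  shows "fr a n \<oplus>\<^bsub>frac_alg\<^esub> fr b m = fr (f [^] m \<otimes> a \<oplus> f [^] n \<otimes> b) (n + m)"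
proof -
  obtain a' n' where 1: "num (fr a n) = a'" "den (fr a n) = n'" "a' \<in> carrier A" "fr a' n' = fr a n"
    using num_den[OF a, of n] by auto
  obtain b' m' where 2: "num (fr b m) = b'" "den (fr b m) = m'" "b' \<in> carrier A" "fr b' m' = fr b m"
    using num_den[OF b, of m] by auto
  obtain k l where kl: "f [^] (k + n) \<otimes> a' \<doteq> f [^] (k + n') \<otimes> a" "f [^] (l + m) \<otimes> b' \<doteq> f [^] (l + m') \<otimes> b"
    using 1 2 a b by (auto simp: fr_eq)
  have "f [^] (l + m + m') \<otimes> (f [^] (k + n) \<otimes> a') \<oplus> f [^] (k + n + n') \<otimes> (f [^] (l + m) \<otimes> b')
     \<doteq> f [^] (l + m + m') \<otimes> (f [^] (k + n') \<otimes> a) \<oplus> f [^] (k + n + n') \<otimes> (f [^] (l + m') \<otimes> b)"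
    using kl a b 1 2 by (intro cong_add cong_f) auto
  then have "f [^] ((k + l) + (n + m)) \<otimes> (f [^] m' \<otimes> a' \<oplus> f [^] n' \<otimes> b')
     \<doteq> f [^] ((k + l) + (n' + m')) \<otimes> (f [^] m \<otimes> a \<oplus> f [^] n \<otimes> b)"
    using a b 1 2 by (simp add: r_distr f_pow_add ac_simps)
  then have "fr (f [^] m' \<otimes> a' \<oplus> f [^] n' \<otimes> b') (n' + m') = fr (f [^] m \<otimes> a \<oplus> f [^] n \<otimes> b) (n + m)"
    using a b 1 2 by (subst fr_eq) auto
  then show ?thesis using 1 2 by (simp add: frac_alg_def)
qed

lemma frac_add:
  assumes a: "a \<in> carrier A" and b: "b \<in> carrier A"
  shows "fr a n \<oplus>\<^bsub>frac_alg\<^esub> fr b n = fr (a \<oplus> b) n"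
  using frac_add'[OF a b, of n n] fr_raise[of "a \<oplus> b" n n] a b by (simp add: r_distr)

lemma frac_smult:
  assumes a: "a \<in> carrier A"
  shows "z \<odot>\<^bsub>frac_alg\<^esub> fr a n = fr (z \<odot> a) n"
proof -
  obtain a' n' where 1: "num (fr a n) = a'" "den (fr a n) = n'" "a' \<in> carrier A" "fr a' n' = fr a n"
    using num_den[OF a, of n] by auto
  obtain k where k: "f [^] (k + n) \<otimes> a' \<doteq> f [^] (k + n') \<otimes> a"
    using 1 a by (auto simp: fr_eq)
  have z: "z \<odot> x = (z \<odot> \<one>) \<otimes> x" if "x \<in> carrier A" for x
    using that by (simp add: smult_mult)
  have "(z \<odot> \<one>) \<otimes> (f [^] (k + n) \<otimes> a') \<doteq> (z \<odot> \<one>) \<otimes> (f [^] (k + n') \<otimes> a)"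
    by (rule cong_mult[OF cong_refl k]) (use a 1 in auto)
  then have "f [^] (k + n) \<otimes> (z \<odot> a') \<doteq> f [^] (k + n') \<otimes> (z \<odot> a)"
    using a 1 by (simp add: z[symmetric] mult_smult)
  then have "fr (z \<odot> a') n' = fr (z \<odot> a) n"
    using a 1 by (subst fr_eq) auto
  then show ?thesis using 1 by (simp add: frac_alg_def)
qed

lemma frac_alg_simps:
  "carrier frac_alg = {fr a n | a n. a \<in> carrier A}" "\<one>\<^bsub>frac_alg\<^esub> = fr \<one> 0" "\<zero>\<^bsub>frac_alg\<^esub> = fr \<zero> 0"
  "even_part frac_alg = {fr a n | a n. a \<in> even_part A}" "odd_part frac_alg = {fr a n | a n. a \<in> odd_part A}"
  by (simp_all add: frac_alg_def)

lemma fr_in: "a \<in> carrier A \<Longrightarrow> fr a n \<in> carrier frac_alg"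
  by (auto simp: frac_alg_simps)

lemma zero_fr: "\<zero>\<^bsub>frac_alg\<^esub> = fr \<zero> n"
  using fr_raise[of \<zero> n 0] by (simp add: frac_alg_simps)

text \<open>Over a common denominator sums are formed on numerators alone, which reduces the axioms
  for fractions to those of \<open>A\<close>.\<close>

lemma common2:
  assumes "x \<in> carrier frac_alg" "y \<in> carrier frac_alg"
  obtains a b n where "a \<in> carrier A" "b \<in> carrier A" "x = fr a n" "y = fr b n"
proof -
  obtain a b n m where *: "a \<in> carrier A" "b \<in> carrier A" "x = fr a n" "y = fr b m"
    using assms by (auto simp: frac_alg_simps)
  show ?thesis
    by (rule that[of "f [^] m \<otimes> a" "f [^] n \<otimes> b" "n + m"]) (use * fr_common[OF *(1,2), where n = n and m = m] in auto)
qed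

lemma common3:
  assumes "x \<in> carrier frac_alg" "y \<in> carrier frac_alg" "z \<in> carrier frac_alg"
  obtains a b c n where "a \<in> carrier A" "b \<in> carrier A" "c \<in> carrier A" "x = fr a n" "y = fr b n" "z = fr c n"
proof -
  obtain a b n where 1: "a \<in> carrier A" "b \<in> carrier A" "x = fr a n" "y = fr b n"
    using common2[OF assms(1,2)] .
  obtain c m where 2: "c \<in> carrier A" "z = fr c m"
    using assms(3) by (auto simp: frac_alg_simps)
  show ?thesis
    by (rule that[of "f [^] m \<otimes> a" "f [^] m \<otimes> b" "f [^] n \<otimes> c" "n + m"])
      (use 1 2 fr_common[OF 1(1) 2(1), where n = n and m = m] fr_common[OF 1(2) 2(1), where n = n and m = m] in auto)
qed

lemma superalgebra_frac: "superalgebra frac_alg"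
proof (rule superalgebraI)
  note [simp] = frac_mult frac_add frac_smult fr_in
  fix x y z assume x: "x \<in> carrier frac_alg" and y: "y \<in> carrier frac_alg" and z: "z \<in> carrier frac_alg"
  obtain a b c n where *: "a \<in> carrier A" "b \<in> carrier A" "c \<in> carrier A" "x = fr a n" "y = fr b n" "z = fr c n"
    using common3[OF x y z] .
  show "x \<oplus>\<^bsub>frac_alg\<^esub> y \<oplus>\<^bsub>frac_alg\<^esub> z = x \<oplus>\<^bsub>frac_alg\<^esub> (y \<oplus>\<^bsub>frac_alg\<^esub> z)"
    using *(1-3) unfolding *(4-6) by (simp add: a_assoc)
  show "x \<otimes>\<^bsub>frac_alg\<^esub> y \<otimes>\<^bsub>frac_alg\<^esub> z = x \<otimes>\<^bsub>frac_alg\<^esub> (y \<otimes>\<^bsub>frac_alg\<^esub> z)"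
    using *(1-3) unfolding *(4-6) by (simp add: m_assoc add.assoc)
  show "(x \<oplus>\<^bsub>frac_alg\<^esub> y) \<otimes>\<^bsub>frac_alg\<^esub> z = x \<otimes>\<^bsub>frac_alg\<^esub> z \<oplus>\<^bsub>frac_alg\<^esub> y \<otimes>\<^bsub>frac_alg\<^esub> z"
    using *(1-3) unfolding *(4-6) by (simp add: l_distr)
  show "z \<otimes>\<^bsub>frac_alg\<^esub> (x \<oplus>\<^bsub>frac_alg\<^esub> y) = z \<otimes>\<^bsub>frac_alg\<^esub> x \<oplus>\<^bsub>frac_alg\<^esub> z \<otimes>\<^bsub>frac_alg\<^esub> y"
    using *(1-3) unfolding *(4-6) by (simp add: r_distr)
next
  note [simp] = frac_mult frac_add frac_smult fr_in
  fix x y :: 'a and z assume x: "x \<in> carrier frac_alg" and y: "y \<in> carrier frac_alg"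
  obtain a b n where *: "a \<in> carrier A" "b \<in> carrier A" "x = fr a n" "y = fr b n"
    using common2[OF x y] .
  show "x \<oplus>\<^bsub>frac_alg\<^esub> y \<in> carrier frac_alg" "x \<otimes>\<^bsub>frac_alg\<^esub> y \<in> carrier frac_alg"
    using *(1-2) unfolding *(3-4) by simp_all
  show "x \<oplus>\<^bsub>frac_alg\<^esub> y = y \<oplus>\<^bsub>frac_alg\<^esub> x"
    using *(1-2) unfolding *(3-4) by (simp add: a_comm)
  show "z \<odot>\<^bsub>frac_alg\<^esub> (x \<oplus>\<^bsub>frac_alg\<^esub> y) = z \<odot>\<^bsub>frac_alg\<^esub> x \<oplus>\<^bsub>frac_alg\<^esub> z \<odot>\<^bsub>frac_alg\<^esub> y"
    using *(1-2) unfolding *(3-4) by (simp add: smult_add_right)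
  show "(z \<odot>\<^bsub>frac_alg\<^esub> x) \<otimes>\<^bsub>frac_alg\<^esub> y = z \<odot>\<^bsub>frac_alg\<^esub> (x \<otimes>\<^bsub>frac_alg\<^esub> y)"
    "x \<otimes>\<^bsub>frac_alg\<^esub> (z \<odot>\<^bsub>frac_alg\<^esub> y) = z \<odot>\<^bsub>frac_alg\<^esub> (x \<otimes>\<^bsub>frac_alg\<^esub> y)"
    using *(1-2) unfolding *(3-4) by (simp_all add: smult_mult mult_smult)
next
  note [simp] = frac_mult frac_add frac_smult fr_in
  fix x :: 'a and z w assume x: "x \<in> carrier frac_alg"
  obtain a n where *: "a \<in> carrier A" "x = fr a n" using x by (auto simp: frac_alg_simps)
  show "z \<odot>\<^bsub>frac_alg\<^esub> x \<in> carrier frac_alg" "1 \<odot>\<^bsub>frac_alg\<^esub> x = x"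
    "(z * w) \<odot>\<^bsub>frac_alg\<^esub> x = z \<odot>\<^bsub>frac_alg\<^esub> (w \<odot>\<^bsub>frac_alg\<^esub> x)"
    "(z + w) \<odot>\<^bsub>frac_alg\<^esub> x = z \<odot>\<^bsub>frac_alg\<^esub> x \<oplus>\<^bsub>frac_alg\<^esub> w \<odot>\<^bsub>frac_alg\<^esub> x"
    "0 \<odot>\<^bsub>frac_alg\<^esub> x = \<zero>\<^bsub>frac_alg\<^esub>"
    "\<zero>\<^bsub>frac_alg\<^esub> \<oplus>\<^bsub>frac_alg\<^esub> x = x"
    "\<one>\<^bsub>frac_alg\<^esub> \<otimes>\<^bsub>frac_alg\<^esub> x = x" "x \<otimes>\<^bsub>frac_alg\<^esub> \<one>\<^bsub>frac_alg\<^esub> = x"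
    using *(1) unfolding *(2) by (simp_all add: smult_smult smult_add_left zero_fr[of n] frac_alg_simps(2))
  obtain u v where uv: "u \<in> even_part A" "v \<in> odd_part A" "a = u \<oplus> v"
    using even_odd_decomp[OF *(1)] .
  have "x = fr u n \<oplus>\<^bsub>frac_alg\<^esub> fr v n"
    using uv even_carrier odd_carrier *(2) by simp
  then show "\<exists>u\<in>even_part frac_alg. \<exists>v\<in>odd_part frac_alg. x = u \<oplus>\<^bsub>frac_alg\<^esub> v"
    using uv by (auto simp: frac_alg_simps)
next
  show "\<zero>\<^bsub>frac_alg\<^esub> \<in> carrier frac_alg" "even_part frac_alg \<subseteq> carrier frac_alg"
    "\<one>\<^bsub>frac_alg\<^esub> \<in> even_part frac_alg" "odd_part frac_alg \<subseteq> carrier frac_alg"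
    "\<zero>\<^bsub>frac_alg\<^esub> \<in> odd_part frac_alg"
    using even_carrier odd_carrier zero_closed one_even zero_odd unfolding frac_alg_simps by blast+
next
  fix x y assume x: "x \<in> even_part frac_alg" and y: "y \<in> even_part frac_alg"
  obtain a b n m where *: "a \<in> even_part A" "b \<in> even_part A" "x = fr a n" "y = fr b m"
    using x y by (auto simp: frac_alg_simps)
  note c = *(1,2)[THEN even_carrier]
  have "x \<oplus>\<^bsub>frac_alg\<^esub> y = fr (f [^] m \<otimes> a \<oplus> f [^] n \<otimes> b) (n + m)" using frac_add' c * by simp
  moreover have "f [^] m \<otimes> a \<oplus> f [^] n \<otimes> b \<in> even_part A"
    using * f_even by (intro even_add even_mult_even even_pow)
  ultimately show "x \<oplus>\<^bsub>frac_alg\<^esub> y \<in> even_part frac_alg" unfolding frac_alg_simps by blast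
  have "x \<otimes>\<^bsub>frac_alg\<^esub> y = fr (a \<otimes> b) (n + m)" using frac_mult c * by simp
  then show "x \<otimes>\<^bsub>frac_alg\<^esub> y \<in> even_part frac_alg"
    using even_mult_even[OF *(1,2)] unfolding frac_alg_simps by blast
next
  fix x y assume x: "x \<in> odd_part frac_alg" and y: "y \<in> odd_part frac_alg"
  obtain a b n m where *: "a \<in> odd_part A" "b \<in> odd_part A" "x = fr a n" "y = fr b m"
    using x y by (auto simp: frac_alg_simps)
  note c = *(1,2)[THEN odd_carrier]
  have "x \<oplus>\<^bsub>frac_alg\<^esub> y = fr (f [^] m \<otimes> a \<oplus> f [^] n \<otimes> b) (n + m)" using frac_add' c * by simp
  moreover have "f [^] m \<otimes> a \<oplus> f [^] n \<otimes> b \<in> odd_part A"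
    using * f_even by (intro odd_add even_mult_odd even_pow)
  ultimately show "x \<oplus>\<^bsub>frac_alg\<^esub> y \<in> odd_part frac_alg" unfolding frac_alg_simps by blast
  have "x \<otimes>\<^bsub>frac_alg\<^esub> y = fr (a \<otimes> b) (n + m)" using frac_mult c * by simp
  then show "x \<otimes>\<^bsub>frac_alg\<^esub> y \<in> even_part frac_alg"
    using odd_mult_odd[OF *(1,2)] unfolding frac_alg_simps by blast
  have "a \<otimes> b = (- 1) \<odot> (b \<otimes> a)" using odd_anticomm[OF *(1,2)] c by (simp add: smult_minus_1)
  then show "x \<otimes>\<^bsub>frac_alg\<^esub> y = (- 1) \<odot>\<^bsub>frac_alg\<^esub> (y \<otimes>\<^bsub>frac_alg\<^esub> x)"
    using c unfolding *(3,4) by (simp add: frac_mult frac_smult add.commute)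
next
  fix x y assume x: "x \<in> even_part frac_alg" and y: "y \<in> odd_part frac_alg"
  obtain a b n m where *: "a \<in> even_part A" "b \<in> odd_part A" "x = fr a n" "y = fr b m"
    using x y by (auto simp: frac_alg_simps)
  have "x \<otimes>\<^bsub>frac_alg\<^esub> y = fr (a \<otimes> b) (n + m)" using frac_mult even_carrier odd_carrier * by simp
  then show "x \<otimes>\<^bsub>frac_alg\<^esub> y \<in> odd_part frac_alg"
    using even_mult_odd[OF *(1,2)] unfolding frac_alg_simps by blast
next
  fix x y assume x: "x \<in> even_part frac_alg" and y: "y \<in> carrier frac_alg"
  obtain a b n m where *: "a \<in> even_part A" "b \<in> carrier A" "x = fr a n" "y = fr b m"
    using x y by (auto simp: frac_alg_simps)
  then show "x \<otimes>\<^bsub>frac_alg\<^esub> y = y \<otimes>\<^bsub>frac_alg\<^esub> x"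
    using even_comm[OF *(1,2)] by (simp add: frac_mult even_carrier add.commute)
next
  fix x z assume x: "x \<in> even_part frac_alg"
  obtain a n where *: "a \<in> even_part A" "x = fr a n"
    using x by (auto simp: frac_alg_simps)
  then show "z \<odot>\<^bsub>frac_alg\<^esub> x \<in> even_part frac_alg"
    using even_smult[OF *(1)] frac_smult[OF even_carrier[OF *(1)]] unfolding frac_alg_simps by auto
next
  fix x z assume x: "x \<in> odd_part frac_alg"
  obtain a n where *: "a \<in> odd_part A" "x = fr a n"
    using x by (auto simp: frac_alg_simps)
  then show "z \<odot>\<^bsub>frac_alg\<^esub> x \<in> odd_part frac_alg"
    using odd_smult[OF *(1)] frac_smult[OF odd_carrier[OF *(1)]] unfolding frac_alg_simps by auto
next
  fix x assume x: "x \<in> even_part frac_alg" "x \<in> odd_part frac_alg"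
  obtain a n b m where *: "a \<in> even_part A" "x = fr a n" "b \<in> odd_part A" "x = fr b m"
    using x unfolding frac_alg_simps by blast
  note c = *(1)[THEN even_carrier] *(3)[THEN odd_carrier]
  obtain k where "f [^] (k + m) \<otimes> a \<ominus> f [^] (k + n) \<otimes> b \<in> I"
    using * c fr_eq[of a b n m] by auto
  moreover have "f [^] (k + m) \<otimes> a \<in> even_part A" "\<ominus> (f [^] (k + n) \<otimes> b) \<in> odd_part A"
    using * f_even by (intro even_mult_even even_pow, simp_all, intro odd_a_inv even_mult_odd even_pow)
  \<comment> \<open>Here the homogeneity of \<open>I\<close> is used: an even and an odd element
    whose difference lies in \<open>I\<close> both lie in \<open>I\<close>.\<close>
  ultimately have "f [^] (k + m) \<otimes> a \<in> I"
    using superideal_I unfolding superideal_def a_minus_def by blast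
  then have "f [^] ((k + m) + 0) \<otimes> a \<doteq> f [^] ((k + m) + n) \<otimes> \<zero>"
    using c by (simp add: a_minus_def)
  then have "fr a n = fr \<zero> 0" using c fr_eq[of a \<zero> n 0] by blast
  then show "x = \<zero>\<^bsub>frac_alg\<^esub>" using * by (simp add: frac_alg_simps)
qed

definition to_frac where "to_frac = (\<lambda>a\<in>carrier A. fr a 0)"

lemma shom_to_frac: "to_frac \<in> shom A frac_alg"
proof (rule shomI)
  fix a assume "a \<in> even_part A"
  then show "to_frac a \<in> even_part frac_alg" using even_carrier by (auto simp: to_frac_def frac_alg_simps)
next
  fix a assume "a \<in> odd_part A"
  then show "to_frac a \<in> odd_part frac_alg" using odd_carrier by (auto simp: to_frac_def frac_alg_simps)
qed (simp_all add: to_frac_def fr_in frac_add frac_mult frac_smult frac_alg_simps(2))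

lemma to_frac_eq_zero:
  assumes a: "a \<in> carrier A"
  shows "to_frac a = \<zero>\<^bsub>frac_alg\<^esub> \<longleftrightarrow> (\<exists>n. f [^] (n::nat) \<otimes> a \<in> I)"
  using a fr_eq[of a \<zero> 0 0] by (simp add: to_frac_def frac_alg_simps(3) a_minus_def)

lemma to_frac_f_pow: "to_frac f [^]\<^bsub>frac_alg\<^esub> (n::nat) = fr (f [^] n) 0"
  using shom_pow[OF superalgebra superalgebra_frac shom_to_frac f_carrier, of n] by (simp add: to_frac_def)

lemma to_frac_Unit: "to_frac f \<in> Units frac_alg"
proof -
  have 1: "fr f 0 \<otimes>\<^bsub>frac_alg\<^esub> fr \<one> 1 = \<one>\<^bsub>frac_alg\<^esub>" "fr \<one> 1 \<otimes>\<^bsub>frac_alg\<^esub> fr f 0 = \<one>\<^bsub>frac_alg\<^esub>"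
    using fr_raise[of \<one> 1 0] by (simp_all add: frac_mult frac_alg_simps(2))
  show ?thesis
    unfolding Units_def to_frac_def using 1 fr_in[of f 0] fr_in[of \<one> 1] by auto
qed

lemma to_frac_surj:
  assumes "y \<in> carrier frac_alg"
  shows "\<exists>a\<in>carrier A. \<exists>n::nat. y \<otimes>\<^bsub>frac_alg\<^esub> (to_frac f [^]\<^bsub>frac_alg\<^esub> n) = to_frac a"
proof -
  obtain a n where *: "a \<in> carrier A" "y = fr a n" using assms by (auto simp: frac_alg_simps)
  have "y \<otimes>\<^bsub>frac_alg\<^esub> (to_frac f [^]\<^bsub>frac_alg\<^esub> n) = fr (f [^] n \<otimes> a) (0 + n)"
    using * by (simp add: to_frac_f_pow frac_mult f_comm)
  also have "\<dots> = to_frac a" using * by (subst fr_raise) (auto simp: to_frac_def)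
  finally show ?thesis using * by blast
qed

end

text \<open>An infinite type admits an injection of the pairs \<open>(a, n)\<close> into itself.
  Composed with a choice of one pair from every class of the equivalence \<open>E\<close> of
  fractions, it is the required \<open>code\<close>.\<close>

lemma exists_fraction_quotient:
  fixes A :: "'a superalg" (structure)
  assumes A: "superalgebra A" and I: "superideal I A" and f: "f \<in> even_part A"
    and inf: "infinite (UNIV :: 'a set)"
  shows "\<exists>L l. fraction_quotient A I f L l"
proof -
  interpret A: salg A using A by (rule salgI)
  interpret I: ideal I A using I by (simp add: superideal_def)
  obtain \<iota> :: "'a \<times> nat \<Rightarrow> 'a" where \<iota>: "inj \<iota>"
  proof -
    have "(card_of (UNIV :: nat set), card_of (UNIV :: 'a set)) \<in> ordLeq"
      using inf by (simp add: infinite_iff_card_of_nat)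
    then have "(card_of ((UNIV :: 'a set) \<times> (UNIV :: nat set)), card_of (UNIV :: 'a set)) \<in> ordLeq"
      using card_of_Times_infinite[OF inf, of "UNIV :: nat set"] ordIso_iff_ordLeq by blast
    then show ?thesis
      using that card_of_ordLeq[of "(UNIV :: 'a set) \<times> (UNIV :: nat set)" "UNIV :: 'a set"] by auto
  qed
  define E where "E p q \<longleftrightarrow> fst p \<in> carrier A \<and> fst q \<in> carrier A \<and>
    (\<exists>k. (f [^] (k + snd q)) \<otimes> fst p \<ominus> (f [^] (k + snd p)) \<otimes> fst q \<in> I)" for p q :: "'a \<times> nat"
  have fc[simp]: "f \<in> carrier A" using f A.even_carrier by blast
  have pow: "(f [^] (n::nat)) \<otimes> ((f [^] m) \<otimes> a) = (f [^] (n + m)) \<otimes> a"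
    if "a \<in> carrier A" for n m a
    using that by (simp add: A.m_assoc[symmetric] A.nat_pow_mult)
  have E_refl: "E p p" if "fst p \<in> carrier A" for p
    using that by (auto simp: E_def a_minus_def A.r_neg)
  have E_sym: "E q p" if E: "E p q" for p q
  proof -
    obtain k where k: "(f [^] (k + snd q)) \<otimes> fst p \<ominus> (f [^] (k + snd p)) \<otimes> fst q \<in> I"
      and c: "fst p \<in> carrier A" "fst q \<in> carrier A" using E by (auto simp: E_def)
    from I.a_inv_closed[OF k] have "(f [^] (k + snd p)) \<otimes> fst q \<ominus> (f [^] (k + snd q)) \<otimes> fst p \<in> I"
      using c by (simp add: a_minus_def A.minus_add A.a_comm)
    then show ?thesis using c by (auto simp: E_def)
  qed
  have E_trans: "E p r" if E: "E p q" "E q r" for p q r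
  proof -
    obtain k l where k: "(f [^] (k + snd q)) \<otimes> fst p \<ominus> (f [^] (k + snd p)) \<otimes> fst q \<in> I"
      and l: "(f [^] (l + snd r)) \<otimes> fst q \<ominus> (f [^] (l + snd q)) \<otimes> fst r \<in> I"
      and c: "fst p \<in> carrier A" "fst q \<in> carrier A" "fst r \<in> carrier A"
      using E by (auto simp: E_def)
    \<comment> \<open>The middle term cancels: \<open>x - y\<close> is \<open>f^(l + snd r)\<close>
      times the first congruence and \<open>y - z\<close> is \<open>f^(k + snd p)\<close> times the
      second. The witness for \<open>E p r\<close> is therefore
      \<open>k + l + snd q\<close>.\<close>
    define x y z where "x = (f [^] (k + l + snd q + snd r)) \<otimes> fst p"
      and "y = (f [^] (k + l + snd p + snd r)) \<otimes> fst q"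
      and "z = (f [^] (k + l + snd q + snd p)) \<otimes> fst r"
    note xyz = x_def y_def z_def
    have xc: "x \<in> carrier A" "y \<in> carrier A" "z \<in> carrier A" using c by (auto simp: xyz)
    have 1: "x \<ominus> y \<in> I"
      using I.I_l_closed[OF k, of "f [^] (l + snd r)"] c
      by (simp add: xyz a_minus_def A.r_distr A.r_minus pow ac_simps)
    have 2: "y \<ominus> z \<in> I"
      using I.I_l_closed[OF l, of "f [^] (k + snd p)"] c
      by (simp add: xyz a_minus_def A.r_distr A.r_minus pow ac_simps)
    have "x \<ominus> z = (x \<ominus> y) \<oplus> (y \<ominus> z)"
      using xc by (simp add: a_minus_def A.a_assoc A.r_neg1)
    then have "x \<ominus> z \<in> I" using I.a_closed[OF 1 2] by simp
    then show ?thesis using c unfolding E_def xyz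
      by (auto intro!: exI[of _ "k + l + snd q"] simp: ac_simps)
  qed
  define code where "code p = \<iota> (SOME q. E p q)" for p
  have code: "code p = code q \<longleftrightarrow> E p q" if "fst p \<in> carrier A" "fst q \<in> carrier A" for p q
  proof
    assume "code p = code q"
    then have "(SOME r. E p r) = (SOME r. E q r)" by (simp add: code_def inj_eq[OF \<iota>])
    moreover have "E p (SOME r. E p r)" "E q (SOME r. E q r)"
      by (rule someI, rule E_refl, fact)+
    ultimately show "E p q" using E_sym E_trans by metis
  next
    assume "E p q"
    then have "E p = E q" using E_sym E_trans by blast
    then show "code p = code q" by (simp add: code_def)
  qed
  interpret fractions A I f code
    by unfold_locales (use I f code in \<open>auto simp: E_def\<close>)
  show ?thesis
    unfolding fraction_quotient_def
    using superalgebra_frac shom_to_frac to_frac_Unit to_frac_surj to_frac_eq_zero by blast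
qed

context salg
begin

lemma even_unit_cancel:
  assumes "e \<in> Units A" "e \<in> even_part A" "x \<in> carrier A" "y \<in> carrier A" "x \<otimes> e [^] (n::nat) = y \<otimes> e [^] n"
  shows "x = y"
  using assms even_comm[OF even_pow[OF assms(2)], of x n] even_comm[OF even_pow[OF assms(2)], of y n]
    Units_l_cancel[OF Units_pow_closed[OF assms(1)], of x y n] by simp

lemma even_unit_eq_zero:
  assumes "e \<in> Units A" "e \<in> even_part A" "x \<in> carrier A" "x \<otimes> e [^] (n::nat) = \<zero>"
  shows "x = \<zero>"
  by (rule even_unit_cancel[OF assms(1-3), of \<zero> n]) (use assms(4) even_carrier[OF assms(2)] in auto)

text \<open>Multiplication by a power of an even unit respects components and kills none of them. It
  recovers the parity of a fraction from that of its numerator.\<close>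

lemma even_from_product:
  assumes "e \<in> Units A" "e \<in> even_part A" "x \<in> carrier A" "x \<otimes> e [^] (n::nat) \<in> even_part A"
  shows "x \<in> even_part A"
proof -
  obtain u v where uv: "u \<in> even_part A" "v \<in> odd_part A" "x = u \<oplus> v"
    using even_odd_decomp[OF assms(3)] .
  have c: "u \<in> carrier A" "v \<in> carrier A" "e \<in> carrier A"
    using uv assms even_carrier odd_carrier by blast+
  have "u \<otimes> e [^] n \<oplus> v \<otimes> e [^] n = x \<otimes> e [^] n \<oplus> \<zero>"
    using c uv(3) by (simp add: l_distr)
  then have "v \<otimes> e [^] n = \<zero>"
    using even_odd_unique(2)[OF even_mult_even[OF uv(1) even_pow[OF assms(2)]]
        odd_mult_even[OF uv(2) even_pow[OF assms(2)]] assms(4) zero_odd] by blast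
  then have "v = \<zero>" using even_unit_eq_zero[OF assms(1,2) c(2)] by blast
  then show ?thesis using uv c by simp
qed

lemma odd_from_product:
  assumes "e \<in> Units A" "e \<in> even_part A" "x \<in> carrier A" "x \<otimes> e [^] (n::nat) \<in> odd_part A"
  shows "x \<in> odd_part A"
proof -
  obtain u v where uv: "u \<in> even_part A" "v \<in> odd_part A" "x = u \<oplus> v"
    using even_odd_decomp[OF assms(3)] .
  have c: "u \<in> carrier A" "v \<in> carrier A" "e \<in> carrier A"
    using uv assms even_carrier odd_carrier by blast+
  have "u \<otimes> e [^] n \<oplus> v \<otimes> e [^] n = \<zero> \<oplus> x \<otimes> e [^] n"
    using c uv(3) by (simp add: l_distr)
  then have "u \<otimes> e [^] n = \<zero>"
    using even_odd_unique(1)[OF even_mult_even[OF uv(1) even_pow[OF assms(2)]]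
        odd_mult_even[OF uv(2) even_pow[OF assms(2)]] zero_even assms(4)] by blast
  then have "u = \<zero>" using even_unit_eq_zero[OF assms(1,2) c(1)] by blast
  then show ?thesis using uv c by simp
qed

end

lemma fraction_quotient_superalgebra: "fraction_quotient A I f L l \<Longrightarrow> superalgebra L"
  and fraction_quotient_shom: "fraction_quotient A I f L l \<Longrightarrow> l \<in> shom A L"
  and fraction_quotient_Units: "fraction_quotient A I f L l \<Longrightarrow> l f \<in> Units L"
  and fraction_quotient_fraction: "fraction_quotient A I f L l \<Longrightarrow> y \<in> carrier L \<Longrightarrow>
    \<exists>a\<in>carrier A. \<exists>n::nat. y \<otimes>\<^bsub>L\<^esub> (l f [^]\<^bsub>L\<^esub> n) = l a"
  and fraction_quotient_zero: "fraction_quotient A I f L l \<Longrightarrow> a \<in> carrier A \<Longrightarrow>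
    l a = \<zero>\<^bsub>L\<^esub> \<longleftrightarrow> (\<exists>n::nat. (f [^]\<^bsub>A\<^esub> n) \<otimes>\<^bsub>A\<^esub> a \<in> I)"
  by (simp_all add: fraction_quotient_def)

text \<open>The universal property of the localized quotient. For \<open>y = a / f^n\<close> the
  value of \<open>u\<close> has to be \<open>g a\<close> divided by \<open>(g f)^n\<close>; it
  remains to see that this depends on \<open>y\<close> only.\<close>

lemma fraction_quotient_factor:
  fixes A (structure)
  assumes A: "superalgebra A" and B: "superalgebra B" and f: "f \<in> even_part A" and I: "I \<subseteq> carrier A"
    and L: "fraction_quotient A I f L l"
    and g: "g \<in> shom A B" "g f \<in> Units B" "\<And>a. a \<in> I \<Longrightarrow> g a = \<zero>\<^bsub>B\<^esub>"
  obtains u where "u \<in> shom L B" "\<And>a. a \<in> carrier A \<Longrightarrow> u (l a) = g a"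
proof -
  interpret A: salg A using A by (rule salgI)
  interpret B: salg B using B by (rule salgI)
  note SL = fraction_quotient_superalgebra[OF L] and l = fraction_quotient_shom[OF L]
  interpret L: salg L using SL by (rule salgI)
  define e where "e = g f"
  have fc[simp]: "f \<in> carrier A" using f A.even_carrier by blast
  have e: "e \<in> Units B" "e \<in> even_part B" using g f by (auto simp: e_def shom_even)
  have ec[simp]: "e \<in> carrier B" using e B.even_carrier by blast
  have lc[simp]: "l a \<in> carrier L" if "a \<in> carrier A" for a using shom_closed[OF l that] .
  have gc[simp]: "g a \<in> carrier B" if "a \<in> carrier A" for a using shom_closed[OF g(1) that] .
  have lp: "l f [^]\<^bsub>L\<^esub> (n::nat) = l (f [^] n)" for n using shom_pow[OF A SL l fc] by simp
  have gp: "g (f [^] n) = e [^]\<^bsub>B\<^esub> (n::nat)" for n using shom_pow[OF A B g(1) fc] by (simp add: e_def)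
  \<comment> \<open>Two fractions for the same \<open>y\<close> have cross-multiplied numerators
    whose difference is killed by \<open>l\<close>. Some power of \<open>f\<close> moves that
    difference into \<open>I\<close>, which \<open>g\<close> kills, and the power of the unit
    \<open>e\<close> cancels.\<close>
  have key: "g a \<otimes>\<^bsub>B\<^esub> e [^]\<^bsub>B\<^esub> m = g b \<otimes>\<^bsub>B\<^esub> e [^]\<^bsub>B\<^esub> n"
    if y: "y \<in> carrier L" and a: "a \<in> carrier A" "y \<otimes>\<^bsub>L\<^esub> (l f [^]\<^bsub>L\<^esub> n) = l a"
      and b: "b \<in> carrier A" "y \<otimes>\<^bsub>L\<^esub> (l f [^]\<^bsub>L\<^esub> m) = l b" for y a b and n m :: nat
  proof -
    have "l (a \<otimes> f [^] m) = y \<otimes>\<^bsub>L\<^esub> (l f [^]\<^bsub>L\<^esub> (n + m))"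
      using a y by (simp add: shom_mult[OF l] lp[symmetric] a(2)[symmetric] L.m_assoc L.nat_pow_mult)
    also have "\<dots> = l (b \<otimes> f [^] n)"
      using b y by (simp add: shom_mult[OF l] lp[symmetric] b(2)[symmetric] L.m_assoc L.nat_pow_mult add.commute)
    finally have "l (a \<otimes> f [^] m \<ominus> b \<otimes> f [^] n) = \<zero>\<^bsub>L\<^esub>"
      using a b by (simp add: a_minus_def shom_add[OF l] shom_a_inv[OF A SL l] L.r_neg)
    then obtain k :: nat where "f [^] k \<otimes> (a \<otimes> f [^] m \<ominus> b \<otimes> f [^] n) \<in> I"
      using fraction_quotient_zero[OF L, of "a \<otimes> f [^] m \<ominus> b \<otimes> f [^] n"] a b by auto
    from g(3)[OF this] have "e [^]\<^bsub>B\<^esub> k \<otimes>\<^bsub>B\<^esub> (g a \<otimes>\<^bsub>B\<^esub> e [^]\<^bsub>B\<^esub> m \<ominus>\<^bsub>B\<^esub> g b \<otimes>\<^bsub>B\<^esub> e [^]\<^bsub>B\<^esub> n) = \<zero>\<^bsub>B\<^esub>"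
      using a b by (simp add: a_minus_def shom_mult[OF g(1)] shom_add[OF g(1)] shom_a_inv[OF A B g(1)] gp)
    then have "(g a \<otimes>\<^bsub>B\<^esub> e [^]\<^bsub>B\<^esub> m \<ominus>\<^bsub>B\<^esub> g b \<otimes>\<^bsub>B\<^esub> e [^]\<^bsub>B\<^esub> n) \<otimes>\<^bsub>B\<^esub> e [^]\<^bsub>B\<^esub> k = \<zero>\<^bsub>B\<^esub>"
      using a b B.even_comm[OF B.even_pow[OF e(2)]] by simp
    then have "g a \<otimes>\<^bsub>B\<^esub> e [^]\<^bsub>B\<^esub> m \<ominus>\<^bsub>B\<^esub> g b \<otimes>\<^bsub>B\<^esub> e [^]\<^bsub>B\<^esub> n = \<zero>\<^bsub>B\<^esub>"
      by (rule B.even_unit_eq_zero[OF e, rotated]) (use a b in auto)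
    then show ?thesis using a b by simp
  qed
  define u where "u = (\<lambda>y\<in>carrier L. SOME w. w \<in> carrier B \<and>
     (\<forall>a\<in>carrier A. \<forall>n::nat. y \<otimes>\<^bsub>L\<^esub> (l f [^]\<^bsub>L\<^esub> n) = l a \<longrightarrow> w \<otimes>\<^bsub>B\<^esub> e [^]\<^bsub>B\<^esub> n = g a))"
  have u_ex: "u y \<in> carrier B \<and>
     (\<forall>a\<in>carrier A. \<forall>n::nat. y \<otimes>\<^bsub>L\<^esub> (l f [^]\<^bsub>L\<^esub> n) = l a \<longrightarrow> u y \<otimes>\<^bsub>B\<^esub> e [^]\<^bsub>B\<^esub> n = g a)"
    if y: "y \<in> carrier L" for y
  proof -
    obtain a n where an: "a \<in> carrier A" "y \<otimes>\<^bsub>L\<^esub> (l f [^]\<^bsub>L\<^esub> (n::nat)) = l a"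
      using fraction_quotient_fraction[OF L y] by blast
    define w where "w = g a \<otimes>\<^bsub>B\<^esub> inv\<^bsub>B\<^esub> (e [^]\<^bsub>B\<^esub> n)"
    have en: "e [^]\<^bsub>B\<^esub> n \<in> Units B" using e B.Units_pow_closed by blast
    have w: "w \<in> carrier B" using an en by (simp add: w_def)
    have wn: "w \<otimes>\<^bsub>B\<^esub> e [^]\<^bsub>B\<^esub> n = g a" using an en by (simp add: w_def B.m_assoc B.Units_l_inv)
    have "w \<otimes>\<^bsub>B\<^esub> e [^]\<^bsub>B\<^esub> m = g b" if b: "b \<in> carrier A" "y \<otimes>\<^bsub>L\<^esub> (l f [^]\<^bsub>L\<^esub> (m::nat)) = l b" for b m
    proof -
      have "(w \<otimes>\<^bsub>B\<^esub> e [^]\<^bsub>B\<^esub> m) \<otimes>\<^bsub>B\<^esub> e [^]\<^bsub>B\<^esub> n = (w \<otimes>\<^bsub>B\<^esub> e [^]\<^bsub>B\<^esub> n) \<otimes>\<^bsub>B\<^esub> e [^]\<^bsub>B\<^esub> m"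
        using w by (simp add: B.m_assoc B.nat_pow_mult add.commute)
      also have "\<dots> = g b \<otimes>\<^bsub>B\<^esub> e [^]\<^bsub>B\<^esub> n" unfolding wn by (rule key[OF y an b])
      finally show ?thesis by (rule B.even_unit_cancel[OF e, rotated 2]) (use w b in auto)
    qed
    with w have "\<exists>w. w \<in> carrier B \<and>
     (\<forall>a\<in>carrier A. \<forall>n::nat. y \<otimes>\<^bsub>L\<^esub> (l f [^]\<^bsub>L\<^esub> n) = l a \<longrightarrow> w \<otimes>\<^bsub>B\<^esub> e [^]\<^bsub>B\<^esub> n = g a)" by blast
    from someI_ex[OF this] y show ?thesis by (simp add: u_def)
  qed
  then have uc[simp]: "u y \<in> carrier B" if "y \<in> carrier L" for y using that by blast
  have ue: "u y \<otimes>\<^bsub>B\<^esub> e [^]\<^bsub>B\<^esub> n = g a"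
    if "y \<in> carrier L" "a \<in> carrier A" "y \<otimes>\<^bsub>L\<^esub> (l f [^]\<^bsub>L\<^esub> n) = l a" for y a and n :: nat
    using u_ex that by blast
  \<comment> \<open>Values of \<open>u\<close> are recognized after multiplication by a power of the
    unit \<open>e\<close>; the algebraic laws below are verified in this form.\<close>
  have uI: "u y = w" if "y \<in> carrier L" "a \<in> carrier A" "y \<otimes>\<^bsub>L\<^esub> (l f [^]\<^bsub>L\<^esub> n) = l a"
      "w \<in> carrier B" "w \<otimes>\<^bsub>B\<^esub> e [^]\<^bsub>B\<^esub> n = g a" for y a w and n :: nat
    by (rule B.even_unit_cancel[OF e uc[OF that(1)] that(4), of n]) (simp add: ue[OF that(1-3)] that(5))
  have ul: "u (l a) = g a" if "a \<in> carrier A" for a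
    by (rule uI[of _ a 0]) (use that in auto)
  have L_comm: "x \<otimes>\<^bsub>L\<^esub> (l f [^]\<^bsub>L\<^esub> (n::nat)) = (l f [^]\<^bsub>L\<^esub> n) \<otimes>\<^bsub>L\<^esub> x" if "x \<in> carrier L" for x n
    using L.even_comm[OF L.even_pow[OF shom_even[OF l f]]] that by simp
  have B_comm: "x \<otimes>\<^bsub>B\<^esub> (e [^]\<^bsub>B\<^esub> (n::nat)) = (e [^]\<^bsub>B\<^esub> n) \<otimes>\<^bsub>B\<^esub> x" if "x \<in> carrier B" for x n
    using B.even_comm[OF B.even_pow[OF e(2)]] that by simp
  have "u \<in> shom L B"
  proof (rule shomI)
    fix y z assume y: "y \<in> carrier L" and z: "z \<in> carrier L"
    obtain a n where a: "a \<in> carrier A" "y \<otimes>\<^bsub>L\<^esub> (l f [^]\<^bsub>L\<^esub> (n::nat)) = l a"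
      using fraction_quotient_fraction[OF L y] by blast
    obtain b m where b: "b \<in> carrier A" "z \<otimes>\<^bsub>L\<^esub> (l f [^]\<^bsub>L\<^esub> (m::nat)) = l b"
      using fraction_quotient_fraction[OF L z] by blast
    note ua = ue[OF y a] and ub = ue[OF z b]
    show "u (y \<oplus>\<^bsub>L\<^esub> z) = u y \<oplus>\<^bsub>B\<^esub> u z"
    proof (rule uI[of _ "a \<otimes> f [^] m \<oplus> b \<otimes> f [^] n" "n + m"])
      have "l (a \<otimes> f [^] m \<oplus> b \<otimes> f [^] n) = l a \<otimes>\<^bsub>L\<^esub> l f [^]\<^bsub>L\<^esub> m \<oplus>\<^bsub>L\<^esub> l b \<otimes>\<^bsub>L\<^esub> l f [^]\<^bsub>L\<^esub> n"
        using a b by (simp add: shom_add[OF l] shom_mult[OF l] lp)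
      also have "\<dots> = (y \<oplus>\<^bsub>L\<^esub> z) \<otimes>\<^bsub>L\<^esub> l f [^]\<^bsub>L\<^esub> (n + m)"
        unfolding a(2)[symmetric] b(2)[symmetric] using y z
        by (simp add: L.m_assoc L.nat_pow_mult L.l_distr add.commute)
      finally show "(y \<oplus>\<^bsub>L\<^esub> z) \<otimes>\<^bsub>L\<^esub> l f [^]\<^bsub>L\<^esub> (n + m) = l (a \<otimes> f [^] m \<oplus> b \<otimes> f [^] n)" by simp
      have "g (a \<otimes> f [^] m \<oplus> b \<otimes> f [^] n) = g a \<otimes>\<^bsub>B\<^esub> e [^]\<^bsub>B\<^esub> m \<oplus>\<^bsub>B\<^esub> g b \<otimes>\<^bsub>B\<^esub> e [^]\<^bsub>B\<^esub> n"
        using a b by (simp add: shom_add[OF g(1)] shom_mult[OF g(1)] gp)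
      also have "\<dots> = (u y \<oplus>\<^bsub>B\<^esub> u z) \<otimes>\<^bsub>B\<^esub> e [^]\<^bsub>B\<^esub> (n + m)"
        unfolding ua[symmetric] ub[symmetric] using y z
        by (simp add: B.m_assoc B.nat_pow_mult B.l_distr add.commute)
      finally show "(u y \<oplus>\<^bsub>B\<^esub> u z) \<otimes>\<^bsub>B\<^esub> e [^]\<^bsub>B\<^esub> (n + m) = g (a \<otimes> f [^] m \<oplus> b \<otimes> f [^] n)" by simp
    qed (use a b y z in auto)
    show "u (y \<otimes>\<^bsub>L\<^esub> z) = u y \<otimes>\<^bsub>B\<^esub> u z"
    proof (rule uI[of _ "a \<otimes> b" "n + m"])
      have "l (a \<otimes> b) = (y \<otimes>\<^bsub>L\<^esub> l f [^]\<^bsub>L\<^esub> n) \<otimes>\<^bsub>L\<^esub> (z \<otimes>\<^bsub>L\<^esub> l f [^]\<^bsub>L\<^esub> m)"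
        using a b by (simp add: shom_mult[OF l])
      also have "\<dots> = y \<otimes>\<^bsub>L\<^esub> ((l f [^]\<^bsub>L\<^esub> n \<otimes>\<^bsub>L\<^esub> z) \<otimes>\<^bsub>L\<^esub> l f [^]\<^bsub>L\<^esub> m)"
        using y z by (simp add: L.m_assoc)
      also have "\<dots> = (y \<otimes>\<^bsub>L\<^esub> z) \<otimes>\<^bsub>L\<^esub> l f [^]\<^bsub>L\<^esub> (n + m)"
        unfolding L_comm[OF z, of n, symmetric] using y z by (simp add: L.m_assoc L.nat_pow_mult)
      finally show "(y \<otimes>\<^bsub>L\<^esub> z) \<otimes>\<^bsub>L\<^esub> l f [^]\<^bsub>L\<^esub> (n + m) = l (a \<otimes> b)" by simp
      have "g (a \<otimes> b) = (u y \<otimes>\<^bsub>B\<^esub> e [^]\<^bsub>B\<^esub> n) \<otimes>\<^bsub>B\<^esub> (u z \<otimes>\<^bsub>B\<^esub> e [^]\<^bsub>B\<^esub> m)"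
        using a b ua ub by (simp add: shom_mult[OF g(1)])
      also have "\<dots> = u y \<otimes>\<^bsub>B\<^esub> ((e [^]\<^bsub>B\<^esub> n \<otimes>\<^bsub>B\<^esub> u z) \<otimes>\<^bsub>B\<^esub> e [^]\<^bsub>B\<^esub> m)"
        using y z by (simp add: B.m_assoc)
      also have "\<dots> = (u y \<otimes>\<^bsub>B\<^esub> u z) \<otimes>\<^bsub>B\<^esub> e [^]\<^bsub>B\<^esub> (n + m)"
        unfolding B_comm[OF uc[OF z], of n, symmetric] using y z by (simp add: B.m_assoc B.nat_pow_mult)
      finally show "(u y \<otimes>\<^bsub>B\<^esub> u z) \<otimes>\<^bsub>B\<^esub> e [^]\<^bsub>B\<^esub> (n + m) = g (a \<otimes> b)" by simp
    qed (use a b y z in auto)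
  next
    fix y z assume y: "y \<in> carrier L"
    obtain a n where a: "a \<in> carrier A" "y \<otimes>\<^bsub>L\<^esub> (l f [^]\<^bsub>L\<^esub> (n::nat)) = l a"
      using fraction_quotient_fraction[OF L y] by blast
    show "u (z \<odot>\<^bsub>L\<^esub> y) = z \<odot>\<^bsub>B\<^esub> u y"
      by (rule uI[of _ "z \<odot> a" n])
        (use a y ue[OF y a] in \<open>simp_all add: L.smult_mult B.smult_mult shom_smult[OF l] shom_smult[OF g(1)]\<close>)
  next
    have "u (l \<one>) = g \<one>" by (rule ul) simp
    then show "u \<one>\<^bsub>L\<^esub> = \<one>\<^bsub>B\<^esub>" by (simp add: shom_one[OF l] shom_one[OF g(1)])
  next
    fix y assume y: "y \<in> even_part L"
    then have yc: "y \<in> carrier L" by (rule L.even_carrier)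
    obtain a n where a: "a \<in> carrier A" "y \<otimes>\<^bsub>L\<^esub> (l f [^]\<^bsub>L\<^esub> (n::nat)) = l a"
      using fraction_quotient_fraction[OF L yc] by blast
    obtain a0 a1 where a01: "a0 \<in> even_part A" "a1 \<in> odd_part A" "a = a0 \<oplus> a1"
      using A.even_odd_decomp[OF a(1)] .
    note c = A.even_carrier[OF a01(1)] A.odd_carrier[OF a01(2)]
    have even: "y \<otimes>\<^bsub>L\<^esub> (l f [^]\<^bsub>L\<^esub> n) \<in> even_part L"
      using y shom_even[OF l f] by (intro L.even_mult_even L.even_pow)
    have "l a0 \<oplus>\<^bsub>L\<^esub> l a1 = l a \<oplus>\<^bsub>L\<^esub> \<zero>\<^bsub>L\<^esub>" using a01 c by (simp add: shom_add[OF l])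
    \<comment> \<open>Since \<open>l a\<close> is even, the odd component \<open>a1\<close>
      contributes nothing, so \<open>a0\<close> is a numerator of \<open>y\<close> as well.\<close>
    then have "l a0 = l a"
      using L.even_odd_unique(1)[OF shom_even[OF l a01(1)] shom_odd[OF l a01(2)] even L.zero_odd] a(2) by simp
    then have "u y \<otimes>\<^bsub>B\<^esub> e [^]\<^bsub>B\<^esub> n = g a0" using ue[OF yc c(1)] a(2) by simp
    then show "u y \<in> even_part B"
      using B.even_from_product[OF e uc[OF yc], of n] shom_even[OF g(1) a01(1)] by simp
  next
    fix y assume y: "y \<in> odd_part L"
    then have yc: "y \<in> carrier L" by (rule L.odd_carrier)
    obtain a n where a: "a \<in> carrier A" "y \<otimes>\<^bsub>L\<^esub> (l f [^]\<^bsub>L\<^esub> (n::nat)) = l a"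
      using fraction_quotient_fraction[OF L yc] by blast
    obtain a0 a1 where a01: "a0 \<in> even_part A" "a1 \<in> odd_part A" "a = a0 \<oplus> a1"
      using A.even_odd_decomp[OF a(1)] .
    note c = A.even_carrier[OF a01(1)] A.odd_carrier[OF a01(2)]
    have odd: "y \<otimes>\<^bsub>L\<^esub> (l f [^]\<^bsub>L\<^esub> n) \<in> odd_part L"
      using y shom_even[OF l f] by (intro L.odd_mult_even L.even_pow)
    have "l a0 \<oplus>\<^bsub>L\<^esub> l a1 = \<zero>\<^bsub>L\<^esub> \<oplus>\<^bsub>L\<^esub> l a" using a01 c by (simp add: shom_add[OF l])
    then have "l a1 = l a"
      using L.even_odd_unique(2)[OF shom_even[OF l a01(1)] shom_odd[OF l a01(2)] L.zero_even odd] a(2) by simp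
    then have "u y \<otimes>\<^bsub>B\<^esub> e [^]\<^bsub>B\<^esub> n = g a1" using ue[OF yc c(2)] a(2) by simp
    then show "u y \<in> odd_part B"
      using B.odd_from_product[OF e uc[OF yc], of n] shom_odd[OF g(1) a01(2)] by simp
  next
    show "u \<in> extensional (carrier L)" by (simp add: u_def)
  qed (rule uc)
  with ul that show ?thesis by blast
qed

section \<open>Residue fields\<close>

lemma superideal_ideal: "superideal I A \<Longrightarrow> ideal I A"
  by (simp add: superideal_def)

lemma superideal_homogeneous:
  "superideal I A \<Longrightarrow> x \<in> even_part A \<Longrightarrow> y \<in> odd_part A \<Longrightarrow> x \<oplus>\<^bsub>A\<^esub> y \<in> I \<Longrightarrow> x \<in> I"
  "superideal I A \<Longrightarrow> x \<in> even_part A \<Longrightarrow> y \<in> odd_part A \<Longrightarrow> x \<oplus>\<^bsub>A\<^esub> y \<in> I \<Longrightarrow> y \<in> I"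
  unfolding superideal_def by blast+

context salg
begin

text \<open>Moving an odd \<open>a\<close> past \<open>s\<close> only changes the sign of the odd
  component of \<open>s\<close>. This lets left multiples of a homogeneous element behave like a
  two-sided ideal.\<close>

lemma homogeneous_commute:
  assumes "a \<in> even_part A \<union> odd_part A" "s \<in> carrier A"
  shows "\<exists>s'\<in>carrier A. a \<otimes> s = s' \<otimes> a"
proof (cases "a \<in> even_part A")
  case True then show ?thesis using even_comm[OF True assms(2)] assms by blast
next
  case False
  then have a: "a \<in> odd_part A" using assms by blast
  obtain u v where uv: "u \<in> even_part A" "v \<in> odd_part A" "s = u \<oplus> v"
    using even_odd_decomp[OF assms(2)] .
  note c = even_carrier[OF uv(1)] odd_carrier[OF uv(2)] odd_carrier[OF a]
  have "a \<otimes> s = (u \<oplus> \<ominus> v) \<otimes> a"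
    using even_comm[OF uv(1) c(3)] odd_anticomm[OF a uv(2)] c by (simp add: uv(3) l_distr r_distr l_minus)
  then show ?thesis using c by blast
qed

text \<open>The elements congruent to a left multiple of \<open>a\<close> modulo \<open>M\<close>
  form a two-sided ideal by \<open>homogeneous_commute\<close>. For maximal \<open>M\<close> this
  description produces left inverses modulo \<open>M\<close>.\<close>

lemma genideal_add_homogeneous:
  assumes M: "superideal M A" and a: "a \<in> even_part A \<union> odd_part A"
  shows "\<exists>I. superideal I A \<and> M \<subseteq> I \<and> a \<in> I \<and> (\<forall>x\<in>I. \<exists>r\<in>carrier A. x \<ominus> r \<otimes> a \<in> M)"
proof -
  interpret M: ideal M A by (rule superideal_ideal[OF M])
  have ac: "a \<in> carrier A" using a even_carrier odd_carrier by blast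
  \<comment> \<open>Only homogeneous elements of \<open>M\<close> serve as generators, so that a
    superideal is generated; all of \<open>M\<close> is recovered because \<open>M\<close> contains
    the components of its elements.\<close>
  define S where "S = insert a (M \<inter> (even_part A \<union> odd_part A))"
  have S: "S \<subseteq> even_part A \<union> odd_part A" using a by (auto simp: S_def)
  then have Sc: "S \<subseteq> carrier A" using even_carrier odd_carrier by blast
  interpret I: ideal "Idl S" A by (rule genideal_ideal[OF Sc])
  have MI: "M \<subseteq> Idl S"
  proof
    fix m assume m: "m \<in> M"
    then have mc: "m \<in> carrier A" using M.a_subset by auto
    obtain u v where uv: "u \<in> even_part A" "v \<in> odd_part A" "m = u \<oplus> v"
      using even_odd_decomp[OF mc] .
    then have "u \<in> S" "v \<in> S" using superideal_homogeneous[OF M uv(1,2)] m by (auto simp: S_def)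
    then have "u \<in> Idl S" "v \<in> Idl S" using genideal_self[OF Sc] by blast+
    then show "m \<in> Idl S" using uv I.a_closed by simp
  qed
  define D where "D = {x \<in> carrier A. \<exists>r\<in>carrier A. x \<ominus> r \<otimes> a \<in> M}"
  have "ideal D A"
  proof (rule idealI)
    show "ring A" by (rule ring_axioms)
    show "subgroup D (add_monoid A)"
    proof (rule add.subgroupI)
      have "\<zero> \<ominus> \<zero> \<otimes> a \<in> M" using ac by (simp add: a_minus_def)
      then show "D \<noteq> {}" unfolding D_def using zero_closed by blast
    next
      fix x assume "x \<in> D"
      then obtain r where r: "x \<in> carrier A" "r \<in> carrier A" "x \<ominus> r \<otimes> a \<in> M" by (auto simp: D_def)
      have "\<ominus> x \<ominus> (\<ominus> r) \<otimes> a = \<ominus> (x \<ominus> r \<otimes> a)"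
        using r ac by (simp add: a_minus_def minus_add l_minus)
      then have "\<ominus> x \<ominus> (\<ominus> r) \<otimes> a \<in> M" using M.a_inv_closed[OF r(3)] by simp
      then show "\<ominus> x \<in> D" using r unfolding D_def by blast
    next
      fix x y assume "x \<in> D" "y \<in> D"
      then obtain r s where r: "x \<in> carrier A" "r \<in> carrier A" "x \<ominus> r \<otimes> a \<in> M"
        and s: "y \<in> carrier A" "s \<in> carrier A" "y \<ominus> s \<otimes> a \<in> M" by (auto simp: D_def)
      have "(x \<oplus> y) \<ominus> (r \<oplus> s) \<otimes> a = (x \<ominus> r \<otimes> a) \<oplus> (y \<ominus> s \<otimes> a)"
        using r s ac by (simp add: a_minus_def minus_add l_distr a_ac)
      then have "(x \<oplus> y) \<ominus> (r \<oplus> s) \<otimes> a \<in> M" using M.a_closed[OF r(3) s(3)] by simp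
      then show "x \<oplus> y \<in> D" using r s unfolding D_def by blast
    qed (auto simp: D_def)
  next
    fix x y assume "x \<in> D" and y: "y \<in> carrier A"
    then obtain r where r: "x \<in> carrier A" "r \<in> carrier A" "x \<ominus> r \<otimes> a \<in> M" by (auto simp: D_def)
    have "y \<otimes> x \<ominus> (y \<otimes> r) \<otimes> a = y \<otimes> (x \<ominus> r \<otimes> a)"
      using r y ac by (simp add: a_minus_def r_distr r_minus m_assoc)
    then have "y \<otimes> x \<ominus> (y \<otimes> r) \<otimes> a \<in> M" using M.I_l_closed[OF r(3) y] by simp
    then show "y \<otimes> x \<in> D" using r y unfolding D_def by blast
    obtain s where s: "s \<in> carrier A" "a \<otimes> y = s \<otimes> a" using homogeneous_commute[OF a y] by blast
    have "x \<otimes> y \<ominus> (r \<otimes> s) \<otimes> a = (x \<ominus> r \<otimes> a) \<otimes> y"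
      using r y s(1) ac by (simp add: a_minus_def l_distr l_minus m_assoc s(2))
    then have "x \<otimes> y \<ominus> (r \<otimes> s) \<otimes> a \<in> M" using M.I_r_closed[OF r(3) y] by simp
    then show "x \<otimes> y \<in> D" using r y s unfolding D_def by blast
  qed
  moreover have "S \<subseteq> D"
  proof
    fix x assume x: "x \<in> S"
    then have xc: "x \<in> carrier A" using Sc by blast
    show "x \<in> D"
    proof (cases "x = a")
      case True
      have "a \<ominus> \<one> \<otimes> a \<in> M" using ac by (simp add: a_minus_def r_neg)
      then show ?thesis unfolding D_def True using ac one_closed by blast
    next
      case False
      then have "x \<ominus> \<zero> \<otimes> a \<in> M" using x xc ac by (simp add: S_def a_minus_def)
      then show ?thesis unfolding D_def using xc zero_closed by blast
    qed
  qed
  ultimately have "Idl S \<subseteq> D" by (rule genideal_minimal)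
  then have "\<forall>x\<in>Idl S. \<exists>r\<in>carrier A. x \<ominus> r \<otimes> a \<in> M" by (auto simp: D_def)
  moreover have "a \<in> Idl S" using genideal_self[OF Sc] by (auto simp: S_def)
  ultimately show ?thesis using superideal_genideal[OF S] MI by blast
qed

text \<open>Zorn's lemma is applied to proper superideals rather than proper ideals because the
  quotient must inherit the grading. This kind of maximality suffices for inverting homogeneous
  elements.\<close>

lemma maximal_superideal:
  assumes J: "superideal J A" "\<one> \<notin> J"
  obtains M where "superideal M A" "J \<subseteq> M" "\<one> \<notin> M" "\<forall>I. superideal I A \<longrightarrow> M \<subseteq> I \<longrightarrow> \<one> \<notin> I \<longrightarrow> I = M"
proof -
  define \<A> where "\<A> = {I. superideal I A \<and> J \<subseteq> I \<and> \<one> \<notin> I}"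
  have "\<exists>M\<in>\<A>. \<forall>X\<in>\<A>. M \<subseteq> X \<longrightarrow> X = M"
  proof (rule subset_Zorn_nonempty)
    show "\<A> \<noteq> {}" using J by (auto simp: \<A>_def)
    fix C assume C: "C \<noteq> {}" "subset.chain \<A> C"
    have CA: "superideal I A" "J \<subseteq> I" "\<one> \<notin> I" if "I \<in> C" for I
      using C(2) that by (auto simp: subset.chain_def \<A>_def)
    have Cc: "I \<subseteq> carrier A" if "I \<in> C" for I
      using additive_subgroup.a_subset[OF ideal.axioms(1)[OF superideal_ideal[OF CA(1)[OF that]]]] .
    have two: "\<exists>I\<in>C. x \<in> I \<and> y \<in> I" if xy: "x \<in> \<Union>C" "y \<in> \<Union>C" for x y
    proof -
      obtain I K where IK: "I \<in> C" "x \<in> I" "K \<in> C" "y \<in> K" using xy by blast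
      then have "I \<subseteq> K \<or> K \<subseteq> I" using C(2) by (simp add: subset_chain_def)
      then show ?thesis using IK by blast
    qed
    have "ideal (\<Union>C) A"
    proof (rule idealI)
      show "subgroup (\<Union>C) (add_monoid A)"
      proof (rule add.subgroupI)
        show "\<Union>C \<noteq> {}"
          using C(1) additive_subgroup.zero_closed[OF ideal.axioms(1)[OF superideal_ideal[OF CA(1)]]] by blast
        show "\<Union>C \<subseteq> carrier A" using Cc by blast
      next
        fix x assume "x \<in> \<Union>C"
        then obtain I where I: "I \<in> C" "x \<in> I" by blast
        interpret I: ideal I A by (rule superideal_ideal[OF CA(1)[OF I(1)]])
        show "\<ominus> x \<in> \<Union>C" using I I.a_inv_closed by blast
      next
        fix x y assume "x \<in> \<Union>C" "y \<in> \<Union>C"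
        then obtain I where "I \<in> C" "x \<in> I" "y \<in> I" using two by blast
        then show "x \<oplus> y \<in> \<Union>C"
          using additive_subgroup.a_closed[OF ideal.axioms(1)[OF superideal_ideal[OF CA(1)]]] by blast
      qed
    next
      fix b x assume "b \<in> \<Union>C" and x: "x \<in> carrier A"
      then obtain I where I: "I \<in> C" "b \<in> I" by blast
      interpret I: ideal I A by (rule superideal_ideal[OF CA(1)[OF I(1)]])
      show "x \<otimes> b \<in> \<Union>C" "b \<otimes> x \<in> \<Union>C"
        using I I.I_l_closed[OF I(2) x] I.I_r_closed[OF I(2) x] by blast+
    qed (rule ring_axioms)
    moreover have "\<forall>x\<in>even_part A. \<forall>y\<in>odd_part A. x \<oplus> y \<in> \<Union>C \<longrightarrow> x \<in> \<Union>C \<and> y \<in> \<Union>C"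
      using superideal_homogeneous[OF CA(1)] by blast
    ultimately show "\<Union>C \<in> \<A>" using C(1) CA unfolding \<A>_def superideal_def by blast
  qed
  then obtain M where M: "M \<in> \<A>" "\<forall>X\<in>\<A>. M \<subseteq> X \<longrightarrow> X = M" by blast
  show ?thesis
  proof (rule that[of M])
    show "\<forall>I. superideal I A \<longrightarrow> M \<subseteq> I \<longrightarrow> \<one> \<notin> I \<longrightarrow> I = M"
      using M unfolding \<A>_def by (metis (mono_tags, lifting) mem_Collect_eq order_trans)
  qed (use M(1) in \<open>auto simp: \<A>_def\<close>)
qed

text \<open>Quasi-compactness: the elements reached by finite subsets of \<open>S\<close> already
  form an ideal. Covers can thus be chosen finite, which later allows a common exponent.\<close>

lemma genideal_finite:
  assumes "S \<subseteq> carrier A" "x \<in> Idl S"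
  shows "\<exists>F. finite F \<and> F \<subseteq> S \<and> x \<in> Idl F"
proof -
  define D where "D = {x. \<exists>F. finite F \<and> F \<subseteq> S \<and> x \<in> Idl F}"
  have I: "ideal (Idl F) A" if "F \<subseteq> S" for F using genideal_ideal that assms(1) by blast
  have sub: "Idl F \<subseteq> Idl G" if "F \<subseteq> G" "G \<subseteq> S" for F G
    using genideal_minimal[OF I[OF that(2)], of F] genideal_self[of G] that assms(1) by blast
  have "ideal D A"
  proof (rule idealI)
    show "subgroup D (add_monoid A)"
    proof (rule add.subgroupI)
      show "D \<subseteq> carrier A"
        using I[THEN ideal.axioms(1), THEN additive_subgroup.a_subset] by (auto simp: D_def)
      have "\<zero> \<in> Idl {}" using I[of "{}", THEN ideal.axioms(1), THEN additive_subgroup.zero_closed] by blast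
      then show "D \<noteq> {}" unfolding D_def by blast
    next
      fix x assume "x \<in> D"
      then obtain F where F: "finite F" "F \<subseteq> S" "x \<in> Idl F" by (auto simp: D_def)
      interpret F: ideal "Idl F" A by (rule I[OF F(2)])
      show "\<ominus> x \<in> D" using F F.a_inv_closed unfolding D_def by blast
    next
      fix x y assume "x \<in> D" "y \<in> D"
      then obtain F G where F: "finite F" "F \<subseteq> S" "x \<in> Idl F" and G: "finite G" "G \<subseteq> S" "y \<in> Idl G"
        by (auto simp: D_def)
      have FG: "F \<union> G \<subseteq> S" "finite (F \<union> G)" using F G by auto
      interpret FG: ideal "Idl (F \<union> G)" A by (rule I[OF FG(1)])
      have "x \<oplus> y \<in> Idl (F \<union> G)"
        using F(3) G(3) sub[of F "F \<union> G"] sub[of G "F \<union> G"] FG by (intro FG.a_closed) auto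
      then show "x \<oplus> y \<in> D" using FG unfolding D_def by blast
    qed
  next
    fix b x assume "b \<in> D" and x: "x \<in> carrier A"
    then obtain F where F: "finite F" "F \<subseteq> S" "b \<in> Idl F" by (auto simp: D_def)
    interpret F: ideal "Idl F" A by (rule I[OF F(2)])
    show "x \<otimes> b \<in> D" "b \<otimes> x \<in> D"
      using F(1,2) F.I_l_closed[OF F(3) x] F.I_r_closed[OF F(3) x] unfolding D_def by blast+
  qed (rule ring_axioms)
  moreover have "S \<subseteq> D"
  proof
    fix s assume s: "s \<in> S"
    then have "s \<in> Idl {s}" using genideal_self[of "{s}"] assms(1) by blast
    then show "s \<in> D" using s unfolding D_def by blast
  qed
  ultimately have "Idl S \<subseteq> D" by (rule genideal_minimal)
  then show ?thesis using assms(2) by (auto simp: D_def)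
qed

end

lemma superfield_odd_zero:
  assumes K: "superfield K" and y: "y \<in> odd_part K" shows "y = \<zero>\<^bsub>K\<^esub>"
proof -
  interpret K: salg K using K by (intro salgI) (simp add: superfield_def)
  interpret F: field K using K by (simp add: superfield_def)
  show ?thesis using K.odd_square[OF y] F.integral[of y y] K.odd_carrier[OF y] by blast
qed

text \<open>The quotient by a maximal superideal \<open>M\<close> has no odd part, since a
  left-invertible odd element cannot have square zero. What remains consists of even elements, so it
  is commutative, and each of them outside \<open>M\<close> becomes invertible.\<close>

lemma residue_superfield:
  fixes A :: "'a superalg" (structure)
  assumes A: "superalgebra A" and inf: "infinite (UNIV :: 'a set)"
    and J: "superideal J A" "\<one> \<notin> J"
  obtains K k where "superfield K" "k \<in> shom A K" "\<And>a. a \<in> J \<Longrightarrow> k a = \<zero>\<^bsub>K\<^esub>"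
proof -
  interpret A: salg A using A by (rule salgI)
  obtain M where M: "superideal M A" "J \<subseteq> M" "\<one> \<notin> M"
    and max: "\<forall>I. superideal I A \<longrightarrow> M \<subseteq> I \<longrightarrow> \<one> \<notin> I \<longrightarrow> I = M"
    using A.maximal_superideal[OF J] .
  interpret M: ideal M A by (rule superideal_ideal[OF M(1)])
  \<comment> \<open>Inverting the unit realizes the plain quotient \<open>A / M\<close> inside the
    type.\<close>
  obtain K k where Kk: "fraction_quotient A M \<one> K k"
    using exists_fraction_quotient[OF A M(1) A.one_even inf] by blast
  note K = fraction_quotient_superalgebra[OF Kk] and k = fraction_quotient_shom[OF Kk]
  interpret K: salg K using K by (rule salgI)
  have k0: "k a = \<zero>\<^bsub>K\<^esub> \<longleftrightarrow> a \<in> M" if "a \<in> carrier A" for a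
    using fraction_quotient_zero[OF Kk that] that by simp
  have ks: "\<exists>a\<in>carrier A. y = k a" if "y \<in> carrier K" for y
    using fraction_quotient_fraction[OF Kk that] that by (simp add: shom_one[OF k])
  have inv: "\<exists>r\<in>carrier A. k r \<otimes>\<^bsub>K\<^esub> k a = \<one>\<^bsub>K\<^esub>"
    if a: "a \<in> even_part A \<union> odd_part A" "a \<notin> M" for a
  proof -
    have ac: "a \<in> carrier A" using a A.even_carrier A.odd_carrier by blast
    obtain I where I: "superideal I A" "M \<subseteq> I" "a \<in> I" "\<forall>x\<in>I. \<exists>r\<in>carrier A. x \<ominus> r \<otimes> a \<in> M"
      using A.genideal_add_homogeneous[OF M(1) a(1)] by blast
    then have "\<one> \<in> I" using max I(1,2) a by blast
    then obtain r where r: "r \<in> carrier A" "\<one> \<ominus> r \<otimes> a \<in> M" using I by blast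
    have "\<one> \<ominus> r \<otimes> a \<in> carrier A" using r(1) ac by simp
    from k0[OF this] r(2) have "k (\<one> \<ominus> r \<otimes> a) = \<zero>\<^bsub>K\<^esub>" by blast
    moreover have "k (\<one> \<ominus> r \<otimes> a) = \<one>\<^bsub>K\<^esub> \<ominus>\<^bsub>K\<^esub> (k r \<otimes>\<^bsub>K\<^esub> k a)"
      using r ac by (simp add: a_minus_def shom_add[OF k] shom_a_inv[OF A K k] shom_one[OF k] shom_mult[OF k])
    ultimately have "\<one>\<^bsub>K\<^esub> \<ominus>\<^bsub>K\<^esub> (k r \<otimes>\<^bsub>K\<^esub> k a) = \<zero>\<^bsub>K\<^esub>" by (simp only:)
    then have "\<one>\<^bsub>K\<^esub> = k r \<otimes>\<^bsub>K\<^esub> k a"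
      using K.r_right_minus_eq[OF K.one_closed K.m_closed[OF shom_closed[OF k r(1)] shom_closed[OF k ac]]] by blast
    then show ?thesis using r(1) by metis
  qed
  have odd: "a \<in> M" if a: "a \<in> odd_part A" for a
  proof (rule ccontr)
    assume "a \<notin> M"
    then obtain r where r: "r \<in> carrier A" "k r \<otimes>\<^bsub>K\<^esub> k a = \<one>\<^bsub>K\<^esub>" using inv[of a] a by blast
    note c = A.odd_carrier[OF a]
    have "k a = (k r \<otimes>\<^bsub>K\<^esub> k a) \<otimes>\<^bsub>K\<^esub> k a" unfolding r(2) using shom_closed[OF k c] by simp
    also have "\<dots> = k r \<otimes>\<^bsub>K\<^esub> k (a \<otimes> a)"
      using K.m_assoc[of "k r" "k a" "k a"] shom_closed[OF k r(1)] shom_closed[OF k c] shom_mult[OF k c c] by simp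
    also have "\<dots> = \<zero>\<^bsub>K\<^esub>" using A.odd_square[OF a] shom_zero[OF A K k] r shom_closed[OF k] by simp
    finally show False using k0[OF c] \<open>a \<notin> M\<close> by blast
  qed
  have even: "\<exists>a\<in>even_part A. y = k a" if y: "y \<in> carrier K" for y
  proof -
    obtain a where a: "a \<in> carrier A" "y = k a" using ks[OF y] by blast
    obtain u v where uv: "u \<in> even_part A" "v \<in> odd_part A" "a = u \<oplus> v"
      using A.even_odd_decomp[OF a(1)] .
    note c = A.even_carrier[OF uv(1)] A.odd_carrier[OF uv(2)]
    have "k a = k u" using uv c k0[OF c(2)] odd[OF uv(2)] shom_closed[OF k] by (simp add: shom_add[OF k])
    then show ?thesis using a uv by blast
  qed
  have comm: "x \<otimes>\<^bsub>K\<^esub> y = y \<otimes>\<^bsub>K\<^esub> x" if xy: "x \<in> carrier K" "y \<in> carrier K" for x y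
  proof -
    obtain a where "a \<in> even_part A" "x = k a" using even[OF xy(1)] by blast
    then show ?thesis using K.even_comm[OF shom_even[OF k] xy(2)] by blast
  qed
  interpret K: cring K
    by (rule cring.intro[OF K.ring_axioms]) (rule comm_monoid.intro[OF K.monoid_axioms], unfold_locales, rule comm)
  have one: "\<one>\<^bsub>K\<^esub> \<noteq> \<zero>\<^bsub>K\<^esub>" using k0[of "\<one>"] M(3) by (simp add: shom_one[OF k])
  have "field K"
  proof (rule K.cring_fieldI)
    show "Units K = carrier K - {\<zero>\<^bsub>K\<^esub>}"
    proof (intro equalityI subsetI)
      fix y assume "y \<in> Units K"
      then show "y \<in> carrier K - {\<zero>\<^bsub>K\<^esub>}"
        using one K.l_null unfolding Units_def by force
    next
      fix y assume y: "y \<in> carrier K - {\<zero>\<^bsub>K\<^esub>}"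
      then obtain a where a: "a \<in> even_part A" "y = k a" using even by blast
      then have "a \<notin> M" using y k0[OF A.even_carrier] by blast
      then obtain r where r: "r \<in> carrier A" "k r \<otimes>\<^bsub>K\<^esub> y = \<one>\<^bsub>K\<^esub>" using inv[of a] a by blast
      then show "y \<in> Units K" using y comm[of y "k r"] shom_closed[OF k r(1)] unfolding Units_def by force
    qed
  qed
  then have "superfield K" using K by (simp add: superfield_def)
  moreover have "k a = \<zero>\<^bsub>K\<^esub>" if "a \<in> J" for a
    using that M(2) k0 M.a_subset by blast
  ultimately show ?thesis using that k by blast
qed

text \<open>If \<open>S\<close> generated a proper ideal, a residue field above that ideal would be
  a field point killing all of \<open>S\<close>.\<close>

lemma finite_unit_subset:
  fixes A :: "'a superalg" (structure)
  assumes A: "superalgebra A" and inf: "infinite (UNIV :: 'a set)" and S: "S \<subseteq> even_part A"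
    and pts: "\<And>K k. superfield K \<Longrightarrow> k \<in> shom A K \<Longrightarrow> \<exists>s\<in>S. k s \<noteq> \<zero>\<^bsub>K\<^esub>"
  obtains F where "finite F" "F \<subseteq> S" "Idl F = carrier A"
proof -
  interpret A: salg A using A by (rule salgI)
  have Sc: "S \<subseteq> carrier A" using S A.even_carrier by blast
  have "superideal (Idl S) A" by (rule A.superideal_genideal) (use S in blast)
  have "\<one> \<in> Idl S"
  proof (rule ccontr)
    assume "\<one> \<notin> Idl S"
    then obtain K k where "superfield K" "k \<in> shom A K" "\<And>a. a \<in> Idl S \<Longrightarrow> k a = \<zero>\<^bsub>K\<^esub>"
      using residue_superfield[OF A inf \<open>superideal (Idl S) A\<close>] by blast
    then show False using pts[of K k] A.genideal_self[OF Sc] by blast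
  qed
  then obtain F where F: "finite F" "F \<subseteq> S" "\<one> \<in> Idl F" using A.genideal_finite[OF Sc] by blast
  interpret F: ideal "Idl F" A using F Sc by (intro A.genideal_ideal) blast
  show ?thesis using that F F.one_imp_carrier by blast
qed

text \<open>The even annihilators of \<open>a\<close> include a power of every \<open>f\<close> in
  \<open>F\<close>. A field point killing all of them would kill \<open>F\<close> and hence the
  unit, so they generate the unit ideal.\<close>

lemma local_zero:
  fixes A :: "'a superalg" (structure)
  assumes A: "superalgebra A" and inf: "infinite (UNIV :: 'a set)" and F: "F \<subseteq> even_part A" "Idl F = carrier A"
    and a: "a \<in> carrier A" "\<And>f. f \<in> F \<Longrightarrow> \<exists>n::nat. (f [^] n) \<otimes> a = \<zero>"
  shows "a = \<zero>"
proof -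
  interpret A: salg A using A by (rule salgI)
  define G where "G = {g \<in> even_part A. g \<otimes> a = \<zero>}"
  have Gc: "G \<subseteq> carrier A" using A.even_carrier by (auto simp: G_def)
  have sup: "superideal (Idl G) A" by (rule A.superideal_genideal) (auto simp: G_def)
  have "\<one> \<in> Idl G"
  proof (rule ccontr)
    assume "\<one> \<notin> Idl G"
    then obtain K k where K: "superfield K" "k \<in> shom A K" "\<And>g. g \<in> Idl G \<Longrightarrow> k g = \<zero>\<^bsub>K\<^esub>"
      using residue_superfield[OF A inf sup] by blast
    then have KA: "superalgebra K" by (simp add: superfield_def)
    interpret F: field K using K by (simp add: superfield_def)
    have pow: "x = \<zero>\<^bsub>K\<^esub>" if "x [^]\<^bsub>K\<^esub> (n::nat) = \<zero>\<^bsub>K\<^esub>" "x \<in> carrier K" for x n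
      using that by (induction n) (use F.integral F.nat_pow_closed in auto)
    have kF: "k f = \<zero>\<^bsub>K\<^esub>" if f: "f \<in> F" for f
    proof -
      have fe: "f \<in> even_part A" using f F by blast
      obtain n :: nat where n: "f [^] n \<otimes> a = \<zero>" using a(2)[OF f] by blast
      have "f [^] n \<in> Idl G"
        using A.genideal_self[OF Gc] n A.even_pow[OF fe] by (auto simp: G_def)
      then show ?thesis
        using K(3) shom_pow[OF A KA K(2) A.even_carrier[OF fe], of n] pow[of "k f" n]
          shom_closed[OF K(2) A.even_carrier[OF fe]] by simp
    qed
    have "k \<one> = \<zero>\<^bsub>K\<^esub>"
      by (rule shom_genideal[OF A KA K(2), of F]) (use F A.even_carrier kF in auto)
    then show False using F.one_not_zero by (simp add: shom_one[OF K(2)])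
  qed
  \<comment> \<open>Asking for annihilation of all left multiples of \<open>a\<close>, not just of
    \<open>a\<close>, gives a two-sided ideal; it contains \<open>G\<close> because even elements
    pass through the factor \<open>c\<close>.\<close>
  moreover have "Idl G \<subseteq> {b \<in> carrier A. \<forall>c\<in>carrier A. b \<otimes> (c \<otimes> a) = \<zero>}"
  proof (rule A.genideal_minimal)
    show "ideal {b \<in> carrier A. \<forall>c\<in>carrier A. b \<otimes> (c \<otimes> a) = \<zero>} A"
    proof (rule idealI[OF A.ring_axioms])
      show "subgroup {b \<in> carrier A. \<forall>c\<in>carrier A. b \<otimes> (c \<otimes> a) = \<zero>} (add_monoid A)"
      proof (rule A.add.subgroupI)
        have "\<zero> \<in> {b \<in> carrier A. \<forall>c\<in>carrier A. b \<otimes> (c \<otimes> a) = \<zero>}" using a by simp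
        then show "{b \<in> carrier A. \<forall>c\<in>carrier A. b \<otimes> (c \<otimes> a) = \<zero>} \<noteq> {}" by blast
      qed (use a in \<open>auto simp: A.l_distr A.l_minus\<close>)
    next
      fix b x assume b: "b \<in> {b \<in> carrier A. \<forall>c\<in>carrier A. b \<otimes> (c \<otimes> a) = \<zero>}"
        and x: "x \<in> carrier A"
      show "x \<otimes> b \<in> {b \<in> carrier A. \<forall>c\<in>carrier A. b \<otimes> (c \<otimes> a) = \<zero>}"
        using b x a by (simp add: A.m_assoc)
      have "(b \<otimes> x) \<otimes> (c \<otimes> a) = b \<otimes> ((x \<otimes> c) \<otimes> a)" if "c \<in> carrier A" for c
        using b x a that by (simp add: A.m_assoc)
      then show "b \<otimes> x \<in> {b \<in> carrier A. \<forall>c\<in>carrier A. b \<otimes> (c \<otimes> a) = \<zero>}"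
        using b x by simp
    qed
    show "G \<subseteq> {b \<in> carrier A. \<forall>c\<in>carrier A. b \<otimes> (c \<otimes> a) = \<zero>}"
    proof
      fix g assume g: "g \<in> G"
      then have ge: "g \<in> even_part A" "g \<otimes> a = \<zero>" "g \<in> carrier A" using Gc by (auto simp: G_def)
      have "g \<otimes> (c \<otimes> a) = c \<otimes> (g \<otimes> a)" if "c \<in> carrier A" for c
        using A.m_assoc[OF ge(3) that a(1)] A.m_assoc[OF that ge(3) a(1)] A.even_comm[OF ge(1) that] by simp
      then show "g \<in> {b \<in> carrier A. \<forall>c\<in>carrier A. b \<otimes> (c \<otimes> a) = \<zero>}"
        using ge a by auto
    qed
  qed
  ultimately have "\<one> \<otimes> (\<one> \<otimes> a) = \<zero>" by blast
  then show ?thesis using a by simp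
qed

section \<open>Closed subfunctors glued from charts\<close>

lemma superideal_zero: "superalgebra A \<Longrightarrow> superideal {\<zero>\<^bsub>A\<^esub>} A"
proof -
  assume A: "superalgebra A"
  interpret A: salg A using A by (rule salgI)
  have "{a \<in> carrier A. restrict id (carrier A) a = \<zero>\<^bsub>A\<^esub>} = {\<zero>\<^bsub>A\<^esub>}" by auto
  then show ?thesis using superideal_kernel[OF A A shom_restrict_id[OF A]] by simp
qed

lemma superideal_Inter:
  fixes A (structure)
  assumes A: "superalgebra A" and K: "\<And>e. e \<in> F \<Longrightarrow> superideal (K e) A"
  shows "superideal {a \<in> carrier A. \<forall>e\<in>F. a \<in> K e} A"
proof -
  interpret A: salg A using A by (rule salgI)
  have I: "ideal (K e) A" if "e \<in> F" for e using superideal_ideal[OF K[OF that]] .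
  note add = I[THEN ideal.axioms(1)]
  have "ideal {a \<in> carrier A. \<forall>e\<in>F. a \<in> K e} A"
  proof (rule idealI[OF A.ring_axioms])
    show "subgroup {a \<in> carrier A. \<forall>e\<in>F. a \<in> K e} (add_monoid A)"
    proof (rule A.add.subgroupI)
      have "\<zero> \<in> {a \<in> carrier A. \<forall>e\<in>F. a \<in> K e}"
        using add[THEN additive_subgroup.zero_closed] by simp
      then show "{a \<in> carrier A. \<forall>e\<in>F. a \<in> K e} \<noteq> {}" by blast
    next
      fix a assume "a \<in> {a \<in> carrier A. \<forall>e\<in>F. a \<in> K e}"
      then show "\<ominus> a \<in> {a \<in> carrier A. \<forall>e\<in>F. a \<in> K e}"
        using add[THEN additive_subgroup.a_inv_closed] by simp
    next
      fix a b assume "a \<in> {a \<in> carrier A. \<forall>e\<in>F. a \<in> K e}" "b \<in> {a \<in> carrier A. \<forall>e\<in>F. a \<in> K e}"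
      then show "a \<oplus> b \<in> {a \<in> carrier A. \<forall>e\<in>F. a \<in> K e}"
        using add[THEN additive_subgroup.a_closed] by simp
    qed auto
  next
    fix a x assume "a \<in> {a \<in> carrier A. \<forall>e\<in>F. a \<in> K e}" "x \<in> carrier A"
    then show "x \<otimes> a \<in> {a \<in> carrier A. \<forall>e\<in>F. a \<in> K e}" "a \<otimes> x \<in> {a \<in> carrier A. \<forall>e\<in>F. a \<in> K e}"
      using I[THEN ideal.I_l_closed] I[THEN ideal.I_r_closed] by simp_all
  qed
  moreover have "x \<in> {a \<in> carrier A. \<forall>e\<in>F. a \<in> K e} \<and> y \<in> {a \<in> carrier A. \<forall>e\<in>F. a \<in> K e}"
    if "x \<in> even_part A" "y \<in> odd_part A" "x \<oplus> y \<in> {a \<in> carrier A. \<forall>e\<in>F. a \<in> K e}" for x y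
    using that superideal_homogeneous[OF K that(1,2)] A.even_carrier A.odd_carrier by auto
  ultimately show ?thesis unfolding superideal_def by blast
qed

text \<open>Principal covers survive base change: the preimage of the ideal generated by the images
  is an ideal of \<open>A\<close> containing \<open>F\<close>, hence the unit.\<close>

lemma genideal_image_unit:
  assumes A: "superalgebra A" and B: "superalgebra B" and f: "f \<in> shom A B"
    and F: "F \<subseteq> carrier A" "Idl\<^bsub>A\<^esub> F = carrier A"
  shows "Idl\<^bsub>B\<^esub> (f ` F) = carrier B"
proof -
  interpret A: salg A using A by (rule salgI)
  interpret B: salg B using B by (rule salgI)
  have fF: "f ` F \<subseteq> carrier B" using shom_closed[OF f] F by blast
  interpret I: ideal "Idl\<^bsub>B\<^esub> (f ` F)" B by (rule B.genideal_ideal[OF fF])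
  have "ideal {a \<in> carrier A. f a \<in> Idl\<^bsub>B\<^esub> (f ` F)} A"
  proof (rule idealI[OF A.ring_axioms])
    show "subgroup {a \<in> carrier A. f a \<in> Idl\<^bsub>B\<^esub> (f ` F)} (add_monoid A)"
    proof (rule A.add.subgroupI)
      have "\<zero>\<^bsub>A\<^esub> \<in> {a \<in> carrier A. f a \<in> Idl\<^bsub>B\<^esub> (f ` F)}" by (simp add: shom_zero[OF A B f])
      then show "{a \<in> carrier A. f a \<in> Idl\<^bsub>B\<^esub> (f ` F)} \<noteq> {}" by blast
    qed (auto simp: shom_a_inv[OF A B f] shom_add[OF f])
  qed (auto simp: shom_mult[OF f] shom_closed[OF f] I.I_l_closed I.I_r_closed)
  then have "Idl\<^bsub>A\<^esub> F \<subseteq> {a \<in> carrier A. f a \<in> Idl\<^bsub>B\<^esub> (f ` F)}"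
    by (rule A.genideal_minimal) (use B.genideal_self[OF fF] F(1) in auto)
  then have "\<one>\<^bsub>A\<^esub> \<in> {a \<in> carrier A. f a \<in> Idl\<^bsub>B\<^esub> (f ` F)}" using F(2) A.one_closed by blast
  then have "\<one>\<^bsub>B\<^esub> \<in> Idl\<^bsub>B\<^esub> (f ` F)" by (simp add: shom_one[OF f])
  then show ?thesis by (rule I.one_imp_carrier)
qed

lemma exists_localization:
  fixes A :: "'a superalg"
  assumes "superalgebra A" "f \<in> even_part A" "infinite (UNIV :: 'a set)"
  shows "\<exists>L l. fraction_quotient A {\<zero>\<^bsub>A\<^esub>} f L l"
  using exists_fraction_quotient[OF assms(1) superideal_zero[OF assms(1)] assms(2,3)] .

text \<open>The form of \<open>local_zero\<close> suited to arguments in which maps out of a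
  localization come from its universal property.\<close>

lemma local_zero_localization:
  fixes A :: "'a superalg" (structure)
  assumes A: "superalgebra A" and inf: "infinite (UNIV :: 'a set)" and F: "F \<subseteq> even_part A" "Idl F = carrier A"
    and a: "a \<in> carrier A" "\<And>f L l. f \<in> F \<Longrightarrow> fraction_quotient A {\<zero>} f L l \<Longrightarrow> l a = \<zero>\<^bsub>L\<^esub>"
  shows "a = \<zero>"
proof (rule local_zero[OF A inf F a(1)])
  fix f assume f: "f \<in> F"
  then obtain L l where L: "fraction_quotient A {\<zero>} f L l" using exists_localization[OF A _ inf] F by blast
  show "\<exists>n::nat. (f [^] n) \<otimes> a = \<zero>"
    using a(2)[OF f L] fraction_quotient_zero[OF L a(1)] by simp
qed

text \<open>Isolates what gluing needs from a toric supervariety. Coverage is demanded on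
  field-valued points only, so being in a chart after localization has to be derived.\<close>

locale atlas =
  fixes X :: "('a, 'x) sfunctor" and T :: "'t set" and R :: "'t \<Rightarrow> 'a superalg"
    and \<phi> :: "'t \<Rightarrow> 'a superalg \<Rightarrow> ('a \<Rightarrow> 'a) \<Rightarrow> 'x"
  assumes sfunctor: "is_sfunctor X" and separated: "separated X" and infinite_UNIV: "infinite (UNIV :: 'a set)"
    and chart: "\<And>t. t \<in> T \<Longrightarrow> affine_open_immersion (R t) X (\<phi> t)"
    and charts_cover: "\<And>K x. superfield K \<Longrightarrow> x \<in> pts X K \<Longrightarrow> \<exists>t\<in>T. x \<in> \<phi> t K ` shom (R t) K"
begin

lemma fmap_in: "superalgebra A \<Longrightarrow> superalgebra B \<Longrightarrow> f \<in> shom A B \<Longrightarrow> x \<in> pts X A \<Longrightarrow> fmap X A B f x \<in> pts X B"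
  and fmap_id: "superalgebra A \<Longrightarrow> x \<in> pts X A \<Longrightarrow> fmap X A A (restrict id (carrier A)) x = x"
  and fmap_compose: "superalgebra A \<Longrightarrow> superalgebra B \<Longrightarrow> superalgebra C \<Longrightarrow> f \<in> shom A B \<Longrightarrow> g \<in> shom B C \<Longrightarrow>
    x \<in> pts X A \<Longrightarrow> fmap X B C g (fmap X A B f x) = fmap X A C (compose (carrier A) g f) x"
  using sfunctor unfolding is_sfunctor_def by metis+

lemma chart_superalgebra: "t \<in> T \<Longrightarrow> superalgebra (R t)"
  using chart unfolding affine_open_immersion_def by blast

lemma chart_in: "t \<in> T \<Longrightarrow> superalgebra A \<Longrightarrow> h \<in> shom (R t) A \<Longrightarrow> \<phi> t A h \<in> pts X A"
  using chart[of t] unfolding affine_open_immersion_def natural_map_def by (auto simp: Sp_def Pi_iff)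

lemma chart_natural: "t \<in> T \<Longrightarrow> superalgebra A \<Longrightarrow> superalgebra B \<Longrightarrow> f \<in> shom A B \<Longrightarrow> h \<in> shom (R t) A \<Longrightarrow>
    \<phi> t B (compose (carrier (R t)) f h) = fmap X A B f (\<phi> t A h)"
  using chart[of t] unfolding affine_open_immersion_def natural_map_def by (auto simp: Sp_def)

lemma chart_inj: "t \<in> T \<Longrightarrow> superalgebra A \<Longrightarrow> h \<in> shom (R t) A \<Longrightarrow> h' \<in> shom (R t) A \<Longrightarrow>
    \<phi> t A h = \<phi> t A h' \<Longrightarrow> h = h'"
  using chart[of t] unfolding affine_open_immersion_def by (auto simp: Sp_def inj_on_def)

lemma chart_open: "t \<in> T \<Longrightarrow> open_sub X (\<lambda>A. \<phi> t A ` shom (R t) A)"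
  using chart[of t] unfolding affine_open_immersion_def by (simp add: Sp_def)

text \<open>Along \<open>x\<close> each chart pulls back to an open set \<open>D(I t)\<close>. The
  even elements of all the \<open>I t\<close> have no common zero over a field because the charts
  cover, so finitely many of them generate the unit ideal; where such an element of
  \<open>I t\<close> is inverted, \<open>x\<close> lies in the chart \<open>t\<close>.\<close>

lemma local_charts:
  assumes A: "superalgebra A" and x: "x \<in> pts X A"
  obtains F where "finite F" "F \<subseteq> even_part A" "Idl\<^bsub>A\<^esub> F = carrier A"
    "\<And>f L l. f \<in> F \<Longrightarrow> superalgebra L \<Longrightarrow> l \<in> shom A L \<Longrightarrow> l f \<in> Units L \<Longrightarrow>
      \<exists>t\<in>T. \<exists>h\<in>shom (R t) L. fmap X A L l x = \<phi> t L h"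
proof -
  interpret A: salg A using A by (rule salgI)
  have "\<forall>t\<in>T. \<exists>I. superideal I A \<and> (\<forall>B f. superalgebra B \<and> f \<in> shom A B \<longrightarrow>
           (fmap X A B f x \<in> \<phi> t B ` shom (R t) B \<longleftrightarrow> Idl\<^bsub>B\<^esub> (f ` I) = carrier B))"
    using chart_open A x unfolding open_sub_def by blast
  then obtain I where I: "\<And>t. t \<in> T \<Longrightarrow> superideal (I t) A"
    "\<And>t B f. t \<in> T \<Longrightarrow> superalgebra B \<Longrightarrow> f \<in> shom A B \<Longrightarrow>
           fmap X A B f x \<in> \<phi> t B ` shom (R t) B \<longleftrightarrow> Idl\<^bsub>B\<^esub> (f ` I t) = carrier B"
    by (metis (no_types))
  have Ic: "I t \<subseteq> carrier A" if "t \<in> T" for t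
    using superideal_ideal[OF I(1)[OF that]] by (rule ideal.axioms(1)[THEN additive_subgroup.a_subset])
  define S where "S = (\<Union>t\<in>T. I t) \<inter> even_part A"
  have Se: "S \<subseteq> even_part A" by (simp add: S_def)
  have pt: "\<exists>s\<in>S. k s \<noteq> \<zero>\<^bsub>K\<^esub>" if K: "superfield K" and k: "k \<in> shom A K" for K k
  proof (rule ccontr)
    assume no: "\<not> (\<exists>s\<in>S. k s \<noteq> \<zero>\<^bsub>K\<^esub>)"
    have KA: "superalgebra K" using K by (simp add: superfield_def)
    interpret K: salg K using KA by (rule salgI)
    interpret Kf: field K using K by (simp add: superfield_def)
    obtain t where t: "t \<in> T" "fmap X A K k x \<in> \<phi> t K ` shom (R t) K"
      using charts_cover[OF K fmap_in[OF A KA k x]] by blast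
    \<comment> \<open>Odd components die in every field and even ones by the assumption
      \<open>no\<close>, so the whole ideal \<open>I t\<close> would vanish although it must
      generate the unit ideal over \<open>K\<close>.\<close>
    have kI: "k a = \<zero>\<^bsub>K\<^esub>" if a: "a \<in> I t" for a
    proof -
      have ac: "a \<in> carrier A" using Ic[OF t(1)] a by blast
      obtain u v where uv: "u \<in> even_part A" "v \<in> odd_part A" "a = u \<oplus>\<^bsub>A\<^esub> v" using A.even_odd_decomp[OF ac] .
      then have "u \<in> I t" using superideal_homogeneous(1)[OF I(1)[OF t(1)] uv(1,2)] a by simp
      then have "k u = \<zero>\<^bsub>K\<^esub>" using no uv(1) t(1) by (auto simp: S_def)
      moreover have "k v = \<zero>\<^bsub>K\<^esub>" using superfield_odd_zero[OF K] shom_odd[OF k uv(2)] by blast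
      ultimately show ?thesis
        using shom_add[OF k A.even_carrier[OF uv(1)] A.odd_carrier[OF uv(2)]] uv(3) by simp
    qed
    have "Idl\<^bsub>K\<^esub> (k ` I t) \<subseteq> {\<zero>\<^bsub>K\<^esub>}"
      by (rule K.genideal_minimal) (use superideal_ideal[OF superideal_zero[OF KA]] kI in auto)
    then have "carrier K \<subseteq> {\<zero>\<^bsub>K\<^esub>}" using I(2)[OF t(1) KA k] t(2) by simp
    then show False using Kf.one_not_zero K.one_closed by blast
  qed
  obtain F where F: "finite F" "F \<subseteq> S" "Idl\<^bsub>A\<^esub> F = carrier A"
    using finite_unit_subset[OF A infinite_UNIV Se pt] by blast
  show ?thesis
  proof (rule that[OF F(1) _ F(3)])
    show "F \<subseteq> even_part A" using F(2) by (simp add: S_def)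
    fix f L l assume f: "f \<in> F" and L: "superalgebra L" and l: "l \<in> shom A L" "l f \<in> Units L"
    interpret L: salg L using L by (rule salgI)
    obtain t where t: "t \<in> T" "f \<in> I t" using f F(2) by (auto simp: S_def)
    have lI: "l ` I t \<subseteq> carrier L" using Ic[OF t(1)] shom_closed[OF l(1)] by blast
    interpret J: ideal "Idl\<^bsub>L\<^esub> (l ` I t)" L by (rule L.genideal_ideal[OF lI])
    have lf: "l f \<in> Idl\<^bsub>L\<^esub> (l ` I t)" using L.genideal_self[OF lI] t(2) by blast
    have "inv\<^bsub>L\<^esub> (l f) \<otimes>\<^bsub>L\<^esub> l f \<in> Idl\<^bsub>L\<^esub> (l ` I t)" by (rule J.I_l_closed[OF lf]) (use l(2) in simp)
    then have "\<one>\<^bsub>L\<^esub> \<in> Idl\<^bsub>L\<^esub> (l ` I t)" using l(2) by simp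
    then have "Idl\<^bsub>L\<^esub> (l ` I t) = carrier L" by (rule J.one_imp_carrier)
    then show "\<exists>t\<in>T. \<exists>h\<in>shom (R t) L. fmap X A L l x = \<phi> t L h" using I(2)[OF t(1) L l(1)] t(1) by blast
  qed
qed

lemma local_vanish:
  fixes A (structure)
  assumes A: "superalgebra A" and x: "x \<in> pts X A" and a: "a \<in> carrier A"
    and loc: "\<And>t B g h. t \<in> T \<Longrightarrow> superalgebra B \<Longrightarrow> g \<in> shom A B \<Longrightarrow> h \<in> shom (R t) B \<Longrightarrow>
      fmap X A B g x = \<phi> t B h \<Longrightarrow> g a = \<zero>\<^bsub>B\<^esub>"
  shows "a = \<zero>"
proof -
  obtain F where F: "F \<subseteq> even_part A" "Idl F = carrier A"
    "\<And>f L l. f \<in> F \<Longrightarrow> superalgebra L \<Longrightarrow> l \<in> shom A L \<Longrightarrow> l f \<in> Units L \<Longrightarrow>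
      \<exists>t\<in>T. \<exists>h\<in>shom (R t) L. fmap X A L l x = \<phi> t L h"
    using local_charts[OF A x] by (metis (no_types))
  show ?thesis
  proof (rule local_zero_localization[OF A infinite_UNIV F(1,2) a])
    fix f L l assume f: "f \<in> F" and L: "fraction_quotient A {\<zero>} f L l"
    note Lf = fraction_quotient_superalgebra[OF L] fraction_quotient_shom[OF L] fraction_quotient_Units[OF L]
    obtain t h where "t \<in> T" "h \<in> shom (R t) L" "fmap X A L l x = \<phi> t L h"
      using F(3)[OF f Lf] by blast
    then show "l a = \<zero>\<^bsub>L\<^esub>" using loc Lf by blast
  qed
qed

text \<open>Closedness and separatedness speak of homomorphisms that kill an ideal. Phrased for the
  identity of \<open>A\<close>, local vanishing can be fed back into either of them.\<close>

lemma killed_local: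
  assumes A: "superalgebra A" and w: "w \<in> pts X A" and I: "superideal I A"
    and loc: "\<And>t B g h. t \<in> T \<Longrightarrow> superalgebra B \<Longrightarrow> g \<in> shom A B \<Longrightarrow> h \<in> shom (R t) B \<Longrightarrow>
      fmap X A B g w = \<phi> t B h \<Longrightarrow> (\<forall>a\<in>I. g a = \<zero>\<^bsub>B\<^esub>)"
  shows "\<forall>a\<in>I. restrict id (carrier A) a = \<zero>\<^bsub>A\<^esub>"
proof
  fix a assume a: "a \<in> I"
  then have ac: "a \<in> carrier A"
    using superideal_ideal[OF I] ideal.axioms(1)[THEN additive_subgroup.a_subset] by blast
  have "a = \<zero>\<^bsub>A\<^esub>" by (rule local_vanish[OF A w ac]) (use loc a in blast)
  then show "restrict id (carrier A) a = \<zero>\<^bsub>A\<^esub>" using ac by simp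
qed

text \<open>Separatedness turns equality into vanishing of an ideal, which is local. The auxiliary
  point \<open>w\<close> supplies the charts and may differ from \<open>x\<close> and
  \<open>y\<close>, for instance when these are two translates of \<open>w\<close>.\<close>

lemma point_eq_local:
  assumes A: "superalgebra A" and w: "w \<in> pts X A" and x: "x \<in> pts X A" and y: "y \<in> pts X A"
    and loc: "\<And>t B g h. t \<in> T \<Longrightarrow> superalgebra B \<Longrightarrow> g \<in> shom A B \<Longrightarrow> h \<in> shom (R t) B \<Longrightarrow>
      fmap X A B g w = \<phi> t B h \<Longrightarrow> fmap X A B g x = fmap X A B g y"
  shows "x = y"
proof -
  obtain I where I: "superideal I A"
    "\<And>B f. superalgebra B \<Longrightarrow> f \<in> shom A B \<Longrightarrow> fmap X A B f x = fmap X A B f y \<longleftrightarrow> (\<forall>a\<in>I. f a = \<zero>\<^bsub>B\<^esub>)"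
    using separated A x y unfolding separated_def by metis
  have "\<forall>a\<in>I. restrict id (carrier A) a = \<zero>\<^bsub>A\<^esub>" by (rule killed_local[OF A w I(1)]) (use loc I(2) in blast)
  then show ?thesis using I(2)[OF A shom_restrict_id[OF A]] fmap_id[OF A] x y by simp
qed

lemma closed_sub_local:
  assumes Y: "closed_sub X Y" and A: "superalgebra A" and w: "w \<in> pts X A" and y: "y \<in> pts X A"
    and loc: "\<And>t B g h. t \<in> T \<Longrightarrow> superalgebra B \<Longrightarrow> g \<in> shom A B \<Longrightarrow> h \<in> shom (R t) B \<Longrightarrow>
      fmap X A B g w = \<phi> t B h \<Longrightarrow> fmap X A B g y \<in> Y B"
  shows "y \<in> Y A"
proof -
  obtain I where I: "superideal I A"
    "\<And>B f. superalgebra B \<Longrightarrow> f \<in> shom A B \<Longrightarrow> fmap X A B f y \<in> Y B \<longleftrightarrow> (\<forall>a\<in>I. f a = \<zero>\<^bsub>B\<^esub>)"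
    using Y A y unfolding closed_sub_def by metis
  have "\<forall>a\<in>I. restrict id (carrier A) a = \<zero>\<^bsub>A\<^esub>" by (rule killed_local[OF A w I(1)]) (use loc I(2) in blast)
  then show ?thesis using I(2)[OF A shom_restrict_id[OF A]] fmap_id[OF A y] by simp
qed

end

locale closed_in_charts = atlas X T R \<phi>
  for X :: "('a, 'x) sfunctor" and T :: "'t set" and R :: "'t \<Rightarrow> 'a superalg"
    and \<phi> :: "'t \<Rightarrow> 'a superalg \<Rightarrow> ('a \<Rightarrow> 'a) \<Rightarrow> 'x" +
  fixes I :: "'t \<Rightarrow> 'a set"
  assumes homogeneous: "\<And>t. t \<in> T \<Longrightarrow> I t \<subseteq> even_part (R t) \<union> odd_part (R t)"
    and compatible: "\<And>t t' B h h'. t \<in> T \<Longrightarrow> t' \<in> T \<Longrightarrow> superalgebra B \<Longrightarrow> h \<in> shom (R t) B \<Longrightarrow> h' \<in> shom (R t') B \<Longrightarrow>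
      \<phi> t B h = \<phi> t' B h' \<Longrightarrow> (\<forall>r\<in>I t. h r = \<zero>\<^bsub>B\<^esub>) \<Longrightarrow> (\<forall>r\<in>I t'. h' r = \<zero>\<^bsub>B\<^esub>)"
begin

text \<open>A point need not lie in any chart, so the condition is imposed on all base changes that
  do. Quantifying over every base change also makes functoriality automatic.\<close>

definition glued_sub :: "'a superalg \<Rightarrow> 'x set" where
  "glued_sub A = {x \<in> pts X A. \<forall>t\<in>T. \<forall>B g h. superalgebra B \<and> g \<in> shom A B \<and> h \<in> shom (R t) B \<and>
     fmap X A B g x = \<phi> t B h \<longrightarrow> (\<forall>r\<in>I t. h r = \<zero>\<^bsub>B\<^esub>)}"

lemma glued_subD:
  assumes "x \<in> glued_sub A" "t \<in> T" "superalgebra B" "g \<in> shom A B" "h \<in> shom (R t) B" "fmap X A B g x = \<phi> t B h" "r \<in> I t"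
  shows "h r = \<zero>\<^bsub>B\<^esub>"
  using assms unfolding glued_sub_def by blast

lemma glued_sub_in: "x \<in> glued_sub A \<Longrightarrow> x \<in> pts X A"
  by (simp add: glued_sub_def)

text \<open>A point in one chart has to be tested there only: \<open>compatible\<close> transports
  the vanishing to any other chart containing a base change of it.\<close>

lemma glued_sub_chart:
  assumes t: "t \<in> T" and A: "superalgebra A" and h: "h \<in> shom (R t) A"
  shows "\<phi> t A h \<in> glued_sub A \<longleftrightarrow> (\<forall>r\<in>I t. h r = \<zero>\<^bsub>A\<^esub>)"
proof
  assume "\<phi> t A h \<in> glued_sub A"
  then show "\<forall>r\<in>I t. h r = \<zero>\<^bsub>A\<^esub>"
    using glued_subD[OF _ t A shom_restrict_id[OF A] h] fmap_id[OF A chart_in[OF t A h]] by blast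
next
  assume kill: "\<forall>r\<in>I t. h r = \<zero>\<^bsub>A\<^esub>"
  show "\<phi> t A h \<in> glued_sub A"
    unfolding glued_sub_def
  proof (intro CollectI conjI ballI allI impI; (elim conjE)?)
    show "\<phi> t A h \<in> pts X A" by (rule chart_in[OF t A h])
    fix t' B g h' r assume t': "t' \<in> T" and B: "superalgebra B" and g: "g \<in> shom A B" and h': "h' \<in> shom (R t') B"
      and eq: "fmap X A B g (\<phi> t A h) = \<phi> t' B h'" and r: "r \<in> I t'"
    interpret Rt: salg "R t" using chart_superalgebra[OF t] by (rule salgI)
    have "\<forall>r\<in>I t. compose (carrier (R t)) g h r = \<zero>\<^bsub>B\<^esub>"
      using kill shom_zero[OF A B g] homogeneous[OF t] Rt.even_carrier Rt.odd_carrier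
      by (auto simp: compose_eq subset_iff)
    from compatible[OF t t' B shom_compose[OF chart_superalgebra[OF t] h g] h' _ this]
    show "h' r = \<zero>\<^bsub>B\<^esub>" using chart_natural[OF t A B g h] eq r by simp
  qed
qed

lemma glued_sub_fmap:
  assumes A: "superalgebra A" and B: "superalgebra B" and f: "f \<in> shom A B" and x: "x \<in> glued_sub A"
  shows "fmap X A B f x \<in> glued_sub B"
  unfolding glued_sub_def
proof (intro CollectI conjI ballI allI impI; (elim conjE)?)
  note xA = glued_sub_in[OF x]
  show "fmap X A B f x \<in> pts X B" by (rule fmap_in[OF A B f xA])
  fix t C g h r assume t: "t \<in> T" and C: "superalgebra C" and g: "g \<in> shom B C" and h: "h \<in> shom (R t) C"
    and eq: "fmap X B C g (fmap X A B f x) = \<phi> t C h" and r: "r \<in> I t"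
  show "h r = \<zero>\<^bsub>C\<^esub>"
    by (rule glued_subD[OF x t C shom_compose[OF A f g] h _ r]) (use fmap_compose[OF A B C f g xA] eq in simp)
qed

end

context closed_in_charts
begin

text \<open>On a principal cover the point has chart coordinates \<open>h f\<close> over
  \<open>L f\<close>, and \<open>Q f\<close> is the quotient of \<open>L f\<close> by the image of
  the chart ideal. The wanted superideal is the common kernel \<open>J\<close> of all maps from
  \<open>A\<close> to \<open>Q f\<close>. Both directions are checked after inverting the members of
  the cover.\<close>

lemma closed_sub_glued_sub: "closed_sub X glued_sub"
  unfolding closed_sub_def
proof (intro conjI allI impI; (elim conjE)?)
  show "subfunctor X glued_sub"
    unfolding subfunctor_def using glued_sub_in glued_sub_fmap by blast
  fix A x assume A: "superalgebra A" and x: "x \<in> pts X A"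
  interpret A: salg A using A by (rule salgI)
  obtain F where F: "finite F" "F \<subseteq> even_part A" "Idl\<^bsub>A\<^esub> F = carrier A"
    "\<And>f L l. f \<in> F \<Longrightarrow> superalgebra L \<Longrightarrow> l \<in> shom A L \<Longrightarrow> l f \<in> Units L \<Longrightarrow>
      \<exists>t\<in>T. \<exists>h\<in>shom (R t) L. fmap X A L l x = \<phi> t L h"
    using local_charts[OF A x] by (metis (no_types))
  have "\<exists>L l t h Q q. fraction_quotient A {\<zero>\<^bsub>A\<^esub>} f L l \<and> t \<in> T \<and> h \<in> shom (R t) L \<and> fmap X A L l x = \<phi> t L h \<and>
     fraction_quotient L (Idl\<^bsub>L\<^esub> (h ` I t)) \<one>\<^bsub>L\<^esub> Q q" if f: "f \<in> F" for f
  proof -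
    obtain L l where L: "fraction_quotient A {\<zero>\<^bsub>A\<^esub>} f L l"
      using exists_localization[OF A _ infinite_UNIV] f F(2) by blast
    note Lf = fraction_quotient_superalgebra[OF L] fraction_quotient_shom[OF L] fraction_quotient_Units[OF L]
    obtain t h where th: "t \<in> T" "h \<in> shom (R t) L" "fmap X A L l x = \<phi> t L h"
      using F(4)[OF f Lf] by blast
    interpret L: salg L using Lf(1) by (rule salgI)
    have "h ` I t \<subseteq> even_part L \<union> odd_part L"
      using homogeneous[OF th(1)] shom_even[OF th(2)] shom_odd[OF th(2)] by (auto simp: subset_iff)
    from L.superideal_genideal[OF this] obtain Q q where "fraction_quotient L (Idl\<^bsub>L\<^esub> (h ` I t)) \<one>\<^bsub>L\<^esub> Q q"
      using exists_fraction_quotient[OF Lf(1) _ L.one_even infinite_UNIV] by blast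
    with L th show ?thesis by blast
  qed
  then obtain L l t h Q q where *: "\<And>f. f \<in> F \<Longrightarrow> fraction_quotient A {\<zero>\<^bsub>A\<^esub>} f (L f) (l f)"
     "\<And>f. f \<in> F \<Longrightarrow> t f \<in> T" "\<And>f. f \<in> F \<Longrightarrow> h f \<in> shom (R (t f)) (L f)"
     "\<And>f. f \<in> F \<Longrightarrow> fmap X A (L f) (l f) x = \<phi> (t f) (L f) (h f)"
     "\<And>f. f \<in> F \<Longrightarrow> fraction_quotient (L f) (Idl\<^bsub>L f\<^esub> (h f ` I (t f))) \<one>\<^bsub>L f\<^esub> (Q f) (q f)"
    by metis
  note LA = fraction_quotient_superalgebra[OF *(1)] and lA = fraction_quotient_shom[OF *(1)]
  note QA = fraction_quotient_superalgebra[OF *(5)] and qA = fraction_quotient_shom[OF *(5)]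
  have fc: "f \<in> carrier A" if "f \<in> F" for f using that F(2) A.even_carrier by blast
  have fe: "f \<in> even_part A" if "f \<in> F" for f using that F(2) by blast
  have hIc: "h f ` I (t f) \<subseteq> carrier (L f)" if f: "f \<in> F" for f
  proof -
    interpret S: salg "R (t f)" using chart_superalgebra[OF *(2)[OF f]] by (rule salgI)
    show ?thesis using homogeneous[OF *(2)[OF f]] S.even_carrier S.odd_carrier shom_closed[OF *(3)[OF f]]
      by (auto simp: subset_iff)
  qed
  have Ic: "I (t f) \<subseteq> carrier (R (t f))" if f: "f \<in> F" for f
  proof -
    interpret S: salg "R (t f)" using chart_superalgebra[OF *(2)[OF f]] by (rule salgI)
    show ?thesis using homogeneous[OF *(2)[OF f]] S.even_carrier S.odd_carrier by (auto simp: subset_iff)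
  qed
  \<comment> \<open>Over any base where \<open>f\<close> becomes invertible, the point is the one
    with coordinates \<open>h f\<close> followed by the induced map from \<open>L f\<close>.\<close>
  have factor: "\<exists>u\<in>shom (L f) C. (\<forall>a\<in>carrier A. u (l f a) = g a) \<and>
      fmap X A C g x = \<phi> (t f) C (compose (carrier (R (t f))) u (h f))"
    if f: "f \<in> F" and C: "superalgebra C" and g: "g \<in> shom A C" "g f \<in> Units C" for f C g
  proof -
    obtain u where u: "u \<in> shom (L f) C" "\<And>a. a \<in> carrier A \<Longrightarrow> u (l f a) = g a"
      using fraction_quotient_factor[OF A C fe[OF f] _ *(1)[OF f] g] shom_zero[OF A C g(1)] by auto
    have "compose (carrier A) u (l f) = g"
      by (rule shom_eqI[OF shom_compose[OF A lA[OF f] u(1)] g(1)]) (simp add: compose_eq u(2))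
    then have "fmap X A C g x = fmap X (L f) C u (fmap X A (L f) (l f) x)"
      using fmap_compose[OF A LA[OF f] C lA[OF f] u(1) x] by simp
    also have "\<dots> = \<phi> (t f) C (compose (carrier (R (t f))) u (h f))"
      using chart_natural[OF *(2)[OF f] LA[OF f] C u(1) *(3)[OF f]] *(4)[OF f] by simp
    finally show ?thesis using u by blast
  qed
  define b where "b f = compose (carrier A) (q f) (l f)" for f
  have b: "b f \<in> shom A (Q f)" if "f \<in> F" for f
    unfolding b_def by (rule shom_compose[OF A lA[OF that] qA[OF that]])
  have bx: "fmap X A (Q f) (b f) x \<in> glued_sub (Q f)" if f: "f \<in> F" for f
  proof -
    have "fmap X A (Q f) (b f) x = \<phi> (t f) (Q f) (compose (carrier (R (t f))) (q f) (h f))"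
      using fmap_compose[OF A LA[OF f] QA[OF f] lA[OF f] qA[OF f] x]
        chart_natural[OF *(2)[OF f] LA[OF f] QA[OF f] qA[OF f] *(3)[OF f]] *(4)[OF f] by (simp add: b_def)
    moreover have "\<forall>r\<in>I (t f). compose (carrier (R (t f))) (q f) (h f) r = \<zero>\<^bsub>Q f\<^esub>"
    proof
      fix r assume r: "r \<in> I (t f)"
      interpret L: salg "L f" using LA[OF f] by (rule salgI)
      have "h f r \<in> Idl\<^bsub>L f\<^esub> (h f ` I (t f))" "h f r \<in> carrier (L f)"
        using L.genideal_self[OF hIc[OF f]] hIc[OF f] r by blast+
      then have "q f (h f r) = \<zero>\<^bsub>Q f\<^esub>"
        by (subst fraction_quotient_zero[OF *(5)[OF f]]) (auto intro: exI[of _ 0])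
      then show "compose (carrier (R (t f))) (q f) (h f) r = \<zero>\<^bsub>Q f\<^esub>"
        using Ic[OF f] r by (simp add: compose_eq subset_iff)
    qed
    ultimately show ?thesis
      using glued_sub_chart[OF *(2)[OF f] QA[OF f] shom_compose[OF chart_superalgebra[OF *(2)[OF f]] *(3)[OF f] qA[OF f]]]
      by simp
  qed
  \<comment> \<open>By \<open>bx\<close> the point satisfies the closed condition over each
    \<open>Q f\<close>, so no larger ideal than this common kernel can be the right one.\<close>
  define J where "J = {a \<in> carrier A. \<forall>f\<in>F. a \<in> {a \<in> carrier A. b f a = \<zero>\<^bsub>Q f\<^esub>}}"
  have J: "superideal J A"
    unfolding J_def by (rule superideal_Inter[OF A superideal_kernel[OF A QA b]])
  \<comment> \<open>Where the closed condition holds and \<open>f\<close> is inverted, the base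
    change factors through \<open>Q f\<close>, which kills \<open>J\<close> by construction.\<close>
  have killed: "g a = \<zero>\<^bsub>B\<^esub>"
    if B: "superalgebra B" and g: "g \<in> shom A B" and gx: "fmap X A B g x \<in> glued_sub B" and a: "a \<in> J" for B g a
  proof (rule local_zero_localization[OF B infinite_UNIV, of "g ` F"])
    have ac: "a \<in> carrier A" using a by (simp add: J_def)
    show "g ` F \<subseteq> even_part B" using shom_even[OF g] fe by auto
    show "Idl\<^bsub>B\<^esub> (g ` F) = carrier B"
      by (rule genideal_image_unit[OF A B g _ F(3)]) (use fc in auto)
    show "g a \<in> carrier B" using shom_closed[OF g ac] .
    fix f' C m assume f': "f' \<in> g ` F" and m: "fraction_quotient B {\<zero>\<^bsub>B\<^esub>} f' C m"
    obtain f where f: "f \<in> F" "f' = g f" using f' by blast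
    note C = fraction_quotient_superalgebra[OF m] and mh = fraction_quotient_shom[OF m]
      and mU = fraction_quotient_Units[OF m, unfolded f(2)]
    have mg: "compose (carrier A) m g \<in> shom A C" by (rule shom_compose[OF A g mh])
    have mgU: "compose (carrier A) m g f \<in> Units C" using mU fc[OF f(1)] by (simp add: compose_eq)
    obtain u where u: "u \<in> shom (L f) C" "\<And>a. a \<in> carrier A \<Longrightarrow> u (l f a) = m (g a)"
      "fmap X A C (compose (carrier A) m g) x = \<phi> (t f) C (compose (carrier (R (t f))) u (h f))"
      using factor[OF f(1) C mg mgU] by (auto simp: compose_eq)
    have uh: "compose (carrier (R (t f))) u (h f) \<in> shom (R (t f)) C"
      by (rule shom_compose[OF chart_superalgebra[OF *(2)[OF f(1)]] *(3)[OF f(1)] u(1)])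
    have "\<phi> (t f) C (compose (carrier (R (t f))) u (h f)) \<in> glued_sub C"
      using glued_sub_fmap[OF B C mh gx] fmap_compose[OF A B C g mh x] u(3) by simp
    then have kill: "\<forall>r\<in>I (t f). compose (carrier (R (t f))) u (h f) r = \<zero>\<^bsub>C\<^esub>"
      using glued_sub_chart[OF *(2)[OF f(1)] C uh] by simp
    have "u y = \<zero>\<^bsub>C\<^esub>" if y: "y \<in> Idl\<^bsub>L f\<^esub> (h f ` I (t f))" for y
    proof (rule shom_genideal[OF LA[OF f(1)] C u(1) hIc[OF f(1)] _ y])
      fix s assume "s \<in> h f ` I (t f)"
      then obtain r where "r \<in> I (t f)" "s = h f r" by blast
      then show "u s = \<zero>\<^bsub>C\<^esub>" using kill Ic[OF f(1)] by (auto simp: compose_eq subset_iff)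
    qed
    moreover have "u \<one>\<^bsub>L f\<^esub> \<in> Units C"
    proof -
      interpret C: salg C using C by (rule salgI)
      show ?thesis by (simp add: shom_one[OF u(1)])
    qed
    moreover have "\<one>\<^bsub>L f\<^esub> \<in> even_part (L f)" "Idl\<^bsub>L f\<^esub> (h f ` I (t f)) \<subseteq> carrier (L f)"
    proof -
      interpret L: salg "L f" using LA[OF f(1)] by (rule salgI)
      show "\<one>\<^bsub>L f\<^esub> \<in> even_part (L f)" by simp
      show "Idl\<^bsub>L f\<^esub> (h f ` I (t f)) \<subseteq> carrier (L f)"
        using L.genideal_ideal[OF hIc[OF f(1)]] by (rule ideal.axioms(1)[THEN additive_subgroup.a_subset])
    qed
    ultimately obtain v where v: "v \<in> shom (Q f) C" "\<And>y. y \<in> carrier (L f) \<Longrightarrow> v (q f y) = u y"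
      using fraction_quotient_factor[OF LA[OF f(1)] C _ _ *(5)[OF f(1)] u(1)] by metis
    have "m (g a) = v (b f a)"
      using u(2)[OF ac] v(2)[OF shom_closed[OF lA[OF f(1)] ac]] ac by (simp add: b_def compose_eq)
    also have "\<dots> = \<zero>\<^bsub>C\<^esub>"
      using a f(1) shom_zero[OF QA[OF f(1)] C v(1)] by (simp add: J_def)
    finally show "m (g a) = \<zero>\<^bsub>C\<^esub>" .
  qed
  \<comment> \<open>A local equation \<open>h f s\<close> over \<open>L f\<close> becomes an element
    of \<open>J\<close> after clearing denominators. The issue is vanishing in \<open>Q e\<close>
    for the other members \<open>e\<close> of the cover: there \<open>f\<close> is inverted as well,
    and membership in \<open>glued_sub\<close> makes the same equation vanish.\<close>
  have in_J: "\<exists>k::nat. f [^]\<^bsub>A\<^esub> k \<otimes>\<^bsub>A\<^esub> a \<in> J"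
    if f: "f \<in> F" and s: "s \<in> I (t f)" and a: "a \<in> carrier A" "h f s \<otimes>\<^bsub>L f\<^esub> (l f f [^]\<^bsub>L f\<^esub> (n::nat)) = l f a"
    for f s a n
  proof -
    interpret Lf: salg "L f" using LA[OF f] by (rule salgI)
    have hs: "h f s \<in> carrier (L f)" using hIc[OF f] s by blast
    have lf: "l f f \<in> carrier (L f)" using shom_closed[OF lA[OF f] fc[OF f]] .
    have "\<exists>k::nat. b e f [^]\<^bsub>Q e\<^esub> k \<otimes>\<^bsub>Q e\<^esub> b e a = \<zero>\<^bsub>Q e\<^esub>" if e: "e \<in> F" for e
    proof -
      obtain D m where m: "fraction_quotient (Q e) {\<zero>\<^bsub>Q e\<^esub>} (b e f) D m"
        using exists_localization[OF QA[OF e] shom_even[OF b[OF e] fe[OF f]] infinite_UNIV] by blast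
      note D = fraction_quotient_superalgebra[OF m] and mh = fraction_quotient_shom[OF m]
        and mU = fraction_quotient_Units[OF m]
      interpret D: salg D using D by (rule salgI)
      have mb: "compose (carrier A) m (b e) \<in> shom A D" by (rule shom_compose[OF A b[OF e] mh])
      have mbU: "compose (carrier A) m (b e) f \<in> Units D" using mU fc[OF f] by (simp add: compose_eq)
      obtain v where v: "v \<in> shom (L f) D" "\<And>a. a \<in> carrier A \<Longrightarrow> v (l f a) = m (b e a)"
        "fmap X A D (compose (carrier A) m (b e)) x = \<phi> (t f) D (compose (carrier (R (t f))) v (h f))"
        using factor[OF f D mb mbU] by (auto simp: compose_eq)
      have vh: "compose (carrier (R (t f))) v (h f) \<in> shom (R (t f)) D"
        by (rule shom_compose[OF chart_superalgebra[OF *(2)[OF f]] *(3)[OF f] v(1)])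
      have "\<phi> (t f) D (compose (carrier (R (t f))) v (h f)) \<in> glued_sub D"
        using glued_sub_fmap[OF QA[OF e] D mh bx[OF e]] fmap_compose[OF A QA[OF e] D b[OF e] mh x] v(3) by simp
      then have "compose (carrier (R (t f))) v (h f) s = \<zero>\<^bsub>D\<^esub>"
        using glued_sub_chart[OF *(2)[OF f] D vh] s by simp
      then have "v (h f s) = \<zero>\<^bsub>D\<^esub>" using Ic[OF f] s by (simp add: compose_eq subset_iff)
      then have "v (l f a) = \<zero>\<^bsub>D\<^esub>"
        using shom_mult[OF v(1) hs, of "l f f [^]\<^bsub>L f\<^esub> n"] a(2) lf
          shom_closed[OF v(1), of "l f f [^]\<^bsub>L f\<^esub> n"] by simp
      then have "m (b e a) = \<zero>\<^bsub>D\<^esub>" using v(2)[OF a(1)] by simp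
      then show ?thesis using fraction_quotient_zero[OF m shom_closed[OF b[OF e] a(1)]] by simp
    qed
    then obtain k where k: "\<And>e. e \<in> F \<Longrightarrow> b e f [^]\<^bsub>Q e\<^esub> (k e::nat) \<otimes>\<^bsub>Q e\<^esub> b e a = \<zero>\<^bsub>Q e\<^esub>" by metis
    \<comment> \<open>The exponents \<open>k e\<close> depend on \<open>e\<close>; their sum over
      the finite cover is at least each of them.\<close>
    have "b e (f [^]\<^bsub>A\<^esub> (sum k F) \<otimes>\<^bsub>A\<^esub> a) = \<zero>\<^bsub>Q e\<^esub>" if e: "e \<in> F" for e
    proof -
      interpret Q: salg "Q e" using QA[OF e] by (rule salgI)
      have bc: "b e f \<in> carrier (Q e)" "b e a \<in> carrier (Q e)"
        using shom_closed[OF b[OF e]] a(1) fc[OF f] by blast+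
      obtain j where j: "sum k F = j + k e"
        using member_le_sum[OF e _ F(1), of k] by (metis le_iff_add add.commute zero_le)
      have "b e (f [^]\<^bsub>A\<^esub> (sum k F) \<otimes>\<^bsub>A\<^esub> a) = b e f [^]\<^bsub>Q e\<^esub> (j + k e) \<otimes>\<^bsub>Q e\<^esub> b e a"
        using fc[OF f] a(1) j by (simp add: shom_mult[OF b[OF e]] shom_pow[OF A QA[OF e] b[OF e]])
      also have "\<dots> = b e f [^]\<^bsub>Q e\<^esub> j \<otimes>\<^bsub>Q e\<^esub> (b e f [^]\<^bsub>Q e\<^esub> k e \<otimes>\<^bsub>Q e\<^esub> b e a)"
        using bc by (simp add: Q.nat_pow_mult[symmetric] Q.m_assoc)
      also have "\<dots> = \<zero>\<^bsub>Q e\<^esub>" using k[OF e] bc by simp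
      finally show ?thesis .
    qed
    then have "f [^]\<^bsub>A\<^esub> (sum k F) \<otimes>\<^bsub>A\<^esub> a \<in> J" using fc[OF f] a(1) by (simp add: J_def)
    then show ?thesis by blast
  qed
  \<comment> \<open>The converse direction. The given chart \<open>t'\<close> need not be one of
    those chosen for the cover, so the equations are first shown in the chart \<open>t f\<close> and
    then moved to \<open>t'\<close> by compatibility.\<close>
  have conv: "fmap X A B g x \<in> glued_sub B"
    if B: "superalgebra B" and g: "g \<in> shom A B" and kill: "\<forall>a\<in>J. g a = \<zero>\<^bsub>B\<^esub>" for B g
    unfolding glued_sub_def
  proof (intro CollectI conjI ballI allI impI; (elim conjE)?)
    show "fmap X A B g x \<in> pts X B" by (rule fmap_in[OF A B g x])
    fix t' C k h' r assume t': "t' \<in> T" and C: "superalgebra C" and k: "k \<in> shom B C" and h': "h' \<in> shom (R t') C"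
      and eq: "fmap X B C k (fmap X A B g x) = \<phi> t' C h'" and r: "r \<in> I t'"
    interpret R': salg "R t'" using chart_superalgebra[OF t'] by (rule salgI)
    have rc: "r \<in> carrier (R t')" using homogeneous[OF t'] R'.even_carrier R'.odd_carrier r by blast
    define kg where "kg = compose (carrier A) k g"
    have kg: "kg \<in> shom A C" unfolding kg_def by (rule shom_compose[OF A g k])
    have kgx: "fmap X A C kg x = \<phi> t' C h'" using fmap_compose[OF A B C g k x] eq by (simp add: kg_def)
    have kgJ: "kg a = \<zero>\<^bsub>C\<^esub>" if "a \<in> J" for a
      using kill that shom_zero[OF B C k] by (auto simp: kg_def compose_eq J_def)
    show "h' r = \<zero>\<^bsub>C\<^esub>"
    proof (rule local_zero_localization[OF C infinite_UNIV, of "kg ` F"])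
      show "kg ` F \<subseteq> even_part C" using shom_even[OF kg] fe by auto
      show "Idl\<^bsub>C\<^esub> (kg ` F) = carrier C"
        by (rule genideal_image_unit[OF A C kg _ F(3)]) (use fc in auto)
      show "h' r \<in> carrier C" using shom_closed[OF h' rc] .
      fix f' D m assume f': "f' \<in> kg ` F" and m: "fraction_quotient C {\<zero>\<^bsub>C\<^esub>} f' D m"
      obtain f where f: "f \<in> F" "f' = kg f" using f' by blast
      note D = fraction_quotient_superalgebra[OF m] and mh = fraction_quotient_shom[OF m]
        and mU = fraction_quotient_Units[OF m, unfolded f(2)]
      interpret D: salg D using D by (rule salgI)
      interpret Lf: salg "L f" using LA[OF f(1)] by (rule salgI)
      have mg: "compose (carrier A) m kg \<in> shom A D" by (rule shom_compose[OF A kg mh])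
      have mgU: "compose (carrier A) m kg f \<in> Units D" using mU fc[OF f(1)] by (simp add: compose_eq)
      obtain u where u: "u \<in> shom (L f) D" "\<And>a. a \<in> carrier A \<Longrightarrow> u (l f a) = m (kg a)"
        "fmap X A D (compose (carrier A) m kg) x = \<phi> (t f) D (compose (carrier (R (t f))) u (h f))"
        using factor[OF f(1) D mg mgU] by (auto simp: compose_eq)
      have uh: "compose (carrier (R (t f))) u (h f) \<in> shom (R (t f)) D"
        by (rule shom_compose[OF chart_superalgebra[OF *(2)[OF f(1)]] *(3)[OF f(1)] u(1)])
      have mh': "compose (carrier (R t')) m h' \<in> shom (R t') D"
        by (rule shom_compose[OF chart_superalgebra[OF t'] h' mh])
      have same: "\<phi> (t f) D (compose (carrier (R (t f))) u (h f)) = \<phi> t' D (compose (carrier (R t')) m h')"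
        using u(3) fmap_compose[OF A C D kg mh x] kgx chart_natural[OF t' C D mh h'] by simp
      have "\<forall>s\<in>I (t f). compose (carrier (R (t f))) u (h f) s = \<zero>\<^bsub>D\<^esub>"
      proof
        fix s assume s: "s \<in> I (t f)"
        have hs: "h f s \<in> carrier (L f)" using hIc[OF f(1)] s by blast
        obtain a n where a: "a \<in> carrier A" "h f s \<otimes>\<^bsub>L f\<^esub> (l f f [^]\<^bsub>L f\<^esub> (n::nat)) = l f a"
          using fraction_quotient_fraction[OF *(1)[OF f(1)] hs] by blast
        obtain i :: nat where i: "f [^]\<^bsub>A\<^esub> i \<otimes>\<^bsub>A\<^esub> a \<in> J" using in_J[OF f(1) s a] by blast
        define e where "e = m (kg f)"
        have e: "e \<in> Units D" "e \<in> even_part D" "e \<in> carrier D"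
          using mU shom_even[OF mh shom_even[OF kg fe[OF f(1)]]] D.even_carrier by (auto simp: e_def)
        have lf: "l f f \<in> carrier (L f)" using shom_closed[OF lA[OF f(1)] fc[OF f(1)]] .
        have ulf: "u (l f f) = e" using u(2)[OF fc[OF f(1)]] by (simp add: e_def)
        have us: "u (h f s) \<in> carrier D" using shom_closed[OF u(1) hs] .
        have ma: "m (kg a) = u (h f s) \<otimes>\<^bsub>D\<^esub> e [^]\<^bsub>D\<^esub> n"
          using u(2)[OF a(1)] a(2)[symmetric] hs lf
          by (simp add: shom_mult[OF u(1)] shom_pow[OF LA[OF f(1)] D u(1)] ulf)
        have "\<zero>\<^bsub>D\<^esub> = m (kg (f [^]\<^bsub>A\<^esub> i \<otimes>\<^bsub>A\<^esub> a))" using kgJ[OF i] shom_zero[OF C D mh] by simp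
        also have "\<dots> = e [^]\<^bsub>D\<^esub> i \<otimes>\<^bsub>D\<^esub> m (kg a)"
          using a(1) fc[OF f(1)] shom_closed[OF kg]
          by (simp add: shom_mult[OF kg] shom_mult[OF mh] shom_pow[OF A C kg] shom_pow[OF C D mh] e_def
              monoid.nat_pow_closed[OF ring.is_monoid] C superalgebra_def[THEN iffD1, THEN conjunct1])
        also have "\<dots> = (u (h f s) \<otimes>\<^bsub>D\<^esub> e [^]\<^bsub>D\<^esub> n) \<otimes>\<^bsub>D\<^esub> e [^]\<^bsub>D\<^esub> i"
          unfolding ma using D.even_comm[OF D.even_pow[OF e(2)], of "u (h f s) \<otimes>\<^bsub>D\<^esub> e [^]\<^bsub>D\<^esub> n" i] us e(3) by simp
        finally have "u (h f s) \<otimes>\<^bsub>D\<^esub> e [^]\<^bsub>D\<^esub> n = \<zero>\<^bsub>D\<^esub>"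
          using D.even_unit_eq_zero[OF e(1,2), of "u (h f s) \<otimes>\<^bsub>D\<^esub> e [^]\<^bsub>D\<^esub> n" i] us e(3) by simp
        then have "u (h f s) = \<zero>\<^bsub>D\<^esub>" by (rule D.even_unit_eq_zero[OF e(1,2) us])
        then show "compose (carrier (R (t f))) u (h f) s = \<zero>\<^bsub>D\<^esub>"
          using Ic[OF f(1)] s by (simp add: compose_eq subset_iff)
      qed
      from bspec[OF compatible[OF *(2)[OF f(1)] t' D uh mh' same this] r]
      show "m (h' r) = \<zero>\<^bsub>D\<^esub>" unfolding compose_eq[OF rc] .
    qed
  qed
  show "\<exists>I. superideal I A \<and> (\<forall>B f. superalgebra B \<and> f \<in> shom A B \<longrightarrow>
           (fmap X A B f x \<in> glued_sub B \<longleftrightarrow> (\<forall>a\<in>I. f a = \<zero>\<^bsub>B\<^esub>)))"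
    using J killed conv by blast
qed

end

lemma restrict_to_simps [simp]: "pts (restrict_to X Y) = Y" "fmap (restrict_to X Y) = fmap X"
  by (simp_all add: restrict_to_def)

lemma closed_sub_subset: "closed_sub X Y \<Longrightarrow> superalgebra A \<Longrightarrow> x \<in> Y A \<Longrightarrow> x \<in> pts X A"
  and closed_sub_fmap: "closed_sub X Y \<Longrightarrow> superalgebra A \<Longrightarrow> superalgebra B \<Longrightarrow> f \<in> shom A B \<Longrightarrow> x \<in> Y A \<Longrightarrow> fmap X A B f x \<in> Y B"
  unfolding closed_sub_def subfunctor_def by blast+

lemma is_sfunctor_restrict:
  assumes "is_sfunctor X" "closed_sub X Y" shows "is_sfunctor (restrict_to X Y)"
  using assms(1) closed_sub_subset[OF assms(2)] closed_sub_fmap[OF assms(2)]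
  unfolding is_sfunctor_def by simp

lemma separated_restrict:
  assumes "separated X" "closed_sub X Y" shows "separated (restrict_to X Y)"
  using assms(1) closed_sub_subset[OF assms(2)] unfolding separated_def by simp

text \<open>Local sections glue in \<open>X\<close>. The ideal that obstructs the glued point from
  lying in \<open>Y\<close> becomes zero in every localization of the cover, hence is zero by
  \<open>local_zero\<close>.\<close>

lemma local_sfunctor_restrict:
  fixes X :: "('a, 'x) sfunctor"
  assumes X: "is_sfunctor X" "local_sfunctor X" and Y: "closed_sub X Y" and inf: "infinite (UNIV :: 'a set)"
  shows "local_sfunctor (restrict_to X Y)"
  unfolding local_sfunctor_def restrict_to_simps
proof (intro allI impI)
  fix A :: "'a superalg" and F and L :: "'a \<Rightarrow> 'a superalg" and l x
  assume *: "superalgebra A \<and> finite F \<and> F \<subseteq> even_part A \<and> Idl\<^bsub>A\<^esub> F = carrier A \<and>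
     (\<forall>f\<in>F. is_localization A f (L f) (l f) \<and> x f \<in> Y (L f)) \<and>
     (\<forall>f\<in>F. \<forall>g\<in>F. \<forall>B u v. superalgebra B \<and> u \<in> shom (L f) B \<and> v \<in> shom (L g) B \<and>
        compose (carrier A) u (l f) = compose (carrier A) v (l g) \<longrightarrow>
        fmap X (L f) B u (x f) = fmap X (L g) B v (x g))"
  then have A: "superalgebra A" and F: "F \<subseteq> even_part A" "Idl\<^bsub>A\<^esub> F = carrier A"
    and loc: "\<And>f. f \<in> F \<Longrightarrow> is_localization A f (L f) (l f)" and xY: "\<And>f. f \<in> F \<Longrightarrow> x f \<in> Y (L f)"
    by blast+
  have LA: "superalgebra (L f)" "l f \<in> shom A (L f)" if "f \<in> F" for f
    using loc[OF that] by (simp_all add: is_localization_def)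
  have xX: "x f \<in> pts X (L f)" if "f \<in> F" for f
    using closed_sub_subset[OF Y LA(1) xY] that by blast
  have "\<exists>!y. y \<in> pts X A \<and> (\<forall>f\<in>F. fmap X A (L f) (l f) y = x f)"
    using X(2)[unfolded local_sfunctor_def, rule_format, of A F L l x] * xX by blast
  then obtain y where y: "y \<in> pts X A" "\<forall>f\<in>F. fmap X A (L f) (l f) y = x f"
    and uniq: "\<And>y'. y' \<in> pts X A \<Longrightarrow> \<forall>f\<in>F. fmap X A (L f) (l f) y' = x f \<Longrightarrow> y' = y" by blast
  obtain I where I: "superideal I A"
    "\<And>B f. superalgebra B \<Longrightarrow> f \<in> shom A B \<Longrightarrow> fmap X A B f y \<in> Y B \<longleftrightarrow> (\<forall>a\<in>I. f a = \<zero>\<^bsub>B\<^esub>)"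
    using Y A y(1) unfolding closed_sub_def by metis
  have Ic: "I \<subseteq> carrier A"
    using superideal_ideal[OF I(1)] by (rule ideal.axioms(1)[THEN additive_subgroup.a_subset])
  have "a = \<zero>\<^bsub>A\<^esub>" if a: "a \<in> I" for a
  proof (rule local_zero[OF A inf F])
    show ac: "a \<in> carrier A" using a Ic by blast
    fix f assume f: "f \<in> F"
    have "l f a = \<zero>\<^bsub>L f\<^esub>" using I(2)[OF LA[OF f]] y(2) xY[OF f] f a by simp
    then show "\<exists>n::nat. f [^]\<^bsub>A\<^esub> n \<otimes>\<^bsub>A\<^esub> a = \<zero>\<^bsub>A\<^esub>" using loc[OF f] ac by (simp add: is_localization_def)
  qed
  then have "\<forall>a\<in>I. restrict id (carrier A) a = \<zero>\<^bsub>A\<^esub>" using Ic by auto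
  then have "fmap X A A (restrict id (carrier A)) y \<in> Y A" using I(2)[OF A shom_restrict_id[OF A]] by simp
  then have "y \<in> Y A" using X(1) A y(1) unfolding is_sfunctor_def by simp
  then show "\<exists>!y. y \<in> Y A \<and> (\<forall>f\<in>F. fmap X A (L f) (l f) y = x f)"
    using y uniq closed_sub_subset[OF Y A] by blast
qed

section \<open>Toric superalgebras\<close>

abbreviation "keys \<equiv> Poly_Mapping.keys"
abbreviation "lookup \<equiv> Poly_Mapping.lookup"
abbreviation "single \<equiv> Poly_Mapping.single"

lemma poly_mapping_add_induct [case_names zero add]:
  fixes f :: "'k \<Rightarrow>\<^sub>0 'b::comm_monoid_add"
  assumes "P 0" "\<And>p a b. a \<notin> keys p \<Longrightarrow> b \<noteq> 0 \<Longrightarrow> P p \<Longrightarrow> P (p + single a b)"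
  shows "P f"
proof (induction f rule: update_induct)
  case const then show ?case using assms(1) by simp
next
  case (update p a b)
  have "Poly_Mapping.update a b p = p + single a b"
    using update(1) by (intro poly_mapping_eqI) (auto simp: lookup_update lookup_add lookup_single in_keys_iff when_def)
  then show ?case using assms(2) update by simp
qed

lemma keys_add_single:
  fixes p :: "'k \<Rightarrow>\<^sub>0 'b::comm_monoid_add"
  assumes "a \<notin> keys p" "b \<noteq> 0"
  shows "keys (p + single a b) = insert a (keys p)"
  using assms by (auto simp: in_keys_iff lookup_add lookup_single when_def split: if_splits)

lemma lookup_scale: "lookup (single 0 z * f) m = z * lookup (f :: 'v::monoid_add \<Rightarrow>\<^sub>0 complex) m"
  by (simp add: mult_map_scale_conv_mult[symmetric] Poly_Mapping.map.rep_eq when_def)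

lemma keys_scale: "keys (single 0 z * f) \<subseteq> keys (f :: 'v::monoid_add \<Rightarrow>\<^sub>0 complex)"
  by (auto simp: in_keys_iff lookup_scale)

text \<open>The closure conditions under which \<complex>[S] + xi J is a superalgebra.
  \<open>J\<close> need be neither nonempty nor contained in \<open>S\<close>: empty
  \<open>J\<close> gives the purely even algebras.\<close>

definition monoid_ideal :: "'v::ab_group_add set \<Rightarrow> 'v set \<Rightarrow> bool" where
  "monoid_ideal S J \<longleftrightarrow> 0 \<in> S \<and> (\<forall>s\<in>S. \<forall>t\<in>S. s + t \<in> S) \<and> (\<forall>s\<in>S. \<forall>t\<in>J. s + t \<in> J)"

lemma keys_times:
  fixes f g :: "'v::ab_group_add \<Rightarrow>\<^sub>0 complex"
  assumes "keys f \<subseteq> S" "keys g \<subseteq> J" "\<And>s t. s \<in> S \<Longrightarrow> t \<in> J \<Longrightarrow> s + t \<in> K"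
  shows "keys (f * g) \<subseteq> K"
  using keys_mult[of f g] assms by blast

lemma keys_plus_subset:
  fixes f g :: "'k \<Rightarrow>\<^sub>0 complex"
  assumes "keys f \<subseteq> S" "keys g \<subseteq> S" shows "keys (f + g) \<subseteq> S"
  using keys_add[of f g] assms by blast

lemma toric_alg_carrier: "q \<in> carrier (toric_alg S J) \<longleftrightarrow> keys (fst q) \<subseteq> S \<and> keys (snd q) \<subseteq> J"
  by (cases q) (simp add: toric_alg_def)

lemma toric_alg_simps:
  "(f, g) \<oplus>\<^bsub>toric_alg S J\<^esub> (f', g') = (f + f', g + g')"
  "(f, g) \<otimes>\<^bsub>toric_alg S J\<^esub> (f', g') = (f * f', f * g' + g * f')"
  "z \<odot>\<^bsub>toric_alg S J\<^esub> (f, g) = (single 0 z * f, single 0 z * g)"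
  "\<zero>\<^bsub>toric_alg S J\<^esub> = (0, 0)" "\<one>\<^bsub>toric_alg S J\<^esub> = (1, 0)"
  "(f, g) \<in> even_part (toric_alg S J) \<longleftrightarrow> keys f \<subseteq> S \<and> g = 0"
  "(f, g) \<in> odd_part (toric_alg S J) \<longleftrightarrow> f = 0 \<and> keys g \<subseteq> J"
  "(f, g) \<in> carrier (toric_alg S J) \<longleftrightarrow> keys f \<subseteq> S \<and> keys g \<subseteq> J"
  by (simp_all add: toric_alg_def)

text \<open>No sign shows up in the multiplication since the even components commute with xi, and
  products of odd elements are zero because xi squares to zero.\<close>

lemma superalgebra_toric_alg:
  assumes SJ: "monoid_ideal S J"
  shows "superalgebra (toric_alg S J)"
proof -
  have m1: "keys (f * g) \<subseteq> S" if "keys f \<subseteq> S" "keys g \<subseteq> S" for f g :: "'a \<Rightarrow>\<^sub>0 complex"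
    by (rule keys_times[OF that]) (use SJ in \<open>auto simp: monoid_ideal_def\<close>)
  have m2: "keys (f * g) \<subseteq> J" if "keys f \<subseteq> S" "keys g \<subseteq> J" for f g :: "'a \<Rightarrow>\<^sub>0 complex"
    by (rule keys_times[OF that]) (use SJ in \<open>auto simp: monoid_ideal_def\<close>)
  have m3: "keys (f * g) \<subseteq> J" if "keys f \<subseteq> J" "keys g \<subseteq> S" for f g :: "'a \<Rightarrow>\<^sub>0 complex"
    using m2[OF that(2,1)] by (simp add: mult.commute)
  have sc: "keys (single 0 z * f) \<subseteq> K" if "keys f \<subseteq> K" for f :: "'a \<Rightarrow>\<^sub>0 complex" and z K
    using keys_scale[of z f] that by blast
  have neg: "single 0 (- 1) * f = - f" for f :: "'a \<Rightarrow>\<^sub>0 complex"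
    by (rule poly_mapping_eqI) (simp add: lookup_scale)
  have ss: "single 0 (z * w) = single (0::'a) z * single 0 w" for z w :: complex
    by (simp add: mult_single)
  have S0: "0 \<in> S" using SJ by (simp add: monoid_ideal_def)
  show ?thesis
  proof (rule superalgebraI; (simp only: split_paired_all)?)
    fix f g :: "'a \<Rightarrow>\<^sub>0 complex"
    assume "(f, g) \<in> carrier (toric_alg S J)"
    then have "(f, 0) \<in> even_part (toric_alg S J)" "(0, g) \<in> odd_part (toric_alg S J)"
      "(f, g) = (f, 0) \<oplus>\<^bsub>toric_alg S J\<^esub> (0, g)"
      by (auto simp: toric_alg_simps)
    then show "\<exists>x\<in>even_part (toric_alg S J). \<exists>y\<in>odd_part (toric_alg S J). (f, g) = x \<oplus>\<^bsub>toric_alg S J\<^esub> y"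
      by blast
  next
    show "even_part (toric_alg S J) \<subseteq> carrier (toric_alg S J)" "odd_part (toric_alg S J) \<subseteq> carrier (toric_alg S J)"
      by (auto simp: toric_alg_def)
  qed (use S0 in \<open>auto simp: toric_alg_simps m1 m2 m3 sc neg keys_plus_subset algebra_simps single_add ss\<close>)
qed

lemma x_monom_carrier: "m \<in> S \<Longrightarrow> x_monom m \<in> carrier (toric_alg S J)"
  and x_monom_even: "m \<in> S \<Longrightarrow> x_monom m \<in> even_part (toric_alg S J)"
  and xi_monom_carrier: "m \<in> J \<Longrightarrow> xi_monom m \<in> carrier (toric_alg S J)"
  and xi_monom_odd: "m \<in> J \<Longrightarrow> xi_monom m \<in> odd_part (toric_alg S J)"
  by (auto simp: x_monom_def xi_monom_def toric_alg_simps)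

lemma monom_mult:
  "x_monom m \<otimes>\<^bsub>toric_alg S J\<^esub> x_monom n = x_monom (m + n)"
  "x_monom m \<otimes>\<^bsub>toric_alg S J\<^esub> xi_monom n = xi_monom (m + n)"
  "xi_monom m \<otimes>\<^bsub>toric_alg S J\<^esub> x_monom n = xi_monom (m + n)"
  "xi_monom m \<otimes>\<^bsub>toric_alg S J\<^esub> xi_monom n = \<zero>\<^bsub>toric_alg S J\<^esub>"
  "x_monom 0 = \<one>\<^bsub>toric_alg S J\<^esub>"
  by (simp_all add: x_monom_def xi_monom_def toric_alg_simps mult_single)

section \<open>Linear extension of maps given on monomials\<close>

context salg
begin

text \<open>The linear extension of \<open>X\<close> from monomials to Laurent polynomials, written
  as the same finite sum that occurs in \<open>conv\<close>.\<close>

definition lin :: "('v \<Rightarrow> 'a) \<Rightarrow> ('v \<Rightarrow>\<^sub>0 complex) \<Rightarrow> 'a" where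
  "lin X f = (\<Oplus>m\<in>keys f. lookup f m \<odot> X m)"

lemma lin_superset:
  assumes "finite K" "keys f \<subseteq> K" "\<And>m. m \<in> K \<Longrightarrow> X m \<in> carrier A"
  shows "lin X f = (\<Oplus>m\<in>K. lookup f m \<odot> X m)"
  unfolding lin_def
proof (rule add.finprod_mono_neutral_cong_left)
  show "\<And>i. i \<in> K - keys f \<Longrightarrow> lookup f i \<odot> X i = \<zero>"
    using assms(3) by (auto simp: in_keys_iff)
qed (use assms in auto)

lemma lin_closed: "(\<And>m. m \<in> keys f \<Longrightarrow> X m \<in> carrier A) \<Longrightarrow> lin X f \<in> carrier A"
  unfolding lin_def by (intro add.finprod_closed) auto

lemma lin_zero [simp]: "lin X 0 = \<zero>"
  by (simp add: lin_def)

lemma lin_cong: "(\<And>m. m \<in> keys f \<Longrightarrow> X m = Y m) \<Longrightarrow> (\<And>m. m \<in> keys f \<Longrightarrow> Y m \<in> carrier A) \<Longrightarrow> lin X f = lin Y f"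
  unfolding lin_def by (intro add.finprod_cong') auto

lemma lin_add:
  assumes "\<And>m. m \<in> keys f \<union> keys g \<Longrightarrow> X m \<in> carrier A"
  shows "lin X (f + g) = lin X f \<oplus> lin X g"
proof -
  have "lin X (f + g) = (\<Oplus>m\<in>keys f \<union> keys g. lookup (f + g) m \<odot> X m)"
    by (rule lin_superset) (use assms keys_add[of f g] in auto)
  also have "\<dots> = (\<Oplus>m\<in>keys f \<union> keys g. lookup f m \<odot> X m \<oplus> lookup g m \<odot> X m)"
    by (rule add.finprod_cong') (use assms in \<open>auto simp: lookup_add smult_add_left\<close>)
  also have "\<dots> = (\<Oplus>m\<in>keys f \<union> keys g. lookup f m \<odot> X m) \<oplus> (\<Oplus>m\<in>keys f \<union> keys g. lookup g m \<odot> X m)"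
    by (rule add.finprod_multf) (use assms in auto)
  also have "\<dots> = lin X f \<oplus> lin X g"
    using lin_superset[of "keys f \<union> keys g" f X] lin_superset[of "keys f \<union> keys g" g X] assms by simp
  finally show ?thesis .
qed

lemma lin_single: "X m \<in> carrier A \<Longrightarrow> lin X (single m z) = z \<odot> X m"
  using lin_superset[of "{m}" "single m z" X] by (simp split: if_splits)

lemma lin_add_single:
  assumes "\<And>m. m \<in> keys p \<Longrightarrow> X m \<in> carrier A" "X a \<in> carrier A"
  shows "lin X (p + single a b) = lin X p \<oplus> b \<odot> X a"
  using assms by (subst lin_add) (auto simp: lin_single split: if_splits)

lemma lin_scale:
  fixes f :: "'v::monoid_add \<Rightarrow>\<^sub>0 complex"
  assumes "\<And>m. m \<in> keys f \<Longrightarrow> X m \<in> carrier A"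
  shows "lin X (single 0 z * f) = z \<odot> lin X f"
proof -
  have "lin X (single 0 z * f) = (\<Oplus>m\<in>keys f. lookup (single 0 z * f) m \<odot> X m)"
    by (rule lin_superset) (use assms keys_scale[of z f] in auto)
  also have "\<dots> = (\<Oplus>m\<in>keys f. z \<odot> (lookup f m \<odot> X m))"
    by (rule add.finprod_cong') (use assms in \<open>auto simp: lookup_scale smult_smult\<close>)
  also have "\<dots> = z \<odot> lin X f"
    unfolding lin_def using scalars.finsum_smult_ldistr[of "keys f" z "\<lambda>m. lookup f m \<odot> X m"] assms by auto
  finally show ?thesis .
qed

lemma lin_zero_fun: "(\<And>m. m \<in> keys f \<Longrightarrow> X m = \<zero>) \<Longrightarrow> lin X f = \<zero>"
  unfolding lin_def using add.finprod_one_eqI[of "keys f" "\<lambda>m. lookup f m \<odot> X m"] by simp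

lemma lin_mult_single:
  fixes g :: "'v::ab_group_add \<Rightarrow>\<^sub>0 complex"
  assumes "X a \<in> carrier A" "\<And>n. n \<in> keys g \<Longrightarrow> Y n \<in> carrier A"
    and "\<And>n. n \<in> keys g \<Longrightarrow> Z (a + n) = X a \<otimes> Y n"
  shows "lin Z (single a b * g) = (b \<odot> X a) \<otimes> lin Y g"
  using assms(2,3)
proof (induction g rule: poly_mapping_add_induct)
  case zero then show ?case using assms(1) by simp
next
  case (add p n z)
  note k = keys_add_single[OF add(1,2)]
  have Yp: "\<And>m. m \<in> keys p \<Longrightarrow> Y m \<in> carrier A" "Y n \<in> carrier A" using add(4) k by auto
  have Zp: "Z (a + m) \<in> carrier A" if "m \<in> insert n (keys p)" for m
    using add(4,5)[of m] that k assms(1) by auto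
  have "keys (single a b * p) \<subseteq> (+) a ` keys p"
    using keys_mult[of "single a b" p] by (auto split: if_splits)
  then have "\<And>m. m \<in> keys (single a b * p) \<union> keys (single (a + n) (b * z)) \<Longrightarrow> Z m \<in> carrier A"
    using Zp by (auto split: if_splits)
  then have "lin Z (single a b * (p + single n z)) = lin Z (single a b * p) \<oplus> lin Z (single (a + n) (b * z))"
    unfolding distrib_left mult_single by (rule lin_add)
  also have "lin Z (single (a + n) (b * z)) = (b \<odot> X a) \<otimes> (z \<odot> Y n)"
    using lin_single[of Z "a + n" "b * z"] Zp[of n] add(5)[of n] k assms(1) Yp
    by (simp add: smult_mult mult_smult smult_smult mult.commute)
  also have "lin Z (single a b * p) = (b \<odot> X a) \<otimes> lin Y p"
    using add(3,4,5) k by auto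
  finally show ?case
    using Yp assms(1) lin_closed[of p Y] by (simp add: lin_add_single r_distr)
qed

text \<open>Three separate functions are allowed so that one lemma serves even times even, even
  times odd, and the vanishing odd times odd products.\<close>

lemma lin_mult:
  fixes f g :: "'v::ab_group_add \<Rightarrow>\<^sub>0 complex"
  assumes "\<And>m. m \<in> keys f \<Longrightarrow> X m \<in> carrier A" "\<And>n. n \<in> keys g \<Longrightarrow> Y n \<in> carrier A"
    and "\<And>m n. m \<in> keys f \<Longrightarrow> n \<in> keys g \<Longrightarrow> Z (m + n) = X m \<otimes> Y n"
  shows "lin Z (f * g) = lin X f \<otimes> lin Y g"
  using assms(1,3)
proof (induction f rule: poly_mapping_add_induct)
  case zero then show ?case using lin_closed[of g Y] assms(2) by simp
next
  case (add p a b)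
  note k = keys_add_single[OF add(1,2)]
  have Xp: "\<And>m. m \<in> keys p \<Longrightarrow> X m \<in> carrier A" "X a \<in> carrier A" using add(4) k by auto
  have Zp: "Z (m + n) \<in> carrier A" if "m \<in> insert a (keys p)" "n \<in> keys g" for m n
    using add(4,5)[of m] that k assms(2) by auto
  have "\<And>m. m \<in> keys (p * g) \<union> keys (single a b * g) \<Longrightarrow> Z m \<in> carrier A"
    using keys_mult[of p g] keys_mult[of "single a b" g] Zp by (force split: if_splits)
  then have "lin Z ((p + single a b) * g) = lin Z (p * g) \<oplus> lin Z (single a b * g)"
    unfolding distrib_right by (rule lin_add)
  also have "lin Z (single a b * g) = (b \<odot> X a) \<otimes> lin Y g"
    by (rule lin_mult_single) (use Xp assms(2) add(5) k in auto)
  also have "lin Z (p * g) = lin X p \<otimes> lin Y g"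
    using add(3,4,5) k by auto
  finally show ?case
    using Xp assms(2) lin_closed[of p X] lin_closed[of g Y] by (simp add: lin_add_single l_distr)
qed

lemma lin_even: "(\<And>m. m \<in> keys f \<Longrightarrow> X m \<in> even_part A) \<Longrightarrow> lin X f \<in> even_part A"
proof (induction f rule: poly_mapping_add_induct)
  case (add p a b)
  note k = keys_add_single[OF add(1,2)]
  then show ?case using add(3,4) by (subst lin_add_single) (auto intro: even_carrier)
qed simp

lemma lin_odd: "(\<And>m. m \<in> keys f \<Longrightarrow> X m \<in> odd_part A) \<Longrightarrow> lin X f \<in> odd_part A"
proof (induction f rule: poly_mapping_add_induct)
  case (add p a b)
  note k = keys_add_single[OF add(1,2)]
  then show ?case using add(3,4) by (subst lin_add_single) (auto intro: odd_carrier)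
qed simp

end

definition toric_lift ::
  "'v::euclidean_space set \<Rightarrow> 'v set \<Rightarrow> 'v coord superalg \<Rightarrow> ('v \<Rightarrow> 'v coord) \<Rightarrow> ('v \<Rightarrow> 'v coord) \<Rightarrow> 'v coord \<Rightarrow> 'v coord" where
  "toric_lift S J A X Y = (\<lambda>q\<in>carrier (toric_alg S J). salg.lin A X (fst q) \<oplus>\<^bsub>A\<^esub> salg.lin A Y (snd q))"

text \<open>A presentation of the toric superalgebra: multiplicativity on monomials, compatibility
  with the module structure of \<open>J\<close>, and vanishing odd products are all the relations
  there are.\<close>

lemma toric_lift_shom:
  fixes A (structure)
  assumes A: "superalgebra A" and SJ: "monoid_ideal S J"
    and X: "\<And>m. m \<in> S \<Longrightarrow> X m \<in> even_part A" "X 0 = \<one>"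
      "\<And>m n. m \<in> S \<Longrightarrow> n \<in> S \<Longrightarrow> X (m + n) = X m \<otimes> X n"
    and Y: "\<And>m. m \<in> J \<Longrightarrow> Y m \<in> odd_part A"
      "\<And>m n. m \<in> S \<Longrightarrow> n \<in> J \<Longrightarrow> Y (m + n) = X m \<otimes> Y n"
      "\<And>m n. m \<in> J \<Longrightarrow> n \<in> J \<Longrightarrow> Y m \<otimes> Y n = \<zero>"
  shows "toric_lift S J A X Y \<in> shom (toric_alg S J) A"
proof -
  interpret A: salg A using A by (rule salgI)
  have Xc: "X m \<in> carrier A" if "m \<in> S" for m using X(1) A.even_carrier that by blast
  have Yc: "Y m \<in> carrier A" if "m \<in> J" for m using Y(1) A.odd_carrier that by blast
  note R = superalgebra_toric_alg[OF SJ]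
  interpret R: salg "toric_alg S J" using R by (rule salgI)
  have ev: "toric_lift S J A X Y (f, g) = A.lin X f \<oplus> A.lin Y g" if "keys f \<subseteq> S" "keys g \<subseteq> J" for f g
    using that by (simp add: toric_lift_def toric_alg_simps)
  have cX: "A.lin X f \<in> carrier A" if "keys f \<subseteq> S" for f using that Xc by (intro A.lin_closed) auto
  have cY: "A.lin Y f \<in> carrier A" if "keys f \<subseteq> J" for f using that Yc by (intro A.lin_closed) auto
  show ?thesis
  proof (rule shomI; (simp only: split_paired_all)?)
    show "toric_lift S J A X Y \<in> extensional (carrier (toric_alg S J))" by (simp add: toric_lift_def)
    have "0 \<in> S" using SJ by (simp add: monoid_ideal_def)
    then have "A.lin X 1 = \<one>" using A.lin_single[of X 0 1] X(2) by simp
    then show "toric_lift S J A X Y \<one>\<^bsub>toric_alg S J\<^esub> = \<one>"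
      using \<open>0 \<in> S\<close> by (simp add: toric_alg_simps ev)
  next
    fix f g assume "(f, g) \<in> carrier (toric_alg S J)"
    then have fg: "keys f \<subseteq> S" "keys g \<subseteq> J" by (simp_all add: toric_alg_simps)
    then show "toric_lift S J A X Y (f, g) \<in> carrier A" using ev cX cY by simp
    fix z
    show "toric_lift S J A X Y (z \<odot>\<^bsub>toric_alg S J\<^esub> (f, g)) = z \<odot> toric_lift S J A X Y (f, g)"
      using fg Xc Yc cX[OF fg(1)] cY[OF fg(2)] keys_scale[of z f] keys_scale[of z g]
      by (simp add: toric_alg_simps ev A.lin_scale A.smult_add_right subset_iff)
  next
    fix f g f' g' assume "(f, g) \<in> carrier (toric_alg S J)" "(f', g') \<in> carrier (toric_alg S J)"
    then have fg: "keys f \<subseteq> S" "keys g \<subseteq> J" "keys f' \<subseteq> S" "keys g' \<subseteq> J" by (simp_all add: toric_alg_simps)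
    note c = cX[OF fg(1)] cY[OF fg(2)] cX[OF fg(3)] cY[OF fg(4)]
    have "A.lin X (f + f') = A.lin X f \<oplus> A.lin X f'" "A.lin Y (g + g') = A.lin Y g \<oplus> A.lin Y g'"
      using fg Xc Yc by (auto intro!: A.lin_add)
    then show "toric_lift S J A X Y ((f, g) \<oplus>\<^bsub>toric_alg S J\<^esub> (f', g')) =
        toric_lift S J A X Y (f, g) \<oplus> toric_lift S J A X Y (f', g')"
      using fg c by (simp add: toric_alg_simps ev keys_plus_subset A.a_ac)
    have k: "keys (f * f') \<subseteq> S" "keys (f * g') \<subseteq> J" "keys (f' * g) \<subseteq> J"
      using keys_times[OF fg(1,3), of S] keys_times[OF fg(1,4), of J] keys_times[OF fg(3,2), of J] SJ
      by (auto simp: monoid_ideal_def)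
    have m1: "A.lin X (f * f') = A.lin X f \<otimes> A.lin X f'"
      by (rule A.lin_mult) (simp_all add: fg[THEN subsetD] Xc X(3))
    have m2: "A.lin Y (f * g') = A.lin X f \<otimes> A.lin Y g'"
      by (rule A.lin_mult) (simp_all add: fg[THEN subsetD] Xc Yc Y(2))
    have m3: "A.lin Y (f' * g) = A.lin X f' \<otimes> A.lin Y g"
      by (rule A.lin_mult) (simp_all add: fg[THEN subsetD] Xc Yc Y(2))
    have m4: "A.lin Y g \<otimes> A.lin Y g' = \<zero>"
    proof -
      have "A.lin Y g \<otimes> A.lin Y g' = A.lin (\<lambda>_. \<zero>) (g * g')"
        by (rule A.lin_mult[symmetric]) (simp_all add: fg[THEN subsetD] Yc Y(3))
      then show ?thesis using A.lin_zero_fun[of "g * g'" "\<lambda>_. \<zero>"] by simp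
    qed
    have "A.lin X f' \<in> even_part A" using fg X(1) by (intro A.lin_even) auto
    then have m5: "A.lin X f' \<otimes> A.lin Y g = A.lin Y g \<otimes> A.lin X f'"
      using A.even_comm c(2) by blast
    have m6: "A.lin Y (g * f') = A.lin Y g \<otimes> A.lin X f'"
      using m3 m5 by (simp add: mult.commute)
    have "A.lin Y (f * g' + g * f') = A.lin Y (f * g') \<oplus> A.lin Y (f' * g)"
      using A.lin_add[of "f * g'" "f' * g" Y] k Yc by (auto simp: mult.commute)
    then show "toric_lift S J A X Y ((f, g) \<otimes>\<^bsub>toric_alg S J\<^esub> (f', g')) =
        toric_lift S J A X Y (f, g) \<otimes> toric_lift S J A X Y (f', g')"
      using fg c k ev[of "f * f'" "f * g' + g * f'"] keys_plus_subset[OF k(2,3)]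
      by (simp add: toric_alg_simps ev m1 m2 m4 m6 A.l_distr A.r_distr A.a_ac mult.commute[of f' g])
  next
    fix f g assume "(f, g) \<in> even_part (toric_alg S J)"
    then show "toric_lift S J A X Y (f, g) \<in> even_part A"
      using X(1) cX by (auto simp: toric_alg_simps ev intro!: A.lin_even)
  next
    fix f g assume "(f, g) \<in> odd_part (toric_alg S J)"
    then show "toric_lift S J A X Y (f, g) \<in> odd_part A"
      using Y(1) cY by (auto simp: toric_alg_simps ev intro!: A.lin_odd)
  qed
qed

lemma toric_lift_monom:
  assumes A: "superalgebra A"
  shows "m \<in> S \<Longrightarrow> X m \<in> carrier A \<Longrightarrow> toric_lift S J A X Y (x_monom m) = X m"
    and "m \<in> J \<Longrightarrow> Y m \<in> carrier A \<Longrightarrow> toric_lift S J A X Y (xi_monom m) = Y m"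
proof -
  interpret A: salg A using A by (rule salgI)
  show "m \<in> S \<Longrightarrow> X m \<in> carrier A \<Longrightarrow> toric_lift S J A X Y (x_monom m) = X m"
    by (simp add: toric_lift_def x_monom_def toric_alg_simps A.lin_single)
  show "m \<in> J \<Longrightarrow> Y m \<in> carrier A \<Longrightarrow> toric_lift S J A X Y (xi_monom m) = Y m"
    by (simp add: toric_lift_def xi_monom_def toric_alg_simps A.lin_single)
qed

lemma shom_toric_expand:
  fixes A (structure)
  assumes A: "superalgebra A" and SJ: "monoid_ideal S J" and h: "h \<in> shom (toric_alg S J) A"
    and q: "q \<in> carrier (toric_alg S J)"
  shows "h q = salg.lin A (\<lambda>m. h (x_monom m)) (fst q) \<oplus> salg.lin A (\<lambda>m. h (xi_monom m)) (snd q)"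
proof -
  interpret A: salg A using A by (rule salgI)
  note R = superalgebra_toric_alg[OF SJ]
  have 0: "h (0, 0) = \<zero>" using shom_zero[OF R A h] by (simp add: toric_alg_simps)
  have hx: "h (x_monom m) \<in> carrier A" if "m \<in> S" for m using shom_closed[OF h x_monom_carrier[OF that]] .
  have hxi: "h (xi_monom m) \<in> carrier A" if "m \<in> J" for m using shom_closed[OF h xi_monom_carrier[OF that]] .
  have 1: "h (f, 0) = A.lin (\<lambda>m. h (x_monom m)) f" if "keys f \<subseteq> S" for f
    using that
  proof (induction f rule: poly_mapping_add_induct)
    case zero then show ?case using 0 by simp
  next
    case (add p a b)
    note k = keys_add_single[OF add(1,2)]
    have a: "a \<in> S" "keys p \<subseteq> S" using add(4) k by auto
    have "(p + single a b, 0) = (p, 0) \<oplus>\<^bsub>toric_alg S J\<^esub> (b \<odot>\<^bsub>toric_alg S J\<^esub> x_monom a)"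
      by (simp add: toric_alg_simps x_monom_def mult_single)
    then have "h (p + single a b, 0) = h (p, 0) \<oplus> (b \<odot> h (x_monom a))"
      using shom_add[OF h, of "(p, 0)" "b \<odot>\<^bsub>toric_alg S J\<^esub> x_monom a"] shom_smult[OF h x_monom_carrier[OF a(1)], of b]
        salg.smult_closed[OF salgI[OF R] x_monom_carrier[OF a(1)], of b] a(2) by (simp add: toric_alg_simps)
    also have "\<dots> = A.lin (\<lambda>m. h (x_monom m)) (p + single a b)"
      using add(3) a hx by (subst A.lin_add_single) auto
    finally show ?case .
  qed
  have 2: "h (0, f) = A.lin (\<lambda>m. h (xi_monom m)) f" if "keys f \<subseteq> J" for f
    using that
  proof (induction f rule: poly_mapping_add_induct)
    case zero then show ?case using 0 by simp
  next
    case (add p a b)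
    note k = keys_add_single[OF add(1,2)]
    have a: "a \<in> J" "keys p \<subseteq> J" using add(4) k by auto
    have "(0, p + single a b) = (0, p) \<oplus>\<^bsub>toric_alg S J\<^esub> (b \<odot>\<^bsub>toric_alg S J\<^esub> xi_monom a)"
      by (simp add: toric_alg_simps xi_monom_def mult_single)
    then have "h (0, p + single a b) = h (0, p) \<oplus> (b \<odot> h (xi_monom a))"
      using shom_add[OF h, of "(0, p)" "b \<odot>\<^bsub>toric_alg S J\<^esub> xi_monom a"] shom_smult[OF h xi_monom_carrier[OF a(1)], of b]
        salg.smult_closed[OF salgI[OF R] xi_monom_carrier[OF a(1)], of b] a(2) by (simp add: toric_alg_simps)
    also have "\<dots> = A.lin (\<lambda>m. h (xi_monom m)) (p + single a b)"
      using add(3) a hxi by (subst A.lin_add_single) auto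
    finally show ?case .
  qed
  obtain f g where q': "q = (f, g)" by (cases q)
  have k: "keys f \<subseteq> S" "keys g \<subseteq> J" using q by (simp_all add: q' toric_alg_simps)
  have "h q = h (f, 0) \<oplus> h (0, g)"
    using shom_add[OF h, of "(f, 0)" "(0, g)"] k by (simp add: toric_alg_simps q')
  then show ?thesis using 1[OF k(1)] 2[OF k(2)] q' by simp
qed

text \<open>Immediate from the expansion in monomials. Most identities between points of charts
  below are verified through this lemma.\<close>

lemma shom_toric_eqI:
  assumes A: "superalgebra A" and SJ: "monoid_ideal S J"
    and h: "h \<in> shom (toric_alg S J) A" "h' \<in> shom (toric_alg S J) A"
    and eq: "\<And>m. m \<in> S \<Longrightarrow> h (x_monom m) = h' (x_monom m)" "\<And>m. m \<in> J \<Longrightarrow> h (xi_monom m) = h' (xi_monom m)"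
  shows "h = h'"
proof (rule shom_eqI[OF h])
  interpret A: salg A using A by (rule salgI)
  fix q assume q: "q \<in> carrier (toric_alg S J)"
  then have k: "keys (fst q) \<subseteq> S" "keys (snd q) \<subseteq> J" by (simp_all add: toric_alg_carrier)
  have "A.lin (\<lambda>m. h (x_monom m)) (fst q) = A.lin (\<lambda>m. h' (x_monom m)) (fst q)"
    by (rule A.lin_cong) (use k eq(1) shom_closed[OF h(2) x_monom_carrier] in auto)
  moreover have "A.lin (\<lambda>m. h (xi_monom m)) (snd q) = A.lin (\<lambda>m. h' (xi_monom m)) (snd q)"
    by (rule A.lin_cong) (use k eq(2) shom_closed[OF h(2) xi_monom_carrier] in auto)
  ultimately show "h q = h' q"
    using shom_toric_expand[OF A SJ h(1) q] shom_toric_expand[OF A SJ h(2) q] by simp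
qed

section \<open>Convolution of points: the group law of the torus and the coaction on charts\<close>

context salg
begin

lemma mult_swap:
  assumes "a \<in> carrier A" "b \<in> carrier A" "a' \<in> carrier A" "b' \<in> carrier A" "b \<otimes> a' = a' \<otimes> b"
  shows "(a \<otimes> b) \<otimes> (a' \<otimes> b') = (a \<otimes> a') \<otimes> (b \<otimes> b')"
proof -
  have "(a \<otimes> b) \<otimes> (a' \<otimes> b') = a \<otimes> ((b \<otimes> a') \<otimes> b')" using assms(1-4) by (simp add: m_assoc)
  also have "\<dots> = (a \<otimes> a') \<otimes> (b \<otimes> b')" unfolding assms(5) using assms(1-4) by (simp add: m_assoc)
  finally show ?thesis .
qed

text \<open>The source of the sign that makes the mixed terms in the comultiplication
  cancel.\<close>

lemma mult_swap_odd:
  assumes "a \<in> carrier A" "b \<in> odd_part A" "a' \<in> odd_part A" "b' \<in> carrier A"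
  shows "(a \<otimes> b) \<otimes> (a' \<otimes> b') = \<ominus> ((a \<otimes> a') \<otimes> (b \<otimes> b'))"
proof -
  note c = assms(1,4) odd_carrier[OF assms(2)] odd_carrier[OF assms(3)]
  have "(a \<otimes> b) \<otimes> (a' \<otimes> b') = a \<otimes> ((b \<otimes> a') \<otimes> b')" using c by (simp add: m_assoc)
  also have "\<dots> = \<ominus> ((a \<otimes> a') \<otimes> (b \<otimes> b'))"
    unfolding odd_anticomm[OF assms(2,3)] using c by (simp add: m_assoc l_minus r_minus)
  finally show ?thesis .
qed

lemma finsum_smult_one: "finite K \<Longrightarrow> (\<Oplus>m\<in>K. w m \<odot> \<one>) = (\<Sum>m\<in>K. w m) \<odot> \<one>"
  by (induction K rule: finite_induct) (simp_all add: smult_add_left)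

lemma lin_scalar: "lin (\<lambda>m. x m \<odot> \<one>) f = (\<Sum>m\<in>keys f. lookup f m * x m) \<odot> \<one>"
proof -
  have "lin (\<lambda>m. x m \<odot> \<one>) f = (\<Oplus>m\<in>keys f. (lookup f m * x m) \<odot> \<one>)"
    unfolding lin_def by (rule add.finprod_cong') (auto simp: smult_smult)
  then show ?thesis by (simp add: finsum_smult_one)
qed

end

text \<open>Puts convolution into the form of a lift, so that it is a homomorphism as soon as the
  relations hold on monomials.\<close>

lemma conv_eq_toric_lift:
  fixes A (structure)
  assumes "superalgebra A"
  shows "conv c (toric_alg S J) A g h = toric_lift S J A
    (\<lambda>m. (g (x_monom m) \<otimes> h (x_monom m)) \<oplus>
         (if pairing m c = 0 then \<zero> else pairing m c \<odot> (g (xi_monom m) \<otimes> h (xi_monom m))))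
    (\<lambda>m. (g (xi_monom m) \<otimes> h (x_monom m)) \<oplus> (g (x_monom m) \<otimes> h (xi_monom m)))"
  unfolding conv_def toric_lift_def salg.lin_def[OF salgI[OF assms]] ..

lemma pairing_add: "pairing (m + n) c = pairing m c + pairing n c"
  by (simp add: pairing_def inner_add_left complex_eq_iff)

lemma pairing_zero [simp]: "pairing 0 c = 0"
  by (simp add: pairing_def complex_eq_iff)

lemma toric_shom_relations:
  fixes A (structure)
  assumes A: "superalgebra A" and SJ: "monoid_ideal S J" and h: "h \<in> shom (toric_alg S J) A"
  shows "m \<in> S \<Longrightarrow> h (x_monom m) \<in> even_part A" "m \<in> J \<Longrightarrow> h (xi_monom m) \<in> odd_part A"
    "m \<in> S \<Longrightarrow> n \<in> S \<Longrightarrow> h (x_monom (m + n)) = h (x_monom m) \<otimes> h (x_monom n)"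
    "m \<in> S \<Longrightarrow> n \<in> J \<Longrightarrow> h (xi_monom (m + n)) = h (x_monom m) \<otimes> h (xi_monom n)"
    "m \<in> J \<Longrightarrow> n \<in> S \<Longrightarrow> h (xi_monom (m + n)) = h (xi_monom m) \<otimes> h (x_monom n)"
    "m \<in> J \<Longrightarrow> n \<in> J \<Longrightarrow> h (xi_monom m) \<otimes> h (xi_monom n) = \<zero>"
    "h (x_monom 0) = \<one>"
proof -
  note mult = shom_mult[OF h, symmetric]
  show "m \<in> S \<Longrightarrow> h (x_monom m) \<in> even_part A" "m \<in> J \<Longrightarrow> h (xi_monom m) \<in> odd_part A"
    using shom_even[OF h x_monom_even] shom_odd[OF h xi_monom_odd] by auto
  show "m \<in> S \<Longrightarrow> n \<in> S \<Longrightarrow> h (x_monom (m + n)) = h (x_monom m) \<otimes> h (x_monom n)"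
    "m \<in> S \<Longrightarrow> n \<in> J \<Longrightarrow> h (xi_monom (m + n)) = h (x_monom m) \<otimes> h (xi_monom n)"
    "m \<in> J \<Longrightarrow> n \<in> S \<Longrightarrow> h (xi_monom (m + n)) = h (xi_monom m) \<otimes> h (x_monom n)"
    "m \<in> J \<Longrightarrow> n \<in> J \<Longrightarrow> h (xi_monom m) \<otimes> h (xi_monom n) = \<zero>"
    by (simp_all add: mult x_monom_carrier xi_monom_carrier monom_mult
        shom_zero[OF superalgebra_toric_alg[OF SJ] A h])
  show "h (x_monom 0) = \<one>" using shom_one[OF h] by (simp add: monom_mult(5)[symmetric])
qed

text \<open>The group-like part is multiplicative, the correction term obeys a Leibniz rule because
  the pairing with \<open>c\<close> is additive, and products of two corrections vanish. The larger
  pair \<open>S1\<close>, \<open>J1\<close> belongs to the torus, whose points act on charts with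
  fewer monomials.\<close>

lemma conv_shom:
  fixes A (structure)
  assumes A: "superalgebra A" and SJ: "monoid_ideal S J" and SJ1: "monoid_ideal S1 J1" and sub: "S \<subseteq> S1" "J \<subseteq> J1"
    and JS: "J \<subseteq> S" and c: "\<And>m. m \<in> S \<Longrightarrow> pairing m c \<noteq> 0 \<Longrightarrow> m \<in> J"
    and g: "g \<in> shom (toric_alg S1 J1) A" and h: "h \<in> shom (toric_alg S J) A"
  shows "conv c (toric_alg S J) A g h \<in> shom (toric_alg S J) A"
    and "\<And>m. m \<in> S \<Longrightarrow> conv c (toric_alg S J) A g h (x_monom m) = (g (x_monom m) \<otimes> h (x_monom m)) \<oplus>
         (if pairing m c = 0 then \<zero> else pairing m c \<odot> (g (xi_monom m) \<otimes> h (xi_monom m)))"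
    and "\<And>m. m \<in> J \<Longrightarrow> conv c (toric_alg S J) A g h (xi_monom m) =
        (g (xi_monom m) \<otimes> h (x_monom m)) \<oplus> (g (x_monom m) \<otimes> h (xi_monom m))"
proof -
  interpret A: salg A using A by (rule salgI)
  note gr = toric_shom_relations[OF A SJ1 g] and hr = toric_shom_relations[OF A SJ h]
  define a b \<alpha> \<beta> where ab: "a m = g (x_monom m)" "b m = h (x_monom m)" "\<alpha> m = g (xi_monom m)" "\<beta> m = h (xi_monom m)" for m
  have ev: "a m \<in> even_part A" "b m \<in> even_part A" if "m \<in> S" for m
    by (simp_all add: ab gr(1) hr(1) sub[THEN subsetD] that)
  have od: "\<alpha> m \<in> odd_part A" "\<beta> m \<in> odd_part A" if "m \<in> J" for m
    by (simp_all add: ab gr(2) hr(2) sub[THEN subsetD] that)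
  have ec: "a m \<in> carrier A" "b m \<in> carrier A" if "m \<in> S" for m
    using ev[OF that] A.even_carrier by auto
  have oc: "\<alpha> m \<in> carrier A" "\<beta> m \<in> carrier A" if "m \<in> J" for m
    using od[OF that] A.odd_carrier by auto
  have add: "a (m + n) = a m \<otimes> a n" "b (m + n) = b m \<otimes> b n" if "m \<in> S" "n \<in> S" for m n
    by (simp_all add: ab gr(3) hr(3) sub[THEN subsetD] that)
  have addr: "\<alpha> (m + n) = a m \<otimes> \<alpha> n" "\<beta> (m + n) = b m \<otimes> \<beta> n" if "m \<in> S" "n \<in> J" for m n
    by (simp_all add: ab gr(4) hr(4) sub[THEN subsetD] that)
  have addl: "\<alpha> (m + n) = \<alpha> m \<otimes> a n" "\<beta> (m + n) = \<beta> m \<otimes> b n" if "m \<in> J" "n \<in> S" for m n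
    by (simp_all add: ab gr(5) hr(5) sub[THEN subsetD] that)
  have nil: "\<alpha> m \<otimes> \<alpha> n = \<zero>" "\<beta> m \<otimes> \<beta> n = \<zero>" if "m \<in> J" "n \<in> J" for m n
    by (simp_all add: ab gr(6) hr(6) sub[THEN subsetD] that)
  have J_add: "m + n \<in> J" if "m \<in> S" "n \<in> J" for m n using SJ that by (auto simp: monoid_ideal_def)
  have J_add': "m + n \<in> J" if "m \<in> J" "n \<in> S" for m n using J_add[OF that(2,1)] by (simp add: add.commute)
  \<comment> \<open>\<open>E\<close> is the correction term. Where its coefficient is nonzero,
    hypothesis \<open>c\<close> puts \<open>m\<close> into \<open>J\<close>, so that the odd
    monomials occurring in it exist.\<close>
  define E where "E m = (if pairing m c = 0 then \<zero> else pairing m c \<odot> (\<alpha> m \<otimes> \<beta> m))" for m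
  define W where "W m = \<alpha> m \<otimes> \<beta> m" for m
  define X where "X m = (a m \<otimes> b m) \<oplus> E m" for m
  define Y where "Y m = (\<alpha> m \<otimes> b m) \<oplus> (a m \<otimes> \<beta> m)" for m
  have Wc: "W m \<in> carrier A" if "m \<in> J" for m using oc[OF that] by (simp add: W_def)
  have We: "W m \<in> even_part A" if "m \<in> J" for m using od[OF that] by (auto simp: W_def)
  have Ee: "E m \<in> even_part A" if "m \<in> S" for m
    using c[OF that] We[of m] by (auto simp: E_def W_def)
  have Ec: "E m \<in> carrier A" if "m \<in> S" for m using Ee[OF that] A.even_carrier by blast
  have abc: "a m \<otimes> b m \<in> carrier A" if "m \<in> S" for m using ec[OF that] by simp
  have lift: "conv c (toric_alg S J) A g h = toric_lift S J A X Y"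
    unfolding conv_eq_toric_lift[OF A] X_def Y_def E_def ab ..
  have comm: "x \<otimes> y = y \<otimes> x" if "y \<in> even_part A" "x \<in> carrier A" for x y
    using A.even_comm[OF that] by simp
  have WS: "W m \<otimes> (a n \<otimes> b n) = W (m + n)" if mn: "m \<in> J" "n \<in> S" for m n
  proof -
    have "(\<alpha> m \<otimes> \<beta> m) \<otimes> (a n \<otimes> b n) = (\<alpha> m \<otimes> a n) \<otimes> (\<beta> m \<otimes> b n)"
      by (rule A.mult_swap) (use ec[OF mn(2)] oc[OF mn(1)] comm[OF ev(1)[OF mn(2)]] in auto)
    then show ?thesis using addl[OF mn] by (simp add: W_def)
  qed
  have SW: "(a m \<otimes> b m) \<otimes> W n = W (m + n)" if mn: "m \<in> S" "n \<in> J" for m n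
  proof -
    have "(a m \<otimes> b m) \<otimes> (\<alpha> n \<otimes> \<beta> n) = (a m \<otimes> \<alpha> n) \<otimes> (b m \<otimes> \<beta> n)"
      by (rule A.mult_swap) (use ec[OF mn(1)] oc[OF mn(2)] A.even_comm[OF ev(2)[OF mn(1)]] in auto)
    then show ?thesis using addr[OF mn] by (simp add: W_def)
  qed
  have WW: "W m \<otimes> W n = \<zero>" if mn: "m \<in> J" "n \<in> J" for m n
    using A.mult_swap_odd[OF oc(1)[OF mn(1)] od(2)[OF mn(1)] od(1)[OF mn(2)] oc(2)[OF mn(2)]] nil[OF mn]
    by (simp add: W_def)
  have S_add: "m + n \<in> S" if "m \<in> S" "n \<in> S" for m n using SJ that by (auto simp: monoid_ideal_def)
  have S0: "0 \<in> S" using SJ by (simp add: monoid_ideal_def)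
  have EE: "E m \<otimes> E n = \<zero>" if "m \<in> S" "n \<in> S" for m n
    using c[OF that(1)] c[OF that(2)] WW[of m n] Wc[of m] Wc[of n] Ec[OF that(1)] Ec[OF that(2)]
    by (auto simp: E_def W_def[symmetric] A.smult_mult A.mult_smult)
  have ES: "E m \<otimes> (a n \<otimes> b n) = pairing m c \<odot> W (m + n)" if "m \<in> S" "n \<in> S" "m + n \<in> J" for m n
    using c[OF that(1)] WS[of m n] Wc[of m] Wc[OF that(3)] abc[OF that(2)] that(2)
    by (auto simp: E_def W_def[symmetric] A.smult_mult)
  have SE: "(a m \<otimes> b m) \<otimes> E n = pairing n c \<odot> W (m + n)" if "m \<in> S" "n \<in> S" "m + n \<in> J" for m n
    using c[OF that(2)] SW[of m n] Wc[of n] Wc[OF that(3)] abc[OF that(1)] that(1)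
    by (auto simp: E_def W_def[symmetric] A.mult_smult)
  \<comment> \<open>The Leibniz rule. Outside \<open>J\<close> both pairings have to vanish, since a
    nonzero one would put \<open>m\<close> or \<open>n\<close>, and with it \<open>m + n\<close>,
    into \<open>J\<close>.\<close>
  have E_add: "E (m + n) = (a m \<otimes> b m) \<otimes> E n \<oplus> E m \<otimes> (a n \<otimes> b n)"
    if mn: "m \<in> S" "n \<in> S" for m n
  proof (cases "m + n \<in> J")
    case True
    have "E (m + n) = pairing (m + n) c \<odot> W (m + n)" using Wc[OF True] by (simp add: E_def W_def)
    then show ?thesis using SE[OF mn True] ES[OF mn True] Wc[OF True]
      by (simp add: pairing_add A.smult_add_left A.a_comm)
  next
    case False
    then have "pairing m c = 0" "pairing n c = 0" using c J_add J_add' mn by blast+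
    then show ?thesis using abc mn by (simp add: E_def pairing_add)
  qed
  have abab: "(a m \<otimes> b m) \<otimes> (a n \<otimes> b n) = a (m + n) \<otimes> b (m + n)" if mn: "m \<in> S" "n \<in> S" for m n
    unfolding add[OF mn] by (rule A.mult_swap) (use ec mn comm[OF ev(1)[OF mn(2)]] in auto)
  have X_add: "X (m + n) = X m \<otimes> X n" if mn: "m \<in> S" "n \<in> S" for m n
    using abab[OF mn] E_add[OF mn] EE[OF mn] abc Ec mn S_add[OF mn]
    by (simp add: X_def A.l_distr A.r_distr A.a_ac)
  have X0: "X 0 = \<one>" using gr(7) hr(7) by (simp add: X_def ab E_def)
  have Xe: "X m \<in> even_part A" if "m \<in> S" for m
    unfolding X_def using ev[OF that] Ee[OF that] by (intro A.even_add A.even_mult_even)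
  have Ye: "Y m \<in> odd_part A" if m: "m \<in> J" for m
    using ev[OF subsetD[OF JS m]] od[OF m] by (auto simp: Y_def)
  have terms: "\<alpha> m \<otimes> b m \<in> carrier A" "a m \<otimes> \<beta> m \<in> carrier A" if "m \<in> J" for m
    using oc[OF that] ec[OF subsetD[OF JS that]] by simp_all
  have Y_add: "Y (m + n) = X m \<otimes> Y n" if mn: "m \<in> S" "n \<in> J" for m n
  proof -
    have nS: "n \<in> S" using JS mn by blast
    have 1: "(a m \<otimes> b m) \<otimes> (\<alpha> n \<otimes> b n) = \<alpha> (m + n) \<otimes> b (m + n)"
      unfolding addr(1)[OF mn] add(2)[OF mn(1) nS]
      by (rule A.mult_swap) (use ec[OF mn(1)] ec[OF nS] oc[OF mn(2)] A.even_comm[OF ev(2)[OF mn(1)]] in auto)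
    have 2: "(a m \<otimes> b m) \<otimes> (a n \<otimes> \<beta> n) = a (m + n) \<otimes> \<beta> (m + n)"
      unfolding addr(2)[OF mn] add(1)[OF mn(1) nS]
      by (rule A.mult_swap) (use ec[OF mn(1)] ec[OF nS] oc[OF mn(2)] A.even_comm[OF ev(2)[OF mn(1)]] in auto)
    have 3: "W m \<otimes> Y n = \<zero>" if m: "m \<in> J"
    proof -
      have "(\<alpha> m \<otimes> \<beta> m) \<otimes> (\<alpha> n \<otimes> b n) = \<zero>"
        using A.mult_swap_odd[OF oc(1)[OF m] od(2)[OF m] od(1)[OF mn(2)] ec(2)[OF nS]] nil(1)[OF m mn(2)]
          oc[OF m] ec[OF nS] by simp
      moreover have "(\<alpha> m \<otimes> \<beta> m) \<otimes> (a n \<otimes> \<beta> n) = \<zero>"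
        using A.mult_swap[OF oc[OF m] ec(1)[OF nS] oc(2)[OF mn(2)] comm[OF ev(1)[OF nS] oc(2)[OF m]]]
          nil(2)[OF m mn(2)] oc[OF m] ec[OF nS] by simp
      ultimately show ?thesis
        using terms[OF mn(2)] oc[OF m] by (simp add: W_def Y_def A.r_distr)
    qed
    have Yc: "Y n \<in> carrier A" using Ye[OF mn(2)] A.odd_carrier by blast
    have "E m \<otimes> Y n = \<zero>"
      using c[OF mn(1)] 3 Wc[of m] Yc by (auto simp: E_def W_def[symmetric] A.smult_mult)
    then have "X m \<otimes> Y n = (a m \<otimes> b m) \<otimes> Y n"
      using abc[OF mn(1)] Ec[OF mn(1)] Yc by (simp add: X_def A.l_distr)
    also have "\<dots> = Y (m + n)"
      using abc[OF mn(1)] terms[OF mn(2)] 1 2 by (simp add: Y_def A.r_distr)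
    finally show ?thesis by simp
  qed
  \<comment> \<open>Of the four products two contain the square of an odd coordinate of one factor
    and vanish; the mixed ones are \<open>W (m + n)\<close> and its negative.\<close>
  have YY: "Y m \<otimes> Y n = \<zero>" if mn: "m \<in> J" "n \<in> J" for m n
  proof -
    have S: "m \<in> S" "n \<in> S" using JS mn by blast+
    have 1: "(\<alpha> m \<otimes> b m) \<otimes> (\<alpha> n \<otimes> b n) = \<zero>"
      using A.mult_swap[OF oc(1)[OF mn(1)] ec(2)[OF S(1)] oc(1)[OF mn(2)] ec(2)[OF S(2)]
          A.even_comm[OF ev(2)[OF S(1)] oc(1)[OF mn(2)]]] nil(1)[OF mn] ec[OF S(1)] ec[OF S(2)] by simp
    have 2: "(\<alpha> m \<otimes> b m) \<otimes> (a n \<otimes> \<beta> n) = W (m + n)"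
      using A.mult_swap[OF oc(1)[OF mn(1)] ec(2)[OF S(1)] ec(1)[OF S(2)] oc(2)[OF mn(2)]
          A.even_comm[OF ev(2)[OF S(1)] ec(1)[OF S(2)]]] addl(1)[OF mn(1) S(2)] addr(2)[OF S(1) mn(2)]
      by (simp add: W_def)
    have 3: "(a m \<otimes> \<beta> m) \<otimes> (\<alpha> n \<otimes> b n) = \<ominus> W (m + n)"
      using A.mult_swap_odd[OF ec(1)[OF S(1)] od(2)[OF mn(1)] od(1)[OF mn(2)] ec(2)[OF S(2)]]
        addl(2)[OF mn(1) S(2)] addr(1)[OF S(1) mn(2)] by (simp add: W_def)
    have 4: "(a m \<otimes> \<beta> m) \<otimes> (a n \<otimes> \<beta> n) = \<zero>"
      using A.mult_swap[OF ec(1)[OF S(1)] oc(2)[OF mn(1)] ec(1)[OF S(2)] oc(2)[OF mn(2)]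
          comm[OF ev(1)[OF S(2)] oc(2)[OF mn(1)]]] nil(2)[OF mn] ec[OF S(1)] ec[OF S(2)] by simp
    show ?thesis
      using terms[OF mn(1)] terms[OF mn(2)] 1 2 3 4 Wc[OF J_add[OF S(1) mn(2)]]
      by (simp add: Y_def A.l_distr A.r_distr A.r_neg A.l_neg)
  qed
  show "conv c (toric_alg S J) A g h \<in> shom (toric_alg S J) A"
    unfolding lift by (rule toric_lift_shom[OF A SJ]) (simp_all add: Xe X0 X_add Ye Y_add YY)
  show "conv c (toric_alg S J) A g h (x_monom m) = (g (x_monom m) \<otimes> h (x_monom m)) \<oplus>
         (if pairing m c = 0 then \<zero> else pairing m c \<odot> (g (xi_monom m) \<otimes> h (xi_monom m)))" if "m \<in> S" for m
    unfolding lift using toric_lift_monom(1)[where X = X, OF A that A.even_carrier[OF Xe[OF that]]]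
    by (simp add: X_def E_def ab)
  show "conv c (toric_alg S J) A g h (xi_monom m) =
        (g (xi_monom m) \<otimes> h (x_monom m)) \<oplus> (g (x_monom m) \<otimes> h (xi_monom m))" if "m \<in> J" for m
    unfolding lift using toric_lift_monom(2)[where Y = Y, OF A that A.odd_carrier[OF Ye[OF that]]]
    by (simp add: Y_def ab)
qed

text \<open>Points on which odd monomials vanish and even ones are scalars. The counit, the
  distinguished point, the structure map of the ground field, the base point of the orbit and the
  exponential points are all of this kind.\<close>

definition scalar_point ::
  "'v::euclidean_space set \<Rightarrow> 'v set \<Rightarrow> 'v coord superalg \<Rightarrow> ('v \<Rightarrow> complex) \<Rightarrow> 'v coord \<Rightarrow> 'v coord" where
  "scalar_point S J A x = toric_lift S J A (\<lambda>m. x m \<odot>\<^bsub>A\<^esub> \<one>\<^bsub>A\<^esub>) (\<lambda>_. \<zero>\<^bsub>A\<^esub>)"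

lemma scalar_point_shom:
  assumes A: "superalgebra A" and SJ: "monoid_ideal S J"
    and x: "x 0 = 1" "\<And>m n. m \<in> S \<Longrightarrow> n \<in> S \<Longrightarrow> x (m + n) = x m * x n"
  shows "scalar_point S J A x \<in> shom (toric_alg S J) A"
proof -
  interpret A: salg A using A by (rule salgI)
  show ?thesis
    unfolding scalar_point_def
    by (rule toric_lift_shom[OF A SJ])
      (auto simp: x A.even_smult A.smult_mult A.smult_smult)
qed

lemma scalar_point_eval:
  assumes A: "superalgebra A" and q: "q \<in> carrier (toric_alg S J)"
  shows "scalar_point S J A x q = (\<Sum>m\<in>keys (fst q). lookup (fst q) m * x m) \<odot>\<^bsub>A\<^esub> \<one>\<^bsub>A\<^esub>"
proof -
  interpret A: salg A using A by (rule salgI)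
  show ?thesis
    using q by (simp add: scalar_point_def toric_lift_def A.lin_scalar A.lin_zero_fun)
qed

lemma scalar_point_monom:
  fixes A (structure)
  assumes A: "superalgebra A"
  shows "m \<in> S \<Longrightarrow> scalar_point S J A x (x_monom m) = x m \<odot> \<one>"
    "m \<in> J \<Longrightarrow> scalar_point S J A x (xi_monom m) = \<zero>"
proof -
  interpret A: salg A using A by (rule salgI)
  show "m \<in> S \<Longrightarrow> scalar_point S J A x (x_monom m) = x m \<odot> \<one>"
    "m \<in> J \<Longrightarrow> scalar_point S J A x (xi_monom m) = \<zero>"
    unfolding scalar_point_def by (simp_all add: toric_lift_monom[OF A])
qed

lemma torus_unit_eq:
  assumes A: "superalgebra A"
  shows "torus_unit (toric_alg S J) A = scalar_point S J A (\<lambda>_. 1)"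
  using scalar_point_eval[OF A, of _ S J "\<lambda>_. 1"]
  by (auto simp: torus_unit_def fun_eq_iff scalar_point_def toric_lift_def)

lemma torus_unit_shom:
  assumes "superalgebra A" "monoid_ideal S J"
  shows "torus_unit (toric_alg S J) A \<in> shom (toric_alg S J) A"
  unfolding torus_unit_eq[OF assms(1)] by (rule scalar_point_shom[OF assms]) simp_all

lemma monoid_ideal_ground: "monoid_ideal {0} {}"
  by (simp add: monoid_ideal_def)

lemma superalgebra_ground: "superalgebra ground"
  unfolding ground_def by (rule superalgebra_toric_alg[OF monoid_ideal_ground])

lemma ground_carrier: "q \<in> carrier ground \<longleftrightarrow> (\<exists>z. q = (single 0 z, 0))"
proof
  assume "q \<in> carrier ground"
  then have k: "keys (fst q) \<subseteq> {0}" "snd q = 0" by (simp_all add: ground_def toric_alg_carrier)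
  have "fst q = single 0 (lookup (fst q) 0)"
    by (rule poly_mapping_eqI) (use k(1) in \<open>auto simp: lookup_single when_def in_keys_iff\<close>)
  then show "\<exists>z. q = (single 0 z, 0)" using k by (metis prod.collapse)
qed (auto simp: ground_def toric_alg_simps)

lemma ground_simps:
  "z \<odot>\<^bsub>ground\<^esub> \<one>\<^bsub>ground\<^esub> = (single 0 z, 0)" "\<zero>\<^bsub>ground\<^esub> = (0, 0)" "\<one>\<^bsub>ground\<^esub> = (1, 0)"
  "(single 0 z, 0) \<otimes>\<^bsub>ground\<^esub> (single 0 w, 0) = (single 0 (z * w), 0)"
  by (simp_all add: ground_def toric_alg_simps mult_single)

lemma superfield_ground: "superfield ground"
proof -
  interpret G: salg ground using superalgebra_ground by (rule salgI)
  have comm: "x \<otimes>\<^bsub>ground\<^esub> y = y \<otimes>\<^bsub>ground\<^esub> x" if "x \<in> carrier ground" "y \<in> carrier ground" for x y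
    using that by (auto simp: ground_carrier ground_simps mult.commute)
  interpret G: cring ground
    by (rule cring.intro[OF G.ring_axioms]) (rule comm_monoid.intro[OF G.monoid_axioms], unfold_locales, rule comm)
  have "field ground"
  proof (rule G.cring_fieldI)
    show "Units ground = carrier ground - {\<zero>\<^bsub>ground\<^esub>}"
    proof (intro equalityI subsetI)
      fix y assume y: "y \<in> Units ground"
      then show "y \<in> carrier ground - {\<zero>\<^bsub>ground\<^esub>}"
        using G.l_null unfolding Units_def by (force simp: ground_simps)
    next
      fix y assume "y \<in> carrier ground - {\<zero>\<^bsub>ground\<^esub>}"
      then obtain z where y: "y = (single 0 z, 0)" "y \<noteq> (0, 0)" by (auto simp: ground_carrier ground_simps)
      then have z: "y = (single 0 z, 0)" "z \<noteq> 0" by (cases "z = 0"; simp)+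
      have "(single 0 (inverse z), 0) \<otimes>\<^bsub>ground\<^esub> y = \<one>\<^bsub>ground\<^esub>" "y \<otimes>\<^bsub>ground\<^esub> (single 0 (inverse z), 0) = \<one>\<^bsub>ground\<^esub>"
        unfolding z(1) using z(2) by (simp_all add: ground_simps)
      moreover have "(single 0 (inverse z), 0) \<in> carrier ground" "y \<in> carrier ground"
        using z(1) by (auto simp: ground_carrier)
      ultimately show "y \<in> Units ground" unfolding Units_def by blast
    qed
  qed
  then show ?thesis using superalgebra_ground by (simp add: superfield_def)
qed

section \<open>Complex torus points that avoid hypersurfaces\<close>

lemma exists_generic_vector:
  fixes D :: "'v::euclidean_space set"
  assumes "finite D" "0 \<notin> D"
  shows "\<exists>v. \<forall>d\<in>D. d \<bullet> v \<noteq> 0"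
  using assms
proof (induction D rule: finite_induct)
  case empty then show ?case by simp
next
  case (insert d D)
  then obtain v where v: "\<forall>e\<in>D. e \<bullet> v \<noteq> 0" by auto
  \<comment> \<open>A small change of \<open>v\<close> along \<open>d\<close> is sought. These are
    the only coefficients for which some \<open>e\<close> with nonzero inner product with
    \<open>d\<close> becomes orthogonal to the new vector.\<close>
  have "finite ((\<lambda>e. - (e \<bullet> v) / (e \<bullet> d)) ` insert d D)" using insert by simp
  then obtain \<epsilon> :: real where \<epsilon>: "\<epsilon> \<notin> insert 0 ((\<lambda>e. - (e \<bullet> v) / (e \<bullet> d)) ` insert d D)"
    using ex_new_if_finite[OF infinite_UNIV_char_0] by (metis finite_insert)
  have "e \<bullet> (v + \<epsilon> *\<^sub>R d) \<noteq> 0" if e: "e \<in> insert d D" for e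
  proof (cases "e \<bullet> d = 0")
    case True
    then have "e \<noteq> d" using insert by auto
    then show ?thesis using v e True by (auto simp: inner_add_right)
  next
    case False
    have "\<epsilon> \<noteq> - (e \<bullet> v) / (e \<bullet> d)" using \<epsilon> e by blast
    then show ?thesis using False by (simp add: inner_add_right field_simps)
  qed
  then show ?case by blast
qed

text \<open>The values of the character \<open>m\<close> on a real one-parameter subgroup of the
  torus with direction \<open>v\<close>. Defined on the whole space, it is multiplicative on every
  monoid of exponents at once.\<close>

definition exp_char :: "'v::euclidean_space \<Rightarrow> real \<Rightarrow> 'v \<Rightarrow> complex" where
  "exp_char v s m = of_real (exp (s * (m \<bullet> v)))"

definition exp_eval :: "'v::euclidean_space \<Rightarrow> real \<Rightarrow> ('v \<Rightarrow>\<^sub>0 complex) \<Rightarrow> complex" where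
  "exp_eval v s f = (\<Sum>m\<in>keys f. lookup f m * exp_char v s m)"

lemma exp_char_hom: "exp_char v s 0 = 1" "exp_char v s (m + n) = exp_char v s m * exp_char v s n"
  by (simp_all add: exp_char_def inner_add_left distrib_left exp_add)

text \<open>For large \<open>s\<close> the term whose exponent maximizes \<open>m \<bullet> v\<close> dominates the sum.\<close>

lemma eventually_exp_eval_nonzero:
  fixes f :: "'v::euclidean_space \<Rightarrow>\<^sub>0 complex"
  assumes "f \<noteq> 0" and inj: "inj_on (\<lambda>m. m \<bullet> v) (keys f)"
  shows "eventually (\<lambda>s. exp_eval v s f \<noteq> 0) at_top"
proof -
  have ne: "keys f \<noteq> {}" using assms(1) by simp
  define t where "t = Max ((\<lambda>m. m \<bullet> v) ` keys f)"
  have "t \<in> (\<lambda>m. m \<bullet> v) ` keys f" unfolding t_def using ne by (intro Max_in) auto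
  then obtain m0 where m0: "m0 \<in> keys f" "m0 \<bullet> v = t" by auto
  have less: "m \<bullet> v < t" if "m \<in> keys f" "m \<noteq> m0" for m
  proof -
    have "m \<bullet> v \<le> t" unfolding t_def using that by (intro Max_ge) auto
    moreover have "m \<bullet> v \<noteq> t" using inj that m0 unfolding inj_on_def by metis
    ultimately show ?thesis by simp
  qed
  have lim: "((\<lambda>s. lookup f m * of_real (exp (s * (m \<bullet> v - t)))) \<longlongrightarrow> (if m = m0 then lookup f m0 else 0)) at_top"
    if m: "m \<in> keys f" for m
  proof (cases "m = m0")
    case True then show ?thesis using m0 by simp
  next
    case False
    then have "m \<bullet> v - t < 0" using less[OF m] by simp
    then have "filterlim (\<lambda>s. (m \<bullet> v - t) * s) at_bot at_top"
      by (rule filterlim_tendsto_neg_mult_at_bot[OF tendsto_const _ filterlim_ident])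
    then have "filterlim (\<lambda>s. s * (m \<bullet> v - t)) at_bot at_top" by (simp add: mult.commute)
    then have "((\<lambda>s. exp (s * (m \<bullet> v - t))) \<longlongrightarrow> 0) at_top"
      by (rule filterlim_compose[OF exp_at_bot])
    then have "((\<lambda>s. lookup f m * of_real (exp (s * (m \<bullet> v - t)))) \<longlongrightarrow> lookup f m * of_real 0) at_top"
      by (intro tendsto_intros)
    then show ?thesis using False by simp
  qed
  have "((\<lambda>s. \<Sum>m\<in>keys f. lookup f m * of_real (exp (s * (m \<bullet> v - t)))) \<longlongrightarrow>
      (\<Sum>m\<in>keys f. if m = m0 then lookup f m0 else 0)) at_top"
    by (intro tendsto_sum lim)
  also have "(\<Sum>m\<in>keys f. if m = m0 then lookup f m0 else 0) = lookup f m0"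
    using m0 by simp
  finally have "eventually (\<lambda>s. (\<Sum>m\<in>keys f. lookup f m * of_real (exp (s * (m \<bullet> v - t)))) \<noteq> 0) at_top"
    by (rule tendsto_imp_eventually_ne) (use m0 in \<open>auto simp: in_keys_iff\<close>)
  then show ?thesis
  proof eventually_elim
    case (elim s)
    have "exp_eval v s f = of_real (exp (s * t)) * (\<Sum>m\<in>keys f. lookup f m * of_real (exp (s * (m \<bullet> v - t))))"
      unfolding exp_eval_def exp_char_def sum_distrib_left
      by (rule sum.cong) (simp_all add: exp_diff right_diff_distrib)
    then show ?case using elim by simp
  qed
qed

text \<open>A direction \<open>v\<close> avoiding all nonzero differences of exponents separates the
  terms of both polynomials, and both values are then nonzero for all large
  \<open>s\<close>.\<close>

lemma exp_eval_nonzero2: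
  fixes f g :: "'v::euclidean_space \<Rightarrow>\<^sub>0 complex"
  assumes "f \<noteq> 0" "g \<noteq> 0"
  obtains v s where "exp_eval v s f \<noteq> 0" "exp_eval v s g \<noteq> 0"
proof -
  define D where "D = (\<lambda>(m, n). m - n) ` ((keys f \<union> keys g) \<times> (keys f \<union> keys g)) - {0}"
  have "finite D" "0 \<notin> D" by (auto simp: D_def)
  from exists_generic_vector[OF this] obtain v where v: "\<forall>d\<in>D. d \<bullet> v \<noteq> 0" by blast
  have inj: "inj_on (\<lambda>m. m \<bullet> v) (keys f \<union> keys g)"
  proof (rule inj_onI, rule ccontr)
    fix m n assume mn: "m \<in> keys f \<union> keys g" "n \<in> keys f \<union> keys g" "m \<bullet> v = n \<bullet> v" "m \<noteq> n"
    then have "m - n \<in> D" by (force simp: D_def)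
    then have "(m - n) \<bullet> v \<noteq> 0" using v by blast
    then show False using mn by (simp add: inner_diff_left)
  qed
  have ev: "eventually (\<lambda>s. exp_eval v s f \<noteq> 0 \<and> exp_eval v s g \<noteq> 0) at_top"
    by (intro eventually_conj eventually_exp_eval_nonzero assms inj_on_subset[OF inj]) auto
  show ?thesis using eventually_happens'[OF trivial_limit_at_top_linorder ev] that by blast
qed

definition exp_point :: "'v::euclidean_space set \<Rightarrow> 'v set \<Rightarrow> 'v \<Rightarrow> real \<Rightarrow> 'v coord \<Rightarrow> 'v coord" where
  "exp_point S J v s = scalar_point S J ground (exp_char v s)"

lemma exp_point_shom: "monoid_ideal S J \<Longrightarrow> exp_point S J v s \<in> shom (toric_alg S J) ground"
  unfolding exp_point_def by (intro scalar_point_shom superalgebra_ground) (simp_all add: exp_char_hom)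

lemma exp_point_eval: "q \<in> carrier (toric_alg S J) \<Longrightarrow> exp_point S J v s q = (single 0 (exp_eval v s (fst q)), 0)"
  unfolding exp_point_def by (simp add: scalar_point_eval[OF superalgebra_ground] ground_simps(1) exp_eval_def)

text \<open>Evaluation at a point where neither factor vanishes is multiplicative.\<close>

lemma poly_mapping_no_zero_divisors:
  fixes f g :: "'v::euclidean_space \<Rightarrow>\<^sub>0 complex"
  assumes "f \<noteq> 0" "g \<noteq> 0" shows "f * g \<noteq> 0"
proof
  assume fg: "f * g = 0"
  obtain v s where vs: "exp_eval v s f \<noteq> 0" "exp_eval v s g \<noteq> 0" using exp_eval_nonzero2[OF assms] .
  have SJ: "monoid_ideal UNIV ({} :: 'v set)" by (simp add: monoid_ideal_def)
  have c: "(h, 0) \<in> carrier (toric_alg UNIV {})" for h :: "'v \<Rightarrow>\<^sub>0 complex" by (simp add: toric_alg_simps)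
  have "exp_point UNIV {} v s ((f, 0) \<otimes>\<^bsub>toric_alg UNIV {}\<^esub> (g, 0)) = (single 0 (exp_eval v s f * exp_eval v s g), 0)"
    by (simp only: shom_mult[OF exp_point_shom[OF SJ] c c] exp_point_eval[OF c] fst_conv ground_simps)
  moreover have "exp_point UNIV {} v s ((f, 0) \<otimes>\<^bsub>toric_alg UNIV {}\<^esub> (g, 0)) = (single 0 0, 0)"
    using exp_point_eval[OF c, of v s 0] by (simp add: toric_alg_simps fg exp_eval_def)
  ultimately have "exp_eval v s f * exp_eval v s g = 0" by (metis inj_single injD prod.inject)
  then show False using vs by simp
qed

section \<open>Integrality and finite generation of toric superalgebras\<close>

lemma odd_ideal_toric_alg:
  assumes SJ: "monoid_ideal S J"
  shows "odd_ideal (toric_alg S J) = odd_part (toric_alg S J)"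
proof -
  interpret R: salg "toric_alg S J" using superalgebra_toric_alg[OF SJ] by (rule salgI)
  have sub: "odd_part (toric_alg S J) \<subseteq> carrier (toric_alg S J)" using R.odd_carrier by blast
  have "ideal (odd_part (toric_alg S J)) (toric_alg S J)"
  proof (rule idealI[OF R.ring_axioms])
    show "subgroup (odd_part (toric_alg S J)) (add_monoid (toric_alg S J))"
    proof (rule R.add.subgroupI[OF sub])
      show "odd_part (toric_alg S J) \<noteq> {}" using R.zero_odd by blast
    qed (auto intro: R.odd_a_inv R.odd_add)
  next
    fix a x assume "a \<in> odd_part (toric_alg S J)" "x \<in> carrier (toric_alg S J)"
    moreover obtain f g where x: "x = (f, g)" by (cases x)
    moreover obtain b where a: "a = (0, b)" "keys b \<subseteq> J" using calculation(1) by (cases a) (auto simp: toric_alg_simps)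
    ultimately have f: "keys f \<subseteq> S" by (simp add: toric_alg_simps)
    have "keys (f * b) \<subseteq> J" by (rule keys_times[OF f a(2)]) (use SJ in \<open>auto simp: monoid_ideal_def\<close>)
    then show "x \<otimes>\<^bsub>toric_alg S J\<^esub> a \<in> odd_part (toric_alg S J)" "a \<otimes>\<^bsub>toric_alg S J\<^esub> x \<in> odd_part (toric_alg S J)"
      by (simp_all add: a x toric_alg_simps mult.commute)
  qed
  then show ?thesis
    unfolding odd_ideal_def using R.genideal_minimal[of "odd_part (toric_alg S J)" "odd_part (toric_alg S J)"]
      R.genideal_self[OF sub] by blast
qed

text \<open>Modulo the odd part this is a ring of Laurent polynomials without zero divisors. An even
  component different from zero cancels first in the even and then in the odd coordinate of a
  product.\<close>

lemma superdomain_toric_alg: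
  assumes SJ: "monoid_ideal S J"
  shows "superdomain (toric_alg S J)"
proof -
  have 0: "0 \<in> S" using SJ by (simp add: monoid_ideal_def)
  have "x_monom 0 \<in> carrier (toric_alg S J)" "x_monom 0 \<notin> odd_part (toric_alg S J)"
    using x_monom_carrier[OF 0] by (simp_all add: x_monom_def toric_alg_simps)
  moreover have "a \<in> odd_part (toric_alg S J) \<or> b \<in> odd_part (toric_alg S J)"
    if "a \<in> carrier (toric_alg S J)" "b \<in> carrier (toric_alg S J)" "a \<otimes>\<^bsub>toric_alg S J\<^esub> b \<in> odd_part (toric_alg S J)" for a b
    using that poly_mapping_no_zero_divisors[of "fst a" "fst b"]
    by (cases a; cases b) (auto simp: toric_alg_simps)
  moreover have "b = \<zero>\<^bsub>toric_alg S J\<^esub>"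
    if "a \<in> carrier (toric_alg S J) - odd_part (toric_alg S J)" "b \<in> carrier (toric_alg S J)" "a \<otimes>\<^bsub>toric_alg S J\<^esub> b = \<zero>\<^bsub>toric_alg S J\<^esub>" for a b
  proof -
    obtain f g f' g' where ab: "a = (f, g)" "b = (f', g')" by (cases a; cases b)
    have "f \<noteq> 0" "f * f' = 0" "f * g' + g * f' = 0" using that by (auto simp: ab toric_alg_simps)
    then have "f' = 0" using poly_mapping_no_zero_divisors by blast
    then have "g' = 0" using poly_mapping_no_zero_divisors[of f g'] \<open>f \<noteq> 0\<close> \<open>f * g' + g * f' = 0\<close> by auto
    then show ?thesis using \<open>f' = 0\<close> by (simp add: ab toric_alg_simps)
  qed
  ultimately show ?thesis
    unfolding superdomain_def odd_ideal_toric_alg[OF SJ] using superalgebra_toric_alg[OF SJ] by blast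
qed

text \<open>The monomials of \<open>G\<close> generate the even part, and \<open>J\<close> is
  generated as a module over \<open>S\<close> by \<open>B\<close>. Generation of \<open>S\<close> is
  stated as an induction principle, the form in which Gordan's lemma delivers it.\<close>

lemma finitely_generated_toric_alg:
  fixes S J :: "'v::euclidean_space set"
  assumes SJ: "monoid_ideal S J" and G: "finite G" "G \<subseteq> S"
    and gen: "\<And>C. 0 \<in> C \<Longrightarrow> (\<And>g m. g \<in> G \<Longrightarrow> m \<in> C \<Longrightarrow> g + m \<in> C) \<Longrightarrow> S \<subseteq> C"
    and B: "finite B" "B \<subseteq> J" "\<And>m. m \<in> J \<Longrightarrow> \<exists>b\<in>B. m - b \<in> S"
  shows "finitely_generated (toric_alg S J)"
  unfolding finitely_generated_def
proof (intro exI[of _ "x_monom ` G \<union> xi_monom ` B"] conjI allI impI; (elim conjE)?)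
  show "x_monom ` G \<union> xi_monom ` B \<subseteq> carrier (toric_alg S J)"
    using G B x_monom_carrier xi_monom_carrier by blast
  fix C assume C: "subring C (toric_alg S J)" and sm: "\<forall>z. \<forall>a\<in>C. z \<odot>\<^bsub>toric_alg S J\<^esub> a \<in> C"
    and sub: "x_monom ` G \<union> xi_monom ` B \<subseteq> C"
  interpret R: salg "toric_alg S J" using superalgebra_toric_alg[OF SJ] by (rule salgI)
  note Cm = subringE(6)[OF C] and Ca = subringE(7)[OF C]
  have "S \<subseteq> {m. x_monom m \<in> C}"
  proof (rule gen)
    show "0 \<in> {m. x_monom m \<in> C}" using subringE(3)[OF C] by (simp add: monom_mult(5)[where S = S and J = J])
    fix g m assume "g \<in> G" "m \<in> {m. x_monom m \<in> C}"
    then show "g + m \<in> {m. x_monom m \<in> C}"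
      using Cm[of "x_monom g" "x_monom m"] sub by (auto simp: monom_mult)
  qed
  then have x: "x_monom m \<in> C" if "m \<in> S" for m using that by blast
  have xi: "xi_monom m \<in> C" if m: "m \<in> J" for m
  proof -
    obtain b where b: "b \<in> B" "m - b \<in> S" using B(3)[OF m] by blast
    have "x_monom (m - b) \<otimes>\<^bsub>toric_alg S J\<^esub> xi_monom b \<in> C" by (rule Cm[OF x[OF b(2)]]) (use sub b in blast)
    then show ?thesis by (simp add: monom_mult)
  qed
  have 0: "(0, 0) \<in> C" using subringE(2)[OF C] by (simp add: toric_alg_simps)
  have f: "(f, 0) \<in> C" if "keys f \<subseteq> S" for f
    using that
  proof (induction f rule: poly_mapping_add_induct)
    case zero show ?case by (rule 0)
  next
    case (add p a b)
    note k = keys_add_single[OF add(1,2)]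
    have "(p + single a b, 0) = (p, 0) \<oplus>\<^bsub>toric_alg S J\<^esub> (b \<odot>\<^bsub>toric_alg S J\<^esub> x_monom a)"
      by (simp add: toric_alg_simps x_monom_def mult_single)
    then show ?case using Ca[OF add(3)] sm x[of a] add(4) k by auto
  qed
  have g: "(0, f) \<in> C" if "keys f \<subseteq> J" for f
    using that
  proof (induction f rule: poly_mapping_add_induct)
    case zero show ?case by (rule 0)
  next
    case (add p a b)
    note k = keys_add_single[OF add(1,2)]
    have "(0, p + single a b) = (0, p) \<oplus>\<^bsub>toric_alg S J\<^esub> (b \<odot>\<^bsub>toric_alg S J\<^esub> xi_monom a)"
      by (simp add: toric_alg_simps xi_monom_def mult_single)
    then show ?case using Ca[OF add(3)] sm xi[of a] add(4) k by auto
  qed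
  show "C = carrier (toric_alg S J)"
  proof
    show "C \<subseteq> carrier (toric_alg S J)" by (rule subringE(1)[OF C])
    show "carrier (toric_alg S J) \<subseteq> C"
    proof
      fix q assume "q \<in> carrier (toric_alg S J)"
      moreover obtain u v where q: "q = (u, v)" by (cases q)
      ultimately have "(u, 0) \<in> C" "(0, v) \<in> C" using f g by (simp_all add: toric_alg_simps)
      from Ca[OF this] show "q \<in> C" by (simp add: q toric_alg_simps)
    qed
  qed
qed (use G B in auto)

section \<open>Lattices and cones\<close>

definition int_span :: "'v::real_vector set \<Rightarrow> 'v set" where
  "int_span E = range (\<lambda>k :: 'v \<Rightarrow> int. \<Sum>e\<in>E. of_int (k e) *\<^sub>R e)"

definition additive_group :: "'v::real_vector set \<Rightarrow> bool" where
  "additive_group L \<longleftrightarrow> 0 \<in> L \<and> (\<forall>x\<in>L. \<forall>y\<in>L. x - y \<in> L)"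

lemma additive_group_zero: "additive_group L \<Longrightarrow> 0 \<in> L"
  and additive_group_diff: "additive_group L \<Longrightarrow> x \<in> L \<Longrightarrow> y \<in> L \<Longrightarrow> x - y \<in> L"
  by (simp_all add: additive_group_def)

lemma additive_group_uminus: "additive_group L \<Longrightarrow> x \<in> L \<Longrightarrow> - x \<in> L"
  using additive_group_diff[of L 0 x] additive_group_zero[of L] by simp

lemma additive_group_add: "additive_group L \<Longrightarrow> x \<in> L \<Longrightarrow> y \<in> L \<Longrightarrow> x + y \<in> L"
  using additive_group_diff[of L x "- y"] additive_group_uminus[of L y] by simp

lemma additive_group_of_int:
  assumes L: "additive_group L" "x \<in> L" shows "of_int k *\<^sub>R x \<in> L"
proof -
  have nat: "of_nat n *\<^sub>R x \<in> L" for n :: nat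
    by (induction n) (use L in \<open>auto simp: algebra_simps intro: additive_group_zero additive_group_add\<close>)
  show ?thesis
    using nat[of "nat k"] additive_group_uminus[OF L(1) nat[of "nat (- k)"]] by (cases "k \<ge> 0") auto
qed

lemma additive_group_sum:
  assumes L: "additive_group L" and "\<And>i. i \<in> K \<Longrightarrow> x i \<in> L"
  shows "(\<Sum>i\<in>K. of_int (k i) *\<^sub>R x i) \<in> L"
  using assms(2)
  by (induction K rule: infinite_finite_induct)
    (auto intro: additive_group_zero[OF L] additive_group_add[OF L] additive_group_of_int[OF L])

lemma additive_group_int_span: "additive_group (int_span E)"
  unfolding additive_group_def
proof (intro conjI ballI)
  show "0 \<in> int_span E" unfolding int_span_def by (rule range_eqI[of _ _ "\<lambda>_. 0"]) simp
  fix x y assume "x \<in> int_span E" "y \<in> int_span E"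
  then obtain k l :: "'a \<Rightarrow> int" where "x = (\<Sum>e\<in>E. of_int (k e) *\<^sub>R e)" "y = (\<Sum>e\<in>E. of_int (l e) *\<^sub>R e)"
    by (auto simp: int_span_def)
  then have "x - y = (\<Sum>e\<in>E. of_int (k e - l e) *\<^sub>R e)"
    by (simp add: sum_subtractf scaleR_left_diff_distrib)
  then show "x - y \<in> int_span E" unfolding int_span_def by (rule range_eqI[of _ _ "\<lambda>e. k e - l e"])
qed

lemma int_span_base: "finite E \<Longrightarrow> e \<in> E \<Longrightarrow> e \<in> int_span E"
  unfolding int_span_def
  by (rule range_eqI[of _ _ "\<lambda>x. if x = e then 1 else 0"]) (simp add: if_distrib[of of_int] if_distrib[of "\<lambda>c. c *\<^sub>R _"] cong: if_cong)

lemma int_span_minimal: "additive_group L \<Longrightarrow> E \<subseteq> L \<Longrightarrow> int_span E \<subseteq> L"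
  unfolding int_span_def using additive_group_sum[of L E "\<lambda>e. e"] by blast

lemma int_span_span: "int_span E \<subseteq> span E"
  unfolding int_span_def by (auto intro: span_sum span_scale span_base)

lemma int_span_insert:
  assumes "finite E" "e \<notin> E"
  shows "x \<in> int_span (insert e E) \<longleftrightarrow> (\<exists>k::int. x - of_int k *\<^sub>R e \<in> int_span E)"
proof
  assume "x \<in> int_span (insert e E)"
  then obtain k :: "'a \<Rightarrow> int" where "x = of_int (k e) *\<^sub>R e + (\<Sum>e\<in>E. of_int (k e) *\<^sub>R e)"
    using assms by (auto simp: int_span_def)
  then have "x - of_int (k e) *\<^sub>R e \<in> int_span E" by (auto simp: int_span_def)
  then show "\<exists>k::int. x - of_int k *\<^sub>R e \<in> int_span E" by blast
next
  have G: "additive_group (int_span (insert e E))" by (rule additive_group_int_span)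
  have sub: "int_span E \<subseteq> int_span (insert e E)"
    by (rule int_span_minimal[OF G]) (use assms int_span_base[of "insert e E"] in auto)
  assume "\<exists>k::int. x - of_int k *\<^sub>R e \<in> int_span E"
  then obtain k :: int where k: "x - of_int k *\<^sub>R e \<in> int_span E" by blast
  have "(x - of_int k *\<^sub>R e) + of_int k *\<^sub>R e \<in> int_span (insert e E)"
    by (rule additive_group_add[OF G subsetD[OF sub k] additive_group_of_int[OF G]])
      (use assms int_span_base[of "insert e E" e] in auto)
  then show "x \<in> int_span (insert e E)" by simp
qed

lemma zlattice_iff: "zlattice N \<longleftrightarrow> (\<exists>E. independent E \<and> N = int_span E)"
  by (simp add: zlattice_def int_span_def)

lemma zlattice_basis:
  fixes N :: "'v::euclidean_space set"
  assumes "zlattice N"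
  obtains E where "independent E" "finite E" "N = int_span E"
  using assms independent_bound unfolding zlattice_iff by blast

lemma zlattice_group: "zlattice N \<Longrightarrow> additive_group N"
  unfolding zlattice_iff using additive_group_int_span by blast

lemma span_int_span: "finite E \<Longrightarrow> span (int_span E) = span E"
  by (intro equalityI span_minimal subspace_span int_span_span) (auto intro: span_base int_span_base)

text \<open>Induction on the basis: the part of \<open>L\<close> without \<open>e\<close> is a
  lattice by induction, and one more vector \<open>l0\<close>, with the least positive
  \<open>e\<close>-coefficient, completes its basis. The clause on the span of \<open>E\<close>
  keeps \<open>l0\<close> independent of the rest.\<close>

lemma subgroup_int_span:
  fixes E :: "'v::euclidean_space set"
  assumes "finite E" "independent E" "additive_group L" "L \<subseteq> int_span E"
  shows "\<exists>E'. independent E' \<and> L = int_span E' \<and> E' \<subseteq> span E"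
  using assms
proof (induction E arbitrary: L rule: finite_induct)
  case empty
  then have "L = {0}" by (auto simp: int_span_def additive_group_def)
  then show ?case by (intro exI[of _ "{}"]) (auto simp: int_span_def independent_empty)
next
  case (insert e E)
  have indE: "independent E" and e: "e \<notin> span E"
    using insert.prems(1) insert.hyps by (auto simp: independent_insert)
  define L' where "L' = L \<inter> int_span E"
  have gL: "additive_group L" by fact
  have gE: "additive_group (int_span E)" by (rule additive_group_int_span)
  have gL': "additive_group L'"
    using additive_group_zero[OF gL] additive_group_zero[OF gE] additive_group_diff[OF gL] additive_group_diff[OF gE]
    by (auto simp: additive_group_def L'_def)
  obtain E' where E': "independent E'" "L' = int_span E'" "E' \<subseteq> span E"
    using insert.IH[OF indE gL'] by (auto simp: L'_def)
  have finE': "finite E'" using independent_bound[OF E'(1)] by simp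
  \<comment> \<open>The group of \<open>e\<close>-coefficients of elements of
    \<open>L\<close>.\<close>
  define C where "C = {k::int. \<exists>l\<in>L. l - of_int k *\<^sub>R e \<in> int_span E}"
  have coef: "\<exists>k\<in>C. l - of_int k *\<^sub>R e \<in> int_span E" if "l \<in> L" for l
  proof -
    have "l \<in> int_span (insert e E)" using that insert.prems by blast
    then obtain k :: int where "l - of_int k *\<^sub>R e \<in> int_span E"
      unfolding int_span_insert[OF insert.hyps] by blast
    then show ?thesis using that unfolding C_def by blast
  qed
  show ?case
  proof (cases "C \<subseteq> {0}")
    case True
    have "L \<subseteq> int_span E"
    proof
      fix l assume "l \<in> L"
      from coef[OF this] show "l \<in> int_span E" using True by auto
    qed
    then have "L = int_span E'" using E'(2) by (auto simp: L'_def)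
    then show ?thesis using E' span_mono[of E "insert e E"] by blast
  next
    case False
    then obtain k0 where k0: "k0 \<in> C" "k0 \<noteq> 0" by auto
    have negC: "- k \<in> C" if k: "k \<in> C" for k
    proof -
      obtain l where l: "l \<in> L" "l - of_int k *\<^sub>R e \<in> int_span E" using k by (auto simp: C_def)
      have "- l - of_int (- k) *\<^sub>R e \<in> int_span E" using additive_group_uminus[OF gE l(2)] by simp
      then show ?thesis using additive_group_uminus[OF gL l(1)] unfolding C_def by blast
    qed
    \<comment> \<open>The least positive coefficient is sought among naturals; a nonzero coefficient
      or its negative shows that there is one.\<close>
    define P where "P n \<longleftrightarrow> 0 < n \<and> int n \<in> C" for n :: nat
    have "\<exists>n. P n"
      using k0 negC[OF k0(1)] by (intro exI[of _ "nat \<bar>k0\<bar>"]) (auto simp: P_def abs_if)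
    then have Pd: "P (LEAST n. P n)" by (rule LeastI_ex)
    define d where "d = int (LEAST n. P n)"
    have d: "0 < d" "d \<in> C" using Pd by (auto simp: d_def P_def)
    have dmin: "k = 0" if "k \<in> C" "0 \<le> k" "k < d" for k
    proof (rule ccontr)
      assume "k \<noteq> 0"
      then have "P (nat k)" using that by (simp add: P_def)
      then have "(LEAST n. P n) \<le> nat k" by (rule Least_le)
      then show False using that by (simp add: d_def)
    qed
    obtain l0 where l0: "l0 \<in> L" "l0 - of_int d *\<^sub>R e \<in> int_span E" using d by (auto simp: C_def)
    have l0_span: "l0 \<notin> span E"
    proof
      assume "l0 \<in> span E"
      then have "l0 - (l0 - of_int d *\<^sub>R e) \<in> span E" by (rule span_diff[OF _ subsetD[OF int_span_span l0(2)]])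
      then have "of_int d *\<^sub>R e \<in> span E" by simp
      from span_scale[OF this, of "1 / of_int d"] show False using e d by simp
    qed
    then have l0': "l0 \<notin> span E'" using span_minimal[OF E'(3) subspace_span] by blast
    have l0E': "l0 \<notin> E'" using l0' span_base by blast
    have "L = int_span (insert l0 E')"
    proof (intro equalityI subsetI)
      fix l assume l: "l \<in> L"
      obtain k where k: "k \<in> C" "l - of_int k *\<^sub>R e \<in> int_span E" using coef[OF l] by blast
      \<comment> \<open>Division with remainder: subtracting \<open>q\<close> times
        \<open>l0\<close> leaves a coefficient below \<open>d\<close>, which must be zero by
        minimality.\<close>
      define q where "q = k div d"
      have inL: "l - of_int q *\<^sub>R l0 \<in> L"
        using additive_group_diff[OF gL l additive_group_of_int[OF gL l0(1)]] .
      have "(l - of_int k *\<^sub>R e) - of_int q *\<^sub>R (l0 - of_int d *\<^sub>R e) \<in> int_span E"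
        using additive_group_diff[OF gE k(2) additive_group_of_int[OF gE l0(2)]] .
      moreover have "(l - of_int k *\<^sub>R e) - of_int q *\<^sub>R (l0 - of_int d *\<^sub>R e)
         = (l - of_int q *\<^sub>R l0) - of_int (k mod d) *\<^sub>R e"
        by (simp add: q_def minus_div_mult_eq_mod[symmetric] scaleR_right_diff_distrib scaleR_left_diff_distrib)
      ultimately have *: "(l - of_int q *\<^sub>R l0) - of_int (k mod d) *\<^sub>R e \<in> int_span E" by simp
      then have "k mod d \<in> C" using inL unfolding C_def by blast
      then have "k mod d = 0" using dmin d by simp
      then have "l - of_int q *\<^sub>R l0 \<in> L'" using * inL by (simp add: L'_def)
      then show "l \<in> int_span (insert l0 E')" unfolding int_span_insert[OF finE' l0E'] E'(2) by blast
    next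
      fix l assume "l \<in> int_span (insert l0 E')"
      moreover have "int_span (insert l0 E') \<subseteq> L"
        by (rule int_span_minimal[OF gL]) (use l0(1) E'(2) int_span_base[OF finE'] in \<open>auto simp: L'_def\<close>)
      ultimately show "l \<in> L" by blast
    qed
    moreover have "independent (insert l0 E')" using E'(1) l0' l0E' by (simp add: independent_insert)
    moreover have "insert l0 E' \<subseteq> span (insert e E)"
      using l0(1) insert.prems(3) int_span_span[of "insert e E"] E'(3) span_mono[of E "insert e E"] by blast
    ultimately show ?thesis by blast
  qed
qed

text \<open>\<open>quot\<close> with an arbitrary set of directions instead of lattice and cone, so
  that statements can be proved by induction over generators.\<close>

definition oproj :: "'v::euclidean_space set \<Rightarrow> 'v \<Rightarrow> 'v" where
  "oproj B u = (THE w. w \<in> (span B)\<^sup>\<bottom> \<and> u - w \<in> span B)"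

lemma quot_eq_oproj: "quot N \<sigma> = oproj (\<sigma> \<inter> N)"
  by (simp add: fun_eq_iff quot_def oproj_def)

lemma orthogonal_comp_span_iff: "w \<in> (span B)\<^sup>\<bottom> \<longleftrightarrow> (\<forall>v\<in>span B. w \<bullet> v = 0)"
  by (auto simp: orthogonal_comp_def orthogonal_def inner_commute)

lemma orthogonal_comp_span_iff': "w \<in> (span B)\<^sup>\<bottom> \<longleftrightarrow> (\<forall>v\<in>B. w \<bullet> v = 0)"
proof
  assume *: "\<forall>v\<in>B. w \<bullet> v = 0"
  have "span B \<subseteq> {v. w \<bullet> v = 0}" by (rule span_minimal) (use * subspace_hyperplane in auto)
  then show "w \<in> (span B)\<^sup>\<bottom>" by (auto simp: orthogonal_comp_span_iff)
qed (auto simp: orthogonal_comp_span_iff span_base)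

lemma oproj_unique:
  assumes "w \<in> (span B)\<^sup>\<bottom>" "u - w \<in> span B"
  shows "oproj B u = w"
  unfolding oproj_def
proof (rule the_equality)
  fix w' assume w': "w' \<in> (span B)\<^sup>\<bottom> \<and> u - w' \<in> span B"
  have "(u - w) - (u - w') \<in> span B" by (rule span_diff[OF assms(2) conjunct2[OF w']])
  then have "w' - w \<in> span B" by simp
  moreover have "w' - w \<in> (span B)\<^sup>\<bottom>"
    using assms w' by (intro subspace_diff[OF subspace_orthogonal_comp]) auto
  ultimately have "(w' - w) \<bullet> (w' - w) = 0" by (simp add: orthogonal_comp_span_iff)
  then show "w' = w" by simp
qed (use assms in auto)

lemma oproj_perp: "oproj B u \<in> (span B)\<^sup>\<bottom>" and oproj_diff: "u - oproj B u \<in> span B"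
proof -
  obtain y z where yz: "y \<in> span B" "\<And>w. w \<in> span B \<Longrightarrow> orthogonal z w" "u = y + z"
    using orthogonal_subspace_decomp_exists[of B u] by blast
  have z: "z \<in> (span B)\<^sup>\<bottom>" "u - z \<in> span B" using yz by (auto simp: orthogonal_comp_span_iff orthogonal_def)
  show "oproj B u \<in> (span B)\<^sup>\<bottom>" "u - oproj B u \<in> span B" unfolding oproj_unique[OF z] by (fact z)+
qed

lemma linear_oproj: "linear (oproj B)"
proof (rule linearI)
  note perp = subspace_orthogonal_comp[of "span B"]
  fix u v
  have "(u - oproj B u) + (v - oproj B v) \<in> span B" by (intro span_add oproj_diff)
  then show "oproj B (u + v) = oproj B u + oproj B v"
    by (intro oproj_unique subspace_add[OF perp] oproj_perp) (simp add: algebra_simps)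
  fix r
  have "r *\<^sub>R (u - oproj B u) \<in> span B" by (intro span_scale oproj_diff)
  then show "oproj B (r *\<^sub>R u) = r *\<^sub>R oproj B u"
    by (intro oproj_unique subspace_scale[OF perp] oproj_perp) (simp add: algebra_simps)
qed

lemma oproj_eq_zero_iff: "oproj B u = 0 \<longleftrightarrow> u \<in> span B"
proof
  assume "oproj B u = 0" then show "u \<in> span B" using oproj_diff[of u B] by simp
next
  assume "u \<in> span B"
  then show "oproj B u = 0" by (intro oproj_unique) (auto simp: orthogonal_comp_span_iff)
qed

lemma oproj_ident: "u \<in> (span B)\<^sup>\<bottom> \<Longrightarrow> oproj B u = u"
  by (rule oproj_unique) (simp_all add: span_zero)

lemma inner_oproj: "m \<in> (span B)\<^sup>\<bottom> \<Longrightarrow> m \<bullet> oproj B u = m \<bullet> u"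
  using oproj_diff[of u B] by (auto simp: orthogonal_comp_span_iff inner_diff_right)

lemma oproj_span_cong: "span B = span B' \<Longrightarrow> oproj B = oproj B'"
  by (simp add: oproj_def fun_eq_iff)

text \<open>A Gram-Schmidt step: the residual of \<open>u\<close> is already orthogonal to
  \<open>G\<close>, and orthogonality to \<open>v\<close> only concerns the component of
  \<open>v\<close> orthogonal to \<open>G\<close>.\<close>

lemma oproj_insert: "oproj (insert v G) u = oproj {oproj G v} (oproj G u)"
proof (rule oproj_unique)
  define v' where "v' = oproj G v"
  define w where "w = oproj {v'} (oproj G u)"
  have v': "v' \<in> (span G)\<^sup>\<bottom>" "v - v' \<in> span G" by (simp_all add: v'_def oproj_perp oproj_diff)
  have "oproj G u - w \<in> span {v'}" by (simp add: w_def oproj_diff)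
  then obtain a where a: "oproj G u - w = a *\<^sub>R v'" by (auto simp: span_singleton)
  then have w: "w = oproj G u - a *\<^sub>R v'" by (simp add: algebra_simps)
  have wG: "w \<in> (span G)\<^sup>\<bottom>"
    unfolding w by (intro subspace_diff subspace_scale subspace_orthogonal_comp oproj_perp v')
  have "w \<bullet> v' = 0" using oproj_perp[of "{v'}" "oproj G u"] by (simp add: w_def orthogonal_comp_span_iff')
  moreover have "w \<bullet> (v - v') = 0" using wG v'(2) by (simp add: orthogonal_comp_span_iff)
  ultimately have "w \<bullet> v = 0" by (simp add: inner_diff_right)
  with wG show "oproj {oproj G v} (oproj G u) \<in> (span (insert v G))\<^sup>\<bottom>"
    unfolding w_def[symmetric] v'_def[symmetric] by (simp add: orthogonal_comp_span_iff')
  have sub: "span G \<subseteq> span (insert v G)" by (intro span_mono) auto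
  have "v' \<in> span (insert v G)"
    using span_diff[OF span_base[of v "insert v G"] subsetD[OF sub v'(2)]] by simp
  then have "(u - oproj G u) + a *\<^sub>R v' \<in> span (insert v G)"
    by (intro span_add span_scale subsetD[OF sub oproj_diff])
  then show "u - oproj {oproj G v} (oproj G u) \<in> span (insert v G)"
    unfolding w_def[symmetric] v'_def[symmetric] by (simp add: w algebra_simps)
qed

lemma additive_group_linear_image:
  assumes f: "linear f" and L: "additive_group L" shows "additive_group (f ` L)"
  unfolding additive_group_def
proof (intro conjI ballI)
  show "0 \<in> f ` L" using additive_group_zero[OF L] linear_0[OF f] by (metis imageI)
  fix x y assume "x \<in> f ` L" "y \<in> f ` L"
  then obtain u v where "u \<in> L" "v \<in> L" "x = f u" "y = f v" by blast
  then show "x - y \<in> f ` L" using additive_group_diff[OF L, of u v] linear_diff[OF f, of u v] by (metis imageI)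
qed

text \<open>Discreteness of the image rests on \<open>v\<close> being a lattice vector: the
  projected basis satisfies an integral linear relation. The image is therefore a subgroup of a
  lattice with a fixed denominator, and \<open>subgroup_int_span\<close> applies.\<close>

lemma zlattice_oproj_single:
  fixes N :: "'v::euclidean_space set"
  assumes N: "zlattice N" and v: "v \<in> N"
  shows "zlattice (oproj {v} ` N)"
proof (cases "v = 0")
  case True
  have "oproj {v} u = u" for u by (rule oproj_ident) (simp add: True orthogonal_comp_span_iff')
  then show ?thesis using N by simp
next
  case False
  obtain E where E: "independent E" "finite E" "N = int_span E" using zlattice_basis[OF N] .
  obtain k :: "'v \<Rightarrow> int" where k: "v = (\<Sum>e\<in>E. of_int (k e) *\<^sub>R e)" using v E by (auto simp: int_span_def)
  have "\<exists>e\<in>E. k e \<noteq> 0" using k False by (metis (no_types, lifting) of_int_0 scaleR_zero_left sum.neutral)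
  then obtain e0 where e0: "e0 \<in> E" "k e0 \<noteq> 0" by blast
  define E' where "E' = E - {e0}"
  have E': "finite E'" "independent E'" "e0 \<notin> span E'" "e0 \<notin> E'" "E = insert e0 E'"
    using E e0 independent_mono[OF E(1)] by (auto simp: E'_def dependent_def insert_absorb)
  define pr where "pr = oproj {v}"
  have lin: "linear pr" by (simp add: pr_def linear_oproj)
  have v': "v = of_int (k e0) *\<^sub>R e0 + (\<Sum>e\<in>E'. of_int (k e) *\<^sub>R e)" using k E'(1,4,5) by simp
  have ker: "x \<in> span {v} \<longleftrightarrow> pr x = 0" for x by (simp add: pr_def oproj_eq_zero_iff)
  have v_notin: "v \<notin> span E'"
  proof
    assume "v \<in> span E'"
    then have "v - (\<Sum>e\<in>E'. of_int (k e) *\<^sub>R e) \<in> span E'"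
      by (rule span_diff) (intro span_sum span_scale span_base)
    then have "(1 / of_int (k e0)) *\<^sub>R (v - (\<Sum>e\<in>E'. of_int (k e) *\<^sub>R e)) \<in> span E'" by (rule span_scale)
    then show False using v' e0 E'(3) by simp
  qed
  have inj: "inj_on pr (span E')"
  proof (subst linear_injective_on_subspace_0[OF lin subspace_span], intro ballI impI)
    fix x assume x: "x \<in> span E'" "pr x = 0"
    then obtain a where a: "x = a *\<^sub>R v" using ker[of x] by (auto simp: span_singleton)
    show "x = 0"
    proof (rule ccontr)
      assume "x \<noteq> 0"
      then have "v = (1 / a) *\<^sub>R x" using a by simp
      then show False using v_notin span_scale[OF x(1), of "1 / a"] by simp
    qed
  qed
  \<comment> \<open>\<open>K\<close> is the coefficient of \<open>e0\<close> in \<open>v\<close>.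
    Solving the relation for \<open>pr e0\<close> divides by it, so the vectors
    \<open>pr e / K\<close> generate a lattice containing the image.\<close>
  define K where "K = of_int (k e0) * (1::real)"
  have K0: "K \<noteq> 0" using e0 by (simp add: K_def)
  define s where "s e = (1 / K) *\<^sub>R pr e" for e
  have lins: "linear s" unfolding s_def by (rule linear_compose_scale_right[OF lin])
  have injs: "inj_on s (span E')" using inj K0 by (auto simp: inj_on_def s_def)
  have ind: "independent (s ` E')" by (rule linear_independent_injective_image[OF lins E'(2) injs])
  have gs: "additive_group (int_span (s ` E'))" by (rule additive_group_int_span)
  have "pr ` N \<subseteq> int_span (s ` E')"
  proof
    fix y assume "y \<in> pr ` N"
    then obtain n :: "'v \<Rightarrow> int" where y: "y = pr (\<Sum>e\<in>E. of_int (n e) *\<^sub>R e)" using E by (auto simp: int_span_def)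
    have "pr v = 0" using ker[of v] by (simp add: span_base)
    then have "K *\<^sub>R pr e0 + (\<Sum>e\<in>E'. of_int (k e) *\<^sub>R pr e) = 0"
      using v' by (simp add: K_def linear_add[OF lin] linear_scale[OF lin] linear_sum[OF lin])
    then have "K *\<^sub>R pr e0 = - (\<Sum>e\<in>E'. of_int (k e) *\<^sub>R pr e)" by (simp add: eq_neg_iff_add_eq_0)
    moreover have "K *\<^sub>R (- (\<Sum>e\<in>E'. of_int (k e) *\<^sub>R s e)) = - (\<Sum>e\<in>E'. of_int (k e) *\<^sub>R pr e)"
      using K0 by (simp add: scaleR_sum_right s_def)
    ultimately have "K *\<^sub>R pr e0 = K *\<^sub>R (- (\<Sum>e\<in>E'. of_int (k e) *\<^sub>R s e))" by simp
    then have pe0: "pr e0 = - (\<Sum>e\<in>E'. of_int (k e) *\<^sub>R s e)" using K0 unfolding scaleR_cancel_left by blast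
    have pe: "pr e = of_int (k e0) *\<^sub>R s e" for e using K0 by (simp add: s_def K_def)
    have "y = of_int (n e0) *\<^sub>R pr e0 + (\<Sum>e\<in>E'. of_int (n e) *\<^sub>R pr e)"
      unfolding y using E'(1,4,5) by (simp add: linear_add[OF lin] linear_scale[OF lin] linear_sum[OF lin])
    also have "\<dots> = of_int (n e0) *\<^sub>R (- (\<Sum>e\<in>E'. of_int (k e) *\<^sub>R s e)) + (\<Sum>e\<in>E'. of_int (n e) *\<^sub>R of_int (k e0) *\<^sub>R s e)"
      unfolding pe0 using pe by simp
    also have "\<dots> = (\<Sum>e\<in>E'. of_int (n e * k e0 - n e0 * k e) *\<^sub>R s e)"
      by (simp add: scaleR_sum_right sum_subtractf[symmetric] algebra_simps)
    also have "\<dots> \<in> int_span (s ` E')"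
      by (rule additive_group_sum[OF gs]) (rule int_span_base[OF finite_imageI[OF E'(1)] imageI])
    finally show "y \<in> int_span (s ` E')" .
  qed
  moreover have "additive_group (pr ` N)"
    by (rule additive_group_linear_image[OF lin zlattice_group[OF N]])
  ultimately obtain E2 where "independent E2" "pr ` N = int_span E2"
    using subgroup_int_span[OF finite_imageI[OF E'(1)] ind, of "pr ` N"] by blast
  then show ?thesis unfolding zlattice_iff pr_def by blast
qed

text \<open>Generators are projected off one at a time; after each step the next one is still a
  vector of the current lattice.\<close>

lemma zlattice_oproj:
  assumes "finite G" "zlattice N" "G \<subseteq> N"
  shows "zlattice (oproj G ` N)"
  using assms
proof (induction G rule: finite_induct)
  case empty
  have "oproj {} u = u" for u :: 'a by (rule oproj_ident) (simp add: orthogonal_comp_span_iff')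
  then show ?case using empty by simp
next
  case (insert v G)
  have "oproj (insert v G) ` N = oproj {oproj G v} ` (oproj G ` N)"
    unfolding image_image by (rule image_cong[OF refl oproj_insert])
  moreover have "zlattice (oproj {oproj G v} ` (oproj G ` N))"
    by (rule zlattice_oproj_single[OF insert.IH]) (use insert.prems in auto)
  ultimately show ?case by simp
qed

lemma span_inner_eqI:
  fixes x y :: "'v::euclidean_space"
  assumes "x \<in> span E" "y \<in> span E" "\<And>e. e \<in> E \<Longrightarrow> x \<bullet> e = y \<bullet> e"
  shows "x = y"
proof -
  have "x - y \<in> (span E)\<^sup>\<bottom>" using assms(3) by (simp add: orthogonal_comp_span_iff' inner_diff_left)
  moreover have "x - y \<in> span E" by (rule span_diff[OF assms(1,2)])
  ultimately have "(x - y) \<bullet> (x - y) = 0" unfolding orthogonal_comp_span_iff by blast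
  then show ?thesis by simp
qed

lemma exists_dual_basis:
  fixes E :: "'v::euclidean_space set"
  assumes "independent E"
  shows "\<exists>\<delta>. \<forall>e\<in>E. \<delta> e \<in> span E \<and> (\<forall>e'\<in>E. \<delta> e \<bullet> e' = (if e = e' then 1 else 0))"
proof -
  have "\<exists>d. d \<in> span E \<and> (\<forall>e'\<in>E. d \<bullet> e' = (if e = e' then 1 else 0))" if e: "e \<in> E" for e
  proof -
    \<comment> \<open>The dual vector of \<open>e\<close> is its component orthogonal to the other
      basis vectors, scaled to have inner product 1 with \<open>e\<close>.\<close>
    define w where "w = oproj (E - {e}) e"
    have "e \<notin> span (E - {e})" using assms e unfolding dependent_def by blast
    then have w0: "w \<noteq> 0" by (simp add: w_def oproj_eq_zero_iff)
    have diff: "e - w \<in> span (E - {e})" unfolding w_def by (rule oproj_diff)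
    have perp: "w \<in> (span (E - {e}))\<^sup>\<bottom>" unfolding w_def by (rule oproj_perp)
    have "w \<bullet> (e - w) = 0" using perp diff unfolding orthogonal_comp_span_iff by blast
    then have we: "w \<bullet> e = w \<bullet> w" by (simp add: inner_diff_right)
    have "e - (e - w) \<in> span E"
      using span_diff[OF span_base[OF e] subsetD[OF span_mono diff]] by blast
    then have "(1 / (w \<bullet> w)) *\<^sub>R w \<in> span E" by (intro span_scale) simp
    moreover have "((1 / (w \<bullet> w)) *\<^sub>R w) \<bullet> e' = (if e = e' then 1 else 0)" if e': "e' \<in> E" for e'
      using w0 we perp e' by (auto simp: orthogonal_comp_span_iff')
    ultimately show ?thesis by blast
  qed
  then show ?thesis by metis
qed

lemma dual_lattice_span: "m \<in> dual_lattice N \<Longrightarrow> m \<in> span N"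
  and dual_lattice_Ints: "m \<in> dual_lattice N \<Longrightarrow> u \<in> N \<Longrightarrow> m \<bullet> u \<in> \<int>"
  by (simp_all add: dual_lattice_def)

lemma additive_group_dual_lattice: "additive_group (dual_lattice N)"
  by (auto simp: additive_group_def dual_lattice_def span_zero span_diff inner_diff_left)

lemma dual_lattice_int_span_iff:
  assumes "finite E"
  shows "m \<in> dual_lattice (int_span E) \<longleftrightarrow> m \<in> span E \<and> (\<forall>e\<in>E. m \<bullet> e \<in> \<int>)"
proof
  assume "m \<in> dual_lattice (int_span E)"
  then show "m \<in> span E \<and> (\<forall>e\<in>E. m \<bullet> e \<in> \<int>)"
    using int_span_base[OF assms] by (auto simp: dual_lattice_def span_int_span[OF assms])
next
  assume m: "m \<in> span E \<and> (\<forall>e\<in>E. m \<bullet> e \<in> \<int>)"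
  have "m \<bullet> u \<in> \<int>" if "u \<in> int_span E" for u
  proof -
    obtain k :: "'a \<Rightarrow> int" where u: "u = (\<Sum>e\<in>E. of_int (k e) *\<^sub>R e)" using \<open>u \<in> int_span E\<close> by (auto simp: int_span_def)
    show ?thesis unfolding u inner_sum_right inner_scaleR_right using m by (intro Ints_sum Ints_mult) auto
  qed
  then show "m \<in> dual_lattice (int_span E)"
    using m by (simp add: dual_lattice_def span_int_span[OF assms])
qed

text \<open>A dual basis consists of elements of the dual lattice, and every vector of the span is
  expanded in it.\<close>

lemma span_dual_lattice:
  fixes N :: "'v::euclidean_space set"
  assumes "zlattice N" shows "span (dual_lattice N) = span N"
proof
  show "span (dual_lattice N) \<subseteq> span N"
    by (rule span_minimal[OF _ subspace_span]) (auto simp: dual_lattice_def)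
  obtain E where E: "independent E" "finite E" "N = int_span E" using zlattice_basis[OF assms] .
  obtain \<delta> where \<delta>: "\<forall>e\<in>E. \<delta> e \<in> span E \<and> (\<forall>e'\<in>E. \<delta> e \<bullet> e' = (if e = e' then 1 else 0))"
    using exists_dual_basis[OF E(1)] by blast
  have "x \<in> span (dual_lattice N)" if x: "x \<in> span E" for x
  proof -
    have \<delta>N: "\<delta> e \<in> dual_lattice N" if "e \<in> E" for e
      unfolding E(3) dual_lattice_int_span_iff[OF E(2)] using \<delta> that by simp
    have "x = (\<Sum>e\<in>E. (x \<bullet> e) *\<^sub>R \<delta> e)"
    proof (rule span_inner_eqI[OF x])
      show "(\<Sum>e\<in>E. (x \<bullet> e) *\<^sub>R \<delta> e) \<in> span E" using \<delta> by (intro span_sum span_scale) auto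
      fix e assume e: "e \<in> E"
      have "(\<Sum>e\<in>E. (x \<bullet> e) *\<^sub>R \<delta> e) \<bullet> e = (\<Sum>e'\<in>E. if e' = e then x \<bullet> e' else 0)"
        unfolding inner_sum_left by (rule sum.cong) (use \<delta> e in auto)
      then show "x \<bullet> e = (\<Sum>e\<in>E. (x \<bullet> e) *\<^sub>R \<delta> e) \<bullet> e" using e E(2) by simp
    qed
    also have "\<dots> \<in> span (dual_lattice N)" using \<delta>N by (intro span_sum span_scale span_base)
    finally show ?thesis .
  qed
  then show "span N \<subseteq> span (dual_lattice N)" using E(2,3) span_int_span by auto
qed

section \<open>Cones, faces and their monoids\<close>

lemma fan_cone_convex_cone: "fan_cone N \<tau> \<Longrightarrow> convex_cone \<tau>"
  unfolding fan_cone_def using convex_cone_convex_cone_hull by blast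

text \<open>Differences of elements of the cone form a subspace, as a negative scalar merely
  exchanges the two terms.\<close>

lemma convex_cone_span_diff:
  fixes \<sigma> :: "'v::euclidean_space set"
  assumes "convex_cone \<sigma>" "x \<in> span \<sigma>"
  obtains s t where "s \<in> \<sigma>" "t \<in> \<sigma>" "x = s - t"
proof -
  define D where "D = {s - t | s t. s \<in> \<sigma> \<and> t \<in> \<sigma>}"
  note c = convex_cone_contains_0[OF assms(1)] convex_cone_add[OF assms(1)] convex_cone_scaleR[OF assms(1)]
  have "subspace D"
    unfolding subspace_def
  proof (intro conjI ballI allI)
    show "0 \<in> D" using c(1) by (force simp: D_def)
    fix x y assume "x \<in> D" "y \<in> D"
    then obtain s t s' t' where "s \<in> \<sigma>" "t \<in> \<sigma>" "x = s - t" "s' \<in> \<sigma>" "t' \<in> \<sigma>" "y = s' - t'" by (auto simp: D_def)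
    then have "x + y = (s + s') - (t + t')" "s + s' \<in> \<sigma>" "t + t' \<in> \<sigma>" using c by auto
    then show "x + y \<in> D" unfolding D_def by blast
  next
    fix r x assume "x \<in> D"
    then obtain s t where st: "s \<in> \<sigma>" "t \<in> \<sigma>" "x = s - t" by (auto simp: D_def)
    show "r *\<^sub>R x \<in> D"
    proof (cases "0 \<le> r")
      case True
      then have "r *\<^sub>R x = r *\<^sub>R s - r *\<^sub>R t" "r *\<^sub>R s \<in> \<sigma>" "r *\<^sub>R t \<in> \<sigma>" using st c by (auto simp: scaleR_right_diff_distrib)
      then show ?thesis unfolding D_def by blast
    next
      case False
      then have "r *\<^sub>R x = (- r) *\<^sub>R t - (- r) *\<^sub>R s" "(- r) *\<^sub>R t \<in> \<sigma>" "(- r) *\<^sub>R s \<in> \<sigma>"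
        using st c(3)[of "- r"] by (auto simp: scaleR_right_diff_distrib)
      then show ?thesis unfolding D_def by blast
    qed
  qed
  moreover have "\<sigma> \<subseteq> D" unfolding D_def using c(1) by force
  ultimately have "span \<sigma> \<subseteq> D" by (intro span_minimal)
  then show ?thesis using assms(2) that unfolding D_def by blast
qed

text \<open>For cones the segment condition defining faces can be rescaled into a condition on sums,
  which passes easily to quotients and to monoids.\<close>

lemma is_face_cone_iff:
  fixes \<tau> :: "'v::euclidean_space set"
  assumes \<tau>: "convex_cone \<tau>"
  shows "is_face \<rho> \<tau> \<longleftrightarrow> \<rho> \<subseteq> \<tau> \<and> convex_cone \<rho> \<and> (\<forall>a\<in>\<tau>. \<forall>b\<in>\<tau>. a + b \<in> \<rho> \<longrightarrow> a \<in> \<rho> \<and> b \<in> \<rho>)"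
proof
  assume "is_face \<rho> \<tau>"
  then have f: "\<rho> face_of \<tau>" "\<rho> \<noteq> {}" by (auto simp: is_face_def)
  have con: "conic \<rho>" using face_of_conic[OF _ f(1)] \<tau> by (simp add: convex_cone_def)
  have cc: "convex_cone \<rho>" using con f face_of_imp_convex by (simp add: convex_cone_def)
  have "a \<in> \<rho> \<and> b \<in> \<rho>" if ab: "a \<in> \<tau>" "b \<in> \<tau>" "a + b \<in> \<rho>" for a b
  proof (cases "a = b")
    case True
    then have "(1/2) *\<^sub>R (a + b) = a" by (simp add: scaleR_2[symmetric])
    then show ?thesis using convex_cone_scaleR[OF cc _ ab(3), of "1/2"] True by simp
  next
    case False
    \<comment> \<open>The sum is the midpoint of \<open>2 a\<close> and \<open>2 b\<close>; equal
      summands were split off because their open segment is empty.\<close>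
    have "a + b \<in> open_segment (2 *\<^sub>R a) (2 *\<^sub>R b)"
      using False by (auto simp: in_segment intro!: exI[of _ "1/2"])
    then have "2 *\<^sub>R a \<in> \<rho> \<and> 2 *\<^sub>R b \<in> \<rho>"
      using face_ofD[OF f(1)] convex_cone_scaleR[OF \<tau>, of 2] ab by simp
    then show ?thesis using convex_cone_scaleR[OF cc, of "1/2" "2 *\<^sub>R a"] convex_cone_scaleR[OF cc, of "1/2" "2 *\<^sub>R b"] by simp
  qed
  then show "\<rho> \<subseteq> \<tau> \<and> convex_cone \<rho> \<and> (\<forall>a\<in>\<tau>. \<forall>b\<in>\<tau>. a + b \<in> \<rho> \<longrightarrow> a \<in> \<rho> \<and> b \<in> \<rho>)"
    using cc face_of_imp_subset[OF f(1)] by blast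
next
  assume r: "\<rho> \<subseteq> \<tau> \<and> convex_cone \<rho> \<and> (\<forall>a\<in>\<tau>. \<forall>b\<in>\<tau>. a + b \<in> \<rho> \<longrightarrow> a \<in> \<rho> \<and> b \<in> \<rho>)"
  have seg: "a \<in> \<rho> \<and> b \<in> \<rho>" if ab: "a \<in> \<tau>" "b \<in> \<tau>" "x \<in> \<rho>" "x \<in> open_segment a b" for a b x
  proof -
    obtain u where u: "0 < u" "u < 1" "x = (1 - u) *\<^sub>R a + u *\<^sub>R b" using ab(4) by (auto simp: in_segment)
    have "(1 - u) *\<^sub>R a \<in> \<tau>" "u *\<^sub>R b \<in> \<tau>" using convex_cone_scaleR[OF \<tau>] u ab by auto
    then have 1: "(1 - u) *\<^sub>R a \<in> \<rho>" "u *\<^sub>R b \<in> \<rho>" using r ab(3) u(3) by blast+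
    have cc: "convex_cone \<rho>" using r by blast
    show ?thesis
      using convex_cone_scaleR[OF cc _ 1(1), of "1 / (1 - u)"] convex_cone_scaleR[OF cc _ 1(2), of "1 / u"] u by simp
  qed
  have "convex \<rho>" "\<rho> \<noteq> {}" "\<rho> \<subseteq> \<tau>" using r by (simp_all add: convex_cone_def)
  moreover have "\<forall>a\<in>\<tau>. \<forall>b\<in>\<tau>. \<forall>x\<in>\<rho>. x \<in> open_segment a b \<longrightarrow> a \<in> \<rho> \<and> b \<in> \<rho>"
    by (intro ballI impI) (rule seg)
  ultimately show "is_face \<rho> \<tau>" unfolding is_face_def face_of_def by simp
qed

lemma is_face_refl: "convex_cone \<tau> \<Longrightarrow> is_face \<tau> \<tau>"
  by (simp add: is_face_cone_iff)

lemma is_face_subset: "is_face \<rho> \<tau> \<Longrightarrow> \<rho> \<subseteq> \<tau>"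
  unfolding is_face_def using face_of_imp_subset by blast

lemma cone_hull_subset_span: "convex_cone hull G \<subseteq> span G"
  by (rule hull_minimal) (auto simp: span_superset convex_cone_span)

lemma fan_cone_span:
  fixes N :: "'v::euclidean_space set"
  assumes "finite G" "G \<subseteq> N" "\<tau> = convex_cone hull G"
  shows "span (\<tau> \<inter> N) = span G" "span \<tau> = span G"
proof -
  have G: "G \<subseteq> \<tau>" using assms(3) hull_subset[of G convex_cone] by simp
  have \<tau>: "\<tau> \<subseteq> span G" using assms(3) cone_hull_subset_span by simp
  show "span (\<tau> \<inter> N) = span G"
    by (intro equalityI span_minimal subspace_span) (use G \<tau> assms(2) span_base[of _ "\<tau> \<inter> N"] in auto)
  show "span \<tau> = span G"
    by (intro equalityI span_minimal subspace_span) (use G \<tau> span_base[of _ "\<tau>"] in auto)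
qed

lemma cone_monoid_dual: "m \<in> cone_monoid N \<tau> \<Longrightarrow> m \<in> dual_lattice N"
  and cone_perp_dual: "m \<in> cone_perp N \<tau> \<Longrightarrow> m \<in> dual_lattice N"
  by (simp_all add: cone_monoid_def cone_perp_def)

lemma cone_monoid_zero: "0 \<in> cone_monoid N \<tau>"
  using additive_group_zero[OF additive_group_dual_lattice] by (auto simp: cone_monoid_def)

lemma cone_monoid_add: "m \<in> cone_monoid N \<tau> \<Longrightarrow> n \<in> cone_monoid N \<tau> \<Longrightarrow> m + n \<in> cone_monoid N \<tau>"
  using additive_group_add[OF additive_group_dual_lattice] by (auto simp: cone_monoid_def inner_add_left)

lemma additive_group_cone_perp: "additive_group (cone_perp N \<tau>)"
  using additive_group_dual_lattice[of N] by (auto simp: additive_group_def cone_perp_def inner_diff_left)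

lemma cone_perp_subset_monoid: "cone_perp N \<tau> \<subseteq> cone_monoid N \<tau>"
  by (auto simp: cone_monoid_def cone_perp_def)

lemma cone_monoid_mono: "\<rho> \<subseteq> \<tau> \<Longrightarrow> cone_monoid N \<tau> \<subseteq> cone_monoid N \<rho>"
  and cone_perp_mono: "\<rho> \<subseteq> \<tau> \<Longrightarrow> cone_perp N \<tau> \<subseteq> cone_perp N \<rho>"
  by (auto simp: cone_monoid_def cone_perp_def)

text \<open>Two nonnegative values with sum zero are both zero. So the orthogonal lattice cuts out a
  face of the monoid, which is what makes the complementary monomials span an ideal.\<close>

lemma cone_perp_face:
  assumes "m \<in> cone_monoid N \<sigma>" "n \<in> cone_monoid N \<sigma>" "m + n \<in> cone_perp N \<sigma>"
  shows "m \<in> cone_perp N \<sigma>" "n \<in> cone_perp N \<sigma>"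
proof -
  have "m \<bullet> u = 0 \<and> n \<bullet> u = 0" if u: "u \<in> \<sigma>" for u
  proof -
    have "m \<bullet> u + n \<bullet> u = 0" "0 \<le> m \<bullet> u" "0 \<le> n \<bullet> u"
      using assms u by (auto simp: cone_monoid_def cone_perp_def inner_add_left)
    then show ?thesis by linarith
  qed
  then show "m \<in> cone_perp N \<sigma>" "n \<in> cone_perp N \<sigma>"
    using assms(1,2) by (auto simp: cone_monoid_def cone_perp_def)
qed

lemma cone_monoid_generators:
  assumes "\<tau> = convex_cone hull G"
  shows "m \<in> cone_monoid N \<tau> \<longleftrightarrow> m \<in> dual_lattice N \<and> (\<forall>g\<in>G. 0 \<le> m \<bullet> g)"
proof -
  have "convex_cone hull G \<subseteq> {u. 0 \<le> m \<bullet> u} \<longleftrightarrow> G \<subseteq> {u. 0 \<le> m \<bullet> u}"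
    by (rule subset_hull) (rule convex_cone_halfspace_ge)
  then show ?thesis unfolding cone_monoid_def assms by auto
qed

locale lattice_cone =
  fixes N :: "'v::euclidean_space set" and \<sigma> :: "'v set"
  assumes zlattice: "zlattice N" and fan_cone: "fan_cone N \<sigma>"
begin

lemma span_cone: "span (\<sigma> \<inter> N) = span \<sigma>"
  using fan_cone fan_cone_span unfolding fan_cone_def by metis

lemma quot_eq: "quot N \<sigma> = oproj \<sigma>"
  unfolding quot_eq_oproj by (rule oproj_span_cong[OF span_cone])

lemma linear_quot: "linear (quot N \<sigma>)"
  unfolding quot_eq by (rule linear_oproj)

lemma quot_zero_iff: "quot N \<sigma> u = 0 \<longleftrightarrow> u \<in> span \<sigma>"
  unfolding quot_eq by (rule oproj_eq_zero_iff)

lemma cone_perp_orthogonal: "m \<in> cone_perp N \<sigma> \<Longrightarrow> m \<in> (span \<sigma>)\<^sup>\<bottom>"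
  by (simp add: orthogonal_comp_span_iff' cone_perp_def)

lemma inner_quot: "m \<in> cone_perp N \<sigma> \<Longrightarrow> m \<bullet> quot N \<sigma> u = m \<bullet> u"
  unfolding quot_eq by (rule inner_oproj[OF cone_perp_orthogonal])

lemma zlattice_quot_lattice: "zlattice (quot_lattice N \<sigma>)"
proof -
  obtain G where G: "finite G" "G \<subseteq> N" "\<sigma> = convex_cone hull G" using fan_cone by (auto simp: fan_cone_def)
  have "quot N \<sigma> = oproj G" unfolding quot_eq by (rule oproj_span_cong) (rule fan_cone_span(2)[OF G])
  then show ?thesis unfolding quot_lattice_def using zlattice_oproj[OF G(1) zlattice G(2)] by simp
qed

lemma cone_subset_span: "\<sigma> \<subseteq> span N"
proof -
  obtain G where G: "G \<subseteq> N" "\<sigma> = convex_cone hull G" using fan_cone by (auto simp: fan_cone_def)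
  then show ?thesis using cone_hull_subset_span[of G] span_mono[OF G(1)] by blast
qed

lemma span_quot_lattice: "span (quot_lattice N \<sigma>) = span N \<inter> (span \<sigma>)\<^sup>\<bottom>"
proof -
  have 1: "span (quot_lattice N \<sigma>) = quot N \<sigma> ` span N"
    unfolding quot_lattice_def by (rule linear_span_image[OF linear_quot])
  have "quot N \<sigma> u \<in> span N \<inter> (span \<sigma>)\<^sup>\<bottom>" if "u \<in> span N" for u
  proof -
    have "u - quot N \<sigma> u \<in> span N"
      unfolding quot_eq using oproj_diff[of u \<sigma>] span_minimal[OF cone_subset_span subspace_span] by blast
    then have "u - (u - quot N \<sigma> u) \<in> span N" by (rule span_diff[OF that])
    then show ?thesis unfolding quot_eq using oproj_perp[of \<sigma> u] by simp
  qed
  moreover have "u = quot N \<sigma> u" if "u \<in> (span \<sigma>)\<^sup>\<bottom>" for u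
    unfolding quot_eq using oproj_ident[OF that] by simp
  ultimately show ?thesis unfolding 1 by blast
qed

text \<open>A functional orthogonal to the cone takes the same value on a vector and on its
  projection, so integrality on \<open>N\<close> and on the quotient lattice agree.\<close>

lemma dual_quot_lattice: "dual_lattice (quot_lattice N \<sigma>) = cone_perp N \<sigma>"
proof (intro equalityI subsetI)
  fix m assume m: "m \<in> dual_lattice (quot_lattice N \<sigma>)"
  then have 1: "m \<in> span N" "m \<in> (span \<sigma>)\<^sup>\<bottom>"
    using dual_lattice_span[OF m] span_quot_lattice by auto
  have "m \<bullet> u \<in> \<int>" if "u \<in> N" for u
    using dual_lattice_Ints[OF m, of "quot N \<sigma> u"] that inner_oproj[OF 1(2), of u]
    by (simp add: quot_lattice_def quot_eq)
  then show "m \<in> cone_perp N \<sigma>"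
    using 1 by (auto simp: cone_perp_def dual_lattice_def orthogonal_comp_span_iff')
next
  fix m assume m: "m \<in> cone_perp N \<sigma>"
  then show "m \<in> dual_lattice (quot_lattice N \<sigma>)"
    using cone_perp_orthogonal[OF m] span_quot_lattice inner_quot[OF m]
    by (auto simp: dual_lattice_def quot_lattice_def cone_perp_def)
qed

lemma span_cone_perp: "span (cone_perp N \<sigma>) = span N \<inter> (span \<sigma>)\<^sup>\<bottom>"
  using span_dual_lattice[OF zlattice_quot_lattice] dual_quot_lattice span_quot_lattice by simp

text \<open>A basis of the quotient lattice is lifted to \<open>N\<close>; the retraction is the
  dual of the resulting section. It involves a choice.\<close>

lemma cone_perp_retraction:
  obtains r where "linear r" "\<And>m. m \<in> dual_lattice N \<Longrightarrow> r m \<in> cone_perp N \<sigma>"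
    "\<And>m. m \<in> cone_perp N \<sigma> \<Longrightarrow> r m = m"
proof -
  obtain E where E: "independent E" "finite E" "quot_lattice N \<sigma> = int_span E"
    using zlattice_basis[OF zlattice_quot_lattice] .
  obtain \<delta> where \<delta>: "\<And>e. e \<in> E \<Longrightarrow> \<delta> e \<in> span E" "\<And>e e'. e \<in> E \<Longrightarrow> e' \<in> E \<Longrightarrow> \<delta> e \<bullet> e' = (if e = e' then 1 else 0)"
    using exists_dual_basis[OF E(1)] by metis
  have "E \<subseteq> quot N \<sigma> ` N"
    using int_span_base[OF E(2)] E(3) unfolding quot_lattice_def by blast
  then have "\<forall>e\<in>E. \<exists>u\<in>N. quot N \<sigma> u = e" by blast
  then obtain s where s: "\<And>e. e \<in> E \<Longrightarrow> s e \<in> N" "\<And>e. e \<in> E \<Longrightarrow> quot N \<sigma> (s e) = e" by metis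
  define r where "r m = (\<Sum>e\<in>E. (m \<bullet> s e) *\<^sub>R \<delta> e)" for m
  have r_span: "r m \<in> span E" for m unfolding r_def by (intro span_sum span_scale \<delta>(1))
  have r_inner: "r m \<bullet> e = m \<bullet> s e" if e: "e \<in> E" for m e
  proof -
    have "r m \<bullet> e = (\<Sum>e'\<in>E. if e' = e then m \<bullet> s e' else 0)"
      unfolding r_def inner_sum_left by (rule sum.cong) (simp_all add: \<delta>(2) e)
    then show ?thesis using e E(2) by simp
  qed
  have iff: "m \<in> cone_perp N \<sigma> \<longleftrightarrow> m \<in> span E \<and> (\<forall>e\<in>E. m \<bullet> e \<in> \<int>)" for m
    unfolding dual_quot_lattice[symmetric] E(3) by (rule dual_lattice_int_span_iff[OF E(2)])
  show ?thesis
  proof (rule that[of r])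
    show "linear r"
      unfolding r_def by (intro linearI)
        (simp_all add: inner_add_left scaleR_add_left sum.distrib scaleR_sum_right)
    show "r m \<in> cone_perp N \<sigma>" if "m \<in> dual_lattice N" for m
      unfolding iff using r_span r_inner dual_lattice_Ints[OF that] s(1) by simp
    show "r m = m" if m: "m \<in> cone_perp N \<sigma>" for m
    proof (rule span_inner_eqI[of _ E])
      show "m \<in> span E" using m iff by blast
      show "r m \<bullet> e = m \<bullet> e" if "e \<in> E" for e
        using r_inner[OF that] inner_quot[OF m, of "s e"] s(2)[OF that] by simp
    qed (rule r_span)
  qed
qed

end

text \<open>A large multiple of \<open>a\<close> is rounded to an element of \<open>L\<close>. The
  rounding error stays bounded while the positive inner products grow.\<close>

lemma additive_group_positive_approx:
  fixes L :: "'v::euclidean_space set"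
  assumes L: "additive_group L" and a: "a \<in> span L" and D: "finite D" "\<And>g. g \<in> D \<Longrightarrow> 0 < a \<bullet> g"
  obtains m where "m \<in> L" "\<And>g. g \<in> D \<Longrightarrow> 0 < m \<bullet> g"
proof -
  obtain T c where T: "finite T" "T \<subseteq> L" "a = (\<Sum>l\<in>T. c l *\<^sub>R l)"
    using a by (auto simp: span_explicit)
  \<comment> \<open>\<open>K g\<close> bounds the total rounding error in the inner product with
    \<open>g\<close>, independently of \<open>n\<close>.\<close>
  define K where "K g = (\<Sum>l\<in>T. \<bar>l \<bullet> g\<bar>)" for g
  obtain n :: nat where n: "\<And>g. g \<in> D \<Longrightarrow> K g < real n * (a \<bullet> g)"
  proof -
    have "\<exists>n::nat. \<forall>g\<in>D. K g < real n * (a \<bullet> g)"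
      using D
    proof (induction D rule: finite_induct)
      case (insert g D)
      then obtain n where n: "\<forall>g\<in>D. K g < real n * (a \<bullet> g)" by auto
      obtain n' :: nat where "K g < real n' * (a \<bullet> g)" using reals_Archimedean3[of "a \<bullet> g"] insert.prems[of g] by auto
      then have "K h < real (max n n') * (a \<bullet> h)" if "h \<in> insert g D" for h
      proof -
        have pos: "0 < a \<bullet> h" using insert.prems that by auto
        have "real n * (a \<bullet> h) \<le> real (max n n') * (a \<bullet> h)" "real n' * (a \<bullet> h) \<le> real (max n n') * (a \<bullet> h)"
          using pos by (auto intro!: mult_right_mono)
        then show ?thesis using n \<open>K g < real n' * (a \<bullet> g)\<close> that by fastforce
      qed
      then show ?case by blast
    qed simp
    then show ?thesis using that by blast
  qed
  define m where "m = (\<Sum>l\<in>T. of_int \<lfloor>real n * c l\<rfloor> *\<^sub>R l)"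
  show ?thesis
  proof (rule that[of m])
    show "m \<in> L" unfolding m_def by (rule additive_group_sum[OF L]) (use T in blast)
    fix g assume g: "g \<in> D"
    have "real n * (a \<bullet> g) - m \<bullet> g = (\<Sum>l\<in>T. (real n * c l - of_int \<lfloor>real n * c l\<rfloor>) * (l \<bullet> g))"
      by (simp add: m_def T(3) inner_sum_left sum_distrib_left sum_subtractf left_diff_distrib mult.assoc)
    also have "\<dots> \<le> (\<Sum>l\<in>T. \<bar>l \<bullet> g\<bar>)"
    proof (rule sum_mono)
      fix l
      define t where "t = real n * c l - of_int \<lfloor>real n * c l\<rfloor>"
      have t: "0 \<le> t" "t \<le> 1" unfolding t_def by linarith+
      have "t * (l \<bullet> g) \<le> t * \<bar>l \<bullet> g\<bar>" using t by (intro mult_left_mono) auto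
      also have "\<dots> \<le> 1 * \<bar>l \<bullet> g\<bar>" using t by (intro mult_right_mono) auto
      finally show "(real n * c l - of_int \<lfloor>real n * c l\<rfloor>) * (l \<bullet> g) \<le> \<bar>l \<bullet> g\<bar>" by (simp add: t_def)
    qed
    finally show "0 < m \<bullet> g" using n[OF g] unfolding K_def by linarith
  qed
qed

text \<open>Faces of polyhedra are exposed by a real functional. It can be taken in the span of the
  lattice elements orthogonal to \<rho> and then approximated by one of these without losing
  positivity on the generators of \<tau> outside \<rho>.\<close>

lemma exposing_monoid_element:
  fixes N :: "'v::euclidean_space set"
  assumes N: "zlattice N" and \<tau>: "fan_cone N \<tau>" and \<rho>: "fan_cone N \<rho>" and face: "is_face \<rho> \<tau>"
  obtains m where "m \<in> cone_monoid N \<tau>" "\<And>u. u \<in> \<tau> \<Longrightarrow> m \<bullet> u = 0 \<longleftrightarrow> u \<in> \<rho>"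
proof -
  interpret R: lattice_cone N \<rho> using N \<rho> by unfold_locales
  interpret T: lattice_cone N \<tau> using N \<tau> by unfold_locales
  obtain G where G: "finite G" "G \<subseteq> N" "\<tau> = convex_cone hull G" using \<tau> by (auto simp: fan_cone_def)
  have "\<rho> face_of \<tau>" using face by (simp add: is_face_def)
  then have "\<rho> exposed_face_of \<tau>"
    using exposed_face_of_polyhedron polyhedron_convex_cone_hull[OF G(1)] G(3) by blast
  then obtain a b where ab: "\<tau> \<subseteq> {x. a \<bullet> x \<le> b}" "\<rho> = \<tau> \<inter> {x. a \<bullet> x = b}" by (auto simp: exposed_face_of_def)
  have "0 \<in> \<rho>" by (rule convex_cone_contains_0[OF fan_cone_convex_cone[OF \<rho>]])
  then have b: "b = 0" using ab by auto
  have neg: "a \<bullet> x \<le> 0" if "x \<in> \<tau>" for x using ab(1) b that by blast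
  have zero: "x \<in> \<rho> \<longleftrightarrow> x \<in> \<tau> \<and> a \<bullet> x = 0" for x using ab(2) b by blast
  \<comment> \<open>The component of \<open>- a\<close> in the span of \<open>N\<close>, where the
    dual lattice lives; the sign makes it nonnegative on \<tau>.\<close>
  define a' where "a' = (- a) - oproj N (- a)"
  have a'N: "a' \<in> span N" unfolding a'_def by (rule oproj_diff)
  have a': "a' \<bullet> x = - (a \<bullet> x)" if x: "x \<in> span N" for x
  proof -
    have "oproj N (- a) \<bullet> x = 0" using oproj_perp[of N "- a"] x unfolding orthogonal_comp_span_iff by blast
    then show ?thesis by (simp add: a'_def inner_diff_left)
  qed
  have "a' \<in> (span \<rho>)\<^sup>\<bottom>"
    unfolding orthogonal_comp_span_iff'
    using a' zero R.cone_subset_span by auto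
  then have "a' \<in> span (cone_perp N \<rho>)" using a'N R.span_cone_perp by blast
  moreover have "0 < a' \<bullet> g" if g: "g \<in> G - \<rho>" for g
  proof -
    have g\<tau>: "g \<in> \<tau>" using g G(3) hull_subset[of G convex_cone] by blast
    then have "a \<bullet> g \<noteq> 0" using zero g by blast
    then show ?thesis using a'[of g] neg[OF g\<tau>] T.cone_subset_span g\<tau> by force
  qed
  ultimately obtain m where m: "m \<in> cone_perp N \<rho>" "\<And>g. g \<in> G - \<rho> \<Longrightarrow> 0 < m \<bullet> g"
    using additive_group_positive_approx[OF additive_group_cone_perp, of a' N \<rho> "G - \<rho>"] G(1) by blast
  have c\<tau>: "convex_cone \<tau>" and c\<rho>: "convex_cone \<rho>" using \<tau> \<rho> fan_cone_convex_cone by blast+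
  have m\<rho>: "m \<bullet> u = 0" if "u \<in> \<rho>" for u using m(1) that by (simp add: cone_perp_def)
  \<comment> \<open>A convex cone containing the generators, so what holds for these extends to all
    of \<tau>.\<close>
  define H where "H = {u \<in> \<tau>. 0 \<le> m \<bullet> u \<and> (m \<bullet> u = 0 \<longrightarrow> u \<in> \<rho>)}"
  have "convex_cone hull G \<subseteq> H"
  proof (rule hull_minimal)
    show "G \<subseteq> H"
    proof
      fix g assume g: "g \<in> G"
      then have "g \<in> \<tau>" using G(3) hull_subset[of G convex_cone] by blast
      then show "g \<in> H" using m\<rho>[of g] m(2)[of g] g by (cases "g \<in> \<rho>") (auto simp: H_def less_imp_le)
    qed
    show "convex_cone H"
      unfolding convex_cone_iff
    proof (intro conjI ballI allI impI)
      show "0 \<in> H" using convex_cone_contains_0[OF c\<tau>] convex_cone_contains_0[OF c\<rho>] by (simp add: H_def)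
      fix x y assume xy: "x \<in> H" "y \<in> H"
      have "x + y \<in> \<tau>" "0 \<le> m \<bullet> (x + y)" using xy convex_cone_add[OF c\<tau>] by (auto simp: H_def inner_add_right)
      moreover have "x + y \<in> \<rho>" if "m \<bullet> (x + y) = 0"
      proof -
        have "m \<bullet> x = 0" "m \<bullet> y = 0" using xy that by (auto simp: H_def inner_add_right)
        then show ?thesis using xy convex_cone_add[OF c\<rho>] by (auto simp: H_def)
      qed
      ultimately show "x + y \<in> H" by (simp add: H_def)
    next
      fix x and c :: real assume x: "x \<in> H" and c: "0 \<le> c"
      have "c *\<^sub>R x \<in> \<tau>" "0 \<le> m \<bullet> (c *\<^sub>R x)" using x c convex_cone_scaleR[OF c\<tau>] by (auto simp: H_def)
      moreover have "c *\<^sub>R x \<in> \<rho>" if "m \<bullet> (c *\<^sub>R x) = 0"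
      proof (cases "c = 0")
        case True then show ?thesis using convex_cone_contains_0[OF c\<rho>] by simp
      next
        case False
        then have "x \<in> \<rho>" using that x by (auto simp: H_def)
        then show ?thesis using convex_cone_scaleR[OF c\<rho> c] by blast
      qed
      ultimately show "c *\<^sub>R x \<in> H" by (simp add: H_def)
    qed
  qed
  then have H: "\<tau> \<subseteq> H" using G(3) by simp
  show ?thesis
  proof (rule that[of m])
    show "m \<in> cone_monoid N \<tau>"
      using m(1) H by (auto simp: cone_monoid_def cone_perp_def H_def)
    show "m \<bullet> u = 0 \<longleftrightarrow> u \<in> \<rho>" if "u \<in> \<tau>" for u
      using m\<rho> H that by (auto simp: H_def)
  qed
qed

text \<open>On generators outside \<rho> the inner product with \<open>m0\<close> is a positive
  integer, hence at least 1, so a large multiple outweighs the negative values of \<open>m\<close>;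
  on \<rho> nothing changes. In effect the monoid of \<rho> arises from that of \<tau> by inverting
  \<open>m0\<close>.\<close>

lemma shift_into_cone_monoid:
  fixes N :: "'v::euclidean_space set"
  assumes \<tau>: "fan_cone N \<tau>" and m0: "m0 \<in> cone_monoid N \<tau>" "\<And>u. u \<in> \<tau> \<Longrightarrow> m0 \<bullet> u = 0 \<longleftrightarrow> u \<in> \<rho>"
    and m: "m \<in> cone_monoid N \<rho>"
  shows "\<exists>k::nat. m + real k *\<^sub>R m0 \<in> cone_monoid N \<tau>"
proof -
  obtain G where G: "finite G" "G \<subseteq> N" "\<tau> = convex_cone hull G" using \<tau> by (auto simp: fan_cone_def)
  have G\<tau>: "G \<subseteq> \<tau>" using G(3) hull_subset[of G convex_cone] by blast
  obtain k :: nat where k: "\<And>g. g \<in> G \<Longrightarrow> - (m \<bullet> g) \<le> real k"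
  proof -
    obtain k :: nat where "Max (insert 0 ((\<lambda>g. - (m \<bullet> g)) ` G)) \<le> real k" using real_arch_simple by blast
    then have "\<forall>g\<in>G. - (m \<bullet> g) \<le> real k" using G(1) by (simp add: Max_le_iff)
    then show ?thesis using that by blast
  qed
  have "0 \<le> (m + real k *\<^sub>R m0) \<bullet> g" if g: "g \<in> G" for g
  proof (cases "g \<in> \<rho>")
    case True
    then have "0 \<le> m \<bullet> g" "m0 \<bullet> g = 0" using m m0(2)[of g] g G\<tau> by (auto simp: cone_monoid_def)
    then show ?thesis by (simp add: inner_add_left)
  next
    case False
    have "m0 \<bullet> g \<noteq> 0" "0 \<le> m0 \<bullet> g" "m0 \<bullet> g \<in> \<int>"
      using m0 False g G\<tau> G(2) dual_lattice_Ints[OF cone_monoid_dual[OF m0(1)], of g] by (auto simp: cone_monoid_def)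
    then have "1 \<le> m0 \<bullet> g" by (elim Ints_cases) auto
    then have "real k * 1 \<le> real k * (m0 \<bullet> g)" by (intro mult_left_mono) auto
    then show ?thesis using k[OF g] by (simp add: inner_add_left)
  qed
  moreover have "m + real k *\<^sub>R m0 \<in> dual_lattice N"
    using additive_group_add[OF additive_group_dual_lattice cone_monoid_dual[OF m]
        additive_group_of_int[OF additive_group_dual_lattice cone_monoid_dual[OF m0(1)], of "int k"]] by simp
  ultimately show ?thesis unfolding cone_monoid_generators[OF G(3)] by blast
qed

text \<open>Dickson's lemma for maps to tuples of naturals, by induction on the set \<open>V\<close>
  of coordinates.\<close>

lemma dickson:
  fixes k :: "'b \<Rightarrow> 'c \<Rightarrow> nat"
  assumes "finite V"
  shows "\<exists>F. finite F \<and> F \<subseteq> S \<and> (\<forall>m\<in>S. \<exists>f\<in>F. \<forall>v\<in>V. k f v \<le> k m v)"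
  using assms
proof (induction V arbitrary: S rule: finite_induct)
  case empty
  show ?case
  proof (cases "S = {}")
    case False
    then obtain s where "s \<in> S" by blast
    then show ?thesis by (intro exI[of _ "{s}"]) auto
  qed auto
next
  case (insert v V)
  obtain F0 where F0: "finite F0" "F0 \<subseteq> S" "\<forall>m\<in>S. \<exists>f\<in>F0. \<forall>v\<in>V. k f v \<le> k m v"
    using insert.IH[of S] by blast
  have "\<forall>n. \<exists>F. finite F \<and> F \<subseteq> {m\<in>S. k m v = n} \<and> (\<forall>m\<in>{m\<in>S. k m v = n}. \<exists>f\<in>F. \<forall>v\<in>V. k f v \<le> k m v)"
    by (rule allI) (rule insert.IH)
  from choice[OF this] obtain Fn where Fn0: "\<forall>n. finite (Fn n) \<and> Fn n \<subseteq> {m\<in>S. k m v = n} \<and>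
      (\<forall>m\<in>{m\<in>S. k m v = n}. \<exists>f\<in>Fn n. \<forall>v\<in>V. k f v \<le> k m v)" by blast
  then have Fn: "\<And>n. finite (Fn n)" "\<And>n. Fn n \<subseteq> {m\<in>S. k m v = n}"
    "\<And>n m. m \<in> {m\<in>S. k m v = n} \<Longrightarrow> \<exists>f\<in>Fn n. \<forall>v\<in>V. k f v \<le> k m v" by simp_all
  \<comment> \<open>Elements whose \<open>v\<close>-coordinate is at least \<open>b\<close> are
    dominated from \<open>F0\<close>. Below \<open>b\<close> only finitely many slices of constant
    \<open>v\<close>-coordinate remain, each settled by the induction hypothesis.\<close>
  define b where "b = Max (insert 0 ((\<lambda>f. k f v) ` F0))"
  show ?case
  proof (intro exI[of _ "F0 \<union> (\<Union>n<b. Fn n)"] conjI ballI)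
    show "finite (F0 \<union> (\<Union>n<b. Fn n))" using F0 Fn by auto
    show "F0 \<union> (\<Union>n<b. Fn n) \<subseteq> S" using F0 Fn by blast
    fix m assume m: "m \<in> S"
    show "\<exists>f\<in>F0 \<union> (\<Union>n<b. Fn n). \<forall>v\<in>insert v V. k f v \<le> k m v"
    proof (cases "b \<le> k m v")
      case True
      obtain f where f: "f \<in> F0" "\<forall>v\<in>V. k f v \<le> k m v" using F0(3) m by blast
      have "k f v \<le> b" unfolding b_def using F0(1) f(1) by (intro Max_ge) auto
      then show ?thesis using f True by (intro bexI[of _ f]) auto
    next
      case False
      obtain f where f: "f \<in> Fn (k m v)" "\<forall>v\<in>V. k f v \<le> k m v" using Fn(3)[of m "k m v"] m by blast
      then have "k f v = k m v" using Fn(2) by blast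
      then show ?thesis using f False by (intro bexI[of _ f]) auto
    qed
  qed
qed

text \<open>Gordan's lemma.  The absolute values of the coordinates enter as
  well, so that subtracting a dominated element makes the coordinates smaller.\<close>

lemma gordan:
  fixes N :: "'v::euclidean_space set"
  assumes N: "zlattice N" and \<tau>: "fan_cone N \<tau>"
  obtains G where "finite G" "G \<subseteq> cone_monoid N \<tau>"
    "\<And>C. 0 \<in> C \<Longrightarrow> (\<And>g m. g \<in> G \<Longrightarrow> m \<in> C \<Longrightarrow> g + m \<in> C) \<Longrightarrow> cone_monoid N \<tau> \<subseteq> C"
proof -
  obtain E where E: "independent E" "finite E" "N = int_span E" using zlattice_basis[OF N] .
  obtain G where G: "finite G" "G \<subseteq> N" "\<tau> = convex_cone hull G" using \<tau> by (auto simp: fan_cone_def)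
  define V where "V = E \<union> uminus ` E \<union> G"
  have finV: "finite V" using E G by (simp add: V_def)
  have EN: "E \<subseteq> N" using int_span_base[OF E(2)] E(3) by blast
  have VN: "V \<subseteq> N" using EN G(2) additive_group_uminus[OF zlattice_group[OF N]] by (auto simp: V_def)
  define k where "k m v = nat \<lfloor>m \<bullet> v\<rfloor>" for m v :: 'v
  define S where "S = cone_monoid N \<tau>"
  obtain F where F: "finite F" "F \<subseteq> S - {0}" "\<forall>m\<in>S - {0}. \<exists>f\<in>F. \<forall>v\<in>V. k f v \<le> k m v"
    using dickson[OF finV, of "S - {0}" k] by blast
  define \<mu> where "\<mu> m = (\<Sum>v\<in>E \<union> uminus ` E. k m v)" for m
  have int: "\<exists>z. m \<bullet> v = of_int z" if "m \<in> S" "v \<in> V" for m v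
    using dual_lattice_Ints[OF cone_monoid_dual, of m N \<tau> v] that VN unfolding S_def by (auto elim: Ints_cases)
  have step: "m - f \<in> S \<and> \<mu> (m - f) < \<mu> m" if m: "m \<in> S" and f: "f \<in> F" and le: "\<forall>v\<in>V. k f v \<le> k m v" for m f
  proof -
    have fS: "f \<in> S" "f \<noteq> 0" using f F by auto
    have "0 \<le> (m - f) \<bullet> g" if g: "g \<in> G" for g
    proof -
      have gV: "g \<in> V" using g by (simp add: V_def)
      obtain z z' where z: "m \<bullet> g = of_int z" "f \<bullet> g = of_int z'" using int[OF m gV] int[OF fS(1) gV] by blast
      have "0 \<le> m \<bullet> g" using m g unfolding S_def cone_monoid_generators[OF G(3)] by blast
      then show ?thesis using bspec[OF le gV] z by (simp add: k_def inner_diff_left)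
    qed
    moreover have "m - f \<in> dual_lattice N"
      using additive_group_diff[OF additive_group_dual_lattice cone_monoid_dual cone_monoid_dual] m fS(1)
      unfolding S_def .
    ultimately have 1: "m - f \<in> S" unfolding S_def cone_monoid_generators[OF G(3)] by blast
    \<comment> \<open>Domination at \<open>v\<close> and at \<open>- v\<close> means that the inner
      product of \<open>f\<close> with \<open>v\<close> has the sign of that of \<open>m\<close> and
      no larger absolute value, so positive parts subtract.\<close>
    have diff: "k (m - f) v + k f v = k m v" if v: "v \<in> E \<union> uminus ` E" for v
    proof -
      have vV: "v \<in> V" "- v \<in> V" using v by (auto simp: V_def)
      obtain z z' where z: "m \<bullet> v = of_int z" "f \<bullet> v = of_int z'" using int[OF m vV(1)] int[OF fS(1) vV(1)] by blast
      have "k f v \<le> k m v" "k f (- v) \<le> k m (- v)" using le vV by auto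
      then have "nat z' \<le> nat z" "nat (- z') \<le> nat (- z)" using z by (auto simp: k_def inner_minus_right)
      then have "nat (z - z') + nat z' = nat z" by linarith
      moreover have "(m - f) \<bullet> v = of_int (z - z')" using z by (simp add: inner_diff_left)
      ultimately show ?thesis using z unfolding k_def by (metis floor_of_int)
    qed
    have "\<exists>v\<in>E. f \<bullet> v \<noteq> 0"
    proof (rule ccontr)
      assume "\<not> (\<exists>v\<in>E. f \<bullet> v \<noteq> 0)"
      moreover have "f \<in> span E"
        using dual_lattice_span[OF cone_monoid_dual[of f N \<tau>]] fS(1) span_int_span[OF E(2)] E(3)
        unfolding S_def by blast
      ultimately have "f = 0" by (intro span_inner_eqI[of f E 0]) (auto simp: span_zero)
      then show False using fS by blast
    qed
    then obtain v where v: "v \<in> E" "f \<bullet> v \<noteq> 0" by blast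
    obtain z where z: "f \<bullet> v = of_int z" using int[OF fS(1), of v] v by (auto simp: V_def)
    then have "0 < k f v \<or> 0 < k f (- v)" using v z by (auto simp: k_def inner_minus_right)
    then obtain w where w: "w \<in> E \<union> uminus ` E" "0 < k f w" using v by blast
    have "\<mu> (m - f) < \<mu> m"
      unfolding \<mu>_def
    proof (rule sum_strict_mono_ex1)
      show "finite (E \<union> uminus ` E)" using E by simp
      show "\<forall>v\<in>E \<union> uminus ` E. k (m - f) v \<le> k m v" using diff by (metis le_add1)
      show "\<exists>v\<in>E \<union> uminus ` E. k (m - f) v < k m v" using diff[OF w(1)] w by (intro bexI[of _ w]) auto
    qed
    with 1 show ?thesis by blast
  qed
  show ?thesis
  proof (rule that[OF F(1)])
    show "F \<subseteq> cone_monoid N \<tau>" using F(2) by (auto simp: S_def)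
    fix C assume C: "0 \<in> C" "\<And>g m. g \<in> F \<Longrightarrow> m \<in> C \<Longrightarrow> g + m \<in> C"
    have "m \<in> C" if "m \<in> S" for m
      using that
    proof (induction "\<mu> m" arbitrary: m rule: less_induct)
      case less
      show ?case
      proof (cases "m = 0")
        case False
        then obtain f where f: "f \<in> F" "\<forall>v\<in>V. k f v \<le> k m v" using F(3) less.prems by blast
        have "m - f \<in> C" using less.hyps step[OF less.prems f] by blast
        then have "f + (m - f) \<in> C" by (rule C(2)[OF f(1)])
        then show ?thesis by simp
      qed (use C in simp)
    qed
    then show "cone_monoid N \<tau> \<subseteq> C" by (auto simp: S_def)
  qed
qed

section \<open>The quotient fan\<close>

locale fan_star =
  fixes N :: "'v::euclidean_space set" and \<Sigma> :: "'v set set" and \<sigma> :: "'v set"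
  assumes zlattice_N: "zlattice N" and fan: "fan N \<Sigma>" and \<sigma>: "\<sigma> \<in> \<Sigma>"
begin

lemma fan_cone_mem: "\<tau> \<in> \<Sigma> \<Longrightarrow> fan_cone N \<tau>"
  and fan_face_mem: "\<tau> \<in> \<Sigma> \<Longrightarrow> is_face \<rho> \<tau> \<Longrightarrow> \<rho> \<in> \<Sigma>"
  and fan_Int: "\<tau> \<in> \<Sigma> \<Longrightarrow> \<tau>' \<in> \<Sigma> \<Longrightarrow> is_face (\<tau> \<inter> \<tau>') \<tau>" "\<tau> \<in> \<Sigma> \<Longrightarrow> \<tau>' \<in> \<Sigma> \<Longrightarrow> is_face (\<tau> \<inter> \<tau>') \<tau>'"
  and fan_finite: "finite \<Sigma>"
  using fan unfolding fan_def by blast+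

sublocale lattice_cone N \<sigma>
  using zlattice_N fan_cone_mem[OF \<sigma>] by unfold_locales

lemma convex_cone_mem: "\<tau> \<in> \<Sigma> \<Longrightarrow> convex_cone \<tau>"
  using fan_cone_convex_cone[OF fan_cone_mem] .

definition star :: "'v set set" where "star = {\<tau> \<in> \<Sigma>. is_face \<sigma> \<tau>}"
definition bar :: "'v set \<Rightarrow> 'v set" where "bar \<tau> = quot N \<sigma> ` \<tau>"

lemma starD: "\<tau> \<in> star \<Longrightarrow> \<tau> \<in> \<Sigma>" "\<tau> \<in> star \<Longrightarrow> is_face \<sigma> \<tau>" "\<tau> \<in> star \<Longrightarrow> \<sigma> \<subseteq> \<tau>"
  unfolding star_def using is_face_subset by auto

lemma \<sigma>_star: "\<sigma> \<in> star"
  using \<sigma> is_face_refl[OF convex_cone_mem[OF \<sigma>]] by (simp add: star_def)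

text \<open>A cone of the fan contained in another is their intersection, hence a face of it by the
  fan axiom.\<close>

lemma star_iff: "\<tau> \<in> \<Sigma> \<Longrightarrow> \<tau> \<in> star \<longleftrightarrow> \<sigma> \<subseteq> \<tau>"
proof -
  assume \<tau>: "\<tau> \<in> \<Sigma>"
  have "is_face \<sigma> \<tau>" if "\<sigma> \<subseteq> \<tau>"
  proof -
    have "\<sigma> \<inter> \<tau> = \<sigma>" using that by blast
    then show ?thesis using fan_Int(2)[OF \<sigma> \<tau>] by simp
  qed
  then show ?thesis using \<tau> is_face_subset by (auto simp: star_def)
qed

lemma star_Int: "\<tau> \<in> star \<Longrightarrow> \<tau>' \<in> star \<Longrightarrow> \<tau> \<inter> \<tau>' \<in> star"
proof -
  assume t: "\<tau> \<in> star" "\<tau>' \<in> star"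
  have "\<tau> \<inter> \<tau>' \<in> \<Sigma>" using fan_face_mem[OF starD(1)[OF t(1)] fan_Int(1)] starD(1)[OF t(1)] starD(1)[OF t(2)] by blast
  then show ?thesis using star_iff starD(3)[OF t(1)] starD(3)[OF t(2)] by simp
qed

lemma quot_fan_eq: "quot_fan N \<Sigma> \<sigma> = bar ` star"
  by (auto simp: quot_fan_def bar_def star_def)

lemma quot_add: "quot N \<sigma> (x + y) = quot N \<sigma> x + quot N \<sigma> y"
  and quot_scale: "quot N \<sigma> (c *\<^sub>R x) = c *\<^sub>R quot N \<sigma> x"
  and quot_minus: "quot N \<sigma> (x - y) = quot N \<sigma> x - quot N \<sigma> y"
  using linear_add[OF linear_quot] linear_scale[OF linear_quot] linear_diff[OF linear_quot] by auto

lemma quot_cone: "s \<in> \<sigma> \<Longrightarrow> quot N \<sigma> s = 0"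
  unfolding quot_zero_iff by (rule span_base)

text \<open>Equality in the quotient is rewritten without subtraction, since the span of \<sigma>
  consists of differences of its elements; sums stay inside the cones that contain \<sigma>.\<close>

lemma quot_eqD:
  assumes "quot N \<sigma> x = quot N \<sigma> y"
  obtains s t where "s \<in> \<sigma>" "t \<in> \<sigma>" "x + s = y + t"
proof -
  have "y - x \<in> span \<sigma>" using assms quot_minus[of y x] quot_zero_iff by simp
  then obtain s t where st: "s \<in> \<sigma>" "t \<in> \<sigma>" "y - x = s - t"
    using convex_cone_span_diff[OF convex_cone_mem[OF \<sigma>]] by metis
  then have "x + s = y + t" by (simp add: algebra_simps)
  then show ?thesis using that st by blast
qed

text \<open>Up to elements of \<sigma>, which lie in \<rho>, the vector \<open>x\<close> equals one
  of \<rho>. So a sum of \<open>x\<close> with an element of \<tau> lies in the face \<rho>, and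
  then so does \<open>x\<close>.\<close>

lemma bar_memD:
  assumes \<rho>: "\<rho> \<in> star" and \<tau>: "\<tau> \<in> \<Sigma>" and face: "is_face \<rho> \<tau>" and x: "x \<in> \<tau>" "quot N \<sigma> x \<in> bar \<rho>"
  shows "x \<in> \<rho>"
proof -
  obtain y where y: "y \<in> \<rho>" "quot N \<sigma> x = quot N \<sigma> y" using x by (auto simp: bar_def)
  obtain s t where st: "s \<in> \<sigma>" "t \<in> \<sigma>" "x + s = y + t" using quot_eqD[OF y(2)] .
  have s: "s \<in> \<rho>" "t \<in> \<rho>" using st starD(3)[OF \<rho>] by auto
  have "y + t \<in> \<rho>" using y(1) s(2) convex_cone_add[OF convex_cone_mem[OF starD(1)[OF \<rho>]]] by blast
  then have "x + s \<in> \<rho>" using st(3) by simp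
  moreover have "s \<in> \<tau>" using s is_face_subset[OF face] by blast
  ultimately show ?thesis using face x(1) unfolding is_face_cone_iff[OF convex_cone_mem[OF \<tau>]] by blast
qed

text \<open>Two preimages of a common point become equal after adding elements of \<sigma>, which
  belongs to both cones.\<close>

lemma bar_Int:
  assumes "\<tau> \<in> star" "\<tau>' \<in> star" shows "bar \<tau> \<inter> bar \<tau>' = bar (\<tau> \<inter> \<tau>')"
proof
  show "bar (\<tau> \<inter> \<tau>') \<subseteq> bar \<tau> \<inter> bar \<tau>'" by (auto simp: bar_def)
  show "bar \<tau> \<inter> bar \<tau>' \<subseteq> bar (\<tau> \<inter> \<tau>')"
  proof
    fix w assume "w \<in> bar \<tau> \<inter> bar \<tau>'"
    then obtain x y where xy: "x \<in> \<tau>" "y \<in> \<tau>'" "w = quot N \<sigma> x" "w = quot N \<sigma> y" by (auto simp: bar_def)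
    have "quot N \<sigma> x = quot N \<sigma> y" using xy by simp
    then obtain s t where st: "s \<in> \<sigma>" "t \<in> \<sigma>" "x + s = y + t" by (rule quot_eqD)
    have "x + s \<in> \<tau>" "y + t \<in> \<tau>'"
      using convex_cone_add[OF convex_cone_mem[OF starD(1)]] assms xy st starD(3)[OF assms(1)] starD(3)[OF assms(2)]
      by blast+
    then have "x + s \<in> \<tau> \<inter> \<tau>'" using st by simp
    moreover have "w = quot N \<sigma> (x + s)" using xy st quot_cone by (simp add: quot_add)
    ultimately show "w \<in> bar (\<tau> \<inter> \<tau>')" by (simp add: bar_def)
  qed
qed

lemma bar_inj:
  assumes "\<tau> \<in> star" "\<tau>' \<in> star" "bar \<tau> = bar \<tau>'" shows "\<tau> = \<tau>'"
proof -
  have *: "\<tau> \<subseteq> \<tau>'" if t: "\<tau> \<in> star" "\<tau>' \<in> star" "bar \<tau> = bar \<tau>'" for \<tau> \<tau>'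
  proof
    fix x assume x: "x \<in> \<tau>"
    have f: "is_face (\<tau> \<inter> \<tau>') \<tau>" by (rule fan_Int(1)[OF starD(1)[OF t(1)] starD(1)[OF t(2)]])
    have "bar (\<tau> \<inter> \<tau>') = bar \<tau>" using bar_Int[OF t(1,2)] t(3) by simp
    then have "quot N \<sigma> x \<in> bar (\<tau> \<inter> \<tau>')" using x by (simp add: bar_def)
    then have "x \<in> \<tau> \<inter> \<tau>'" by (rule bar_memD[OF star_Int[OF t(1,2)] starD(1)[OF t(1)] f x])
    then show "x \<in> \<tau>'" by simp
  qed
  show ?thesis using *[OF assms] *[OF assms(2,1) assms(3)[symmetric]] by blast
qed

lemma convex_cone_bar: "\<tau> \<in> star \<Longrightarrow> convex_cone (bar \<tau>)"
  unfolding bar_def using convex_cone_linear_image convex_cone_mem starD(1) linear_quot by blast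

lemma bar_face_iff:
  assumes \<rho>: "\<rho> \<in> star" and \<tau>: "\<tau> \<in> star"
  shows "is_face (bar \<rho>) (bar \<tau>) \<longleftrightarrow> is_face \<rho> \<tau>"
proof
  assume face: "is_face \<rho> \<tau>"
  have "a \<in> bar \<rho> \<and> b \<in> bar \<rho>" if ab: "a \<in> bar \<tau>" "b \<in> bar \<tau>" "a + b \<in> bar \<rho>" for a b
  proof -
    obtain x y where xy: "x \<in> \<tau>" "y \<in> \<tau>" "a = quot N \<sigma> x" "b = quot N \<sigma> y" using ab by (auto simp: bar_def)
    have xy\<tau>: "x + y \<in> \<tau>" by (rule convex_cone_add[OF convex_cone_mem[OF starD(1)[OF \<tau>]] xy(1,2)])
    have "x + y \<in> \<rho>" by (rule bar_memD[OF \<rho> starD(1)[OF \<tau>] face xy\<tau>]) (use ab xy in \<open>simp add: quot_add\<close>)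
    then have "x \<in> \<rho>" "y \<in> \<rho>"
      using face xy unfolding is_face_cone_iff[OF convex_cone_mem[OF starD(1)[OF \<tau>]]] by blast+
    then show ?thesis using xy by (simp add: bar_def)
  qed
  moreover have "bar \<rho> \<subseteq> bar \<tau>" using is_face_subset[OF face] by (auto simp: bar_def)
  ultimately show "is_face (bar \<rho>) (bar \<tau>)"
    unfolding is_face_cone_iff[OF convex_cone_bar[OF \<tau>]] using convex_cone_bar[OF \<rho>] by blast
next
  assume "is_face (bar \<rho>) (bar \<tau>)"
  then have "bar \<rho> \<inter> bar \<tau> = bar \<rho>" using is_face_subset by blast
  then have "bar (\<rho> \<inter> \<tau>) = bar \<rho>" using bar_Int[OF \<rho> \<tau>] by simp
  then have "\<rho> \<inter> \<tau> = \<rho>" by (rule bar_inj[OF star_Int[OF \<rho> \<tau>] \<rho>])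
  then show "is_face \<rho> \<tau>" using fan_Int(2)[OF starD(1)[OF \<rho>] starD(1)[OF \<tau>]] by simp
qed

text \<open>The preimage of a face within \<tau> is a face; it contains \<sigma> because \<sigma> is
  sent to zero, so it belongs to the star.\<close>

lemma face_of_bar:
  assumes \<tau>: "\<tau> \<in> star" and F: "is_face F (bar \<tau>)"
  obtains \<rho> where "\<rho> \<in> star" "is_face \<rho> \<tau>" "F = bar \<rho>"
proof -
  note c\<tau> = convex_cone_mem[OF starD(1)[OF \<tau>]]
  have f: "F \<subseteq> bar \<tau>" "convex_cone F" "\<And>a b. a \<in> bar \<tau> \<Longrightarrow> b \<in> bar \<tau> \<Longrightarrow> a + b \<in> F \<Longrightarrow> a \<in> F \<and> b \<in> F"
    using F unfolding is_face_cone_iff[OF convex_cone_bar[OF \<tau>]] by blast+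
  define \<rho> where "\<rho> = {x \<in> \<tau>. quot N \<sigma> x \<in> F}"
  have "convex_cone \<rho>"
    using f(2) c\<tau> unfolding convex_cone_iff \<rho>_def by (auto simp: quot_add quot_scale linear_0[OF linear_quot])
  moreover have "a \<in> \<rho> \<and> b \<in> \<rho>" if "a \<in> \<tau>" "b \<in> \<tau>" "a + b \<in> \<rho>" for a b
    using that f(3)[of "quot N \<sigma> a" "quot N \<sigma> b"] by (auto simp: \<rho>_def bar_def quot_add)
  moreover have "\<rho> \<subseteq> \<tau>" by (auto simp: \<rho>_def)
  ultimately have face: "is_face \<rho> \<tau>" unfolding is_face_cone_iff[OF c\<tau>] by blast
  have "\<rho> \<in> \<Sigma>" by (rule fan_face_mem[OF starD(1)[OF \<tau>] face])
  moreover have "\<sigma> \<subseteq> \<rho>"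
    using starD(3)[OF \<tau>] quot_cone convex_cone_contains_0[OF f(2)] by (auto simp: \<rho>_def)
  ultimately have "\<rho> \<in> star" by (simp add: star_iff)
  moreover have "F = bar \<rho>" using f(1) by (auto simp: \<rho>_def bar_def)
  ultimately show ?thesis using that face by blast
qed

lemma bar_\<sigma>: "bar \<sigma> = {0}"
  using quot_cone convex_cone_contains_0[OF convex_cone_mem[OF \<sigma>]] by (force simp: bar_def)

lemma fan_cone_bar:
  assumes \<tau>: "\<tau> \<in> star" shows "fan_cone (quot_lattice N \<sigma>) (bar \<tau>)"
proof -
  note c\<tau> = convex_cone_mem[OF starD(1)[OF \<tau>]]
  obtain G where G: "finite G" "G \<subseteq> N" "\<tau> = convex_cone hull G" and pt: "\<tau> \<inter> uminus ` \<tau> = {0}"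
    using fan_cone_mem[OF starD(1)[OF \<tau>]] by (auto simp: fan_cone_def)
  have "bar \<tau> = convex_cone hull (quot N \<sigma> ` G)"
    unfolding bar_def G(3) by (rule convex_cone_hull_linear_image[OF linear_quot, symmetric])
  \<comment> \<open>Pointedness: if the images of \<open>x\<close> and \<open>y\<close> are
    opposite, \<open>x + y\<close> lies in \<sigma> by \<open>bar_memD\<close>, and the face
    property gives \<open>x\<close> in \<sigma>.\<close>
  moreover have "bar \<tau> \<inter> uminus ` bar \<tau> = {0}"
  proof (intro equalityI subsetI)
    fix w assume "w \<in> bar \<tau> \<inter> uminus ` bar \<tau>"
    then obtain x y where xy: "x \<in> \<tau>" "y \<in> \<tau>" "w = quot N \<sigma> x" "w = - quot N \<sigma> y" by (auto simp: bar_def)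
    have "x + y \<in> \<tau>" by (rule convex_cone_add[OF c\<tau> xy(1,2)])
    moreover have "quot N \<sigma> (x + y) \<in> bar \<sigma>"
      unfolding bar_\<sigma> quot_add using xy(3,4) by (metis add.left_inverse singletonI)
    ultimately have "x + y \<in> \<sigma>" by (rule bar_memD[OF \<sigma>_star starD(1)[OF \<tau>] starD(2)[OF \<tau>]])
    then have "x \<in> \<sigma>" using starD(2)[OF \<tau>] xy unfolding is_face_cone_iff[OF c\<tau>] by blast
    then show "w \<in> {0}" using xy quot_cone by simp
  next
    fix w :: 'v assume "w \<in> {0}"
    then show "w \<in> bar \<tau> \<inter> uminus ` bar \<tau>"
      using convex_cone_contains_0[OF convex_cone_bar[OF \<tau>]] by force
  qed
  ultimately show ?thesis
    unfolding fan_cone_def quot_lattice_def using G(1,2) by (auto intro!: exI[of _ "quot N \<sigma> ` G"])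
qed

lemma fan_quot_fan: "fan (quot_lattice N \<sigma>) (quot_fan N \<Sigma> \<sigma>)"
  unfolding fan_def quot_fan_eq
proof (intro conjI ballI allI impI)
  show "finite (bar ` star)" using fan_finite by (simp add: star_def)
  show "bar ` star \<noteq> {}" using \<sigma>_star by blast
  show "fan_cone (quot_lattice N \<sigma>) \<kappa>" if "\<kappa> \<in> bar ` star" for \<kappa> using that fan_cone_bar by blast
  show "F \<in> bar ` star" if \<kappa>: "\<kappa> \<in> bar ` star" "is_face F \<kappa>" for \<kappa> F
  proof -
    obtain \<tau> where \<tau>: "\<tau> \<in> star" "\<kappa> = bar \<tau>" using \<kappa> by blast
    obtain \<rho> where "\<rho> \<in> star" "F = bar \<rho>" using face_of_bar[OF \<tau>(1), of F] \<kappa>(2) \<tau>(2) by blast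
    then show ?thesis by blast
  qed
  fix \<kappa> \<kappa>' assume "\<kappa> \<in> bar ` star" "\<kappa>' \<in> bar ` star"
  then obtain \<tau> \<tau>' where t: "\<tau> \<in> star" "\<kappa> = bar \<tau>" "\<tau>' \<in> star" "\<kappa>' = bar \<tau>'" by blast
  show "is_face (\<kappa> \<inter> \<kappa>') \<kappa>" "is_face (\<kappa> \<inter> \<kappa>') \<kappa>'"
    unfolding t(2,4) bar_Int[OF t(1,3)] bar_face_iff[OF star_Int[OF t(1,3)] t(1)] bar_face_iff[OF star_Int[OF t(1,3)] t(3)]
    using fan_Int[OF starD(1)[OF t(1)] starD(1)[OF t(3)]] by auto
qed

lemma cone_monoid_bar: "cone_monoid (quot_lattice N \<sigma>) (bar \<tau>) = cone_monoid N \<tau> \<inter> cone_perp N \<sigma>"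
  unfolding cone_monoid_def[of "quot_lattice N \<sigma>"] dual_quot_lattice
  using inner_quot cone_perp_dual by (auto simp: cone_monoid_def bar_def)

lemma pairing_quot_param: "m \<in> cone_perp N \<sigma> \<Longrightarrow> pairing m (quot_param N \<sigma> c) = pairing m c"
  by (simp add: pairing_def quot_param_def inner_quot)

lemma quot_param_complexified: "c \<in> complexified N \<Longrightarrow> quot_param N \<sigma> c \<in> complexified (quot_lattice N \<sigma>)"
  using linear_span_image[OF linear_quot, of N]
  by (auto simp: complexified_def quot_param_def quot_lattice_def)

text \<open>Decorations and charts of the quotient are indexed by quotient cones, while their data
  come from cones of the star; by \<open>bar_inj\<close> the latter can be recovered.\<close>

definition unbar :: "'v set \<Rightarrow> 'v set" where "unbar \<kappa> = (THE \<tau>. \<tau> \<in> star \<and> bar \<tau> = \<kappa>)"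

lemma unbar_bar: "\<tau> \<in> star \<Longrightarrow> unbar (bar \<tau>) = \<tau>"
  unfolding unbar_def using bar_inj by (intro the_equality) auto

end

section \<open>The orbit\<close>

lemma infinite_UNIV_coord: "infinite (UNIV :: ('v::euclidean_space) coord set)"
proof -
  have "inj (\<lambda>z :: complex. (single (0::'v) z, 0 :: 'v \<Rightarrow>\<^sub>0 complex))"
    by (auto simp: inj_def dest: injD[OF inj_single])
  then have "infinite (range (\<lambda>z :: complex. (single (0::'v) z, 0 :: 'v \<Rightarrow>\<^sub>0 complex)))"
    using infinite_UNIV_char_0 finite_imageD by blast
  then show ?thesis using finite_subset[OF subset_UNIV] by blast
qed

text \<open>All toric superalgebras share the same operations and differ only in their carriers and
  homogeneous parts, so restriction of functions is restriction to a subalgebra.\<close>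

lemma shom_restrict_subalgebra:
  assumes g: "g \<in> shom (toric_alg S1 J1) A" and SJ: "monoid_ideal S J" and sub: "S \<subseteq> S1" "J \<subseteq> J1"
  shows "restrict g (carrier (toric_alg S J)) \<in> shom (toric_alg S J) A"
proof -
  interpret R: salg "toric_alg S J" using superalgebra_toric_alg[OF SJ] by (rule salgI)
  have c: "q \<in> carrier (toric_alg S1 J1)" if "q \<in> carrier (toric_alg S J)" for q
    using sub that by (auto simp: toric_alg_carrier)
  have ops: "(\<oplus>\<^bsub>toric_alg S J\<^esub>) = (\<oplus>\<^bsub>toric_alg S1 J1\<^esub>)" "(\<otimes>\<^bsub>toric_alg S J\<^esub>) = (\<otimes>\<^bsub>toric_alg S1 J1\<^esub>)"
    "(\<odot>\<^bsub>toric_alg S J\<^esub>) = (\<odot>\<^bsub>toric_alg S1 J1\<^esub>)" "\<one>\<^bsub>toric_alg S J\<^esub> = \<one>\<^bsub>toric_alg S1 J1\<^esub>"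
    by (simp_all add: toric_alg_def)
  show ?thesis
  proof (rule shomI)
    fix a b assume ab: "a \<in> carrier (toric_alg S J)" "b \<in> carrier (toric_alg S J)"
    show "restrict g (carrier (toric_alg S J)) (a \<oplus>\<^bsub>toric_alg S J\<^esub> b) =
        restrict g (carrier (toric_alg S J)) a \<oplus>\<^bsub>A\<^esub> restrict g (carrier (toric_alg S J)) b"
      using ab R.a_closed[OF ab] shom_add[OF g c[OF ab(1)] c[OF ab(2)]] unfolding ops by simp
    show "restrict g (carrier (toric_alg S J)) (a \<otimes>\<^bsub>toric_alg S J\<^esub> b) =
        restrict g (carrier (toric_alg S J)) a \<otimes>\<^bsub>A\<^esub> restrict g (carrier (toric_alg S J)) b"
      using ab R.m_closed[OF ab] shom_mult[OF g c[OF ab(1)] c[OF ab(2)]] unfolding ops by simp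
  next
    fix z a assume a: "a \<in> carrier (toric_alg S J)"
    show "restrict g (carrier (toric_alg S J)) a \<in> carrier A" using a shom_closed[OF g c[OF a]] by simp
    show "restrict g (carrier (toric_alg S J)) (z \<odot>\<^bsub>toric_alg S J\<^esub> a) = z \<odot>\<^bsub>A\<^esub> restrict g (carrier (toric_alg S J)) a"
      using a R.smult_closed[OF a, of z] shom_smult[OF g c[OF a]] unfolding ops by simp
  next
    show "restrict g (carrier (toric_alg S J)) \<one>\<^bsub>toric_alg S J\<^esub> = \<one>\<^bsub>A\<^esub>"
      using R.one_closed shom_one[OF g] unfolding ops by simp
  next
    fix a assume a: "a \<in> even_part (toric_alg S J)"
    then have "a \<in> even_part (toric_alg S1 J1)" using sub by (cases a) (auto simp: toric_alg_simps)
    then show "restrict g (carrier (toric_alg S J)) a \<in> even_part A"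
      using R.even_carrier[OF a] shom_even[OF g] by simp
  next
    fix a assume a: "a \<in> odd_part (toric_alg S J)"
    then have "a \<in> odd_part (toric_alg S1 J1)" using sub by (cases a) (auto simp: toric_alg_simps)
    then show "restrict g (carrier (toric_alg S J)) a \<in> odd_part A"
      using R.odd_carrier[OF a] shom_odd[OF g] by simp
  qed simp
qed

definition decorated_ideal :: "'v::euclidean_space set \<Rightarrow> ('v set \<Rightarrow> 'v set) \<Rightarrow> 'v set \<Rightarrow> 'v set" where
  "decorated_ideal N \<B> \<tau> = {b + s | b s. b \<in> \<B> \<tau> \<and> s \<in> cone_monoid N \<tau>}"

lemma chart_alg_eq: "chart_alg N \<B> \<tau> = toric_alg (cone_monoid N \<tau>) (decorated_ideal N \<B> \<tau>)"
  by (simp add: chart_alg_def decorated_ideal_def)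

lemma decorated_ideal_iff: "m \<in> decorated_ideal N \<B> \<tau> \<longleftrightarrow> (\<exists>b\<in>\<B> \<tau>. m - b \<in> cone_monoid N \<tau>)"
proof
  assume "\<exists>b\<in>\<B> \<tau>. m - b \<in> cone_monoid N \<tau>"
  then obtain b where "b \<in> \<B> \<tau>" "m - b \<in> cone_monoid N \<tau>" by blast
  moreover have "m = b + (m - b)" by simp
  ultimately show "m \<in> decorated_ideal N \<B> \<tau>" unfolding decorated_ideal_def by blast
next
  assume "m \<in> decorated_ideal N \<B> \<tau>"
  then obtain b s where "m = b + s" "b \<in> \<B> \<tau>" "s \<in> cone_monoid N \<tau>" unfolding decorated_ideal_def by blast
  then show "\<exists>b\<in>\<B> \<tau>. m - b \<in> cone_monoid N \<tau>" by (intro bexI[of _ b]) simp_all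
qed

lemma monoid_ideal_decorated: "monoid_ideal (cone_monoid N \<tau>) (decorated_ideal N \<B> \<tau>)"
  unfolding monoid_ideal_def
proof (intro conjI ballI)
  fix s t assume s: "s \<in> cone_monoid N \<tau>" and "t \<in> decorated_ideal N \<B> \<tau>"
  then obtain b where b: "b \<in> \<B> \<tau>" "t - b \<in> cone_monoid N \<tau>" by (auto simp: decorated_ideal_iff)
  have "s + t - b \<in> cone_monoid N \<tau>" using cone_monoid_add[OF s b(2)] by (simp add: algebra_simps)
  then show "s + t \<in> decorated_ideal N \<B> \<tau>" using b by (auto simp: decorated_ideal_iff)
qed (auto simp: cone_monoid_zero cone_monoid_add)

lemma monoid_ideal_group: "additive_group L \<Longrightarrow> monoid_ideal L L"
  by (simp add: monoid_ideal_def additive_group_zero additive_group_add)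

lemma monoid_ideal_Int:
  "monoid_ideal S J \<Longrightarrow> additive_group L \<Longrightarrow> monoid_ideal (S \<inter> L) (J \<inter> L)"
  by (auto simp: monoid_ideal_def additive_group_zero additive_group_add)

locale toric_orbit =
  fixes N :: "'v::euclidean_space set" and c :: "'v \<times> 'v"
    and \<Sigma> :: "'v set set" and \<B> :: "'v set \<Rightarrow> 'v set"
    and X :: "('v coord, 'x) sfunctor"
    and \<phi> :: "'v set \<Rightarrow> 'v coord superalg \<Rightarrow> ('v coord \<Rightarrow> 'v coord) \<Rightarrow> 'x"
    and act :: "'v coord superalg \<Rightarrow> ('v coord \<Rightarrow> 'v coord) \<Rightarrow> 'x \<Rightarrow> 'x"
    and \<sigma> :: "'v set" and p :: 'x
  assumes X: "is_toric_supervariety_of_fan N c \<Sigma> \<B> X \<phi> act"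
    and \<sigma>_mem: "\<sigma> \<in> \<Sigma>" and p_orbit: "p \<in> Orb N \<B> \<phi> act \<sigma>"
begin

lemma X_facts: "zlattice N" "c \<in> complexified N" "fan N \<Sigma>" "admissible N c \<Sigma> \<B>"
    "glued_toric (supertorus_alg N) N c \<Sigma> \<B> X \<phi> act"
  using X unfolding is_toric_supervariety_of_fan_def by blast+

sublocale fan_star N \<Sigma> \<sigma>
  using X_facts \<sigma>_mem by unfold_locales

abbreviation "M \<equiv> dual_lattice N"
abbreviation "P \<equiv> cone_perp N \<sigma>"
abbreviation "S \<equiv> cone_monoid N"
abbreviation "J \<equiv> decorated_ideal N \<B>"
abbreviation "R \<equiv> chart_alg N \<B>"
abbreviation "H \<equiv> supertorus_alg N"

lemma glued:
  "toric_supervariety H c X (\<phi> {0}) act"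
  "\<And>\<tau>. \<tau> \<in> \<Sigma> \<Longrightarrow> affine_open_immersion (R \<tau>) X (\<phi> \<tau>)"
  "open_cover X ((\<lambda>\<tau> A. \<phi> \<tau> A ` shom (R \<tau>) A) ` \<Sigma>)"
  "\<And>\<rho> \<tau> A h. \<rho> \<in> \<Sigma> \<Longrightarrow> \<tau> \<in> \<Sigma> \<Longrightarrow> is_face \<rho> \<tau> \<Longrightarrow> superalgebra A \<Longrightarrow> h \<in> shom (R \<rho>) A \<Longrightarrow>
     \<phi> \<rho> A h = \<phi> \<tau> A (restrict h (carrier (R \<tau>)))"
  "\<And>\<rho> \<tau> A. \<rho> \<in> \<Sigma> \<Longrightarrow> \<tau> \<in> \<Sigma> \<Longrightarrow> superalgebra A \<Longrightarrow>
     \<phi> \<rho> A ` shom (R \<rho>) A \<inter> \<phi> \<tau> A ` shom (R \<tau>) A = \<phi> (\<rho> \<inter> \<tau>) A ` shom (R (\<rho> \<inter> \<tau>)) A"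
  "\<And>\<tau> A g h. \<tau> \<in> \<Sigma> \<Longrightarrow> superalgebra A \<Longrightarrow> g \<in> shom H A \<Longrightarrow> h \<in> shom (R \<tau>) A \<Longrightarrow>
     act A g (\<phi> \<tau> A h) = \<phi> \<tau> A (conv c (R \<tau>) A g h)"
proof -
  note G = X_facts(5)[unfolded glued_toric_def]
  note G1 = conjunct2[OF G] note G2 = conjunct2[OF G1] note G3 = conjunct2[OF G2] note G4 = conjunct2[OF G3]
  note G5 = conjunct2[OF G4]
  show "toric_supervariety H c X (\<phi> {0}) act" by (rule conjunct1[OF G])
  show "affine_open_immersion (R \<tau>) X (\<phi> \<tau>)" if "\<tau> \<in> \<Sigma>" for \<tau>
    using conjunct1[OF G1] that by simp
  show "open_cover X ((\<lambda>\<tau> A. \<phi> \<tau> A ` shom (R \<tau>) A) ` \<Sigma>)" by (rule conjunct1[OF G2])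
  show "\<phi> \<rho> A h = \<phi> \<tau> A (restrict h (carrier (R \<tau>)))"
    if "\<rho> \<in> \<Sigma>" "\<tau> \<in> \<Sigma>" "is_face \<rho> \<tau>" "superalgebra A" "h \<in> shom (R \<rho>) A" for \<rho> \<tau> A h
    using conjunct1[OF G3] that by simp
  show "\<phi> \<rho> A ` shom (R \<rho>) A \<inter> \<phi> \<tau> A ` shom (R \<tau>) A = \<phi> (\<rho> \<inter> \<tau>) A ` shom (R (\<rho> \<inter> \<tau>)) A"
    if "\<rho> \<in> \<Sigma>" "\<tau> \<in> \<Sigma>" "superalgebra A" for \<rho> \<tau> A
    using conjunct1[OF G4] that by simp
  show "act A g (\<phi> \<tau> A h) = \<phi> \<tau> A (conv c (R \<tau>) A g h)"
    if "\<tau> \<in> \<Sigma>" "superalgebra A" "g \<in> shom H A" "h \<in> shom (R \<tau>) A" for \<tau> A g h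
    using G5 that by simp
qed

lemma supervariety_X: "supervariety X" and torus_action_X: "torus_action H c X act"
  using glued(1) unfolding toric_supervariety_def by blast+

sublocale atlas X \<Sigma> R \<phi>
proof
  show "is_sfunctor X" "separated X" using supervariety_X by (simp_all add: supervariety_def)
  show "infinite (UNIV :: 'v coord set)" by (rule infinite_UNIV_coord)
  show "affine_open_immersion (R t) X (\<phi> t)" if "t \<in> \<Sigma>" for t by (rule glued(2)[OF that])
  show "\<exists>t\<in>\<Sigma>. x \<in> \<phi> t K ` shom (R t) K" if K: "superfield K" and x: "x \<in> pts X K" for K x
  proof -
    have "pts X K \<subseteq> (\<Union>U\<in>(\<lambda>\<tau> A. \<phi> \<tau> A ` shom (R \<tau>) A) ` \<Sigma>. U K)"
      using glued(3) K unfolding open_cover_def by blast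
    then show ?thesis using x by blast
  qed
qed

lemma act_in: "superalgebra A \<Longrightarrow> g \<in> shom H A \<Longrightarrow> x \<in> pts X A \<Longrightarrow> act A g x \<in> pts X A"
  and act_unit: "superalgebra A \<Longrightarrow> x \<in> pts X A \<Longrightarrow> act A (torus_unit H A) x = x"
  and act_conv: "superalgebra A \<Longrightarrow> g \<in> shom H A \<Longrightarrow> h \<in> shom H A \<Longrightarrow> x \<in> pts X A \<Longrightarrow>
    act A (conv c H A g h) x = act A g (act A h x)"
  and act_natural: "superalgebra A \<Longrightarrow> superalgebra B \<Longrightarrow> f \<in> shom A B \<Longrightarrow> g \<in> shom H A \<Longrightarrow> x \<in> pts X A \<Longrightarrow>
    fmap X A B f (act A g x) = act B (compose (carrier H) f g) (fmap X A B f x)"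
proof -
  note T = torus_action_X[unfolded torus_action_def]
  show "superalgebra A \<Longrightarrow> g \<in> shom H A \<Longrightarrow> x \<in> pts X A \<Longrightarrow> act A g x \<in> pts X A"
    "superalgebra A \<Longrightarrow> x \<in> pts X A \<Longrightarrow> act A (torus_unit H A) x = x"
    "superalgebra A \<Longrightarrow> g \<in> shom H A \<Longrightarrow> h \<in> shom H A \<Longrightarrow> x \<in> pts X A \<Longrightarrow>
      act A (conv c H A g h) x = act A g (act A h x)"
    using conjunct1[OF T] by simp_all
  show "superalgebra A \<Longrightarrow> superalgebra B \<Longrightarrow> f \<in> shom A B \<Longrightarrow> g \<in> shom H A \<Longrightarrow> x \<in> pts X A \<Longrightarrow>
    fmap X A B f (act A g x) = act B (compose (carrier H) f g) (fmap X A B f x)"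
    using conjunct2[OF T] by simp
qed

lemma R_eq: "R \<tau> = toric_alg (S \<tau>) (J \<tau>)"
  by (rule chart_alg_eq)

lemma H_eq: "H = toric_alg M M"
  by (simp add: supertorus_alg_def)

lemma mi_R: "monoid_ideal (S \<tau>) (J \<tau>)"
  by (rule monoid_ideal_decorated)

lemma mi_H: "monoid_ideal M M"
  by (rule monoid_ideal_group[OF additive_group_dual_lattice])

lemma superalgebra_R: "superalgebra (R \<tau>)"
  unfolding R_eq by (rule superalgebra_toric_alg[OF mi_R])

lemma superalgebra_H: "superalgebra H"
  unfolding H_eq by (rule superalgebra_toric_alg[OF mi_H])

lemma decorations:
  "\<tau> \<in> \<Sigma> \<Longrightarrow> finite (\<B> \<tau>)" "\<tau> \<in> \<Sigma> \<Longrightarrow> \<B> \<tau> \<noteq> {}" "\<tau> \<in> \<Sigma> \<Longrightarrow> \<B> \<tau> \<subseteq> S \<tau>"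
  "\<tau> \<in> \<Sigma> \<Longrightarrow> m \<in> S \<tau> \<Longrightarrow> pairing m c \<noteq> 0 \<Longrightarrow> \<exists>b\<in>\<B> \<tau>. m - b \<in> S \<tau>"
  "\<tau> \<in> \<Sigma> \<Longrightarrow> \<tau>' \<in> \<Sigma> \<Longrightarrow> b \<in> \<B> \<tau> \<Longrightarrow> \<exists>b'\<in>\<B> \<tau>'. b - b' \<in> S (\<tau> \<inter> \<tau>')"
  "\<tau> \<in> \<Sigma> \<Longrightarrow> a \<in> \<B> \<tau> \<Longrightarrow> b \<in> \<B> \<tau> \<Longrightarrow> b - a \<in> S \<tau> \<Longrightarrow> a = b"
  using X_facts(4) unfolding admissible_def cone_le_def by blast+

lemma J_subset: "\<tau> \<in> \<Sigma> \<Longrightarrow> J \<tau> \<subseteq> S \<tau>"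
proof
  fix m assume \<tau>: "\<tau> \<in> \<Sigma>" and "m \<in> J \<tau>"
  then obtain b where b: "b \<in> \<B> \<tau>" "m - b \<in> S \<tau>" by (auto simp: decorated_ideal_iff)
  have "b + (m - b) \<in> S \<tau>" by (rule cone_monoid_add) (use b decorations(3)[OF \<tau>] in auto)
  then show "m \<in> S \<tau>" by simp
qed

lemma S_subset: "S \<tau> \<subseteq> M"
  using cone_monoid_dual by blast

lemma pairing_J: "\<tau> \<in> \<Sigma> \<Longrightarrow> m \<in> S \<tau> \<Longrightarrow> pairing m c \<noteq> 0 \<Longrightarrow> m \<in> J \<tau>"
  using decorations(4) by (auto simp: decorated_ideal_iff)

text \<open>The face property of \<open>P\<close> inside the monoid of each cone of the star. It
  makes extension by zero from \<open>P\<close> multiplicative.\<close>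

lemma P_add_iff: "\<tau> \<in> star \<Longrightarrow> m \<in> S \<tau> \<Longrightarrow> n \<in> S \<tau> \<Longrightarrow> m + n \<in> P \<longleftrightarrow> m \<in> P \<and> n \<in> P"
  using cone_perp_face[of m N \<sigma> n] cone_monoid_mono[OF starD(3)] additive_group_add[OF additive_group_cone_perp]
  by blast

lemma P_zero: "0 \<in> P"
  by (rule additive_group_zero[OF additive_group_cone_perp])

lemma conv_R:
  fixes A (structure)
  assumes \<tau>: "\<tau> \<in> \<Sigma>" and A: "superalgebra A" and g: "g \<in> shom H A" and h: "h \<in> shom (R \<tau>) A"
  shows "conv c (R \<tau>) A g h \<in> shom (R \<tau>) A"
    and "\<And>m. m \<in> S \<tau> \<Longrightarrow> conv c (R \<tau>) A g h (x_monom m) = (g (x_monom m) \<otimes> h (x_monom m)) \<oplus>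
         (if pairing m c = 0 then \<zero> else pairing m c \<odot> (g (xi_monom m) \<otimes> h (xi_monom m)))"
    and "\<And>m. m \<in> J \<tau> \<Longrightarrow> conv c (R \<tau>) A g h (xi_monom m) =
        (g (xi_monom m) \<otimes> h (x_monom m)) \<oplus> (g (x_monom m) \<otimes> h (xi_monom m))"
proof -
  have *: "S \<tau> \<subseteq> M" "J \<tau> \<subseteq> M" using S_subset J_subset[OF \<tau>] by auto
  note conv = conv_shom[where c = c, OF A mi_R[of \<tau>] mi_H * J_subset[OF \<tau>] _ g[unfolded H_eq] h[unfolded R_eq],
      OF pairing_J[OF \<tau>], simplified]
  show "conv c (R \<tau>) A g h \<in> shom (R \<tau>) A" unfolding R_eq by (rule conv(1))
  show "conv c (R \<tau>) A g h (x_monom m) = (g (x_monom m) \<otimes> h (x_monom m)) \<oplus>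
         (if pairing m c = 0 then \<zero> else pairing m c \<odot> (g (xi_monom m) \<otimes> h (xi_monom m)))"
    if "m \<in> S \<tau>" for m unfolding R_eq by (rule conv(2)[OF that])
  show "conv c (R \<tau>) A g h (xi_monom m) =
        (g (xi_monom m) \<otimes> h (x_monom m)) \<oplus> (g (x_monom m) \<otimes> h (xi_monom m))"
    if "m \<in> J \<tau>" for m unfolding R_eq by (rule conv(3)[OF that])
qed

text \<open>A torus element carrying the distinguished point to \<open>p\<close> is unique only up
  to the stabilizer, so one is fixed. Its effect on \<open>p\<close> is through the values of its
  character on \<open>P\<close>.\<close>

definition t where "t = (SOME t. t \<in> shom H ground \<and> p = act ground t (\<phi> \<sigma> ground (distinguished_point N \<B> \<sigma>)))"

lemma t: "t \<in> shom H ground" "p = act ground t (\<phi> \<sigma> ground (distinguished_point N \<B> \<sigma>))"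
proof -
  have "\<exists>t. t \<in> shom H ground \<and> p = act ground t (\<phi> \<sigma> ground (distinguished_point N \<B> \<sigma>))"
    using p_orbit unfolding Orb_def by blast
  from someI_ex[OF this] show "t \<in> shom H ground" "p = act ground t (\<phi> \<sigma> ground (distinguished_point N \<B> \<sigma>))"
    unfolding t_def by blast+
qed

definition z :: "'v \<Rightarrow> complex" where "z m = lookup (fst (t (x_monom m))) 0"

lemma t_monom: "m \<in> M \<Longrightarrow> t (x_monom m) = (single 0 (z m), 0)" "m \<in> M \<Longrightarrow> t (xi_monom m) = (0, 0)"
proof -
  assume m: "m \<in> M"
  have "t (x_monom m) \<in> carrier ground" using shom_closed[OF t(1)] m by (simp add: H_eq x_monom_carrier)
  then show "t (x_monom m) = (single 0 (z m), 0)" by (auto simp: ground_carrier z_def)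
  have "t (xi_monom m) \<in> odd_part ground" using shom_odd[OF t(1)] m by (simp add: H_eq xi_monom_odd)
  then show "t (xi_monom m) = (0, 0)" by (cases "t (xi_monom m)") (simp add: ground_def toric_alg_simps)
qed

lemma z_zero [simp]: "z 0 = 1"
  using toric_shom_relations(7)[OF superalgebra_ground mi_H t(1)[unfolded H_eq]] by (simp add: z_def ground_simps)

lemma z_add: "m \<in> M \<Longrightarrow> n \<in> M \<Longrightarrow> z (m + n) = z m * z n"
proof -
  assume mn: "m \<in> M" "n \<in> M"
  have "t (x_monom (m + n)) = t (x_monom m) \<otimes>\<^bsub>ground\<^esub> t (x_monom n)"
    using toric_shom_relations(3)[OF superalgebra_ground mi_H t(1)[unfolded H_eq] mn] .
  also have "\<dots> = (single 0 (z m * z n), 0)" unfolding t_monom(1)[OF mn(1)] t_monom(1)[OF mn(2)] by (rule ground_simps)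
  finally show ?thesis by (simp add: z_def[of "m + n"])
qed

lemma z_nonzero: "m \<in> M \<Longrightarrow> z m \<noteq> 0"
  using z_add[of m "- m"] additive_group_uminus[OF additive_group_dual_lattice, of m N] by auto

lemma z_inverse: "m \<in> M \<Longrightarrow> z (- m) * z m = 1"
  using z_add[of "- m" m] additive_group_uminus[OF additive_group_dual_lattice, of m N] by simp

text \<open>The coordinates of \<open>p\<close> in the chart of \<sigma>: the character
  \<open>z\<close> on \<open>P\<close>, extended by zero.\<close>

definition \<zeta> :: "'v \<Rightarrow> complex" where "\<zeta> m = (if m \<in> P then z m else 0)"

lemma P_subset: "P \<subseteq> M"
  using cone_perp_dual by blast

lemma \<zeta>_hom: "\<tau> \<in> star \<Longrightarrow> m \<in> S \<tau> \<Longrightarrow> n \<in> S \<tau> \<Longrightarrow> \<zeta> (m + n) = \<zeta> m * \<zeta> n" "\<zeta> 0 = 1"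
proof -
  assume *: "\<tau> \<in> star" "m \<in> S \<tau>" "n \<in> S \<tau>"
  then have "m \<in> M" "n \<in> M" using S_subset by blast+
  then show "\<zeta> (m + n) = \<zeta> m * \<zeta> n" using P_add_iff[OF *] by (simp add: \<zeta>_def z_add)
qed (simp add: \<zeta>_def P_zero)

definition pt :: "'v coord superalg \<Rightarrow> 'v coord \<Rightarrow> 'v coord" where "pt A = scalar_point (S \<sigma>) (J \<sigma>) A \<zeta>"

lemma pt_shom: "superalgebra A \<Longrightarrow> pt A \<in> shom (R \<sigma>) A"
  unfolding pt_def R_eq by (rule scalar_point_shom[OF _ mi_R]) (auto simp: \<zeta>_hom(2) intro: \<zeta>_hom(1)[OF \<sigma>_star])

lemma pt_monom:
  assumes "superalgebra A"
  shows "m \<in> S \<sigma> \<Longrightarrow> pt A (x_monom m) = \<zeta> m \<odot>\<^bsub>A\<^esub> \<one>\<^bsub>A\<^esub>" "m \<in> J \<sigma> \<Longrightarrow> pt A (xi_monom m) = \<zero>\<^bsub>A\<^esub>"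
  unfolding pt_def by (simp_all add: scalar_point_monom[OF assms])

lemma distinguished_point_eq:
  "distinguished_point N \<B> \<sigma> = scalar_point (S \<sigma>) (J \<sigma>) ground (\<lambda>m. if m \<in> P then 1 else 0)"
proof
  fix q
  show "distinguished_point N \<B> \<sigma> q = scalar_point (S \<sigma>) (J \<sigma>) ground (\<lambda>m. if m \<in> P then 1 else 0) q"
  proof (cases "q \<in> carrier (toric_alg (S \<sigma>) (J \<sigma>))")
    case True
    have "(\<Sum>m\<in>keys (fst q) \<inter> P. lookup (fst q) m) = (\<Sum>m\<in>keys (fst q). lookup (fst q) m * (if m \<in> P then 1 else 0))"
      by (simp add: sum.inter_restrict if_distrib cong: if_cong)
    then show ?thesis
      unfolding scalar_point_eval[OF superalgebra_ground True] ground_simps(1)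
      using True by (simp add: distinguished_point_def R_eq)
  next
    case False
    then show ?thesis by (simp add: distinguished_point_def R_eq scalar_point_def toric_lift_def)
  qed
qed

lemma distinguished_shom: "distinguished_point N \<B> \<sigma> \<in> shom (R \<sigma>) ground"
  unfolding distinguished_point_eq R_eq
  by (rule scalar_point_shom[OF superalgebra_ground mi_R]) (auto simp: P_zero P_add_iff[OF \<sigma>_star])

text \<open>The action is computed in the chart. The odd coordinates of complex points vanish, so
  convolution reduces to the product of scalar values.\<close>

lemma p_eq: "p = \<phi> \<sigma> ground (pt ground)"
proof -
  interpret G: salg ground using superalgebra_ground by (rule salgI)
  note cv = conv_R[OF \<sigma>_mem superalgebra_ground t(1) distinguished_shom]
  have "conv c (R \<sigma>) ground t (distinguished_point N \<B> \<sigma>) = pt ground"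
  proof (rule shom_toric_eqI[OF superalgebra_ground mi_R])
    show "conv c (R \<sigma>) ground t (distinguished_point N \<B> \<sigma>) \<in> shom (toric_alg (S \<sigma>) (J \<sigma>)) ground"
      using cv(1) unfolding R_eq .
    show "pt ground \<in> shom (toric_alg (S \<sigma>) (J \<sigma>)) ground" using pt_shom[OF superalgebra_ground] unfolding R_eq .
    fix m assume m: "m \<in> S \<sigma>"
    then have mM: "m \<in> M" using S_subset by blast
    have d: "distinguished_point N \<B> \<sigma> (x_monom m) = (single 0 (if m \<in> P then 1 else 0), 0)"
      unfolding distinguished_point_eq scalar_point_monom(1)[OF superalgebra_ground m] ground_simps(1) ..
    have "t (x_monom m) \<otimes>\<^bsub>ground\<^esub> distinguished_point N \<B> \<sigma> (x_monom m) = (single 0 (\<zeta> m), 0)"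
      unfolding d t_monom(1)[OF mM] ground_simps(4) by (simp add: \<zeta>_def)
    moreover have "t (xi_monom m) \<otimes>\<^bsub>ground\<^esub> distinguished_point N \<B> \<sigma> (xi_monom m) = \<zero>\<^bsub>ground\<^esub>" if "m \<in> J \<sigma>"
      using t_monom(2)[OF mM] shom_closed[OF distinguished_shom, of "xi_monom m"] that
      by (simp add: R_eq xi_monom_carrier ground_simps(2)[symmetric])
    moreover have "(single 0 (\<zeta> m), 0) \<oplus>\<^bsub>ground\<^esub> \<zero>\<^bsub>ground\<^esub> = (single 0 (\<zeta> m), 0)"
      by (rule G.r_zero) (auto simp: ground_carrier)
    ultimately show "conv c (R \<sigma>) ground t (distinguished_point N \<B> \<sigma>) (x_monom m) = pt ground (x_monom m)"
      using cv(2)[OF m] pt_monom(1)[OF superalgebra_ground m] pairing_J[OF \<sigma>_mem m] by (simp add: ground_simps(1))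
  next
    fix m assume m: "m \<in> J \<sigma>"
    then have mS: "m \<in> S \<sigma>" using J_subset[OF \<sigma>_mem] by blast
    then have mM: "m \<in> M" using S_subset by blast
    have "distinguished_point N \<B> \<sigma> (xi_monom m) = \<zero>\<^bsub>ground\<^esub>"
      unfolding distinguished_point_eq by (rule scalar_point_monom(2)[OF superalgebra_ground m])
    moreover have "t (xi_monom m) = \<zero>\<^bsub>ground\<^esub>" using t_monom(2)[OF mM] by (simp add: ground_simps(2))
    moreover have "t (x_monom m) \<in> carrier ground" "distinguished_point N \<B> \<sigma> (x_monom m) \<in> carrier ground"
      using shom_closed[OF t(1)] mM shom_closed[OF distinguished_shom] mS by (simp_all add: R_eq H_eq x_monom_carrier)
    ultimately show "conv c (R \<sigma>) ground t (distinguished_point N \<B> \<sigma>) (xi_monom m) = pt ground (xi_monom m)"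
      using cv(3)[OF m] pt_monom(2)[OF superalgebra_ground m] by simp
  qed
  then show ?thesis
    using t(2) glued(6)[OF \<sigma>_mem superalgebra_ground t(1) distinguished_shom] by simp
qed

text \<open>Values of \<open>z\<close> are nonzero, so a monomial vanishes at \<open>p\<close>
  exactly when its exponent is outside \<open>P\<close>. Injectivity of the chart makes
  \<open>pt ground\<close> the only homomorphism to be examined.\<close>

lemma decorations_vanish_iff: "decorations_vanish N \<B> \<phi> \<sigma> p \<longleftrightarrow> \<B> \<sigma> \<inter> P = {}"
proof -
  have "pt ground (x_monom b) = \<zero>\<^bsub>ground\<^esub> \<longleftrightarrow> b \<notin> P" if "b \<in> \<B> \<sigma>" for b
  proof -
    have bS: "b \<in> S \<sigma>" using that decorations(3)[OF \<sigma>_mem] by blast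
    have "z b \<noteq> 0" using z_nonzero bS S_subset by blast
    moreover have "single (0::'v) w = 0 \<longleftrightarrow> w = 0" for w :: complex
      by (metis lookup_single_eq lookup_zero single_zero)
    ultimately show ?thesis unfolding pt_monom(1)[OF superalgebra_ground bS] ground_simps(1,2) by (simp add: \<zeta>_def)
  qed
  then have vanish: "(\<forall>b\<in>\<B> \<sigma>. pt ground (x_monom b) = \<zero>\<^bsub>ground\<^esub>) \<longleftrightarrow> \<B> \<sigma> \<inter> P = {}" by auto
  have uniq: "h = pt ground" if "h \<in> shom (R \<sigma>) ground" "\<phi> \<sigma> ground h = p" for h
    using chart_inj[OF \<sigma>_mem superalgebra_ground that(1) pt_shom[OF superalgebra_ground]] that(2) p_eq by simp
  have "decorations_vanish N \<B> \<phi> \<sigma> p \<longleftrightarrow> (\<forall>b\<in>\<B> \<sigma>. pt ground (x_monom b) = \<zero>\<^bsub>ground\<^esub>)"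
  proof
    assume "decorations_vanish N \<B> \<phi> \<sigma> p"
    then show "\<forall>b\<in>\<B> \<sigma>. pt ground (x_monom b) = \<zero>\<^bsub>ground\<^esub>"
      unfolding decorations_vanish_def using pt_shom[OF superalgebra_ground] p_eq[symmetric] by simp
  next
    assume *: "\<forall>b\<in>\<B> \<sigma>. pt ground (x_monom b) = \<zero>\<^bsub>ground\<^esub>"
    show "decorations_vanish N \<B> \<phi> \<sigma> p"
      unfolding decorations_vanish_def
    proof (intro ballI impI)
      fix h b assume h: "h \<in> shom (R \<sigma>) ground" "\<phi> \<sigma> ground h = p" and b: "b \<in> \<B> \<sigma>"
      show "h (x_monom b) = \<zero>\<^bsub>ground\<^esub>" unfolding uniq[OF h] using * b by blast
    qed
  qed
  then show ?thesis unfolding vanish .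
qed

lemma structure_map_eq: "structure_map A = scalar_point {0} {} A (\<lambda>_. 1)" if A: "superalgebra A"
proof
  fix q
  show "structure_map A q = scalar_point {0} {} A (\<lambda>_. 1) q"
  proof (cases "q \<in> carrier ground")
    case True
    then obtain w where q: "q = (single 0 w, 0)" by (auto simp: ground_carrier)
    show ?thesis using True scalar_point_eval[OF A, of q "{0}" "{}" "\<lambda>_. 1"]
      by (simp add: structure_map_def q ground_def)
  next
    case False
    then show ?thesis by (simp add: structure_map_def scalar_point_def toric_lift_def ground_def)
  qed
qed

lemma structure_map_shom: "superalgebra A \<Longrightarrow> structure_map A \<in> shom ground A"
  unfolding structure_map_eq unfolding ground_def
  by (rule scalar_point_shom[OF _ monoid_ideal_ground]) auto

lemma fmap_structure_p:
  assumes A: "superalgebra A"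
  shows "fmap X ground A (structure_map A) p = \<phi> \<sigma> A (pt A)"
proof -
  interpret A: salg A using A by (rule salgI)
  note sm = structure_map_shom[OF A] and pg = pt_shom[OF superalgebra_ground]
  interpret G: salg ground using superalgebra_ground by (rule salgI)
  have "compose (carrier (R \<sigma>)) (structure_map A) (pt ground) = pt A"
  proof (rule shom_toric_eqI[OF A mi_R])
    show "compose (carrier (R \<sigma>)) (structure_map A) (pt ground) \<in> shom (toric_alg (S \<sigma>) (J \<sigma>)) A"
      using shom_compose[OF superalgebra_R pg sm] unfolding R_eq .
    show "pt A \<in> shom (toric_alg (S \<sigma>) (J \<sigma>)) A" using pt_shom[OF A] unfolding R_eq .
    fix m assume m: "m \<in> S \<sigma>"
    have "structure_map A (\<zeta> m \<odot>\<^bsub>ground\<^esub> \<one>\<^bsub>ground\<^esub>) = \<zeta> m \<odot>\<^bsub>A\<^esub> \<one>\<^bsub>A\<^esub>"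
      by (simp add: shom_smult[OF sm] shom_one[OF sm])
    then show "compose (carrier (R \<sigma>)) (structure_map A) (pt ground) (x_monom m) = pt A (x_monom m)"
      using m by (simp add: compose_eq R_eq x_monom_carrier pt_monom A superalgebra_ground)
  next
    fix m assume m: "m \<in> J \<sigma>"
    then show "compose (carrier (R \<sigma>)) (structure_map A) (pt ground) (xi_monom m) = pt A (xi_monom m)"
      by (simp add: compose_eq R_eq xi_monom_carrier pt_monom A superalgebra_ground
          shom_zero[OF superalgebra_ground A sm])
  qed
  then show ?thesis
    using chart_natural[OF \<sigma>_mem superalgebra_ground A sm pg] p_eq by simp
qed

end

section \<open>The closure of the orbit\<close>

context toric_orbit
begin

text \<open>Outside the star of \<open>\<sigma>\<close> the ideal below contains \<open>x\<^sup>0 = 1\<close>: the closure does not meet those charts.\<close>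

definition residual :: "'v set \<Rightarrow> 'v set" where "residual \<tau> = (if \<tau> \<in> star then P else {})"

definition closure_ideal :: "'v set \<Rightarrow> 'v coord set" where
  "closure_ideal \<tau> = x_monom ` (S \<tau> - residual \<tau>) \<union> xi_monom ` (J \<tau> - residual \<tau>)"

definition kills :: "'v set \<Rightarrow> 'v coord superalg \<Rightarrow> ('v coord \<Rightarrow> 'v coord) \<Rightarrow> bool" where
  "kills \<tau> A h \<longleftrightarrow> (\<forall>r\<in>closure_ideal \<tau>. h r = \<zero>\<^bsub>A\<^esub>)"

lemma kills_iff: "kills \<tau> A h \<longleftrightarrow>
    (\<forall>m\<in>S \<tau> - residual \<tau>. h (x_monom m) = \<zero>\<^bsub>A\<^esub>) \<and> (\<forall>m\<in>J \<tau> - residual \<tau>. h (xi_monom m) = \<zero>\<^bsub>A\<^esub>)"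
  by (auto simp: kills_def closure_ideal_def)

lemma face_subset: "is_face \<rho> \<tau> \<Longrightarrow> S \<tau> \<subseteq> S \<rho>"
  by (rule cone_monoid_mono[OF is_face_subset])

lemma face_J_subset:
  assumes "\<rho> \<in> \<Sigma>" "\<tau> \<in> \<Sigma>" "is_face \<rho> \<tau>" shows "J \<tau> \<subseteq> J \<rho>"
proof
  fix m assume "m \<in> J \<tau>"
  then obtain b where b: "b \<in> \<B> \<tau>" "m - b \<in> S \<tau>" by (auto simp: decorated_ideal_iff)
  have "\<tau> \<inter> \<rho> = \<rho>" using is_face_subset[OF assms(3)] by blast
  then obtain b' where b': "b' \<in> \<B> \<rho>" "b - b' \<in> S \<rho>" using decorations(5)[OF assms(2,1) b(1)] by auto
  have "(m - b) + (b - b') \<in> S \<rho>" using cone_monoid_add[OF _ b'(2)] b(2) face_subset[OF assms(3)] by blast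
  then show "m \<in> J \<rho>" using b'(1) by (auto simp: decorated_ideal_iff)
qed

text \<open>A monomial with invertible exponent goes to a unit, and a unit is zero only in the zero
  ring.\<close>

lemma zero_if_kills:
  fixes A (structure)
  assumes A: "superalgebra A" and h: "h \<in> shom (R \<tau>) A" and m: "m \<in> S \<tau>" "- m \<in> S \<tau>" "h (x_monom m) = \<zero>"
    and a: "a \<in> carrier A"
  shows "a = \<zero>"
proof -
  interpret A: salg A using A by (rule salgI)
  note r = toric_shom_relations[OF A mi_R h[unfolded R_eq]]
  have "\<one> = h (x_monom m) \<otimes> h (x_monom (- m))" using r(3)[OF m(1,2)] r(7) by simp
  also have "\<dots> = \<zero>" using r(1)[OF m(2)] A.even_carrier m(3) by simp
  finally show ?thesis using A.zero_ring_eq a by blast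
qed

lemma kills_zero_ring:
  fixes A (structure)
  assumes A: "superalgebra A" and h: "h \<in> shom (R \<tau>) A" and "\<tau> \<notin> star" "kills \<tau> A h" "a \<in> carrier A"
  shows "a = \<zero>"
proof (rule zero_if_kills[OF A h _ _ _ assms(5)])
  show "h (x_monom 0) = \<zero>" using assms(3,4) by (simp add: kills_iff residual_def cone_monoid_zero)
qed (simp_all add: cone_monoid_zero)

lemma kills_if_zero_ring:
  assumes h: "h \<in> shom (R \<tau>) A" and "\<And>a. a \<in> carrier A \<Longrightarrow> a = \<zero>\<^bsub>A\<^esub>"
  shows "kills \<tau> A h"
  unfolding kills_iff
proof (intro conjI ballI)
  fix m assume "m \<in> S \<tau> - residual \<tau>"
  then have "x_monom m \<in> carrier (R \<tau>)" by (simp add: R_eq x_monom_carrier)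
  then show "h (x_monom m) = \<zero>\<^bsub>A\<^esub>" by (rule assms(2)[OF shom_closed[OF h]])
next
  fix m assume "m \<in> J \<tau> - residual \<tau>"
  then have "xi_monom m \<in> carrier (R \<tau>)" by (simp add: R_eq xi_monom_carrier)
  then show "h (xi_monom m) = \<zero>\<^bsub>A\<^esub>" by (rule assms(2)[OF shom_closed[OF h]])
qed

lemma restrict_face:
  assumes \<rho>: "\<rho> \<in> \<Sigma>" and \<tau>: "\<tau> \<in> \<Sigma>" and face: "is_face \<rho> \<tau>" and h: "h \<in> shom (R \<rho>) A"
  shows "restrict h (carrier (R \<tau>)) \<in> shom (R \<tau>) A"
  using shom_restrict_subalgebra[OF h[unfolded R_eq] mi_R[of \<tau>] face_subset[OF face] face_J_subset[OF \<rho> \<tau> face]]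
  unfolding R_eq .

lemma restrict_monom:
  "m \<in> S \<tau> \<Longrightarrow> restrict h (carrier (R \<tau>)) (x_monom m) = h (x_monom m)"
  "m \<in> J \<tau> \<Longrightarrow> restrict h (carrier (R \<tau>)) (xi_monom m) = h (xi_monom m)"
  by (simp_all add: R_eq x_monom_carrier xi_monom_carrier)

text \<open>Passing to a face inverts a monomial, and vanishing of the remaining monomials has to
  survive this. For a face outside the star the conditions hold over the zero ring only.\<close>

lemma kills_restrict_face:
  fixes A (structure)
  assumes \<rho>: "\<rho> \<in> \<Sigma>" and \<tau>: "\<tau> \<in> \<Sigma>" and face: "is_face \<rho> \<tau>" and A: "superalgebra A" and h: "h \<in> shom (R \<rho>) A"
  shows "kills \<rho> A h \<longleftrightarrow> kills \<tau> A (restrict h (carrier (R \<tau>)))"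
proof
  assume k: "kills \<rho> A h"
  show "kills \<tau> A (restrict h (carrier (R \<tau>)))"
  proof (cases "\<rho> \<in> star")
    case True
    then have "\<tau> \<in> star" using star_iff[OF \<tau>] starD(3)[OF True] is_face_subset[OF face] by blast
    with True have "residual \<rho> = residual \<tau>" by (simp add: residual_def)
    then show ?thesis
      using k face_subset[OF face] face_J_subset[OF \<rho> \<tau> face] unfolding kills_iff by (auto simp: R_eq x_monom_carrier xi_monom_carrier)
  next
    case False
    show ?thesis by (rule kills_if_zero_ring[OF restrict_face[OF \<rho> \<tau> face h] kills_zero_ring[OF A h False k]])
  qed
next
  assume k: "kills \<tau> A (restrict h (carrier (R \<tau>)))"
  have kS: "h (x_monom m) = \<zero>" if "m \<in> S \<tau>" "m \<notin> residual \<tau>" for m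
    using k that by (auto simp: kills_iff R_eq x_monom_carrier xi_monom_carrier)
  have kJ: "h (xi_monom m) = \<zero>" if "m \<in> J \<tau>" "m \<notin> residual \<tau>" for m
    using k that by (auto simp: kills_iff R_eq x_monom_carrier xi_monom_carrier)
  \<comment> \<open>The monomial with exponent \<open>m0\<close> is the one whose inversion turns
    the chart of \<tau> into that of \<rho>.\<close>
  obtain m0 where m0: "m0 \<in> S \<tau>" "\<And>u. u \<in> \<tau> \<Longrightarrow> m0 \<bullet> u = 0 \<longleftrightarrow> u \<in> \<rho>"
    using exposing_monoid_element[OF zlattice fan_cone_mem[OF \<tau>] fan_cone_mem[OF \<rho>] face] by blast
  have m0_perp: "m0 \<in> cone_perp N \<rho>"
    using m0 is_face_subset[OF face] by (auto simp: cone_perp_def cone_monoid_def)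
  have km0: "real k *\<^sub>R m0 \<in> cone_perp N \<rho>" "- (real k *\<^sub>R m0) \<in> cone_perp N \<rho>" for k
    using additive_group_of_int[OF additive_group_cone_perp m0_perp, of "int k"]
      additive_group_uminus[OF additive_group_cone_perp] by auto
  note r = toric_shom_relations[OF A mi_R h[unfolded R_eq]]
  interpret A: salg A using A by (rule salgI)
  show "kills \<rho> A h"
  proof (cases "\<rho> \<in> star")
    case True
    then have \<tau>s: "\<tau> \<in> star" using star_iff[OF \<tau>] starD(3)[OF True] is_face_subset[OF face] by blast
    with True have res: "residual \<rho> = P" "residual \<tau> = P" by (simp_all add: residual_def)
    \<comment> \<open>As \<sigma> is contained in \<rho>, the exponent \<open>m0\<close> lies in the
      group \<open>P\<close>, so shifts by its multiples do not affect membership in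
      \<open>P\<close>.\<close>
    have kP: "real k *\<^sub>R m0 \<in> P" for k using km0 cone_perp_mono[OF starD(3)[OF True]] by blast
    have kP': "m + real k *\<^sub>R m0 \<notin> P" if "m \<notin> P" for m k
      using additive_group_diff[OF additive_group_cone_perp _ kP, of "m + real k *\<^sub>R m0" k] that by auto
    have kS0: "real k *\<^sub>R m0 \<in> S \<rho>" "- (real k *\<^sub>R m0) \<in> S \<rho>" for k using km0 cone_perp_subset_monoid by blast+
    show ?thesis
      unfolding kills_iff res
    proof (intro conjI ballI)
      fix m assume m: "m \<in> S \<rho> - P"
      obtain k :: nat where k: "m + real k *\<^sub>R m0 \<in> S \<tau>"
        using shift_into_cone_monoid[OF fan_cone_mem[OF \<tau>] m0] m by blast
      have "h (x_monom m) = h (x_monom (m + real k *\<^sub>R m0)) \<otimes> h (x_monom (- (real k *\<^sub>R m0)))"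
        using r(3)[of "m + real k *\<^sub>R m0" "- (real k *\<^sub>R m0)"] k kS0(2) face_subset[OF face] by auto
      also have "\<dots> = \<zero>" using kS[OF k] kP'[of m k] m r(1)[OF kS0(2)] A.even_carrier res by simp
      finally show "h (x_monom m) = \<zero>" .
    next
      fix m assume m: "m \<in> J \<rho> - P"
      then obtain b where b: "b \<in> \<B> \<rho>" "m - b \<in> S \<rho>" by (auto simp: decorated_ideal_iff)
      have "\<rho> \<inter> \<tau> = \<rho>" using is_face_subset[OF face] by blast
      \<comment> \<open>The second admissibility condition supplies a decoration of \<tau> below
        \<open>b\<close>; with it odd exponents of \<rho> can also be shifted into the module of
        \<tau>.\<close>
      then obtain b' where b': "b' \<in> \<B> \<tau>" "b - b' \<in> S \<rho>" using decorations(5)[OF \<rho> \<tau> b(1)] by auto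
      have "m - b' \<in> S \<rho>" using cone_monoid_add[OF b(2) b'(2)] by simp
      then obtain k :: nat where "m - b' + real k *\<^sub>R m0 \<in> S \<tau>"
        using shift_into_cone_monoid[OF fan_cone_mem[OF \<tau>] m0] by blast
      then have k: "m + real k *\<^sub>R m0 \<in> J \<tau>" using b'(1) by (auto simp: decorated_ideal_iff algebra_simps)
      have "h (xi_monom m) = h (xi_monom (m + real k *\<^sub>R m0)) \<otimes> h (x_monom (- (real k *\<^sub>R m0)))"
        using r(5)[of "m + real k *\<^sub>R m0" "- (real k *\<^sub>R m0)"] k kS0(2) face_J_subset[OF \<rho> \<tau> face] by auto
      also have "\<dots> = \<zero>" using kJ[OF k] kP'[of m k] m r(1)[OF kS0(2)] A.even_carrier res by simp
      finally show "h (xi_monom m) = \<zero>" .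
    qed
  next
    case False
    \<comment> \<open>Some vector of \<sigma> is missing from \<rho>. If \<tau> contains \<sigma>,
      then \<open>m0\<close> is positive on that vector, so the invertible monomial is among those
      killed.\<close>
    have "m0 \<notin> residual \<tau>"
    proof (cases "\<tau> \<in> star")
      case True
      obtain u where u: "u \<in> \<sigma>" "u \<notin> \<rho>" using star_iff[OF \<rho>] False by blast
      then have "m0 \<bullet> u \<noteq> 0" using m0(2) starD(3)[OF True] by blast
      then show ?thesis using u True by (auto simp: residual_def cone_perp_def)
    qed (simp add: residual_def)
    then have "h (x_monom m0) = \<zero>" using kS[OF m0(1)] by blast
    moreover have "m0 \<in> S \<rho>" "- m0 \<in> S \<rho>" using m0_perp km0(2)[of 1] cone_perp_subset_monoid by auto
    ultimately have "a = \<zero>" if "a \<in> carrier A" for a using zero_if_kills[OF A h, of m0] that by blast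
    then show ?thesis by (rule kills_if_zero_ring[OF h])
  qed
qed

text \<open>A point lying in two charts comes from the chart of the common face, so compatibility is
  \<open>kills_restrict_face\<close> applied once downwards and once upwards.\<close>

sublocale closed_in_charts X \<Sigma> R \<phi> closure_ideal
proof
  show "closure_ideal \<tau> \<subseteq> even_part (R \<tau>) \<union> odd_part (R \<tau>)" for \<tau>
    by (auto simp: closure_ideal_def R_eq x_monom_even xi_monom_odd)
  fix \<tau> \<tau>' A h h' assume \<tau>: "\<tau> \<in> \<Sigma>" "\<tau>' \<in> \<Sigma>" and A: "superalgebra A" and h: "h \<in> shom (R \<tau>) A" "h' \<in> shom (R \<tau>') A"
    and eq: "\<phi> \<tau> A h = \<phi> \<tau>' A h'" and k: "\<forall>r\<in>closure_ideal \<tau>. h r = \<zero>\<^bsub>A\<^esub>"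
  have face: "is_face (\<tau> \<inter> \<tau>') \<tau>" "is_face (\<tau> \<inter> \<tau>') \<tau>'" using fan_Int[OF \<tau>] by blast+
  then have \<rho>: "\<tau> \<inter> \<tau>' \<in> \<Sigma>" using fan_face_mem \<tau> by blast
  have "\<phi> \<tau> A h \<in> \<phi> \<tau> A ` shom (R \<tau>) A \<inter> \<phi> \<tau>' A ` shom (R \<tau>') A" using imageI[OF h(1), of "\<phi> \<tau> A"] imageI[OF h(2), of "\<phi> \<tau>' A"] eq by simp
  then obtain g where g: "g \<in> shom (R (\<tau> \<inter> \<tau>')) A" "\<phi> \<tau> A h = \<phi> (\<tau> \<inter> \<tau>') A g" using glued(5)[OF \<tau> A] by auto
  have "h = restrict g (carrier (R \<tau>))"
    using chart_inj[OF \<tau>(1) A h(1) restrict_face[OF \<rho> \<tau>(1) face(1) g(1)]] g(2) glued(4)[OF \<rho> \<tau>(1) face(1) A g(1)] by simp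
  moreover have "h' = restrict g (carrier (R \<tau>'))"
    using chart_inj[OF \<tau>(2) A h(2) restrict_face[OF \<rho> \<tau>(2) face(2) g(1)]] g(2) eq
      glued(4)[OF \<rho> \<tau>(2) face(2) A g(1)] by simp
  moreover have "kills \<tau> A h" using k by (simp add: kills_def)
  ultimately have "kills \<tau>' A h'"
    using kills_restrict_face[OF \<rho> \<tau>(1) face(1) A g(1)] kills_restrict_face[OF \<rho> \<tau>(2) face(2) A g(1)] by simp
  then show "\<forall>r\<in>closure_ideal \<tau>'. h' r = \<zero>\<^bsub>A\<^esub>" by (simp add: kills_def)
qed

lemma glued_sub_chart_kills: "\<tau> \<in> \<Sigma> \<Longrightarrow> superalgebra A \<Longrightarrow> h \<in> shom (R \<tau>) A \<Longrightarrow> \<phi> \<tau> A h \<in> glued_sub A \<longleftrightarrow> kills \<tau> A h"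
  unfolding kills_def by (rule glued_sub_chart)

end

context toric_orbit
begin

abbreviation R' :: "'v set \<Rightarrow> 'v coord superalg" where "R' \<tau> \<equiv> toric_alg (S \<tau> \<inter> P) (J \<tau> \<inter> P)"
abbreviation "H' \<equiv> R' \<sigma>"

lemma mi_R': "monoid_ideal (S \<tau> \<inter> P) (J \<tau> \<inter> P)"
  by (rule monoid_ideal_Int[OF mi_R additive_group_cone_perp])

lemma superalgebra_R': "superalgebra (R' \<tau>)"
  by (rule superalgebra_toric_alg[OF mi_R'])

lemma star_subset: "\<tau> \<in> star \<Longrightarrow> S \<tau> \<subseteq> S \<sigma>" "\<tau> \<in> star \<Longrightarrow> J \<tau> \<subseteq> J \<sigma>"
  using face_subset[OF starD(2)] face_J_subset[OF \<sigma>_mem starD(1) starD(2)] by blast+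

lemma S\<sigma>_P: "S \<sigma> \<inter> P = P"
  using cone_perp_subset_monoid by blast

text \<open>The set on the left is stable under translation by the group \<open>P\<close>, which is
  contained in the monoid of \<sigma>. This dichotomy separates the purely even orbit from the super
  one.\<close>

lemma J\<sigma>_P: "J \<sigma> \<inter> P = {} \<or> J \<sigma> \<inter> P = P"
proof -
  have "n \<in> J \<sigma>" if m: "m \<in> J \<sigma>" "m \<in> P" and n: "n \<in> P" for m n
  proof -
    have "n - m \<in> S \<sigma>"
      using additive_group_diff[OF additive_group_cone_perp n m(2)] cone_perp_subset_monoid by blast
    moreover obtain b where b: "b \<in> \<B> \<sigma>" "m - b \<in> S \<sigma>" using m(1) by (auto simp: decorated_ideal_iff)
    ultimately have "n - m + (m - b) \<in> S \<sigma>" using cone_monoid_add by blast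
    then show ?thesis using b(1) by (auto simp: decorated_ideal_iff)
  qed
  then show ?thesis by blast
qed

lemma chart_shom_eqI:
  assumes A: "superalgebra A" and h: "h \<in> shom (R \<tau>) A" "h' \<in> shom (R \<tau>) A"
    and eq: "\<And>m. m \<in> S \<tau> \<Longrightarrow> h (x_monom m) = h' (x_monom m)" "\<And>m. m \<in> J \<tau> \<Longrightarrow> h (xi_monom m) = h' (xi_monom m)"
  shows "h = h'"
  by (rule shom_toric_eqI[OF A mi_R h[unfolded R_eq] eq])

text \<open>The twist by \<open>z\<close> moves the distinguished point of the orbit to \<open>p\<close>.\<close>

definition proj :: "'v set \<Rightarrow> 'v coord \<Rightarrow> 'v coord" where
  "proj \<tau> = toric_lift (S \<tau>) (J \<tau>) (R' \<tau>)
     (\<lambda>m. if m \<in> P then z m \<odot>\<^bsub>R' \<tau>\<^esub> x_monom m else \<zero>\<^bsub>R' \<tau>\<^esub>)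
     (\<lambda>m. if m \<in> P then z m \<odot>\<^bsub>R' \<tau>\<^esub> xi_monom m else \<zero>\<^bsub>R' \<tau>\<^esub>)"

lemma proj_shom: assumes \<tau>: "\<tau> \<in> star" shows "proj \<tau> \<in> shom (R \<tau>) (R' \<tau>)"
  unfolding proj_def R_eq
proof (rule toric_lift_shom[OF superalgebra_R' mi_R])
  interpret R': salg "R' \<tau>" using superalgebra_R' by (rule salgI)
  note J_sub = J_subset[OF starD(1)[OF \<tau>]]
  have x: "x_monom m \<in> even_part (R' \<tau>)" "x_monom m \<in> carrier (R' \<tau>)" if "m \<in> S \<tau>" "m \<in> P" for m
    using that by (simp_all add: x_monom_even x_monom_carrier)
  have xi: "xi_monom m \<in> odd_part (R' \<tau>)" "xi_monom m \<in> carrier (R' \<tau>)" if "m \<in> J \<tau>" "m \<in> P" for m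
    using that by (simp_all add: xi_monom_odd xi_monom_carrier)
  have zadd: "z (m + n) = z m * z n" if "m \<in> P" "n \<in> P" for m n using z_add P_subset that by blast
  show "(if 0 \<in> P then z 0 \<odot>\<^bsub>R' \<tau>\<^esub> x_monom 0 else \<zero>\<^bsub>R' \<tau>\<^esub>) = \<one>\<^bsub>R' \<tau>\<^esub>"
    by (simp add: P_zero monom_mult(5)[of "S \<tau> \<inter> P" "J \<tau> \<inter> P"])
  fix m
  show "(if m \<in> P then z m \<odot>\<^bsub>R' \<tau>\<^esub> x_monom m else \<zero>\<^bsub>R' \<tau>\<^esub>) \<in> even_part (R' \<tau>)" if "m \<in> S \<tau>"
    using x(1)[OF that] R'.even_smult by simp
  show "(if m \<in> P then z m \<odot>\<^bsub>R' \<tau>\<^esub> xi_monom m else \<zero>\<^bsub>R' \<tau>\<^esub>) \<in> odd_part (R' \<tau>)" if "m \<in> J \<tau>"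
    using xi(1)[OF that] R'.odd_smult by simp
  fix n
  show "(if m + n \<in> P then z (m + n) \<odot>\<^bsub>R' \<tau>\<^esub> x_monom (m + n) else \<zero>\<^bsub>R' \<tau>\<^esub>) =
    (if m \<in> P then z m \<odot>\<^bsub>R' \<tau>\<^esub> x_monom m else \<zero>\<^bsub>R' \<tau>\<^esub>) \<otimes>\<^bsub>R' \<tau>\<^esub>
    (if n \<in> P then z n \<odot>\<^bsub>R' \<tau>\<^esub> x_monom n else \<zero>\<^bsub>R' \<tau>\<^esub>)" if mn: "m \<in> S \<tau>" "n \<in> S \<tau>"
    using x(2)[OF mn(1)] x(2)[OF mn(2)] R'.m_closed[OF x(2)[OF mn(1)] x(2)[OF mn(2)]]
    by (simp add: P_add_iff[OF \<tau> mn] zadd R'.smult_mult R'.mult_smult R'.smult_smult monom_mult mult.commute)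
  show "(if m + n \<in> P then z (m + n) \<odot>\<^bsub>R' \<tau>\<^esub> xi_monom (m + n) else \<zero>\<^bsub>R' \<tau>\<^esub>) =
    (if m \<in> P then z m \<odot>\<^bsub>R' \<tau>\<^esub> x_monom m else \<zero>\<^bsub>R' \<tau>\<^esub>) \<otimes>\<^bsub>R' \<tau>\<^esub>
    (if n \<in> P then z n \<odot>\<^bsub>R' \<tau>\<^esub> xi_monom n else \<zero>\<^bsub>R' \<tau>\<^esub>)" if mn: "m \<in> S \<tau>" "n \<in> J \<tau>"
  proof -
    have "n \<in> S \<tau>" using mn J_sub by blast
    then show ?thesis
      using x(2)[OF mn(1)] xi(2)[OF mn(2)] R'.m_closed[OF x(2)[OF mn(1)] xi(2)[OF mn(2)]]
      by (simp add: P_add_iff[OF \<tau> mn(1)] zadd R'.smult_mult R'.mult_smult R'.smult_smult monom_mult mult.commute)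
  qed
  show "(if m \<in> P then z m \<odot>\<^bsub>R' \<tau>\<^esub> xi_monom m else \<zero>\<^bsub>R' \<tau>\<^esub>) \<otimes>\<^bsub>R' \<tau>\<^esub>
    (if n \<in> P then z n \<odot>\<^bsub>R' \<tau>\<^esub> xi_monom n else \<zero>\<^bsub>R' \<tau>\<^esub>) = \<zero>\<^bsub>R' \<tau>\<^esub>" if "m \<in> J \<tau>" "n \<in> J \<tau>"
    using xi(2)[OF that(1)] xi(2)[OF that(2)]
    by (simp add: R'.smult_mult R'.mult_smult monom_mult)
qed

lemma proj_monom:
  "m \<in> S \<tau> \<Longrightarrow> proj \<tau> (x_monom m) = (if m \<in> P then z m \<odot>\<^bsub>R' \<tau>\<^esub> x_monom m else \<zero>\<^bsub>R' \<tau>\<^esub>)"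
  "m \<in> J \<tau> \<Longrightarrow> proj \<tau> (xi_monom m) = (if m \<in> P then z m \<odot>\<^bsub>R' \<tau>\<^esub> xi_monom m else \<zero>\<^bsub>R' \<tau>\<^esub>)"
proof -
  interpret R': salg "R' \<tau>" using superalgebra_R' by (rule salgI)
  show "m \<in> S \<tau> \<Longrightarrow> proj \<tau> (x_monom m) = (if m \<in> P then z m \<odot>\<^bsub>R' \<tau>\<^esub> x_monom m else \<zero>\<^bsub>R' \<tau>\<^esub>)"
    unfolding proj_def by (rule toric_lift_monom(1)[OF superalgebra_R']) (auto simp: x_monom_carrier)
  show "m \<in> J \<tau> \<Longrightarrow> proj \<tau> (xi_monom m) = (if m \<in> P then z m \<odot>\<^bsub>R' \<tau>\<^esub> xi_monom m else \<zero>\<^bsub>R' \<tau>\<^esub>)"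
    unfolding proj_def by (rule toric_lift_monom(2)[OF superalgebra_R']) (auto simp: xi_monom_carrier)
qed

text \<open>On points, the closed immersion of the quotient chart into the chart of \<tau>.\<close>

definition pull :: "'v set \<Rightarrow> ('v coord \<Rightarrow> 'v coord) \<Rightarrow> 'v coord \<Rightarrow> 'v coord" where
  "pull \<tau> h = compose (carrier (R \<tau>)) h (proj \<tau>)"

lemma pull_shom: "\<tau> \<in> star \<Longrightarrow> h \<in> shom (R' \<tau>) A \<Longrightarrow> pull \<tau> h \<in> shom (R \<tau>) A"
  unfolding pull_def by (rule shom_compose[OF superalgebra_R proj_shom])

lemma pull_monom:
  fixes A (structure)
  assumes \<tau>: "\<tau> \<in> star" and A: "superalgebra A" and h: "h \<in> shom (R' \<tau>) A"
  shows "m \<in> S \<tau> \<Longrightarrow> pull \<tau> h (x_monom m) = (if m \<in> P then z m \<odot> h (x_monom m) else \<zero>)"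
    "m \<in> J \<tau> \<Longrightarrow> pull \<tau> h (xi_monom m) = (if m \<in> P then z m \<odot> h (xi_monom m) else \<zero>)"
  by (simp_all add: pull_def compose_eq R_eq x_monom_carrier xi_monom_carrier proj_monom
      shom_smult[OF h] shom_zero[OF superalgebra_R' A h])

lemma kills_pull:
  assumes "\<tau> \<in> star" "superalgebra A" "h \<in> shom (R' \<tau>) A" shows "kills \<tau> A (pull \<tau> h)"
  using assms(1) by (simp add: kills_iff residual_def pull_monom[OF assms])

text \<open>On \<open>P\<close> the twist multiplies by nonzero scalars, so values on monomials can
  be recovered.\<close>

lemma pull_inj:
  fixes A (structure)
  assumes \<tau>: "\<tau> \<in> star" and A: "superalgebra A" and h: "h \<in> shom (R' \<tau>) A" "h' \<in> shom (R' \<tau>) A"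
    and eq: "pull \<tau> h = pull \<tau> h'"
  shows "h = h'"
proof (rule shom_toric_eqI[OF A mi_R' h])
  interpret A: salg A using A by (rule salgI)
  have cancel: "a = b" if "z m \<odot> a = z m \<odot> b" "m \<in> P" "a \<in> carrier A" "b \<in> carrier A" for m a b
  proof -
    have "m \<in> M" using that P_subset by blast
    have "z (- m) \<odot> (z m \<odot> a) = z (- m) \<odot> (z m \<odot> b)" using that by simp
    then show ?thesis unfolding A.smult_smult[OF that(3)] A.smult_smult[OF that(4)] z_inverse[OF \<open>m \<in> M\<close>]
      using that by simp
  qed
  fix m
  show "h (x_monom m) = h' (x_monom m)" if m: "m \<in> S \<tau> \<inter> P"
  proof (rule cancel)
    have "z m \<odot> k (x_monom m) = pull \<tau> k (x_monom m)" if "k \<in> shom (R' \<tau>) A" for k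
      using pull_monom(1)[OF \<tau> A that, of m] m by simp
    from this[OF h(1)] this[OF h(2)] show "z m \<odot> h (x_monom m) = z m \<odot> h' (x_monom m)" unfolding eq by simp
    show "h (x_monom m) \<in> carrier A" "h' (x_monom m) \<in> carrier A"
      using shom_closed[OF h(1) x_monom_carrier[OF m]] shom_closed[OF h(2) x_monom_carrier[OF m]] by blast+
  qed (use m in blast)
  show "h (xi_monom m) = h' (xi_monom m)" if m: "m \<in> J \<tau> \<inter> P"
  proof (rule cancel)
    have "z m \<odot> k (xi_monom m) = pull \<tau> k (xi_monom m)" if "k \<in> shom (R' \<tau>) A" for k
      using pull_monom(2)[OF \<tau> A that, of m] m by simp
    from this[OF h(1)] this[OF h(2)] show "z m \<odot> h (xi_monom m) = z m \<odot> h' (xi_monom m)" unfolding eq by simp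
    show "h (xi_monom m) \<in> carrier A" "h' (xi_monom m) \<in> carrier A"
      using shom_closed[OF h(1) xi_monom_carrier[OF m]] shom_closed[OF h(2) xi_monom_carrier[OF m]] by blast+
  qed (use m in blast)
qed

lemma pull_natural:
  assumes \<tau>: "\<tau> \<in> star"
  shows "pull \<tau> (compose (carrier (R' \<tau>)) f h) = compose (carrier (R \<tau>)) f (pull \<tau> h)"
  unfolding pull_def using shom_closed[OF proj_shom[OF \<tau>]] by (auto simp: compose_def)

text \<open>The preimage undoes the twist by scaling with \<open>z (- m)\<close>. No monomial
  outside \<open>P\<close> contributes because \<open>h\<close> kills it.\<close>

lemma pull_surj:
  fixes A (structure)
  assumes \<tau>: "\<tau> \<in> star" and A: "superalgebra A" and h: "h \<in> shom (R \<tau>) A" and k: "kills \<tau> A h"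
  obtains h' where "h' \<in> shom (R' \<tau>) A" "h = pull \<tau> h'"
proof -
  interpret A: salg A using A by (rule salgI)
  note r = toric_shom_relations[OF A mi_R h[unfolded R_eq]]
  note J_sub = J_subset[OF starD(1)[OF \<tau>]]
  have c: "h (x_monom m) \<in> carrier A" if "m \<in> S \<tau>" for m using r(1)[OF that] by (rule A.even_carrier)
  have ci: "h (xi_monom m) \<in> carrier A" if "m \<in> J \<tau>" for m using r(2)[OF that] by (rule A.odd_carrier)
  have um: "- m \<in> P" if "m \<in> P" for m using additive_group_uminus[OF additive_group_cone_perp that] .
  have zadd: "z (- m - n) = z (- m) * z (- n)" if "m \<in> P" "n \<in> P" for m n
    using z_add[of "- m" "- n"] P_subset um[OF that(1)] um[OF that(2)] by auto
  define h' where "h' = toric_lift (S \<tau> \<inter> P) (J \<tau> \<inter> P) A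
     (\<lambda>m. z (- m) \<odot> h (x_monom m)) (\<lambda>m. z (- m) \<odot> h (xi_monom m))"
  have h': "h' \<in> shom (R' \<tau>) A"
    unfolding h'_def
  proof (rule toric_lift_shom[OF A mi_R'])
    show "z (- 0) \<odot> h (x_monom 0) = \<one>" by (simp add: r(7))
    fix m
    show "m \<in> S \<tau> \<inter> P \<Longrightarrow> z (- m) \<odot> h (x_monom m) \<in> even_part A" using r(1) by (intro A.even_smult) blast
    show "m \<in> J \<tau> \<inter> P \<Longrightarrow> z (- m) \<odot> h (xi_monom m) \<in> odd_part A" using r(2) by (intro A.odd_smult) blast
    fix n
    show "z (- (m + n)) \<odot> h (x_monom (m + n)) = (z (- m) \<odot> h (x_monom m)) \<otimes> (z (- n) \<odot> h (x_monom n))"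
      if "m \<in> S \<tau> \<inter> P" "n \<in> S \<tau> \<inter> P"
      using that r(3)[of m n] c zadd[of m n] by (simp add: A.smult_mult A.mult_smult A.smult_smult mult.commute)
    show "z (- (m + n)) \<odot> h (xi_monom (m + n)) = (z (- m) \<odot> h (x_monom m)) \<otimes> (z (- n) \<odot> h (xi_monom n))"
      if "m \<in> S \<tau> \<inter> P" "n \<in> J \<tau> \<inter> P"
      using that r(4)[of m n] c ci zadd[of m n] by (simp add: A.smult_mult A.mult_smult A.smult_smult mult.commute)
    show "(z (- m) \<odot> h (xi_monom m)) \<otimes> (z (- n) \<odot> h (xi_monom n)) = \<zero>"
      if "m \<in> J \<tau> \<inter> P" "n \<in> J \<tau> \<inter> P"
      using that r(6)[of m n] ci by (simp add: A.smult_mult A.mult_smult)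
  qed
  have h'_monom: "m \<in> S \<tau> \<Longrightarrow> m \<in> P \<Longrightarrow> h' (x_monom m) = z (- m) \<odot> h (x_monom m)"
    "m \<in> J \<tau> \<Longrightarrow> m \<in> P \<Longrightarrow> h' (xi_monom m) = z (- m) \<odot> h (xi_monom m)" for m
    unfolding h'_def by (simp_all add: toric_lift_monom[OF A] c ci)
  have zz: "z m * z (- m) = 1" if "m \<in> P" for m using z_inverse[of m] P_subset that by (auto simp: mult.commute)
  have "h = pull \<tau> h'"
  proof (rule chart_shom_eqI[OF A h pull_shom[OF \<tau> h']])
    fix m
    show "h (x_monom m) = pull \<tau> h' (x_monom m)" if "m \<in> S \<tau>"
      using that k \<tau> c[OF that] by (auto simp: pull_monom[OF \<tau> A h'] h'_monom A.smult_smult zz kills_iff residual_def)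
    show "h (xi_monom m) = pull \<tau> h' (xi_monom m)" if "m \<in> J \<tau>"
      using that k \<tau> ci[OF that] by (auto simp: pull_monom[OF \<tau> A h'] h'_monom A.smult_smult zz kills_iff residual_def)
  qed
  with h' show ?thesis by (rule that)
qed

definition chart' :: "'v set \<Rightarrow> 'v coord superalg \<Rightarrow> ('v coord \<Rightarrow> 'v coord) \<Rightarrow> 'x" where
  "chart' \<tau> A h = \<phi> \<tau> A (pull \<tau> h)"

lemma restrict_H': "g \<in> shom H A \<Longrightarrow> restrict g (carrier H') \<in> shom H' A"
  unfolding H_eq by (rule shom_restrict_subalgebra[OF _ mi_R']) (use P_subset in auto)

lemma restrict_H'_monom:
  "m \<in> P \<Longrightarrow> restrict g (carrier H') (x_monom m) = g (x_monom m)"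
  "m \<in> J \<sigma> \<Longrightarrow> m \<in> P \<Longrightarrow> restrict g (carrier H') (xi_monom m) = g (xi_monom m)"
  using S\<sigma>_P by (auto simp: x_monom_carrier xi_monom_carrier)

definition retr :: "'v \<Rightarrow> 'v" where
  "retr = (SOME r. linear r \<and> (\<forall>m\<in>M. r m \<in> P) \<and> (\<forall>m\<in>P. r m = m))"

lemma retr: "linear retr" "m \<in> M \<Longrightarrow> retr m \<in> P" "m \<in> P \<Longrightarrow> retr m = m"
proof -
  have "\<exists>r. linear r \<and> (\<forall>m\<in>M. r m \<in> P) \<and> (\<forall>m\<in>P. r m = m)" using cone_perp_retraction by metis
  from someI_ex[OF this] show "linear retr" "m \<in> M \<Longrightarrow> retr m \<in> P" "m \<in> P \<Longrightarrow> retr m = m"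
    unfolding retr_def by blast+
qed

text \<open>A section of the restriction of torus points to \<open>H'\<close>, built from the
  retraction of exponents. If \<open>H'\<close> is purely even the odd coordinates are sent to zero;
  otherwise \<open>J\<sigma>_P\<close> ensures that the odd monomial with exponent
  \<open>retr m\<close> lies in \<open>H'\<close>.\<close>

definition lift :: "'v coord superalg \<Rightarrow> ('v coord \<Rightarrow> 'v coord) \<Rightarrow> 'v coord \<Rightarrow> 'v coord" where
  "lift A g = toric_lift M M A (\<lambda>m. g (x_monom (retr m)))
     (\<lambda>m. if J \<sigma> \<inter> P = {} then \<zero>\<^bsub>A\<^esub> else g (xi_monom (retr m)))"

lemma lift_shom:
  assumes A: "superalgebra A" and g: "g \<in> shom H' A"
  shows "lift A g \<in> shom H A" "restrict (lift A g) (carrier H') = g"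
proof -
  interpret A: salg A using A by (rule salgI)
  note r = toric_shom_relations[OF A mi_R' g, unfolded S\<sigma>_P]
  note retr_add = linear_add[OF retr(1)]
  have c: "g (x_monom m) \<in> carrier A" if "m \<in> P" for m using r(1)[OF that] by (rule A.even_carrier)
  have ci: "g (xi_monom m) \<in> carrier A" if "m \<in> J \<sigma> \<inter> P" for m using r(2)[OF that] by (rule A.odd_carrier)
  have "lift A g \<in> shom (toric_alg M M) A"
    unfolding lift_def
    by (rule toric_lift_shom[OF A mi_H])
       (use J\<sigma>_P in \<open>auto simp: retr r linear_0[OF retr(1)] retr_add c\<close>)
  then show *: "lift A g \<in> shom H A" unfolding H_eq .
  have eval: "lift A g (x_monom m) = g (x_monom m)" if "m \<in> P" for m
    unfolding lift_def by (subst toric_lift_monom[OF A]) (use that retr P_subset c in auto)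
  have evali: "lift A g (xi_monom m) = g (xi_monom m)" if "m \<in> J \<sigma>" "m \<in> P" for m
    unfolding lift_def by (subst toric_lift_monom[OF A]) (use that retr P_subset ci in auto)
  show "restrict (lift A g) (carrier H') = g"
    by (rule shom_toric_eqI[OF A mi_R' restrict_H'[OF *] g])
       (auto simp: restrict_H'_monom eval evali simp del: restrict_apply)
qed

text \<open>The odd coordinates of the base point vanish, so the correction term of the coaction
  drops out and a monomial in \<open>P\<close> is merely scaled by \<open>z\<close>. The same
  scaling is built into \<open>proj\<close>.\<close>

lemma orbit_map:
  assumes A: "superalgebra A" and g: "g \<in> shom H A"
  shows "act A g (\<phi> \<sigma> A (pt A)) = chart' \<sigma> A (restrict g (carrier H'))"
proof -
  interpret A: salg A using A by (rule salgI)
  note cv = conv_R[OF \<sigma>_mem A g pt_shom[OF A]]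
  note gH = restrict_H'[OF g]
  have c: "g (x_monom m) \<in> carrier A" "g (xi_monom m) \<in> carrier A" if "m \<in> S \<sigma>" for m
  proof -
    have "m \<in> M" using that S_subset by blast
    then have "x_monom m \<in> carrier H" "xi_monom m \<in> carrier H" by (simp_all add: H_eq x_monom_carrier xi_monom_carrier)
    then show "g (x_monom m) \<in> carrier A" "g (xi_monom m) \<in> carrier A" using shom_closed[OF g] by blast+
  qed
  have "conv c (R \<sigma>) A g (pt A) = pull \<sigma> (restrict g (carrier H'))"
  proof (rule chart_shom_eqI[OF A cv(1) pull_shom[OF \<sigma>_star gH]])
    fix m assume m: "m \<in> S \<sigma>"
    show "conv c (R \<sigma>) A g (pt A) (x_monom m) = pull \<sigma> (restrict g (carrier H')) (x_monom m)"
      using c[OF m] pt_monom[OF A] pairing_J[OF \<sigma>_mem m] m unfolding cv(2)[OF m] pull_monom(1)[OF \<sigma>_star A gH m]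
      by (simp add: A.mult_smult restrict_H'_monom \<zeta>_def del: restrict_apply)
  next
    fix m assume m: "m \<in> J \<sigma>"
    then have mS: "m \<in> S \<sigma>" using J_subset[OF \<sigma>_mem] by blast
    show "conv c (R \<sigma>) A g (pt A) (xi_monom m) = pull \<sigma> (restrict g (carrier H')) (xi_monom m)"
      using c[OF mS] pt_monom[OF A] mS m unfolding cv(3)[OF m] pull_monom(2)[OF \<sigma>_star A gH m]
      by (simp add: A.mult_smult restrict_H'_monom \<zeta>_def del: restrict_apply)
  qed
  then show ?thesis unfolding glued(6)[OF \<sigma>_mem A g pt_shom[OF A]] chart'_def by simp
qed

lemma chart'_inj: "\<tau> \<in> star \<Longrightarrow> superalgebra A \<Longrightarrow> inj_on (chart' \<tau> A) (shom (R' \<tau>) A)"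
proof (rule inj_onI)
  fix h h' assume \<tau>: "\<tau> \<in> star" and A: "superalgebra A" and h: "h \<in> shom (R' \<tau>) A" "h' \<in> shom (R' \<tau>) A"
    and eq: "chart' \<tau> A h = chart' \<tau> A h'"
  have "pull \<tau> h = pull \<tau> h'"
    using chart_inj[OF starD(1)[OF \<tau>] A pull_shom[OF \<tau> h(1)] pull_shom[OF \<tau> h(2)]] eq by (simp add: chart'_def)
  then show "h = h'" by (rule pull_inj[OF \<tau> A h])
qed

text \<open>By \<open>orbit_map\<close> only the restriction of a torus point to \<open>H'\<close>
  matters, and \<open>lift\<close> shows that every point of \<open>H'\<close> is such a
  restriction.\<close>

lemma torus_is_orbit: "torus_is_orbit H' H X act p (chart' \<sigma>)"
  unfolding torus_is_orbit_def
proof (intro allI impI conjI ballI)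
  fix A :: "'v coord superalg" assume A: "superalgebra A"
  show *: "chart' \<sigma> A (restrict g (carrier H')) = act A g (fmap X ground A (structure_map A) p)" if "g \<in> shom H A" for g
    unfolding fmap_structure_p[OF A] orbit_map[OF A that] ..
  have "chart' \<sigma> A ` shom H' A = orbit_functor H X act p A"
  proof
    show "chart' \<sigma> A ` shom H' A \<subseteq> orbit_functor H X act p A"
    proof
      fix y assume "y \<in> chart' \<sigma> A ` shom H' A"
      then obtain g where g: "g \<in> shom H' A" "y = chart' \<sigma> A g" by blast
      have "y = act A (lift A g) (fmap X ground A (structure_map A) p)"
        using *[OF lift_shom(1)[OF A g(1)]] lift_shom(2)[OF A g(1)] g(2) by simp
      then show "y \<in> orbit_functor H X act p A" unfolding orbit_functor_def using lift_shom(1)[OF A g(1)] by blast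
    qed
    show "orbit_functor H X act p A \<subseteq> chart' \<sigma> A ` shom H' A"
      unfolding orbit_functor_def using *[symmetric] restrict_H' by auto
  qed
  then show "bij_betw (chart' \<sigma> A) (shom H' A) (orbit_functor H X act p A)"
    unfolding bij_betw_def using chart'_inj[OF \<sigma>_star A] by blast
qed

lemma orbit_eq: "superalgebra A \<Longrightarrow> orbit_functor H X act p A = chart' \<sigma> A ` shom H' A"
  using torus_is_orbit unfolding torus_is_orbit_def by (simp add: bij_betw_def)

end

text \<open>Over the zero ring every ideal is killed, so no closed condition can fail.\<close>

lemma closed_sub_zero_ring:
  assumes X: "is_sfunctor X" and Y: "closed_sub X Y" and A: "superalgebra A" and x: "x \<in> pts X A"
    and zero: "\<And>a. a \<in> carrier A \<Longrightarrow> a = \<zero>\<^bsub>A\<^esub>"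
  shows "x \<in> Y A"
proof -
  obtain I where I: "superideal I A"
    "\<And>B f. superalgebra B \<Longrightarrow> f \<in> shom A B \<Longrightarrow> fmap X A B f x \<in> Y B \<longleftrightarrow> (\<forall>a\<in>I. f a = \<zero>\<^bsub>B\<^esub>)"
    using Y A x unfolding closed_sub_def by metis
  have "I \<subseteq> carrier A"
    using superideal_ideal[OF I(1)] by (rule ideal.axioms(1)[THEN additive_subgroup.a_subset])
  then have "\<forall>a\<in>I. restrict id (carrier A) a = \<zero>\<^bsub>A\<^esub>" using zero by auto
  then have "fmap X A A (restrict id (carrier A)) x \<in> Y A" using I(2)[OF A shom_restrict_id[OF A]] by simp
  then show ?thesis using X A x unfolding is_sfunctor_def by simp
qed

context toric_orbit
begin

lemma R'_subset: assumes "\<rho> \<in> star" "\<tau> \<in> star" "is_face \<rho> \<tau>" shows "S \<tau> \<inter> P \<subseteq> S \<rho> \<inter> P" "J \<tau> \<inter> P \<subseteq> J \<rho> \<inter> P"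
  using face_subset[OF assms(3)] face_J_subset[OF starD(1)[OF assms(1)] starD(1)[OF assms(2)] assms(3)] by blast+

lemma restrict_R':
  assumes "\<rho> \<in> star" "\<tau> \<in> star" "is_face \<rho> \<tau>" "h \<in> shom (R' \<rho>) A"
  shows "restrict h (carrier (R' \<tau>)) \<in> shom (R' \<tau>) A"
  using assms(4) mi_R' R'_subset[OF assms(1-3)] by (rule shom_restrict_subalgebra)

lemma chart'_face:
  assumes \<rho>: "\<rho> \<in> star" and \<tau>: "\<tau> \<in> star" and face: "is_face \<rho> \<tau>" and A: "superalgebra A" and h: "h \<in> shom (R' \<rho>) A"
  shows "chart' \<rho> A h = chart' \<tau> A (restrict h (carrier (R' \<tau>)))"
proof -
  note \<Sigma>s = starD(1)[OF \<rho>] starD(1)[OF \<tau>]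
  note hr = restrict_R'[OF \<rho> \<tau> face h] and ph = pull_shom[OF \<rho> h]
  have "restrict (pull \<rho> h) (carrier (R \<tau>)) = pull \<tau> (restrict h (carrier (R' \<tau>)))"
  proof (rule chart_shom_eqI[OF A restrict_face[OF \<Sigma>s face ph] pull_shom[OF \<tau> hr]])
    fix m
    show "restrict (pull \<rho> h) (carrier (R \<tau>)) (x_monom m) = pull \<tau> (restrict h (carrier (R' \<tau>))) (x_monom m)"
      if m: "m \<in> S \<tau>"
    proof -
      have "m \<in> S \<rho>" using m face_subset[OF face] by blast
      then show ?thesis
        unfolding restrict_monom(1)[OF m] pull_monom(1)[OF \<tau> A hr m] pull_monom(1)[OF \<rho> A h \<open>m \<in> S \<rho>\<close>]
        using m by (simp add: x_monom_carrier)
    qed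
    show "restrict (pull \<rho> h) (carrier (R \<tau>)) (xi_monom m) = pull \<tau> (restrict h (carrier (R' \<tau>))) (xi_monom m)"
      if m: "m \<in> J \<tau>"
    proof -
      have "m \<in> J \<rho>" using m face_J_subset[OF \<Sigma>s face] by blast
      then show ?thesis
        unfolding restrict_monom(2)[OF m] pull_monom(2)[OF \<tau> A hr m] pull_monom(2)[OF \<rho> A h \<open>m \<in> J \<rho>\<close>]
        using m by (simp add: xi_monom_carrier)
    qed
  qed
  then show ?thesis using glued(4)[OF \<Sigma>s face A ph] by (simp add: chart'_def)
qed

text \<open>The inclusion of \<open>R' \<tau>\<close> into \<open>H'\<close> is an \<open>H'\<close>-point of the orbit whose chart homomorphism has the
  same kernel as \<open>proj \<tau>\<close>, so that a closed subfunctor containing the orbit contains all points that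
  factor through \<open>proj \<tau>\<close>.\<close>

lemma glued_sub_minimal:
  assumes Y: "closed_sub X Y" and orbit: "\<And>A. superalgebra A \<Longrightarrow> orbit_functor H X act p A \<subseteq> Y A"
    and A: "superalgebra A"
  shows "glued_sub A \<subseteq> Y A"
proof
  fix x assume x: "x \<in> glued_sub A"
  note xX = glued_sub_in[OF x]
  show "x \<in> Y A"
  proof (rule closed_sub_local[OF Y A xX xX])
    fix \<tau> B g h assume \<tau>: "\<tau> \<in> \<Sigma>" and B: "superalgebra B" and g: "g \<in> shom A B" and h: "h \<in> shom (R \<tau>) B"
      and eq: "fmap X A B g x = \<phi> \<tau> B h"
    have k: "kills \<tau> B h" using glued_subD[OF x \<tau> B g h eq] by (simp add: kills_def)
    have "\<phi> \<tau> B h \<in> Y B"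
    proof (cases "\<tau> \<in> star")
      case False
      show ?thesis
        by (rule closed_sub_zero_ring[OF sfunctor Y B chart_in[OF \<tau> B h] kills_zero_ring[OF B h False k]])
    next
      case True
      obtain h' where h': "h' \<in> shom (R' \<tau>) B" "h = pull \<tau> h'" using pull_surj[OF True B h k] .
      define j where "j = restrict (restrict id (carrier H')) (carrier (R' \<tau>))"
      note id' = shom_restrict_id[OF superalgebra_R'[of \<sigma>]]
      have j: "j \<in> shom (R' \<tau>) H'" unfolding j_def by (rule restrict_R'[OF \<sigma>_star True starD(2)[OF True] id'])
      have pj: "pull \<tau> j \<in> shom (R \<tau>) H'" by (rule pull_shom[OF True j])
      \<comment> \<open>The universal point of the chart: the ideal that cuts out \<open>Y\<close>
        at \<open>u\<close> decides membership in \<open>Y\<close> for all points of the chart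
        simultaneously.\<close>
      define u where "u = \<phi> \<tau> (R \<tau>) (restrict id (carrier (R \<tau>)))"
      note idR = shom_restrict_id[OF superalgebra_R[of \<tau>]]
      have u: "u \<in> pts X (R \<tau>)" unfolding u_def by (rule chart_in[OF \<tau> superalgebra_R idR])
      have fu: "fmap X (R \<tau>) C f u = \<phi> \<tau> C f" if "superalgebra C" "f \<in> shom (R \<tau>) C" for C f
      proof -
        have "compose (carrier (R \<tau>)) f (restrict id (carrier (R \<tau>))) = f"
          using shom_extensional[OF that(2)] by (auto simp: compose_def extensional_def fun_eq_iff)
        then show ?thesis using chart_natural[OF \<tau> superalgebra_R that(1,2) idR] by (simp add: u_def)
      qed
      obtain I where I: "superideal I (R \<tau>)"
        "\<And>C f. superalgebra C \<Longrightarrow> f \<in> shom (R \<tau>) C \<Longrightarrow> fmap X (R \<tau>) C f u \<in> Y C \<longleftrightarrow> (\<forall>a\<in>I. f a = \<zero>\<^bsub>C\<^esub>)"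
        using Y superalgebra_R u unfolding closed_sub_def by metis
      have Ic: "I \<subseteq> carrier (R \<tau>)"
        using superideal_ideal[OF I(1)] by (rule ideal.axioms(1)[THEN additive_subgroup.a_subset])
      have "chart' \<tau> H' j \<in> orbit_functor H X act p H'"
        unfolding orbit_eq[OF superalgebra_R'] j_def
          chart'_face[OF \<sigma>_star True starD(2)[OF True] superalgebra_R' id', symmetric] by (rule imageI[OF id'])
      then have "\<phi> \<tau> H' (pull \<tau> j) \<in> Y H'" using orbit[OF superalgebra_R'] by (auto simp: chart'_def)
      then have kI: "\<forall>a\<in>I. pull \<tau> j a = \<zero>\<^bsub>H'\<^esub>" using I(2)[OF superalgebra_R' pj] fu[OF superalgebra_R' pj] by simp
      have "h a = \<zero>\<^bsub>B\<^esub>" if a: "a \<in> I" for a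
      proof -
        have ac: "a \<in> carrier (R \<tau>)" using a Ic by blast
        have pa: "proj \<tau> a \<in> carrier (R' \<tau>)" by (rule shom_closed[OF proj_shom[OF True] ac])
        then have "proj \<tau> a \<in> carrier H'" using star_subset[OF True] by (auto simp: toric_alg_carrier)
        then have "j (proj \<tau> a) = proj \<tau> a" using pa by (simp add: j_def)
        then have "pull \<tau> j a = proj \<tau> a" using ac by (simp add: pull_def compose_eq)
        then have "proj \<tau> a = \<zero>\<^bsub>R' \<tau>\<^esub>" using bspec[OF kI a] by (simp add: toric_alg_simps)
        then show ?thesis using ac shom_zero[OF superalgebra_R' B h'(1)] by (simp add: h'(2) pull_def compose_eq)
      qed
      then show ?thesis using I(2)[OF B h] fu[OF B h] by simp
    qed
    then show "fmap X A B g x \<in> Y B" using eq by simp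
  qed
qed

end

text \<open>\<open>Y\<close> stands for both \<open>glued_sub\<close> and the Zariski closure, which
  are known to agree only on arguments that are superalgebras. The parameter \<open>c'\<close> is 0
  or the image of \<open>c\<close>; on \<open>P\<close> it pairs as \<open>c\<close> does.\<close>

locale orbit_closure = toric_orbit N c \<Sigma> \<B> X \<phi> act \<sigma> p
  for N :: "'v::euclidean_space set" and c :: "'v \<times> 'v" and \<Sigma> \<B> and X :: "('v coord, 'x) sfunctor"
    and \<phi> act \<sigma> p +
  fixes Y :: "'v coord superalg \<Rightarrow> 'x set" and c' :: "'v \<times> 'v"
  assumes closed: "closed_sub X Y"
    and chart_Y: "\<And>\<tau> A h. \<tau> \<in> \<Sigma> \<Longrightarrow> superalgebra A \<Longrightarrow> h \<in> shom (R \<tau>) A \<Longrightarrow> \<phi> \<tau> A h \<in> Y A \<longleftrightarrow> kills \<tau> A h"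
    and c': "\<And>m. m \<in> P \<Longrightarrow> pairing m c' = pairing m c"
begin

lemma Y_in: "superalgebra A \<Longrightarrow> x \<in> Y A \<Longrightarrow> x \<in> pts X A"
  by (rule closed_sub_subset[OF closed])

lemma Y_fmap: "superalgebra A \<Longrightarrow> superalgebra B \<Longrightarrow> f \<in> shom A B \<Longrightarrow> x \<in> Y A \<Longrightarrow> fmap X A B f x \<in> Y B"
  by (rule closed_sub_fmap[OF closed])

lemma chart'_in: "\<tau> \<in> star \<Longrightarrow> superalgebra A \<Longrightarrow> h \<in> shom (R' \<tau>) A \<Longrightarrow> chart' \<tau> A h \<in> Y A"
  unfolding chart'_def using chart_Y[OF starD(1) _ pull_shom] kills_pull by blast

lemma chart'_natural:
  assumes \<tau>: "\<tau> \<in> star" and A: "superalgebra A" and B: "superalgebra B" and f: "f \<in> shom A B" and h: "h \<in> shom (R' \<tau>) A"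
  shows "chart' \<tau> B (compose (carrier (R' \<tau>)) f h) = fmap X A B f (chart' \<tau> A h)"
  unfolding chart'_def pull_natural[OF \<tau>] by (rule chart_natural[OF starD(1)[OF \<tau>] A B f pull_shom[OF \<tau> h]])

lemma chart'_image:
  assumes \<tau>: "\<tau> \<in> star" and A: "superalgebra A"
  shows "chart' \<tau> A ` shom (R' \<tau>) A = \<phi> \<tau> A ` shom (R \<tau>) A \<inter> Y A"
proof
  show "chart' \<tau> A ` shom (R' \<tau>) A \<subseteq> \<phi> \<tau> A ` shom (R \<tau>) A \<inter> Y A"
    using chart'_in[OF \<tau> A] pull_shom[OF \<tau>] by (auto simp: chart'_def)
  show "\<phi> \<tau> A ` shom (R \<tau>) A \<inter> Y A \<subseteq> chart' \<tau> A ` shom (R' \<tau>) A"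
  proof
    fix y assume "y \<in> \<phi> \<tau> A ` shom (R \<tau>) A \<inter> Y A"
    then obtain h where h: "h \<in> shom (R \<tau>) A" "y = \<phi> \<tau> A h" "y \<in> Y A" by blast
    then have "kills \<tau> A h" using chart_Y[OF starD(1)[OF \<tau>] A] by simp
    then obtain h' where "h' \<in> shom (R' \<tau>) A" "h = pull \<tau> h'" using pull_surj[OF \<tau> A h(1)] by blast
    then show "y \<in> chart' \<tau> A ` shom (R' \<tau>) A" using h(2) by (auto simp: chart'_def)
  qed
qed

text \<open>The new chart is the trace on \<open>Y\<close> of the old one, so the ideal that
  describes the latter describes the former too.\<close>

lemma open_sub_chart':
  assumes \<tau>: "\<tau> \<in> star"
  shows "open_sub (restrict_to X Y) (\<lambda>A. chart' \<tau> A ` shom (R' \<tau>) A)"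
  unfolding open_sub_def subfunctor_def restrict_to_simps
proof (intro conjI allI impI; (elim conjE)?)
  note O = chart_open[OF starD(1)[OF \<tau>], unfolded open_sub_def subfunctor_def]
  show "chart' \<tau> A ` shom (R' \<tau>) A \<subseteq> Y A" if "superalgebra A" for A using chart'_image[OF \<tau> that] by blast
  show "fmap X A B f y \<in> chart' \<tau> B ` shom (R' \<tau>) B"
    if "superalgebra A" "superalgebra B" "f \<in> shom A B" "y \<in> chart' \<tau> A ` shom (R' \<tau>) A" for A B f y
    using that chart'_natural[OF \<tau> that(1-3), symmetric] shom_compose[OF superalgebra_R' _ that(3)] by auto
  fix A x assume A: "superalgebra A" and x: "x \<in> Y A"
  obtain I where I: "superideal I A" "\<And>B f. superalgebra B \<Longrightarrow> f \<in> shom A B \<Longrightarrow>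
      fmap X A B f x \<in> \<phi> \<tau> B ` shom (R \<tau>) B \<longleftrightarrow> Idl\<^bsub>B\<^esub> (f ` I) = carrier B"
    using conjunct2[OF O] A Y_in[OF A x] by metis
  have "fmap X A B f x \<in> chart' \<tau> B ` shom (R' \<tau>) B \<longleftrightarrow> Idl\<^bsub>B\<^esub> (f ` I) = carrier B"
    if "superalgebra B" "f \<in> shom A B" for B f
    unfolding chart'_image[OF \<tau> that(1)] using I(2)[OF that] Y_fmap[OF A that x] by simp
  then show "\<exists>I. superideal I A \<and> (\<forall>B f. superalgebra B \<and> f \<in> shom A B \<longrightarrow>
           (fmap X A B f x \<in> chart' \<tau> B ` shom (R' \<tau>) B \<longleftrightarrow> Idl\<^bsub>B\<^esub> (f ` I) = carrier B))"
    using I(1) by blast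
qed

lemma affine_open_immersion_chart':
  assumes \<tau>: "\<tau> \<in> star" shows "affine_open_immersion (R' \<tau>) (restrict_to X Y) (chart' \<tau>)"
  unfolding affine_open_immersion_def natural_map_def
  using superalgebra_R' open_sub_chart'[OF \<tau>] chart'_inj[OF \<tau>] chart'_in[OF \<tau>] chart'_natural[OF \<tau>]
  by (auto simp: Sp_def)

lemma affine_open_chart':
  assumes \<tau>: "\<tau> \<in> star" shows "affine_open (R' \<tau>) (restrict_to X Y) (\<lambda>A. chart' \<tau> A ` shom (R' \<tau>) A)"
  using affine_open_immersion_chart'[OF \<tau>]
  unfolding affine_open_def affine_open_immersion_def by (auto simp: Sp_def bij_betw_def)

text \<open>A chart outside the star would force the zero ring, and a field is not zero.\<close>

lemma field_point:
  assumes K: "superfield K" and x: "x \<in> Y K"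
  obtains \<tau> h where "\<tau> \<in> star" "h \<in> shom (R' \<tau>) K" "x = chart' \<tau> K h"
proof -
  have KA: "superalgebra K" using K by (simp add: superfield_def)
  interpret K: field K using K by (simp add: superfield_def)
  obtain \<tau> h where \<tau>: "\<tau> \<in> \<Sigma>" "h \<in> shom (R \<tau>) K" "x = \<phi> \<tau> K h"
    using charts_cover[OF K Y_in[OF KA x]] by blast
  then have "kills \<tau> K h" using chart_Y[OF \<tau>(1) KA \<tau>(2)] x by simp
  then have "\<tau> \<in> star" using kills_zero_ring[OF KA \<tau>(2) _ _ K.one_closed] K.one_not_zero by blast
  moreover obtain h' where "h' \<in> shom (R' \<tau>) K" "h = pull \<tau> h'"
    using pull_surj[OF \<open>\<tau> \<in> star\<close> KA \<tau>(2) \<open>kills \<tau> K h\<close>] .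
  ultimately show ?thesis using that[of \<tau> h'] \<tau>(3) by (simp add: chart'_def)
qed

lemma open_cover_charts': "open_cover (restrict_to X Y) ((\<lambda>\<tau> A. chart' \<tau> A ` shom (R' \<tau>) A) ` star)"
  unfolding open_cover_def restrict_to_simps
proof (intro conjI ballI allI impI subsetI)
  show "open_sub (restrict_to X Y) U" if "U \<in> (\<lambda>\<tau> A. chart' \<tau> A ` shom (R' \<tau>) A) ` star" for U
    using that open_sub_chart' by auto
  fix K x assume "superfield K" "x \<in> Y K"
  then obtain \<tau> h where "\<tau> \<in> star" "h \<in> shom (R' \<tau>) K" "x = chart' \<tau> K h" by (rule field_point)
  then show "x \<in> (\<Union>U\<in>(\<lambda>\<tau> A. chart' \<tau> A ` shom (R' \<tau>) A) ` star. U K)" by blast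
qed

text \<open>On the universal point of a chart of \<open>Y\<close> the open set is given by an ideal
  containing an element with nonzero even component \<open>f\<close>. Wherever \<open>f\<close> does
  not vanish on the torus, the point belongs to \<open>U\<close>.\<close>

lemma open_meets_torus:
  assumes U: "open_sub (restrict_to X Y) U" and K: "superfield K" and y: "y \<in> U K"
  obtains f where "f \<noteq> 0"
    "\<And>v s. exp_eval v s f \<noteq> 0 \<Longrightarrow> chart' \<sigma> ground (exp_point (S \<sigma> \<inter> P) (J \<sigma> \<inter> P) v s) \<in> U ground"
proof -
  have KA: "superalgebra K" using K by (simp add: superfield_def)
  interpret K: salg K using KA by (rule salgI)
  interpret Kf: field K using K by (simp add: superfield_def)
  note O = U[unfolded open_sub_def subfunctor_def restrict_to_simps]
  have "y \<in> Y K" using O KA y by blast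
  then obtain \<tau> h where \<tau>: "\<tau> \<in> star" and h: "h \<in> shom (R' \<tau>) K" and yh: "y = chart' \<tau> K h"
    using field_point[OF K] by metis
  define u where "u = chart' \<tau> (R' \<tau>) (restrict id (carrier (R' \<tau>)))"
  note id' = shom_restrict_id[OF superalgebra_R'[of \<tau>]]
  have u: "u \<in> Y (R' \<tau>)" unfolding u_def by (rule chart'_in[OF \<tau> superalgebra_R' id'])
  have fu: "fmap X (R' \<tau>) C f u = chart' \<tau> C f" if "superalgebra C" "f \<in> shom (R' \<tau>) C" for C f
  proof -
    have "compose (carrier (R' \<tau>)) f (restrict id (carrier (R' \<tau>))) = f"
      using shom_extensional[OF that(2)] by (auto simp: compose_def extensional_def fun_eq_iff)
    then show ?thesis using chart'_natural[OF \<tau> superalgebra_R' that(1,2) id'] by (simp add: u_def)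
  qed
  obtain I where I: "superideal I (R' \<tau>)" "\<And>C f. superalgebra C \<Longrightarrow> f \<in> shom (R' \<tau>) C \<Longrightarrow>
      fmap X (R' \<tau>) C f u \<in> U C \<longleftrightarrow> Idl\<^bsub>C\<^esub> (f ` I) = carrier C"
    using conjunct2[OF O] superalgebra_R' u by metis
  have Ic: "I \<subseteq> carrier (R' \<tau>)"
    using superideal_ideal[OF I(1)] by (rule ideal.axioms(1)[THEN additive_subgroup.a_subset])
  \<comment> \<open>An ideal of odd elements would be killed by the given field point and could not
    generate the unit ideal there.\<close>
  have "\<exists>a\<in>I. fst a \<noteq> 0"
  proof (rule ccontr)
    assume no: "\<not> (\<exists>a\<in>I. fst a \<noteq> 0)"
    have "h a = \<zero>\<^bsub>K\<^esub>" if a: "a \<in> I" for a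
    proof -
      have "a \<in> carrier (R' \<tau>)" "fst a = 0" using a no Ic by blast+
      then have "a \<in> odd_part (R' \<tau>)" by (cases a) (simp add: toric_alg_simps)
      then show ?thesis using superfield_odd_zero[OF K] shom_odd[OF h] by blast
    qed
    then have "Idl\<^bsub>K\<^esub> (h ` I) \<subseteq> {\<zero>\<^bsub>K\<^esub>}"
      by (intro K.genideal_minimal) (use superideal_ideal[OF superideal_zero[OF KA]] in auto)
    moreover have "Idl\<^bsub>K\<^esub> (h ` I) = carrier K" using I(2)[OF KA h] fu[OF KA h] yh y by simp
    ultimately show False using Kf.one_not_zero K.one_closed by blast
  qed
  then obtain a where a: "a \<in> I" "fst a \<noteq> 0" by blast
  show ?thesis
  proof (rule that[OF a(2)])
    fix v s assume nz: "exp_eval v s (fst a) \<noteq> 0"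
    let ?e = "exp_point (S \<sigma> \<inter> P) (J \<sigma> \<inter> P) v s"
    interpret G: salg "ground :: 'v coord superalg" using superalgebra_ground by (rule salgI)
    interpret Gf: field "ground :: 'v coord superalg" using superfield_ground unfolding superfield_def by (rule conjunct2)
    have e: "?e \<in> shom H' ground" by (rule exp_point_shom[OF mi_R'])
    note er = restrict_R'[OF \<sigma>_star \<tau> starD(2)[OF \<tau>] e]
    have ac: "a \<in> carrier (R' \<tau>)" using a Ic by blast
    then have "a \<in> carrier H'" using star_subset[OF \<tau>] by (auto simp: toric_alg_carrier)
    from exp_point_eval[OF this, of v s] ac
    have ea: "restrict ?e (carrier (R' \<tau>)) a = (single 0 (exp_eval v s (fst a)), 0)" by simp
    have "single (0::'v) (exp_eval v s (fst a)) \<noteq> 0" using nz by (metis lookup_single_eq lookup_zero)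
    then have "restrict ?e (carrier (R' \<tau>)) a \<noteq> \<zero>\<^bsub>ground\<^esub>" unfolding ea by (simp add: ground_simps(2))
    then have unit: "restrict ?e (carrier (R' \<tau>)) a \<in> Units ground"
      using Gf.field_Units shom_closed[OF er ac] by blast
    have sub: "restrict ?e (carrier (R' \<tau>)) ` I \<subseteq> carrier ground" using shom_closed[OF er] Ic by blast
    interpret D: ideal "Idl\<^bsub>ground\<^esub> (restrict ?e (carrier (R' \<tau>)) ` I)" ground by (rule G.genideal_ideal[OF sub])
    have "restrict ?e (carrier (R' \<tau>)) a \<in> Idl\<^bsub>ground\<^esub> (restrict ?e (carrier (R' \<tau>)) ` I)"
      using G.genideal_self[OF sub] a(1) by blast
    from D.I_l_closed[OF this G.Units_inv_closed[OF unit]]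
    have "\<one>\<^bsub>ground\<^esub> \<in> Idl\<^bsub>ground\<^esub> (restrict ?e (carrier (R' \<tau>)) ` I)" unfolding G.Units_l_inv[OF unit] .
    then have "Idl\<^bsub>ground\<^esub> (restrict ?e (carrier (R' \<tau>)) ` I) = carrier ground" by (rule D.one_imp_carrier)
    then have "fmap X (R' \<tau>) ground (restrict ?e (carrier (R' \<tau>))) u \<in> U ground"
      using I(2)[OF superalgebra_ground er] by simp
    then show "chart' \<sigma> ground ?e \<in> U ground"
      unfolding fu[OF superalgebra_ground er] chart'_face[OF \<sigma>_star \<tau> starD(2)[OF \<tau>] superalgebra_ground e] .
  qed
qed

text \<open>Two nonempty open sets yield two nonzero Laurent polynomials, and a single complex torus
  point avoids the zeros of both.\<close>

lemma irreducible_Y: "irreducible_sfunctor (restrict_to X Y)"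
  unfolding irreducible_sfunctor_def restrict_to_simps
proof (intro conjI allI impI)
  show "\<exists>K. superfield K \<and> Y K \<noteq> {}"
    using superfield_ground chart'_in[OF \<sigma>_star superalgebra_ground exp_point_shom[OF mi_R']] by blast
  fix U V :: "'v coord superalg \<Rightarrow> 'x set"
  assume "open_sub (restrict_to X Y) U \<and> open_sub (restrict_to X Y) V \<and>
    (\<exists>K. superfield K \<and> U K \<noteq> {}) \<and> (\<exists>K. superfield K \<and> V K \<noteq> {})"
  then obtain K y K' y' where U: "open_sub (restrict_to X Y) U" "superfield K" "y \<in> U K"
    and V: "open_sub (restrict_to X Y) V" "superfield K'" "y' \<in> V K'" by blast
  obtain f where f: "f \<noteq> 0"
    "\<And>v s. exp_eval v s f \<noteq> 0 \<Longrightarrow> chart' \<sigma> ground (exp_point (S \<sigma> \<inter> P) (J \<sigma> \<inter> P) v s) \<in> U ground"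
    using open_meets_torus[OF U] by metis
  obtain g where g: "g \<noteq> 0"
    "\<And>v s. exp_eval v s g \<noteq> 0 \<Longrightarrow> chart' \<sigma> ground (exp_point (S \<sigma> \<inter> P) (J \<sigma> \<inter> P) v s) \<in> V ground"
    using open_meets_torus[OF V] by metis
  obtain v s where "exp_eval v s f \<noteq> 0" "exp_eval v s g \<noteq> 0" using exp_eval_nonzero2[OF f(1) g(1)] .
  then show "\<exists>K. superfield K \<and> U K \<inter> V K \<noteq> {}" using f(2) g(2) superfield_ground by blast
qed

text \<open>The exponents in \<open>P\<close> form the monoid of a quotient cone, to which Gordan's
  lemma applies. By the face property the decorations in \<open>P\<close> generate the odd
  module.\<close>

lemma finitely_generated_R':
  assumes \<tau>: "\<tau> \<in> star" shows "finitely_generated (R' \<tau>)"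
proof -
  obtain G where G: "finite G" "G \<subseteq> S \<tau> \<inter> P"
    "\<And>C. 0 \<in> C \<Longrightarrow> (\<And>g m. g \<in> G \<Longrightarrow> m \<in> C \<Longrightarrow> g + m \<in> C) \<Longrightarrow> S \<tau> \<inter> P \<subseteq> C"
    using gordan[OF zlattice_quot_lattice fan_cone_bar[OF \<tau>]] unfolding cone_monoid_bar by metis
  show ?thesis
  proof (rule finitely_generated_toric_alg[OF mi_R' G(1,2)])
    show "S \<tau> \<inter> P \<subseteq> C" if "0 \<in> C" "\<And>g m. g \<in> G \<Longrightarrow> m \<in> C \<Longrightarrow> g + m \<in> C" for C using G(3) that by blast
    show "finite (\<B> \<tau> \<inter> P)" using decorations(1)[OF starD(1)[OF \<tau>]] by blast
    show "\<B> \<tau> \<inter> P \<subseteq> J \<tau> \<inter> P" using cone_monoid_zero[of N \<tau>] by (force simp: decorated_ideal_iff)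
    fix m assume m: "m \<in> J \<tau> \<inter> P"
    then obtain b where b: "b \<in> \<B> \<tau>" "m - b \<in> S \<tau>" by (auto simp: decorated_ideal_iff)
    have "b \<in> S \<tau>" using b(1) decorations(3)[OF starD(1)[OF \<tau>]] by blast
    then have "b \<in> P" "m - b \<in> P" using P_add_iff[OF \<tau> b(2), of b] m by auto
    then show "\<exists>b\<in>\<B> \<tau> \<inter> P. m - b \<in> S \<tau> \<inter> P" using b by blast
  qed
qed

lemma supervariety_Y: "supervariety (restrict_to X Y)"
  unfolding supervariety_def
proof (intro conjI)
  show "is_sfunctor (restrict_to X Y)" by (rule is_sfunctor_restrict[OF sfunctor closed])
  show "local_sfunctor (restrict_to X Y)"
    using supervariety_X by (intro local_sfunctor_restrict[OF sfunctor _ closed infinite_UNIV]) (simp add: supervariety_def)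
  show "separated (restrict_to X Y)" by (rule separated_restrict[OF separated closed])
  show "irreducible_sfunctor (restrict_to X Y)" by (rule irreducible_Y)
  have "finite star" using fan_finite by (simp add: star_def)
  moreover have "\<exists>R. superdomain R \<and> finitely_generated R \<and> affine_open R (restrict_to X Y) U"
    if "U \<in> (\<lambda>\<tau> A. chart' \<tau> A ` shom (R' \<tau>) A) ` star" for U
    using that superdomain_toric_alg[OF mi_R'] finitely_generated_R' affine_open_chart' by blast
  ultimately show "\<exists>\<U>. finite \<U> \<and> open_cover (restrict_to X Y) \<U> \<and>
      (\<forall>U\<in>\<U>. \<exists>R. superdomain R \<and> finitely_generated R \<and> affine_open R (restrict_to X Y) U)"
    using open_cover_charts' by (intro exI[of _ "(\<lambda>\<tau> A. chart' \<tau> A ` shom (R' \<tau>) A) ` star"]) simp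
qed

end

section \<open>The action on the closure\<close>

context orbit_closure
begin

text \<open>An exponent in \<open>P\<close> that pairs nontrivially with \<open>c'\<close> does so
  with \<open>c\<close> as well and therefore lies in the odd module; hence convolution on the
  quotient charts is defined.\<close>

lemma conv_R':
  fixes A (structure)
  assumes \<tau>: "\<tau> \<in> star" and A: "superalgebra A" and g: "g \<in> shom H' A" and h: "h \<in> shom (R' \<tau>) A"
  shows "conv c' (R' \<tau>) A g h \<in> shom (R' \<tau>) A"
    and "\<And>m. m \<in> S \<tau> \<Longrightarrow> m \<in> P \<Longrightarrow> conv c' (R' \<tau>) A g h (x_monom m) = (g (x_monom m) \<otimes> h (x_monom m)) \<oplus>
         (if pairing m c = 0 then \<zero> else pairing m c \<odot> (g (xi_monom m) \<otimes> h (xi_monom m)))"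
    and "\<And>m. m \<in> J \<tau> \<Longrightarrow> m \<in> P \<Longrightarrow> conv c' (R' \<tau>) A g h (xi_monom m) =
        (g (xi_monom m) \<otimes> h (x_monom m)) \<oplus> (g (x_monom m) \<otimes> h (xi_monom m))"
proof -
  have sub: "S \<tau> \<inter> P \<subseteq> S \<sigma> \<inter> P" "J \<tau> \<inter> P \<subseteq> J \<sigma> \<inter> P" "J \<tau> \<inter> P \<subseteq> S \<tau> \<inter> P"
    using star_subset[OF \<tau>] J_subset[OF starD(1)[OF \<tau>]] by blast+
  have pc: "m \<in> J \<tau> \<inter> P" if "m \<in> S \<tau> \<inter> P" "pairing m c' \<noteq> 0" for m
    using that c' pairing_J[OF starD(1)[OF \<tau>]] by auto
  note cv = conv_shom[where c = c', OF A mi_R'[of \<tau>] mi_R'[of \<sigma>] sub _ g h]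
  show "conv c' (R' \<tau>) A g h \<in> shom (R' \<tau>) A" by (rule cv(1)) (erule (1) pc)
  show "conv c' (R' \<tau>) A g h (x_monom m) = (g (x_monom m) \<otimes> h (x_monom m)) \<oplus>
         (if pairing m c = 0 then \<zero> else pairing m c \<odot> (g (xi_monom m) \<otimes> h (xi_monom m)))"
    if "m \<in> S \<tau>" "m \<in> P" for m unfolding c'[OF that(2), symmetric] by (rule cv(2)[OF _ IntI[OF that]]) (erule (1) pc)
  show "conv c' (R' \<tau>) A g h (xi_monom m) =
        (g (xi_monom m) \<otimes> h (x_monom m)) \<oplus> (g (x_monom m) \<otimes> h (xi_monom m))"
    if "m \<in> J \<tau>" "m \<in> P" for m by (rule cv(3)[OF _ IntI[OF that]]) (erule (1) pc)
qed

lemma H_monom_closed: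
  assumes "g \<in> shom H A" "m \<in> M" shows "g (x_monom m) \<in> carrier A" "g (xi_monom m) \<in> carrier A"
  using shom_closed[OF assms(1), of "x_monom m"] shom_closed[OF assms(1), of "xi_monom m"] assms(2)
  by (simp_all add: H_eq x_monom_carrier xi_monom_carrier)

text \<open>The coaction is diagonal in the exponents. Monomials outside \<open>P\<close> stay zero,
  and on \<open>P\<close> only the restriction of \<open>g\<close> to \<open>H'\<close> enters; the
  scalar \<open>z m\<close> passes through by linearity.\<close>

lemma conv_pull:
  assumes \<tau>: "\<tau> \<in> star" and A: "superalgebra A" and g: "g \<in> shom H A" and h: "h \<in> shom (R' \<tau>) A"
  shows "conv c (R \<tau>) A g (pull \<tau> h) = pull \<tau> (conv c' (R' \<tau>) A (restrict g (carrier H')) h)"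
proof -
  interpret A: salg A using A by (rule salgI)
  note gH = restrict_H'[OF g]
  note cv = conv_R[OF starD(1)[OF \<tau>] A g pull_shom[OF \<tau> h]] and cv' = conv_R'[OF \<tau> A gH h]
  have J_sub: "m \<in> S \<tau>" "m \<in> J \<sigma>" if "m \<in> J \<tau>" for m
    using that J_subset[OF starD(1)[OF \<tau>]] star_subset[OF \<tau>] by blast+
  have gc: "g (x_monom m) \<in> carrier A" "g (xi_monom m) \<in> carrier A" if "m \<in> S \<tau>" for m
    using H_monom_closed[OF g, of m] that S_subset by auto
  have hc: "h (x_monom m) \<in> carrier A" if "m \<in> S \<tau>" "m \<in> P" for m
    using shom_closed[OF h, of "x_monom m"] that by (simp add: x_monom_carrier)
  have hci: "h (xi_monom m) \<in> carrier A" if "m \<in> J \<tau>" "m \<in> P" for m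
    using shom_closed[OF h, of "xi_monom m"] that by (simp add: xi_monom_carrier)
  note pull = pull_monom[OF \<tau> A h] pull_monom[OF \<tau> A cv'(1)]
  note comm = A.smult_smult A.mult_smult A.smult_add_right mult.commute
  show ?thesis
  proof (rule chart_shom_eqI[OF A cv(1) pull_shom[OF \<tau> cv'(1)]])
    fix m assume m: "m \<in> S \<tau>"
    show "conv c (R \<tau>) A g (pull \<tau> h) (x_monom m) =
        pull \<tau> (conv c' (R' \<tau>) A (restrict g (carrier H')) h) (x_monom m)"
    proof (cases "pairing m c = 0")
      case True
      then show ?thesis
        using gc[OF m] hc[OF m] unfolding cv(2)[OF m] pull(3)[OF m] pull(1)[OF m]
        by (simp add: cv'(2)[OF m] restrict_H'_monom comm del: restrict_apply)
    next
      case False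
      then have mJ: "m \<in> J \<tau>" by (rule pairing_J[OF starD(1)[OF \<tau>] m])
      show ?thesis
        using gc[OF m] hc[OF m] hci[OF mJ] False unfolding cv(2)[OF m] pull(3)[OF m] pull(1)[OF m] pull(2)[OF mJ]
        by (simp add: cv'(2)[OF m] restrict_H'_monom J_sub[OF mJ] comm del: restrict_apply)
    qed
  next
    fix m assume m: "m \<in> J \<tau>"
    note mS = J_sub(1)[OF m]
    show "conv c (R \<tau>) A g (pull \<tau> h) (xi_monom m) =
        pull \<tau> (conv c' (R' \<tau>) A (restrict g (carrier H')) h) (xi_monom m)"
      using gc[OF mS] hc[OF mS] hci[OF m] unfolding cv(3)[OF m] pull(4)[OF m] pull(1)[OF mS] pull(2)[OF m]
      by (simp add: cv'(3)[OF m] restrict_H'_monom J_sub[OF m] comm del: restrict_apply)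
  qed
qed

lemma act_chart':
  assumes \<tau>: "\<tau> \<in> star" and A: "superalgebra A" and g: "g \<in> shom H A" and h: "h \<in> shom (R' \<tau>) A"
  shows "act A g (chart' \<tau> A h) = chart' \<tau> A (conv c' (R' \<tau>) A (restrict g (carrier H')) h)"
  unfolding chart'_def glued(6)[OF starD(1)[OF \<tau>] A g pull_shom[OF \<tau> h]] conv_pull[OF assms] ..

text \<open>Outside the star a chart meets \<open>Y\<close> over the zero ring only, so the second
  alternative is degenerate.\<close>

lemma Y_chart_cases:
  assumes \<tau>: "\<tau> \<in> \<Sigma>" and A: "superalgebra A" and h: "h \<in> shom (R \<tau>) A" and Y: "\<phi> \<tau> A h \<in> Y A"
  obtains h' where "\<tau> \<in> star" "h' \<in> shom (R' \<tau>) A" "\<phi> \<tau> A h = chart' \<tau> A h'"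
    | "\<And>a. a \<in> carrier A \<Longrightarrow> a = \<zero>\<^bsub>A\<^esub>"
proof -
  have k: "kills \<tau> A h" using Y chart_Y[OF \<tau> A h] by simp
  show ?thesis
  proof (cases "\<tau> \<in> star")
    case True
    obtain h' where "h' \<in> shom (R' \<tau>) A" "h = pull \<tau> h'" using pull_surj[OF True A h k] .
    then show ?thesis using that(1)[OF True] by (simp add: chart'_def)
  next
    case False
    show ?thesis by (rule that(2)) (rule kills_zero_ring[OF A h False k])
  qed
qed

text \<open>Stability is local by closedness of \<open>Y\<close>, and in a chart of the star the
  translate is again given by quotient coordinates.\<close>

lemma act_Y:
  assumes A: "superalgebra A" and g: "g \<in> shom H A" and x: "x \<in> Y A"
  shows "act A g x \<in> Y A"
proof (rule closed_sub_local[OF closed A Y_in[OF A x] act_in[OF A g Y_in[OF A x]]])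
  fix \<tau> B f h assume \<tau>: "\<tau> \<in> \<Sigma>" and B: "superalgebra B" and f: "f \<in> shom A B" and h: "h \<in> shom (R \<tau>) B"
    and eq: "fmap X A B f x = \<phi> \<tau> B h"
  have fg: "compose (carrier H) f g \<in> shom H B" by (rule shom_compose[OF superalgebra_H g f])
  have act: "fmap X A B f (act A g x) = act B (compose (carrier H) f g) (\<phi> \<tau> B h)"
    unfolding eq[symmetric] by (rule act_natural[OF A B f g Y_in[OF A x]])
  have "\<phi> \<tau> B h \<in> Y B" using Y_fmap[OF A B f x] eq by simp
  from \<tau> B h this show "fmap X A B f (act A g x) \<in> Y B"
  proof (cases rule: Y_chart_cases)
    case (1 h')
    show ?thesis
      unfolding act 1(3) act_chart'[OF 1(1) B fg 1(2)]
      by (rule chart'_in[OF 1(1) B conv_R'(1)[OF 1(1) B restrict_H'[OF fg] 1(2)]])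
  next
    case 2
    show ?thesis
      unfolding act by (rule closed_sub_zero_ring[OF sfunctor closed B act_in[OF B fg chart_in[OF \<tau> B h]] 2])
  qed
qed

lemma restrict_compose_H':
  "g \<in> shom H A \<Longrightarrow> restrict (compose (carrier H) f g) (carrier H') = compose (carrier H') f (restrict g (carrier H'))"
proof -
  have "carrier H' \<subseteq> carrier H" using P_subset unfolding H_eq subset_iff toric_alg_carrier by blast
  then show ?thesis by (auto simp: compose_def fun_eq_iff)
qed

text \<open>The action factors through the quotient torus: in a chart it depends on the restriction
  alone, and separatedness makes equality of translates a local matter.\<close>

lemma act_cong:
  assumes A: "superalgebra A" and g: "g \<in> shom H A" "g' \<in> shom H A" and x: "x \<in> Y A"
    and eq: "restrict g (carrier H') = restrict g' (carrier H')"
  shows "act A g x = act A g' x"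
proof (rule point_eq_local[OF A Y_in[OF A x] act_in[OF A g(1) Y_in[OF A x]] act_in[OF A g(2) Y_in[OF A x]]])
  fix \<tau> B f h assume \<tau>: "\<tau> \<in> \<Sigma>" and B: "superalgebra B" and f: "f \<in> shom A B" and h: "h \<in> shom (R \<tau>) B"
    and fx: "fmap X A B f x = \<phi> \<tau> B h"
  have fg: "compose (carrier H) f g \<in> shom H B" "compose (carrier H) f g' \<in> shom H B"
    using shom_compose[OF superalgebra_H _ f] g by blast+
  have act: "fmap X A B f (act A k x) = act B (compose (carrier H) f k) (\<phi> \<tau> B h)" if "k \<in> shom H A" for k
    unfolding fx[symmetric] by (rule act_natural[OF A B f that Y_in[OF A x]])
  have "\<phi> \<tau> B h \<in> Y B" using Y_fmap[OF A B f x] fx by simp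
  from \<tau> B h this show "fmap X A B f (act A g x) = fmap X A B f (act A g' x)"
  proof (cases rule: Y_chart_cases)
    case (1 h')
    show ?thesis
      unfolding act[OF g(1)] act[OF g(2)] 1(3) act_chart'[OF 1(1) B fg(1) 1(2)] act_chart'[OF 1(1) B fg(2) 1(2)]
        restrict_compose_H'[OF g(1)] restrict_compose_H'[OF g(2)] eq ..
  next
    case 2
    \<comment> \<open>Over the zero ring all homomorphisms coincide.\<close>
    have "compose (carrier H) f g = compose (carrier H) f g'"
    proof (rule shom_eqI[OF fg])
      fix a assume "a \<in> carrier H"
      then show "compose (carrier H) f g a = compose (carrier H) f g' a"
        using 2[OF shom_closed[OF fg(1)]] 2[OF shom_closed[OF fg(2)]] by simp
    qed
    then show ?thesis unfolding act[OF g(1)] act[OF g(2)] by simp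
  qed
qed

text \<open>The lift need not be compatible with convolution, because \<open>m\<close> and
  \<open>retr m\<close> can pair differently with \<open>c\<close>. By \<open>act_cong\<close> any
  other lift gives the same action on \<open>Y\<close>.\<close>

definition act' :: "'v coord superalg \<Rightarrow> ('v coord \<Rightarrow> 'v coord) \<Rightarrow> 'x \<Rightarrow> 'x" where
  "act' A g x = act A (lift A g) x"

lemma act'_chart':
  assumes \<tau>: "\<tau> \<in> star" and A: "superalgebra A" and g: "g \<in> shom H' A" and h: "h \<in> shom (R' \<tau>) A"
  shows "act' A g (chart' \<tau> A h) = chart' \<tau> A (conv c' (R' \<tau>) A g h)"
  unfolding act'_def act_chart'[OF \<tau> A lift_shom(1)[OF A g] h] lift_shom(2)[OF A g] ..

lemma act'_eq:
  assumes "superalgebra A" "g \<in> shom H A" "x \<in> Y A"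
  shows "act' A (restrict g (carrier H')) x = act A g x"
  unfolding act'_def
  by (rule act_cong[OF assms(1) lift_shom(1)[OF assms(1) restrict_H'[OF assms(2)]] assms(2,3)
        lift_shom(2)[OF assms(1) restrict_H'[OF assms(2)]]])

lemma restrict_conv:
  assumes A: "superalgebra A" and g: "g \<in> shom H A" and h: "h \<in> shom H A"
  shows "restrict (conv c H A g h) (carrier H') = conv c' H' A (restrict g (carrier H')) (restrict h (carrier H'))"
    and "conv c H A g h \<in> shom H A"
proof -
  note cv = conv_shom[where c = c, OF A mi_H mi_H order_refl order_refl order_refl _ g[unfolded H_eq] h[unfolded H_eq], folded H_eq]
  show *: "conv c H A g h \<in> shom H A" by (rule cv(1))
  note cv' = conv_R'[OF \<sigma>_star A restrict_H'[OF g] restrict_H'[OF h]]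
  show "restrict (conv c H A g h) (carrier H') = conv c' H' A (restrict g (carrier H')) (restrict h (carrier H'))"
  proof (rule shom_toric_eqI[OF A mi_R' restrict_H'[OF *] cv'(1)])
    fix m assume m: "m \<in> S \<sigma> \<inter> P"
    then have "m \<in> M" using P_subset by blast
    show "restrict (conv c H A g h) (carrier H') (x_monom m) =
        conv c' H' A (restrict g (carrier H')) (restrict h (carrier H')) (x_monom m)"
      using m pairing_J[OF \<sigma>_mem, of m] cv'(2)[of m] cv(2)[OF _ \<open>m \<in> M\<close>]
      by (auto simp: restrict_H'_monom simp del: restrict_apply)
  next
    fix m assume m: "m \<in> J \<sigma> \<inter> P"
    then have "m \<in> M" using P_subset by blast
    show "restrict (conv c H A g h) (carrier H') (xi_monom m) =
        conv c' H' A (restrict g (carrier H')) (restrict h (carrier H')) (xi_monom m)"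
      using m cv'(3)[of m] cv(3)[OF _ \<open>m \<in> M\<close>]
      by (auto simp: restrict_H'_monom simp del: restrict_apply)
  qed
qed

text \<open>The axioms are inherited from the big torus. The lift of a product and the product of
  the lifts have the same restriction, so \<open>act'_eq\<close> allows exchanging them.\<close>

lemma torus_action_Y: "torus_action H' c' (restrict_to X Y) act'"
  unfolding torus_action_def restrict_to_simps
proof (intro conjI allI impI ballI; (elim conjE)?)
  fix A :: "'v coord superalg" and x assume A: "superalgebra A" and x: "x \<in> Y A"
  show "act' A g x \<in> Y A" if "g \<in> shom H' A" for g
    unfolding act'_def by (rule act_Y[OF A lift_shom(1)[OF A that] x])
  have "restrict (torus_unit H A) (carrier H') = torus_unit H' A"
    using P_subset by (auto simp: torus_unit_def H_eq toric_alg_carrier fun_eq_iff)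
  then have "act' A (torus_unit H' A) x = act A (torus_unit H A) x"
    using act'_eq[OF A _ x, of "torus_unit H A"] torus_unit_shom[OF A mi_H] by (simp add: H_eq)
  then show "act' A (torus_unit H' A) x = x" using act_unit[OF A Y_in[OF A x]] by simp
  fix g h assume g: "g \<in> shom H' A" and h: "h \<in> shom H' A"
  note l = lift_shom[OF A g] and l' = lift_shom[OF A h]
  have "act' A (conv c' H' A g h) x = act A (conv c H A (lift A g) (lift A h)) x"
    using act'_eq[OF A restrict_conv(2)[OF A l(1) l'(1)] x] restrict_conv(1)[OF A l(1) l'(1)] l(2) l'(2) by simp
  then show "act' A (conv c' H' A g h) x = act' A g (act' A h x)"
    using act_conv[OF A l(1) l'(1) Y_in[OF A x]] by (simp add: act'_def)
next
  fix A B f g x assume A: "superalgebra A" and B: "superalgebra B" and f: "f \<in> shom A B" and g: "g \<in> shom H' A" and x: "x \<in> Y A"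
  note l = lift_shom[OF A g]
  have fl: "compose (carrier H) f (lift A g) \<in> shom H B" by (rule shom_compose[OF superalgebra_H l(1) f])
  have "fmap X A B f (act' A g x) = act B (compose (carrier H) f (lift A g)) (fmap X A B f x)"
    unfolding act'_def by (rule act_natural[OF A B f l(1) Y_in[OF A x]])
  also have "\<dots> = act' B (compose (carrier H') f g) (fmap X A B f x)"
    using act'_eq[OF B fl Y_fmap[OF A B f x]] unfolding restrict_compose_H'[OF l(1)] l(2) by simp
  finally show "fmap X A B f (act' A g x) = act' B (compose (carrier H') f g) (fmap X A B f x)" .
qed

lemma toric_supervariety_Y: "toric_supervariety H' c' (restrict_to X Y) (chart' \<sigma>) act'"
  unfolding toric_supervariety_def
  using supervariety_Y affine_open_immersion_chart'[OF \<sigma>_star] torus_action_Y act'_chart'[OF \<sigma>_star] by blast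

lemma chart'_Int:
  assumes \<rho>: "\<rho> \<in> star" and \<tau>: "\<tau> \<in> star" and A: "superalgebra A"
  shows "chart' \<rho> A ` shom (R' \<rho>) A \<inter> chart' \<tau> A ` shom (R' \<tau>) A = chart' (\<rho> \<inter> \<tau>) A ` shom (R' (\<rho> \<inter> \<tau>)) A"
  unfolding chart'_image[OF \<rho> A] chart'_image[OF \<tau> A] chart'_image[OF star_Int[OF \<rho> \<tau>] A]
    glued(5)[OF starD(1)[OF \<rho>] starD(1)[OF \<tau>] A, symmetric] by blast

text \<open>The hypothesis on chart algebras is where the even and the super case part; everything
  else about the gluing is common to both.\<close>

lemma glued_toric_Y:
  assumes chart: "\<And>\<tau>. \<tau> \<in> star \<Longrightarrow> chart_alg (quot_lattice N \<sigma>) \<B>' (bar \<tau>) = R' \<tau>"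
  shows "glued_toric H' (quot_lattice N \<sigma>) c' (quot_fan N \<Sigma> \<sigma>) \<B>' (restrict_to X Y) (\<lambda>\<kappa>. chart' (unbar \<kappa>)) act'"
  unfolding glued_toric_def quot_fan_eq ball_simps
proof (intro conjI ballI allI impI)
  have unbar0: "unbar {0} = \<sigma>" using unbar_bar[OF \<sigma>_star] by (simp add: bar_\<sigma>)
  show "toric_supervariety H' c' (restrict_to X Y) (chart' (unbar {0})) act'"
    unfolding unbar0 by (rule toric_supervariety_Y)
  show "affine_open_immersion (chart_alg (quot_lattice N \<sigma>) \<B>' (bar \<tau>)) (restrict_to X Y) (chart' (unbar (bar \<tau>)))"
    if "\<tau> \<in> star" for \<tau>
    unfolding chart[OF that] unbar_bar[OF that] by (rule affine_open_immersion_chart'[OF that])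
  have "(\<lambda>\<kappa> A. chart' (unbar \<kappa>) A ` shom (chart_alg (quot_lattice N \<sigma>) \<B>' \<kappa>) A) ` bar ` star =
      (\<lambda>\<tau> A. chart' \<tau> A ` shom (R' \<tau>) A) ` star"
    unfolding image_image by (intro image_cong refl) (simp add: chart unbar_bar)
  then show "open_cover (restrict_to X Y)
     ((\<lambda>\<kappa> A. chart' (unbar \<kappa>) A ` shom (chart_alg (quot_lattice N \<sigma>) \<B>' \<kappa>) A) ` bar ` star)"
    using open_cover_charts' by simp
  show "chart' (unbar (bar \<rho>)) A h =
      chart' (unbar (bar \<tau>)) A (restrict h (carrier (chart_alg (quot_lattice N \<sigma>) \<B>' (bar \<tau>))))"
    if *: "\<rho> \<in> star" "\<tau> \<in> star" and "is_face (bar \<rho>) (bar \<tau>)" "superalgebra A" "h \<in> shom (chart_alg (quot_lattice N \<sigma>) \<B>' (bar \<rho>)) A"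
    for \<rho> \<tau> A h
    using that chart'_face[OF *, of A h] by (simp add: chart unbar_bar bar_face_iff)
  show "chart' (unbar (bar \<rho>)) A ` shom (chart_alg (quot_lattice N \<sigma>) \<B>' (bar \<rho>)) A \<inter>
      chart' (unbar (bar \<tau>)) A ` shom (chart_alg (quot_lattice N \<sigma>) \<B>' (bar \<tau>)) A =
      chart' (unbar (bar \<rho> \<inter> bar \<tau>)) A ` shom (chart_alg (quot_lattice N \<sigma>) \<B>' (bar \<rho> \<inter> bar \<tau>)) A"
    if *: "\<rho> \<in> star" "\<tau> \<in> star" and A: "superalgebra A" for \<rho> \<tau> A
    using chart'_Int[OF * A] by (simp add: bar_Int[OF *] chart unbar_bar * star_Int[OF *])
  show "act' A g (chart' (unbar (bar \<tau>)) A h) =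
      chart' (unbar (bar \<tau>)) A (conv c' (chart_alg (quot_lattice N \<sigma>) \<B>' (bar \<tau>)) A g h)"
    if *: "\<tau> \<in> star" "superalgebra A" "g \<in> shom H' A" and "h \<in> shom (chart_alg (quot_lattice N \<sigma>) \<B>' (bar \<tau>)) A"
    for \<tau> A g h
    using that(4) act'_chart'[OF *, of h] by (simp add: chart unbar_bar *(1))
qed

end

lemma closed_sub_cong:
  assumes "\<And>A. superalgebra A \<Longrightarrow> Y A = Y' A" and Y: "closed_sub X Y" shows "closed_sub X Y'"
  using Y unfolding closed_sub_def subfunctor_def by (simp add: assms(1))

context toric_orbit
begin

lemma decoration_mem_P:
  assumes "\<tau> \<in> star" "b \<in> S \<tau>" "m \<in> P" "m - b \<in> S \<tau>" shows "b \<in> P" "m - b \<in> P"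
  using P_add_iff[OF assms(1,4,2)] assms(3) by simp_all

lemma decorated_ideal_bar:
  assumes \<tau>: "\<tau> \<in> star" and \<B>': "\<B>' (bar \<tau>) = \<B> \<tau> \<inter> P"
  shows "decorated_ideal (quot_lattice N \<sigma>) \<B>' (bar \<tau>) = J \<tau> \<inter> P"
proof (intro equalityI subsetI)
  fix m assume "m \<in> decorated_ideal (quot_lattice N \<sigma>) \<B>' (bar \<tau>)"
  then obtain b where b: "b \<in> \<B> \<tau>" "b \<in> P" "m - b \<in> S \<tau>" "m - b \<in> P"
    by (auto simp: decorated_ideal_iff \<B>' cone_monoid_bar)
  then show "m \<in> J \<tau> \<inter> P"
    using additive_group_add[OF additive_group_cone_perp b(4,2)] by (auto simp: decorated_ideal_iff)
next
  fix m assume m: "m \<in> J \<tau> \<inter> P"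
  then obtain b where b: "b \<in> \<B> \<tau>" "m - b \<in> S \<tau>" by (auto simp: decorated_ideal_iff)
  then have "b \<in> P" "m - b \<in> P"
    using decoration_mem_P[OF \<tau>, of b m] m decorations(3)[OF starD(1)[OF \<tau>]] by blast+
  then show "m \<in> decorated_ideal (quot_lattice N \<sigma>) \<B>' (bar \<tau>)"
    using b by (auto simp: decorated_ideal_iff \<B>' cone_monoid_bar)
qed

lemma chart_alg_bar:
  assumes "\<tau> \<in> star" "\<B>' (bar \<tau>) = \<B> \<tau> \<inter> P" shows "chart_alg (quot_lattice N \<sigma>) \<B>' (bar \<tau>) = R' \<tau>"
  unfolding chart_alg_eq[of "quot_lattice N \<sigma>"] cone_monoid_bar decorated_ideal_bar[of \<tau> \<B>', OF assms] ..

text \<open>An exponent of the odd module in \<open>P\<close> has a decoration of \<sigma> below it,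
  which the face property would place in \<open>P\<close> as well. The odd modules of larger cones
  are contained in that of \<sigma>.\<close>

lemma decorations_P_empty:
  assumes \<tau>: "\<tau> \<in> star" and "\<B> \<sigma> \<inter> P = {}" shows "\<B> \<tau> \<inter> P = {}" "J \<tau> \<inter> P = {}"
proof -
  have "b \<notin> P" if bJ: "b \<in> J \<sigma>" for b
  proof
    assume b: "b \<in> P"
    obtain b' where b': "b' \<in> \<B> \<sigma>" "b - b' \<in> S \<sigma>" using bJ by (auto simp: decorated_ideal_iff)
    then have "b' \<in> P" using decoration_mem_P(1)[OF \<sigma>_star, of b' b] b decorations(3)[OF \<sigma>_mem] by blast
    then show False using b'(1) assms(2) by blast
  qed
  then show "J \<tau> \<inter> P = {}" using star_subset(2)[OF \<tau>] by blast
  moreover have "\<B> \<tau> \<subseteq> J \<tau>" using cone_monoid_zero[of N \<tau>] by (force simp: decorated_ideal_iff)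
  ultimately show "\<B> \<tau> \<inter> P = {}" by blast
qed

text \<open>The second admissibility condition for \<sigma> and \<tau>, whose intersection is
  \<sigma>, gives a decoration of \<tau> below one in \<open>P\<close>; the face property puts it
  into \<open>P\<close>.\<close>

lemma decorations_P_nonempty:
  assumes \<tau>: "\<tau> \<in> star" and "\<B> \<sigma> \<inter> P \<noteq> {}" shows "\<B> \<tau> \<inter> P \<noteq> {}"
proof -
  obtain b where b: "b \<in> \<B> \<sigma>" "b \<in> P" using assms(2) by blast
  have "\<sigma> \<inter> \<tau> = \<sigma>" using starD(3)[OF \<tau>] by blast
  then obtain b' where b': "b' \<in> \<B> \<tau>" "b - b' \<in> S \<sigma>" using decorations(5)[OF \<sigma>_mem starD(1)[OF \<tau>] b(1)] by auto
  have "b' \<in> S \<sigma>" using b'(1) decorations(3)[OF starD(1)[OF \<tau>]] star_subset(1)[OF \<tau>] by blast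
  then have "b' \<in> P" using decoration_mem_P(1)[OF \<sigma>_star _ b(2) b'(2)] by blast
  then show ?thesis using b'(1) by blast
qed

text \<open>Every decoration obtained from admissibility over \<open>N\<close> is a summand of an
  exponent in \<open>P\<close>, so the face property confines it and the difference to
  \<open>P\<close>.\<close>

lemma admissible_bar:
  assumes ne: "\<B> \<sigma> \<inter> P \<noteq> {}" and \<B>': "\<And>\<tau>. \<tau> \<in> star \<Longrightarrow> \<B>' (bar \<tau>) = \<B> \<tau> \<inter> P"
  shows "admissible (quot_lattice N \<sigma>) (quot_param N \<sigma> c) (quot_fan N \<Sigma> \<sigma>) \<B>'"
  unfolding admissible_def quot_fan_eq ball_simps
proof (intro conjI ballI impI)
  fix \<tau> assume \<tau>: "\<tau> \<in> star"
  note D = decorations[OF starD(1)[OF \<tau>]]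
  show "finite (\<B>' (bar \<tau>))" "\<B>' (bar \<tau>) \<noteq> {}" "\<B>' (bar \<tau>) \<subseteq> cone_monoid (quot_lattice N \<sigma>) (bar \<tau>)"
    using D(1,3) decorations_P_nonempty[OF \<tau> ne] by (auto simp: \<B>'[OF \<tau>] cone_monoid_bar)
  show "\<exists>b\<in>\<B>' (bar \<tau>). cone_le (quot_lattice N \<sigma>) (bar \<tau>) b m"
    if m: "m \<in> cone_monoid (quot_lattice N \<sigma>) (bar \<tau>)" "pairing m (quot_param N \<sigma> c) \<noteq> 0" for m
  proof -
    have mP: "m \<in> S \<tau>" "m \<in> P" using m(1) by (simp_all add: cone_monoid_bar)
    then obtain b where b: "b \<in> \<B> \<tau>" "m - b \<in> S \<tau>" using D(4)[OF mP(1)] m(2) pairing_quot_param[OF mP(2)] by auto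
    then have "b \<in> P" "m - b \<in> P" using decoration_mem_P[OF \<tau>, of b m] mP D(3) by blast+
    then show ?thesis using b by (auto simp: \<B>'[OF \<tau>] cone_le_def cone_monoid_bar)
  qed
  show "a = b" if "a \<in> \<B>' (bar \<tau>)" "b \<in> \<B>' (bar \<tau>)" "cone_le (quot_lattice N \<sigma>) (bar \<tau>) a b" for a b
    using that D(6)[of a b] by (simp add: \<B>'[OF \<tau>] cone_le_def cone_monoid_bar)
  fix \<tau>' b assume \<tau>': "\<tau>' \<in> star" and b: "b \<in> \<B>' (bar \<tau>)"
  then have b: "b \<in> \<B> \<tau>" "b \<in> P" by (simp_all add: \<B>'[OF \<tau>])
  obtain b' where b': "b' \<in> \<B> \<tau>'" "b - b' \<in> S (\<tau> \<inter> \<tau>')" using D(5)[OF starD(1)[OF \<tau>'] b(1)] by blast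
  \<comment> \<open>The difference \<open>b - b'\<close> is only known to be nonnegative on the
    intersection cone, so \<open>b'\<close> has to be regarded there as well before the face
    property applies.\<close>
  have "b' \<in> S (\<tau> \<inter> \<tau>')"
    using b'(1) decorations(3)[OF starD(1)[OF \<tau>']] cone_monoid_mono[of "\<tau> \<inter> \<tau>'" \<tau>' N] by blast
  then have "b' \<in> P" "b - b' \<in> P" using decoration_mem_P[OF star_Int[OF \<tau> \<tau>'] _ b(2) b'(2)] by blast+
  then show "\<exists>b'\<in>\<B>' (bar \<tau>'). cone_le (quot_lattice N \<sigma>) (bar \<tau> \<inter> bar \<tau>') b' b"
    using b' by (auto simp: \<B>'[OF \<tau>'] cone_le_def bar_Int[OF \<tau> \<tau>'] cone_monoid_bar)
qed

abbreviation "Z \<equiv> zariski_closure X (orbit_functor H X act p)"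

lemma orbit_subset_glued_sub: "superalgebra A \<Longrightarrow> orbit_functor H X act p A \<subseteq> glued_sub A"
  using glued_sub_chart_kills[OF \<sigma>_mem _ pull_shom[OF \<sigma>_star]] kills_pull[OF \<sigma>_star]
  by (auto simp: orbit_eq chart'_def)

text \<open>The glued subfunctor is itself one of the closed subvarieties being intersected, which
  gives one inclusion; minimality gives the other.\<close>

lemma closure_eq:
  assumes A: "superalgebra A" shows "Z A = glued_sub A"
proof -
  interpret W: orbit_closure N c \<Sigma> \<B> X \<phi> act \<sigma> p glued_sub c
    using closed_sub_glued_sub glued_sub_chart_kills by unfold_locales auto
  have "closed_subvariety X glued_sub"
    unfolding closed_subvariety_def using closed_sub_glued_sub W.supervariety_Y by blast
  then have "Z A \<subseteq> glued_sub A" unfolding zariski_closure_def using orbit_subset_glued_sub by blast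
  moreover have "x \<in> Z A" if x: "x \<in> glued_sub A" for x
    unfolding zariski_closure_def
  proof (intro CollectI conjI allI impI; (elim conjE)?)
    show "x \<in> pts X A" by (rule glued_sub_in[OF x])
    fix Y assume "closed_subvariety X Y" "\<forall>B. superalgebra B \<longrightarrow> orbit_functor H X act p B \<subseteq> Y B"
    then show "x \<in> Y A" using glued_sub_minimal[of Y, OF _ _ A] x unfolding closed_subvariety_def by blast
  qed
  ultimately show ?thesis by blast
qed

lemma orbit_closure_Z:
  assumes "\<And>m. m \<in> P \<Longrightarrow> pairing m c' = pairing m c"
  shows "orbit_closure N c \<Sigma> \<B> X \<phi> act \<sigma> p Z c'"
proof unfold_locales
  show "closed_sub X Z" using closed_sub_cong[OF _ closed_sub_glued_sub] closure_eq by simp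
  show "\<phi> \<tau> A h \<in> Z A \<longleftrightarrow> kills \<tau> A h" if "\<tau> \<in> \<Sigma>" "superalgebra A" "h \<in> shom (R \<tau>) A" for \<tau> A h
    using glued_sub_chart_kills[OF that] closure_eq[OF that(2)] by simp
qed (rule assms)

lemma closure_facts: "closed_subvariety X Z" "superalgebra A \<Longrightarrow> orbit_functor H X act p A \<subseteq> Z A"
proof -
  interpret Z: orbit_closure N c \<Sigma> \<B> X \<phi> act \<sigma> p Z c by (rule orbit_closure_Z) simp
  show "closed_subvariety X Z" unfolding closed_subvariety_def using Z.closed Z.supervariety_Y by blast
  show "superalgebra A \<Longrightarrow> orbit_functor H X act p A \<subseteq> Z A" using orbit_subset_glued_sub closure_eq by simp
qed

lemma closure_even:
  assumes empty: "\<B> \<sigma> \<inter> P = {}"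
  shows "\<exists>\<phi>' act'.
    torus_is_orbit (even_torus_alg (quot_lattice N \<sigma>)) H X act p (\<phi>' {0}) \<and>
    toric_supervariety (even_torus_alg (quot_lattice N \<sigma>)) 0 (restrict_to X Z) (\<phi>' {0}) act' \<and>
    is_toric_variety_of_fan (quot_lattice N \<sigma>) (quot_fan N \<Sigma> \<sigma>) (restrict_to X Z) \<phi>' act'"
proof -
  have J: "J \<sigma> \<inter> P = {}" by (rule decorations_P_empty(2)[OF \<sigma>_star empty])
  \<comment> \<open>A nonzero pairing with \<open>c\<close> would put the exponent into the odd
    module, which does not meet \<open>P\<close>. So the parameter 0 of the purely even torus agrees
    with \<open>c\<close> on \<open>P\<close>.\<close>
  have pairing: "pairing m 0 = pairing m c" if "m \<in> P" for m
    using pairing_J[OF \<sigma>_mem, of m] that J cone_perp_subset_monoid by (auto simp: pairing_def zero_prod_def complex_eq_iff)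
  interpret Z: orbit_closure N c \<Sigma> \<B> X \<phi> act \<sigma> p Z 0 by (rule orbit_closure_Z[OF pairing])
  have H': "H' = even_torus_alg (quot_lattice N \<sigma>)" by (simp add: even_torus_alg_def dual_quot_lattice S\<sigma>_P J)
  have "chart_alg (quot_lattice N \<sigma>) (\<lambda>_. {}) (bar \<tau>) = R' \<tau>" if "\<tau> \<in> star" for \<tau>
    by (rule chart_alg_bar[OF that]) (simp add: decorations_P_empty(1)[OF that empty])
  note G = Z.glued_toric_Y[of "\<lambda>_. {}", OF this]
  have unbar0: "unbar {0} = \<sigma>" using unbar_bar[OF \<sigma>_star] by (simp add: bar_\<sigma>)
  show ?thesis
  proof (intro exI conjI)
    show "torus_is_orbit (even_torus_alg (quot_lattice N \<sigma>)) H X act p ((\<lambda>\<kappa>. chart' (unbar \<kappa>)) {0})"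
      unfolding unbar0 H'[symmetric] by (rule torus_is_orbit)
    show "toric_supervariety (even_torus_alg (quot_lattice N \<sigma>)) 0 (restrict_to X Z) ((\<lambda>\<kappa>. chart' (unbar \<kappa>)) {0}) Z.act'"
      unfolding unbar0 H'[symmetric] by (rule Z.toric_supervariety_Y)
    show "is_toric_variety_of_fan (quot_lattice N \<sigma>) (quot_fan N \<Sigma> \<sigma>) (restrict_to X Z) (\<lambda>\<kappa>. chart' (unbar \<kappa>)) Z.act'"
      unfolding is_toric_variety_of_fan_def H'[symmetric]
      using zlattice_quot_lattice fan_quot_fan G by blast
  qed
qed

lemma closure_super:
  assumes ne: "\<B> \<sigma> \<inter> P \<noteq> {}"
  shows "\<exists>\<B>' \<phi>' act'.
    (\<forall>\<tau>\<in>\<Sigma>. is_face \<sigma> \<tau> \<longrightarrow> \<B>' (quot N \<sigma> ` \<tau>) = \<B> \<tau> \<inter> P) \<and>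
    torus_is_orbit (supertorus_alg (quot_lattice N \<sigma>)) H X act p (\<phi>' {0}) \<and>
    toric_supervariety (supertorus_alg (quot_lattice N \<sigma>)) (quot_param N \<sigma> c) (restrict_to X Z) (\<phi>' {0}) act' \<and>
    is_toric_supervariety_of_fan (quot_lattice N \<sigma>) (quot_param N \<sigma> c) (quot_fan N \<Sigma> \<sigma>) \<B>'
      (restrict_to X Z) \<phi>' act'"
proof -
  have "\<B> \<sigma> \<subseteq> J \<sigma>" using cone_monoid_zero[of N \<sigma>] by (force simp: decorated_ideal_iff)
  then have J: "J \<sigma> \<inter> P = P" using J\<sigma>_P ne by blast
  interpret Z: orbit_closure N c \<Sigma> \<B> X \<phi> act \<sigma> p Z "quot_param N \<sigma> c"
    by (rule orbit_closure_Z[OF pairing_quot_param])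
  have H': "H' = supertorus_alg (quot_lattice N \<sigma>)" unfolding supertorus_alg_def dual_quot_lattice S\<sigma>_P J ..
  \<comment> \<open>Decorations of a quotient cone are read off from the unique cone of the star
    lying over it.\<close>
  define \<B>' where "\<B>' = (\<lambda>\<kappa>. \<B> (unbar \<kappa>) \<inter> P)"
  have \<B>': "\<B>' (bar \<tau>) = \<B> \<tau> \<inter> P" if "\<tau> \<in> star" for \<tau> by (simp add: \<B>'_def unbar_bar[OF that])
  note G = Z.glued_toric_Y[of \<B>', OF chart_alg_bar, OF _ \<B>']
  have unbar0: "unbar {0} = \<sigma>" using unbar_bar[OF \<sigma>_star] by (simp add: bar_\<sigma>)
  show ?thesis
  proof (intro exI conjI)
    show "\<forall>\<tau>\<in>\<Sigma>. is_face \<sigma> \<tau> \<longrightarrow> \<B>' (quot N \<sigma> ` \<tau>) = \<B> \<tau> \<inter> P"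
      using \<B>' by (simp add: star_def bar_def)
    show "torus_is_orbit (supertorus_alg (quot_lattice N \<sigma>)) H X act p ((\<lambda>\<kappa>. chart' (unbar \<kappa>)) {0})"
      unfolding unbar0 H'[symmetric] by (rule torus_is_orbit)
    show "toric_supervariety (supertorus_alg (quot_lattice N \<sigma>)) (quot_param N \<sigma> c) (restrict_to X Z)
        ((\<lambda>\<kappa>. chart' (unbar \<kappa>)) {0}) Z.act'"
      unfolding unbar0 H'[symmetric] by (rule Z.toric_supervariety_Y)
    show "is_toric_supervariety_of_fan (quot_lattice N \<sigma>) (quot_param N \<sigma> c) (quot_fan N \<Sigma> \<sigma>) \<B>'
        (restrict_to X Z) (\<lambda>\<kappa>. chart' (unbar \<kappa>)) Z.act'"
      unfolding is_toric_supervariety_of_fan_def H'[symmetric]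
      using zlattice_quot_lattice quot_param_complexified[OF X_facts(2)] fan_quot_fan admissible_bar[of \<B>', OF ne \<B>'] G
      by simp
  qed
qed

end

theorem proposition7p15:
  fixes N :: "'v::euclidean_space set" and c :: "'v \<times> 'v"
    and \<Sigma> :: "'v set set" and \<B> :: "'v set \<Rightarrow> 'v set"
    and X :: "('v coord, 'x) sfunctor"
    and \<phi> :: "'v set \<Rightarrow> 'v coord superalg \<Rightarrow> ('v coord \<Rightarrow> 'v coord) \<Rightarrow> 'x"
    and act :: "'v coord superalg \<Rightarrow> ('v coord \<Rightarrow> 'v coord) \<Rightarrow> 'x \<Rightarrow> 'x"
    and \<sigma> :: "'v set" and p :: 'x
    and Orb\<^sub>c Z :: "'v coord superalg \<Rightarrow> 'x set"
  assumes X: "is_toric_supervariety_of_fan N c \<Sigma> \<B> X \<phi> act" "quasinormal X"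
    and \<sigma>: "\<sigma> \<in> \<Sigma>"
    and p: "p \<in> Orb N \<B> \<phi> act \<sigma>"
  defines "Orb\<^sub>c \<equiv> orbit_functor (supertorus_alg N) X act p"
    and "Z \<equiv> zariski_closure X Orb\<^sub>c"
  shows "closed_subvariety X Z \<and> (\<forall>A. superalgebra A \<longrightarrow> Orb\<^sub>c A \<subseteq> Z A) \<and>
    (decorations_vanish N \<B> \<phi> \<sigma> p \<longrightarrow>
       (\<exists>\<phi>' act'.
          torus_is_orbit (even_torus_alg (quot_lattice N \<sigma>)) (supertorus_alg N) X act p (\<phi>' {0}) \<and>
          toric_supervariety (even_torus_alg (quot_lattice N \<sigma>)) 0 (restrict_to X Z) (\<phi>' {0}) act' \<and>
          is_toric_variety_of_fan (quot_lattice N \<sigma>) (quot_fan N \<Sigma> \<sigma>) (restrict_to X Z) \<phi>' act')) \<and>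
    (\<not> decorations_vanish N \<B> \<phi> \<sigma> p \<longrightarrow>
       (\<exists>\<B>' \<phi>' act'.
          (\<forall>\<tau>\<in>\<Sigma>. is_face \<sigma> \<tau> \<longrightarrow> \<B>' (quot N \<sigma> ` \<tau>) = \<B> \<tau> \<inter> cone_perp N \<sigma>) \<and>
          torus_is_orbit (supertorus_alg (quot_lattice N \<sigma>)) (supertorus_alg N) X act p (\<phi>' {0}) \<and>
          toric_supervariety (supertorus_alg (quot_lattice N \<sigma>)) (quot_param N \<sigma> c)
            (restrict_to X Z) (\<phi>' {0}) act' \<and>
          is_toric_supervariety_of_fan (quot_lattice N \<sigma>) (quot_param N \<sigma> c) (quot_fan N \<Sigma> \<sigma>) \<B>'
            (restrict_to X Z) \<phi>' act'))"
proof -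
  interpret toric_orbit N c \<Sigma> \<B> X \<phi> act \<sigma> p using X(1) \<sigma> p by unfold_locales
  show ?thesis
    unfolding Z_def Orb\<^sub>c_def decorations_vanish_iff
    using closure_facts closure_even closure_super by blast
qed

end
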